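(* Let $G=\mathrm{SL}_n(\mathbb K)$, let $Q=P_{k_1}\cap\dots\cap P_{k_m}$ with $1\le k_1<\dots<k_m\le n-1$, and consider the Seshadri stratification on $G/Q\hookrightarrow\prod_{j=1}^m\mathbb P(V(\omega_{k_j}))$ indexed by $\underline W$, with strata $X_{(\theta,i)}$ and extremal functions $p_{(\theta,i)}$ (defined in the context). Let $\Gamma$ be its fan of monoids. Then: (a) The map $\mathrm{SSYT}_Q\to\Gamma$, $((\theta_1,i_1),\dots,(\theta_\ell,i_\ell))\mapsto e_{(\theta_1,i_1)}+\dots+e_{(\theta_\ell,i_\ell)}$ is a bijection (a tableau is written as the list of its columns from left to right). (b) The Seshadri stratification on $G/Q$ is normal and balanced. (c) The set $\mathbb G$ of all indecomposable elements of $\Gamma$ coincides with $\{\underline a\in\Gamma\mid|\deg\underline a|=1\}=\{e_{(\theta,i)}\mid(\theta,i)\in\underline W\}$. (d) Let $\mathbb G_R$ be the set of all Plücker coordinates $p_{(\theta,i)}$, $(\theta,i)\in\underline W$, where $x_{\underline a}=p_{(\theta,i)}$ for $\underline a=e_{(\theta,i)}\in\mathbb G$. Then the basis of $R=\mathbb K[G/Q]$ given by the standard monomials $x_{\underline a}$, $\underline a\in\Gamma$, agrees with the basis consisting of the products $p_{(\theta_1,i_1)}\cdots p_{(\theta_\ell,i_\ell)}$ with $i_1\ge\dots\ge i_\ell$ for which the Young-tableau with columns $\theta_1,\dots,\theta_\ell$ (from left to right) is semistandard.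
   Context: Groups. $\mathbb K$ is an algebraically closed field of characteristic zero, $G=\mathrm{SL}_n(\mathbb K)$, $B$ the upper triangular matrices in $G$, $W\cong S_n$ the Weyl group, $\omega_1,\dots,\omega_{n-1}$ the fundamental weights, $V(\omega_i)=\bigwedge^i\mathbb K^n$, and $P_i\supseteq B$ the maximal parabolic subgroup whose Weyl group $W_{P_i}$ is the stabilizer of $\omega_i$ (so $W_{P_i}\cong S_i\times S_{n-i}$). For a parabolic $P\supseteq B$, $W_P$ is its Weyl group and $W/W_P$ carries the Bruhat order. Put $W_i=W_{P_{k_i}}$ and $Q_i=P_{k_i}\cap\dots\cap P_{k_m}$. For parabolics $P\subseteq P'$ containing $B$ and $\theta\in W/W_{P'}$, $\max_P(\theta)$ denotes the unique maximal preimage of $\theta$ in $W/W_P$. Stratification. $\underline W=\coprod_{i=1}^mW/W_i\times\{i\}$. An element $(\theta,i)$, $\theta=\sigma W_i$, corresponds to the subset $\{\sigma(1),\dots,\sigma(k_i)\}\subseteq[n]$, i.e. to a column of length $k_i$ with strictly increasing entries $j_1<\dots<j_{k_i}$ in $[n]$; the Plücker coordinate $p_{(\theta,i)}\in V(\omega_{k_i})^*$ is the element of the dual basis corresponding to $e_{j_1}\wedge\dots\wedge e_{j_{k_i}}$, viewed in $R$ by pullback along the projection to $V(\omega_{k_i})$. $G/Q$ is embedded in $\prod_{j=1}^m\mathbb P(V(\omega_{k_j}))$ by the Plücker embedding, $R=\mathbb K[G/Q]$ is the $\mathbb N_0^m$-graded multihomogeneous coordinate ring, i.e. the coordinate ring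 of the multicone. (The multicone $\hat Y$ of a closed $Y\subseteq\prod_{j\in I}\mathbb P(V_j)$ is the set of tuples $(v_j)$ such that there are non-zero $w_j$ with $v_j\in\mathbb Kw_j$, $([w_j])_j\in Y$; it is viewed in the full product $\prod_{j=1}^mV_j$ by setting the other coordinates zero.) The stratum $X_{(\theta,i)}$ is the Schubert variety $X_{\max_{Q_i}(\theta)}\subseteq G/Q_i\hookrightarrow\prod_{j=i}^m\mathbb P(V(\omega_{k_j}))$ with index set $I_{(\theta,i)}=\{i,\dots,m\}$ and multicone $\hat X_{(\theta,i)}$, and its extremal function is $f_{(\theta,i)}=p_{(\theta,i)}$. $A=\underline W$ is partially ordered by $q\le p\Leftrightarrow\hat X_q\subseteq\hat X_p$. These data form a multiprojective Seshadri stratification; in particular every maximal chain of $A$ has length $s=\dim\hat X-1$ with $X=G/Q$, and for covering relations $q<p$ the multicone $\hat X_q$ is a prime divisor of $\hat X_p$. Quasi-valuation and $\Gamma$. Add to $A$ a least element $p_{-1}$ with $\hat X_{p_{-1}}=\{0\}$. For a covering relation $q<p$ in $A\cup\{p_{-1}\}$ let $\nu_{p,q}$ be the discrete valuation on $\mathbb K(\hat X_p)$ of the prime divisor $\hat X_q$ and $b_{p,q}=\nu_{p,q}(f_p|_{\hat X_p})$. For a maximal chain $\mathfrak C:p_s>\dots>p_0$ and $g\in R\setminus\{0\}$ put $g_s=g$, $g_{i-1}=\bigl(g_i^{b_{p_i,p_{i-1}}}/f_{p_i}^{\nu_{p_i,p_{i-1}}(g_i)}\bigr)\big|_{\hat X_{p_{i-1}}}$,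 $\mathcal V_{\mathfrak C}(g)=\sum_{j=0}^s\frac{\nu_{p_j,p_{j-1}}(g_j)}{\prod_{k=j}^sb_{p_k,p_{k-1}}}e_{p_j}\in\mathbb Q^A$, where $\{e_p\mid p\in A\}$ is the standard basis. Fix a total order $\ge^t$ on $A$ refining the partial order, order $\mathbb Q^A$ lexicographically (compare coefficients at the $\ge^t$-largest element where they differ), and set $\mathcal V(g)=\min_{\mathfrak C}\mathcal V_{\mathfrak C}(g)$ over all maximal chains. The fan of monoids is $\Gamma=\{\mathcal V(g)\mid g\in R\setminus\{0\}\}$, and $\Gamma_{\mathfrak C}=\{\underline a\in\Gamma\mid\operatorname{supp}\underline a\subseteq\mathfrak C\}$, a monoid. The degree map is the linear map $\deg:\mathbb Q^A\to\mathbb Q^m$, $e_p\mapsto\deg f_p$, and $|\underline d|=d_1+\dots+d_m$. The stratification is normal if every $\Gamma_{\mathfrak C}$ is the intersection of the lattice it generates with $\mathbb Q^{\mathfrak C}_{\ge0}$, and balanced if $\Gamma$ does not depend on the choice of $\ge^t$. Indecomposables and standard monomials. $\underline a\in\Gamma$ is decomposable if it is $0$ or $\underline a=\underline a^1+\underline a^2$ with $\underline a^1,\underline a^2\in\Gamma\setminus\{0\}$ and $\min\operatorname{supp}\underline a^1\ge\max\operatorname{supp}\underline a^2$; otherwise indecomposable. For a normal stratification each $\underline a\in\Gamma$ has a unique decomposition $\underline a=\underline a^1+\dots+\underline a^s$ into indecomposables with $\min\operatorname{supp}\underline a^k\ge\max\operatorname{supp}\underline a^{k+1}$ for all $k$;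 given functions $x_{\underline b}\in R$ with $\mathcal V(x_{\underline b})=\underline b$ for the indecomposables $\underline b$, the standard monomial of $\underline a$ is $x_{\underline a}=x_{\underline a^1}\cdots x_{\underline a^s}$. Tableaux. $\mathrm{SSYT}_Q$ is the set of all semistandard Young-tableaux (English notation; rows weakly increasing left to right, columns strictly increasing top to bottom; the empty tableau included) with entries in $[n]$ all of whose columns have length in $\{k_1,\dots,k_m\}$; columns are identified with elements of $\underline W$. *)

theory Defs
  imports
    "HOL-Algebra.Sym_Groups"
    "HOL-Algebra.Left_Coset"
    "HOL-Library.Function_Algebras"
    "HOL-Combinatorics.Transposition"
    "HOL-Computational_Algebra.Polynomial"
    "Jordan_Normal_Form.Determinant"
    "Jordan_Normal_Form.DL_Submatrix"
begin

definition evec :: "'a \<Rightarrow> 'a \<Rightarrow> 'c::zero_neq_one" where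
  "evec p = (\<lambda>q. if q = p then 1 else 0)"


section \<open>Multiprojective varieties and their multicones\<close>

text \<open>
  A point \<open>v\<close> of a product of based vector spaces \<open>V\<^sub>1 \<times> \<dots> \<times> V\<^sub>m\<close> is the family of its
  coordinates: \<open>v j b\<close> is the coefficient of \<open>v\<^sub>j\<close> at the basis vector \<open>b\<close>. Coordinates
  which do not occur in the product are zero. The ground field is infinite, so polynomials
  are represented by polynomial functions.
\<close>

type_synonym ('b, 'k) mpoint = "nat \<Rightarrow> 'b \<Rightarrow> 'k"

inductive polyfun :: "(('b, 'k::comm_ring_1) mpoint \<Rightarrow> 'k) \<Rightarrow> bool" where
  poly_const: "polyfun (\<lambda>v. c)"
| poly_coord: "polyfun (\<lambda>v. v j b)"
| poly_add: "polyfun F \<Longrightarrow> polyfun G \<Longrightarrow> polyfun (\<lambda>v. F v + G v)"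
| poly_mult: "polyfun F \<Longrightarrow> polyfun G \<Longrightarrow> polyfun (\<lambda>v. F v * G v)"

text \<open>Multihomogeneous polynomials of multidegree \<open>d\<close>; the coordinate \<open>v j b\<close> has
  multidegree \<open>e\<^sub>j\<close>.\<close>

inductive mhom :: "(nat \<Rightarrow> nat) \<Rightarrow> (('b, 'k::comm_ring_1) mpoint \<Rightarrow> 'k) \<Rightarrow> bool" where
  mhom_const: "mhom 0 (\<lambda>v. c)"
| mhom_coord: "mhom (evec j) (\<lambda>v. v j b)"
| mhom_add: "mhom d F \<Longrightarrow> mhom d G \<Longrightarrow> mhom d (\<lambda>v. F v + G v)"
| mhom_mult: "mhom d F \<Longrightarrow> mhom e G \<Longrightarrow> mhom (d + e) (\<lambda>v. F v * G v)"

definition nonzero_tuples ::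
    "(nat \<Rightarrow> ('b \<Rightarrow> 'k::comm_ring_1) set) \<Rightarrow> nat set \<Rightarrow> ('b, 'k) mpoint set" where
  "nonzero_tuples V I = {w. (\<forall>j\<in>I. w j \<in> V j \<and> w j \<noteq> 0) \<and> (\<forall>j. j \<notin> I \<longrightarrow> w j = 0)}"

text \<open>The point \<open>([w\<^sub>j])\<^sub>j\<close> of the product of the projective spaces \<open>\<P>(V\<^sub>j)\<close>, \<open>j \<in> I\<close>; here
  \<open>[w]\<close> is the set of all non-zero multiples of \<open>w\<close>.\<close>

definition proj_point ::
    "nat set \<Rightarrow> ('b, 'k::comm_ring_1) mpoint \<Rightarrow> nat \<Rightarrow> ('b \<Rightarrow> 'k) set" where
  "proj_point I w = (\<lambda>j. if j \<in> I then {(\<lambda>b. c * w j b) | c. c \<noteq> 0} else {})"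

definition zariski_closure ::
    "(nat \<Rightarrow> ('b \<Rightarrow> 'k::comm_ring_1) set) \<Rightarrow> nat set \<Rightarrow> (nat \<Rightarrow> ('b \<Rightarrow> 'k) set) set
      \<Rightarrow> (nat \<Rightarrow> ('b \<Rightarrow> 'k) set) set" where
  "zariski_closure V I S =
     {proj_point I w | w. w \<in> nonzero_tuples V I \<and>
        (\<forall>d F. mhom d F \<and> (\<forall>u\<in>nonzero_tuples V I. proj_point I u \<in> S \<longrightarrow> F u = 0)
               \<longrightarrow> F w = 0)}"

definition multicone ::
    "(nat \<Rightarrow> ('b \<Rightarrow> 'k::comm_ring_1) set) \<Rightarrow> nat set \<Rightarrow> (nat \<Rightarrow> ('b \<Rightarrow> 'k) set) set
      \<Rightarrow> ('b, 'k) mpoint set" where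
  "multicone V I Y =
     {v. \<exists>w\<in>nonzero_tuples V I. proj_point I w \<in> Y \<and>
           (\<forall>j\<in>I. \<exists>c. v j = (\<lambda>b. c * w j b)) \<and> (\<forall>j. j \<notin> I \<longrightarrow> v j = 0)}"


section \<open>Coordinate rings, function fields and discrete valuations\<close>

text \<open>A regular function on \<open>Y\<close> is represented by its extension by zero.\<close>

definition restr :: "'v set \<Rightarrow> ('v \<Rightarrow> 'k::zero) \<Rightarrow> 'v \<Rightarrow> 'k" where
  "restr Y F = (\<lambda>v. if v \<in> Y then F v else 0)"

definition coord_ring :: "('b, 'k::comm_ring_1) mpoint set \<Rightarrow> (('b, 'k) mpoint \<Rightarrow> 'k) ring" where
  "coord_ring Y =
     \<lparr>carrier = {restr Y F | F. polyfun F},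
      mult = (\<lambda>f g v. f v * g v),
      one = restr Y (\<lambda>v. 1),
      zero = (\<lambda>v. 0),
      add = (\<lambda>f g v. f v + g v)\<rparr>"

definition vanishing_ideal ::
    "('b, 'k::comm_ring_1) mpoint set \<Rightarrow> ('b, 'k) mpoint set \<Rightarrow> (('b, 'k) mpoint \<Rightarrow> 'k) set" where
  "vanishing_ideal Y Z = {f \<in> carrier (coord_ring Y). \<forall>v\<in>Z. f v = 0}"

text \<open>The fraction \<open>a / b\<close> in the field of fractions of an integral domain.\<close>

definition frac :: "('a, 'x) ring_scheme \<Rightarrow> 'a \<Rightarrow> 'a \<Rightarrow> ('a \<times> 'a) set" where
  "frac R a b = {(c, d). c \<in> carrier R \<and> d \<in> carrier R - {\<zero>\<^bsub>R\<^esub>} \<and> a \<otimes>\<^bsub>R\<^esub> d = c \<otimes>\<^bsub>R\<^esub> b}"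

definition frac_field :: "('a, 'x) ring_scheme \<Rightarrow> ('a \<times> 'a) set ring" where
  "frac_field R =
     \<lparr>carrier = {frac R a b | a b. a \<in> carrier R \<and> b \<in> carrier R - {\<zero>\<^bsub>R\<^esub>}},
      mult = (\<lambda>x y. \<Union>(a, b)\<in>x. \<Union>(c, d)\<in>y. frac R (a \<otimes>\<^bsub>R\<^esub> c) (b \<otimes>\<^bsub>R\<^esub> d)),
      one = frac R \<one>\<^bsub>R\<^esub> \<one>\<^bsub>R\<^esub>,
      zero = frac R \<zero>\<^bsub>R\<^esub> \<one>\<^bsub>R\<^esub>,
      add = (\<lambda>x y. \<Union>(a, b)\<in>x. \<Union>(c, d)\<in>y.
               frac R (a \<otimes>\<^bsub>R\<^esub> d \<oplus>\<^bsub>R\<^esub> c \<otimes>\<^bsub>R\<^esub> b) (b \<otimes>\<^bsub>R\<^esub> d))\<rparr>"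

definition to_frac :: "('a, 'x) ring_scheme \<Rightarrow> 'a \<Rightarrow> ('a \<times> 'a) set" where
  "to_frac R a = frac R a \<one>\<^bsub>R\<^esub>"

text \<open>The localization of \<open>R\<close> at a prime ideal \<open>P\<close>, as a subring of the field of fractions,
  and its maximal ideal.\<close>

definition local_ring :: "('a, 'x) ring_scheme \<Rightarrow> 'a set \<Rightarrow> ('a \<times> 'a) set set" where
  "local_ring R P = {frac R a b | a b. a \<in> carrier R \<and> b \<in> carrier R - P}"

definition local_max :: "('a, 'x) ring_scheme \<Rightarrow> 'a set \<Rightarrow> ('a \<times> 'a) set set" where
  "local_max R P = {frac R a b | a b. a \<in> P \<and> b \<in> carrier R - P}"

definition uniformizer :: "('a, 'x) ring_scheme \<Rightarrow> 'a set \<Rightarrow> ('a \<times> 'a) set \<Rightarrow> bool" where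
  "uniformizer R P t \<longleftrightarrow>
     t \<in> local_max R P \<and> local_max R P = (\<lambda>u. u \<otimes>\<^bsub>frac_field R\<^esub> t) ` local_ring R P"

text \<open>The valuation of a non-zero \<open>x\<close> in the field of fractions, if the localization at \<open>P\<close> is
  a discrete valuation ring.\<close>

definition disc_val :: "('a, 'x) ring_scheme \<Rightarrow> 'a set \<Rightarrow> ('a \<times> 'a) set \<Rightarrow> int" where
  "disc_val R P x =
     (THE k. \<exists>t u. uniformizer R P t \<and> u \<in> local_ring R P - local_max R P \<and>
                   x = u \<otimes>\<^bsub>frac_field R\<^esub> t [^]\<^bsub>frac_field R\<^esub> k)"

text \<open>Restriction to \<open>Z \<subseteq> Y\<close> of a rational function on \<open>Y\<close> which is defined at the
  generic point of \<open>Z\<close>.\<close>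

definition rat_restrict ::
    "('b, 'k::comm_ring_1) mpoint set \<Rightarrow> ('b, 'k) mpoint set
      \<Rightarrow> ((('b, 'k) mpoint \<Rightarrow> 'k) \<times> (('b, 'k) mpoint \<Rightarrow> 'k)) set
      \<Rightarrow> ((('b, 'k) mpoint \<Rightarrow> 'k) \<times> (('b, 'k) mpoint \<Rightarrow> 'k)) set" where
  "rat_restrict Y Z x =
     (\<Union>(a, b)\<in>{(a, b) \<in> x. b \<notin> vanishing_ideal Y Z}.
        frac (coord_ring Z) (restr Z a) (restr Z b))"


section \<open>Multiprojective stratifications and their quasi-valuations\<close>

text \<open>
  The data of a stratification of \<open>X\<close> in a product of \<open>nfac\<close> projective spaces: the multicone
  of \<open>X\<close>, the index set, the multicones of the strata, and the extremal functions as elements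
  of \<open>\<K>[X]\<close>.
\<close>

record ('a, 'b, 'k) stratification =
  nfac :: nat
  total :: "('b, 'k) mpoint set"
  strata :: "'a set"
  scone :: "'a \<Rightarrow> ('b, 'k) mpoint set"
  extremal :: "'a \<Rightarrow> ('b, 'k) mpoint \<Rightarrow> 'k"

definition str_le :: "('a, 'b, 'k) stratification \<Rightarrow> 'a \<Rightarrow> 'a \<Rightarrow> bool" where
  "str_le S q p \<longleftrightarrow> scone S q \<subseteq> scone S p"

definition str_less :: "('a, 'b, 'k) stratification \<Rightarrow> 'a \<Rightarrow> 'a \<Rightarrow> bool" where
  "str_less S q p \<longleftrightarrow> str_le S q p \<and> q \<noteq> p"

text \<open>\<open>None\<close> is the additional least element \<open>p\<^sub>-\<^sub>1\<close>.\<close>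

fun scone' :: "('a, 'b, 'k::zero) stratification \<Rightarrow> 'a option \<Rightarrow> ('b, 'k) mpoint set" where
  "scone' S None = {0}"
| "scone' S (Some q) = scone S q"

definition str_val :: "('a, 'b, 'k::comm_ring_1) stratification \<Rightarrow> 'a \<Rightarrow> 'a option
    \<Rightarrow> ((('b, 'k) mpoint \<Rightarrow> 'k) \<times> (('b, 'k) mpoint \<Rightarrow> 'k)) set \<Rightarrow> int" where
  "str_val S p q = disc_val (coord_ring (scone S p)) (vanishing_ideal (scone S p) (scone' S q))"

definition rat_extremal :: "('a, 'b, 'k::comm_ring_1) stratification \<Rightarrow> 'a
    \<Rightarrow> ((('b, 'k) mpoint \<Rightarrow> 'k) \<times> (('b, 'k) mpoint \<Rightarrow> 'k)) set" where
  "rat_extremal S p = to_frac (coord_ring (scone S p)) (restr (scone S p) (extremal S p))"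

definition bond :: "('a, 'b, 'k::comm_ring_1) stratification \<Rightarrow> 'a \<Rightarrow> 'a option \<Rightarrow> int" where
  "bond S p q = str_val S p q (rat_extremal S p)"

text \<open>Maximal chains \<open>p\<^sub>0 < \<dots> < p\<^sub>s\<close> are represented by the list of their elements in
  increasing order.\<close>

definition max_chain :: "('a, 'b, 'k) stratification \<Rightarrow> 'a list \<Rightarrow> bool" where
  "max_chain S ps \<longleftrightarrow> set ps \<subseteq> strata S \<and> sorted_wrt (str_less S) ps \<and>
     (\<forall>qs. set qs \<subseteq> strata S \<and> sorted_wrt (str_less S) qs \<and> set ps \<subseteq> set qs
           \<longrightarrow> set qs = set ps)"

definition below :: "'a list \<Rightarrow> nat \<Rightarrow> 'a option" where
  "below ps j = (if j = 0 then None else Some (ps ! (j - 1)))"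

text \<open>\<open>chain_fun_rev S ps g i\<close> is the function \<open>g\<^sub>s\<^sub>-\<^sub>i\<close>, and \<open>chain_fun S ps g j\<close> is \<open>g\<^sub>j\<close>.\<close>

primrec chain_fun_rev :: "('a, 'b, 'k::comm_ring_1) stratification \<Rightarrow> 'a list
    \<Rightarrow> (('b, 'k) mpoint \<Rightarrow> 'k) \<Rightarrow> nat
    \<Rightarrow> ((('b, 'k) mpoint \<Rightarrow> 'k) \<times> (('b, 'k) mpoint \<Rightarrow> 'k)) set" where
  "chain_fun_rev S ps g 0 = to_frac (coord_ring (scone S (last ps))) (restr (scone S (last ps)) g)"
| "chain_fun_rev S ps g (Suc i) =
     (let j = length ps - 1 - i; p = ps ! j; q = below ps j;
          K = frac_field (coord_ring (scone S p)); h = chain_fun_rev S ps g i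
      in rat_restrict (scone S p) (scone' S q)
           (h [^]\<^bsub>K\<^esub> bond S p q \<otimes>\<^bsub>K\<^esub> rat_extremal S p [^]\<^bsub>K\<^esub> (- str_val S p q h)))"

definition chain_fun :: "('a, 'b, 'k::comm_ring_1) stratification \<Rightarrow> 'a list
    \<Rightarrow> (('b, 'k) mpoint \<Rightarrow> 'k) \<Rightarrow> nat
    \<Rightarrow> ((('b, 'k) mpoint \<Rightarrow> 'k) \<times> (('b, 'k) mpoint \<Rightarrow> 'k)) set" where
  "chain_fun S ps g j = chain_fun_rev S ps g (length ps - 1 - j)"

definition chain_val :: "('a, 'b, 'k::comm_ring_1) stratification \<Rightarrow> 'a list
    \<Rightarrow> (('b, 'k) mpoint \<Rightarrow> 'k) \<Rightarrow> 'a \<Rightarrow> rat" where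
  "chain_val S ps g = (\<lambda>p. \<Sum>j<length ps.
     of_int (str_val S (ps ! j) (below ps j) (chain_fun S ps g j))
       / of_int (\<Prod>i = j..<length ps. bond S (ps ! i) (below ps i)) * evec (ps ! j) p)"

text \<open>\<open>(q, p) \<in> r\<close> means \<open>p \<ge>\<^sup>t q\<close>.\<close>

definition total_refinement :: "('a, 'b, 'k) stratification \<Rightarrow> 'a rel \<Rightarrow> bool" where
  "total_refinement S r \<longleftrightarrow> linear_order_on (strata S) r \<and>
     (\<forall>q\<in>strata S. \<forall>p\<in>strata S. str_le S q p \<longrightarrow> (q, p) \<in> r)"

definition lex_less ::
    "('a, 'b, 'k) stratification \<Rightarrow> 'a rel \<Rightarrow> ('a \<Rightarrow> rat) \<Rightarrow> ('a \<Rightarrow> rat) \<Rightarrow> bool" where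
  "lex_less S r a b \<longleftrightarrow> (\<exists>q\<in>strata S. a q < b q \<and>
     (\<forall>p\<in>strata S. (q, p) \<in> r \<and> p \<noteq> q \<longrightarrow> a p = b p))"

definition quasi_val :: "('a, 'b, 'k::comm_ring_1) stratification \<Rightarrow> 'a rel
    \<Rightarrow> (('b, 'k) mpoint \<Rightarrow> 'k) \<Rightarrow> 'a \<Rightarrow> rat" where
  "quasi_val S r g =
     (THE a. (\<exists>ps. max_chain S ps \<and> a = chain_val S ps g) \<and>
             (\<forall>ps. max_chain S ps \<longrightarrow> a = chain_val S ps g \<or> lex_less S r a (chain_val S ps g)))"

definition fan :: "('a, 'b, 'k::comm_ring_1) stratification \<Rightarrow> 'a rel \<Rightarrow> ('a \<Rightarrow> rat) set" where
  "fan S r = quasi_val S r ` (carrier (coord_ring (total S)) - {\<zero>\<^bsub>coord_ring (total S)\<^esub>})"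

definition supp :: "('a \<Rightarrow> rat) \<Rightarrow> 'a set" where
  "supp a = {p. a p \<noteq> 0}"

definition fan_chain ::
    "('a, 'b, 'k::comm_ring_1) stratification \<Rightarrow> 'a rel \<Rightarrow> 'a set \<Rightarrow> ('a \<Rightarrow> rat) set" where
  "fan_chain S r C = {a \<in> fan S r. supp a \<subseteq> C}"

definition lattice_gen :: "('a \<Rightarrow> rat) set \<Rightarrow> ('a \<Rightarrow> rat) set" where
  "lattice_gen M = \<Inter>{H. M \<subseteq> H \<and> 0 \<in> H \<and> (\<forall>a\<in>H. \<forall>b\<in>H. a - b \<in> H)}"

definition str_normal :: "('a, 'b, 'k::comm_ring_1) stratification \<Rightarrow> 'a rel \<Rightarrow> bool" where
  "str_normal S r \<longleftrightarrow> (\<forall>ps. max_chain S ps \<longrightarrow>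
     fan_chain S r (set ps) =
       lattice_gen (fan_chain S r (set ps)) \<inter> {a. supp a \<subseteq> set ps \<and> (\<forall>p. 0 \<le> a p)})"

definition str_balanced :: "('a, 'b, 'k::comm_ring_1) stratification \<Rightarrow> bool" where
  "str_balanced S \<longleftrightarrow>
     (\<forall>r r'. total_refinement S r \<and> total_refinement S r' \<longrightarrow> fan S r = fan S r')"

text \<open>The degree \<open>d\<close> of a multihomogeneous \<open>f \<noteq> 0\<close> in the coordinate ring, and the degree map
  on \<open>\<rat>\<^sup>A\<close>.\<close>

definition mdegree :: "('a, 'b, 'k::comm_ring_1) stratification
    \<Rightarrow> (('b, 'k) mpoint \<Rightarrow> 'k) \<Rightarrow> nat \<Rightarrow> nat" where
  "mdegree S f = (THE d. \<exists>F. mhom d F \<and> f = restr (total S) F)"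

definition deg_map :: "('a, 'b, 'k::comm_ring_1) stratification \<Rightarrow> ('a \<Rightarrow> rat) \<Rightarrow> nat \<Rightarrow> rat" where
  "deg_map S a = (\<lambda>j. \<Sum>p\<in>strata S. a p * of_nat (mdegree S (extremal S p) j))"

definition total_degree :: "('a, 'b, 'k::comm_ring_1) stratification \<Rightarrow> ('a \<Rightarrow> rat) \<Rightarrow> rat" where
  "total_degree S a = (\<Sum>j = 1..nfac S. deg_map S a j)"


section \<open>Indecomposable elements and standard monomials\<close>

text \<open>The relation \<open>min supp a \<ge> max supp b\<close>.\<close>

definition supp_ge ::
    "('a, 'b, 'k) stratification \<Rightarrow> ('a \<Rightarrow> rat) \<Rightarrow> ('a \<Rightarrow> rat) \<Rightarrow> bool" where
  "supp_ge S a b \<longleftrightarrow>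
     (\<exists>p\<in>supp a. \<exists>q\<in>supp b. (\<forall>p'\<in>supp a. str_le S p p') \<and> (\<forall>q'\<in>supp b. str_le S q' q) \<and>
        str_le S q p)"

definition decomposable ::
    "('a, 'b, 'k::comm_ring_1) stratification \<Rightarrow> 'a rel \<Rightarrow> ('a \<Rightarrow> rat) \<Rightarrow> bool" where
  "decomposable S r a \<longleftrightarrow> a = 0 \<or>
     (\<exists>b\<in>fan S r - {0}. \<exists>c\<in>fan S r - {0}. a = b + c \<and> supp_ge S b c)"

definition indecomposables ::
    "('a, 'b, 'k::comm_ring_1) stratification \<Rightarrow> 'a rel \<Rightarrow> ('a \<Rightarrow> rat) set" where
  "indecomposables S r = {a \<in> fan S r. \<not> decomposable S r a}"

definition decomposition ::
    "('a, 'b, 'k::comm_ring_1) stratification \<Rightarrow> 'a rel \<Rightarrow> ('a \<Rightarrow> rat) \<Rightarrow> ('a \<Rightarrow> rat) list" where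
  "decomposition S r a =
     (THE as. set as \<subseteq> indecomposables S r \<and> sum_list as = a \<and>
              (\<forall>i. Suc i < length as \<longrightarrow> supp_ge S (as ! i) (as ! Suc i)))"

definition ring_prod :: "('a, 'x) ring_scheme \<Rightarrow> 'a list \<Rightarrow> 'a" where
  "ring_prod R xs = foldr (mult R) xs \<one>\<^bsub>R\<^esub>"

definition std_monomial :: "('a, 'b, 'k::comm_ring_1) stratification \<Rightarrow> 'a rel
    \<Rightarrow> (('a \<Rightarrow> rat) \<Rightarrow> ('b, 'k) mpoint \<Rightarrow> 'k) \<Rightarrow> ('a \<Rightarrow> rat) \<Rightarrow> ('b, 'k) mpoint \<Rightarrow> 'k" where
  "std_monomial S r x a = ring_prod (coord_ring (total S)) (map x (decomposition S r a))"

definition fun_scale :: "'k::comm_ring_1 \<Rightarrow> ('v \<Rightarrow> 'k) \<Rightarrow> 'v \<Rightarrow> 'k" where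
  "fun_scale c f = (\<lambda>v. c * f v)"

definition is_basis :: "('v \<Rightarrow> 'k::comm_ring_1) set \<Rightarrow> ('v \<Rightarrow> 'k) set \<Rightarrow> bool" where
  "is_basis E M \<longleftrightarrow> \<not> module.dependent fun_scale E \<and> module.span fun_scale E = M"


section \<open>Weyl groups and Bruhat order\<close>

text \<open>The Weyl group of the intersection of the maximal parabolic subgroups \<open>P\<^sub>i\<close>, \<open>i \<in> D\<close>:
  a permutation stabilizes the weight \<open>\<omega>\<^sub>i = \<epsilon>\<^sub>1 + \<dots> + \<epsilon>\<^sub>i\<close> if and only if it stabilizes
  \<open>{1, \<dots>, i}\<close>.\<close>

definition weyl_par :: "nat \<Rightarrow> nat set \<Rightarrow> (nat \<Rightarrow> nat) set" where
  "weyl_par n D = {\<sigma> \<in> carrier (sym_group n). \<forall>i\<in>D. \<sigma> ` {1..i} = {1..i}}"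

definition perm_length :: "nat \<Rightarrow> (nat \<Rightarrow> nat) \<Rightarrow> nat" where
  "perm_length n \<sigma> = card {(i, j). 1 \<le> i \<and> i < j \<and> j \<le> n \<and> \<sigma> j < \<sigma> i}"

definition bruhat_step :: "nat \<Rightarrow> (nat \<Rightarrow> nat) \<Rightarrow> (nat \<Rightarrow> nat) \<Rightarrow> bool" where
  "bruhat_step n \<sigma> \<tau> \<longleftrightarrow>
     (\<exists>a\<in>{1..n}. \<exists>b\<in>{1..n}. \<tau> = \<sigma> \<circ> transpose a b) \<and> perm_length n \<sigma> < perm_length n \<tau>"

definition bruhat_le :: "nat \<Rightarrow> (nat \<Rightarrow> nat) \<Rightarrow> (nat \<Rightarrow> nat) \<Rightarrow> bool" where
  "bruhat_le n = (bruhat_step n)\<^sup>*\<^sup>*"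

text \<open>The induced order on cosets.\<close>

definition coset_le :: "nat \<Rightarrow> (nat \<Rightarrow> nat) set \<Rightarrow> (nat \<Rightarrow> nat) set \<Rightarrow> bool" where
  "coset_le n \<theta> \<theta>' \<longleftrightarrow> (\<exists>\<sigma>\<in>\<theta>. \<exists>\<sigma>'\<in>\<theta>'. bruhat_le n \<sigma> \<sigma>')"

text \<open>The preimages of a coset \<open>\<theta>\<close> in \<open>W / W\<^sub>P\<close>, where \<open>W\<^sub>P = weyl_par n D\<close>, are the cosets
  contained in \<open>\<theta>\<close>.\<close>

definition max_lift :: "nat \<Rightarrow> nat set \<Rightarrow> (nat \<Rightarrow> nat) set \<Rightarrow> (nat \<Rightarrow> nat) set" where
  "max_lift n D \<theta> =
     (let L = {\<tau> \<in> lcosets\<^bsub>sym_group n\<^esub> weyl_par n D. \<tau> \<subseteq> \<theta>}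
      in THE \<tau>. \<tau> \<in> L \<and> (\<forall>\<tau>'\<in>L. coset_le n \<tau> \<tau>' \<longrightarrow> \<tau>' = \<tau>))"


section \<open>Partial flag varieties and their Schubert varieties\<close>

definition SL :: "nat \<Rightarrow> 'k::comm_ring_1 mat set" where
  "SL n = {g \<in> carrier_mat n n. det g = 1}"

definition borel :: "nat \<Rightarrow> 'k::comm_ring_1 mat set" where
  "borel n = {g \<in> SL n. upper_triangular g}"

text \<open>The representatives of \<open>\<sigma>\<close> in the normalizer of the diagonal torus. Matrix indices
  start with 0.\<close>

definition weyl_reps :: "nat \<Rightarrow> (nat \<Rightarrow> nat) \<Rightarrow> 'k::comm_ring_1 mat set" where
  "weyl_reps n \<sigma> = {g \<in> SL n. \<forall>i<n. \<forall>j<n. g $$ (i, j) \<noteq> 0 \<longleftrightarrow> Suc i = \<sigma> (Suc j)}"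

text \<open>The \<open>i\<close>-th exterior power of \<open>\<K>\<^sup>n\<close>: the basis vector \<open>e\<^sub>j\<^sub>1 \<and> \<dots> \<and> e\<^sub>j\<^sub>i\<close> with
  \<open>j\<^sub>1 < \<dots> < j\<^sub>i\<close> has the index \<open>{j\<^sub>1, \<dots>, j\<^sub>i}\<close>.\<close>

definition ext_power :: "nat \<Rightarrow> nat \<Rightarrow> (nat set \<Rightarrow> 'k::comm_ring_1) set" where
  "ext_power n i = {x. \<forall>J. x J \<noteq> 0 \<longrightarrow> J \<subseteq> {1..n} \<and> card J = i}"

text \<open>The coordinates of \<open>g e\<^sub>1 \<and> \<dots> \<and> g e\<^sub>i\<close>, which are the minors of \<open>g\<close> on its first
  \<open>i\<close> columns.\<close>

definition wedge_cols :: "nat \<Rightarrow> nat \<Rightarrow> 'k::comm_ring_1 mat \<Rightarrow> nat set \<Rightarrow> 'k" where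
  "wedge_cols n i g = (\<lambda>J. if J \<subseteq> {1..n} \<and> card J = i
     then det (submatrix g ((\<lambda>j. j - 1) ` J) {..<i}) else 0)"

text \<open>The image of the coset of \<open>g\<close> under the Pluecker embedding of the quotient of \<open>SL\<^sub>n\<close> by
  the intersection of the \<open>P\<^bsub>k\<^sub>j\<^esub>\<close>, \<open>j \<in> I\<close>.\<close>

definition flag_point :: "nat \<Rightarrow> (nat \<Rightarrow> nat) \<Rightarrow> nat set \<Rightarrow> 'k::comm_ring_1 mat
    \<Rightarrow> nat \<Rightarrow> (nat set \<Rightarrow> 'k) set" where
  "flag_point n k I g = proj_point I (\<lambda>j. if j \<in> I then wedge_cols n (k j) g else 0)"

definition flag_variety :: "nat \<Rightarrow> (nat \<Rightarrow> nat) \<Rightarrow> nat set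
    \<Rightarrow> (nat \<Rightarrow> (nat set \<Rightarrow> 'k::comm_ring_1) set) set" where
  "flag_variety n k I = flag_point n k I ` SL n"

definition schubert_variety :: "nat \<Rightarrow> (nat \<Rightarrow> nat) \<Rightarrow> nat set \<Rightarrow> (nat \<Rightarrow> nat) set
    \<Rightarrow> (nat \<Rightarrow> (nat set \<Rightarrow> 'k::comm_ring_1) set) set" where
  "schubert_variety n k I \<tau> = zariski_closure (\<lambda>j. ext_power n (k j)) I
     {flag_point n k I (b * s) | b s. b \<in> borel n \<and> (\<exists>\<sigma>\<in>\<tau>. s \<in> weyl_reps n \<sigma>)}"


section \<open>The stratification of a partial flag variety and semistandard tableaux\<close>

definition flag_strata :: "nat \<Rightarrow> nat \<Rightarrow> (nat \<Rightarrow> nat) \<Rightarrow> ((nat \<Rightarrow> nat) set \<times> nat) set" where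
  "flag_strata n m k =
     {(\<theta>, i). i \<in> {1..m} \<and> \<theta> \<in> lcosets\<^bsub>sym_group n\<^esub> weyl_par n {k i}}"

text \<open>The set \<open>\<sigma> ` {1..k i}\<close> does not depend on the choice of \<open>\<sigma> \<in> \<theta>\<close>.\<close>

definition column_set :: "(nat \<Rightarrow> nat) \<Rightarrow> (nat \<Rightarrow> nat) set \<times> nat \<Rightarrow> nat set" where
  "column_set k = (\<lambda>(\<theta>, i). \<Union>\<sigma>\<in>\<theta>. \<sigma> ` {1..k i})"

definition column :: "(nat \<Rightarrow> nat) \<Rightarrow> (nat \<Rightarrow> nat) set \<times> nat \<Rightarrow> nat list" where
  "column k p = sorted_list_of_set (column_set k p)"

definition flag_stratification :: "nat \<Rightarrow> nat \<Rightarrow> (nat \<Rightarrow> nat)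
    \<Rightarrow> ((nat \<Rightarrow> nat) set \<times> nat, nat set, 'k::comm_ring_1) stratification" where
  "flag_stratification n m k =
     (let V = (\<lambda>j. ext_power n (k j)); Xhat = multicone V {1..m} (flag_variety n k {1..m})
      in \<lparr>nfac = m,
          total = Xhat,
          strata = flag_strata n m k,
          scone = (\<lambda>(\<theta>, i). multicone V {i..m}
            (schubert_variety n k {i..m} (max_lift n (k ` {i..m}) \<theta>))),
          extremal = (\<lambda>p. restr Xhat (\<lambda>v. v (snd p) (column_set k p)))\<rparr>)"

text \<open>Semistandard Young tableaux with entries in \<open>{1..n}\<close> all of whose columns have length in
  \<open>L\<close>, as lists of columns; every column is read from top to bottom.\<close>

definition SSYT :: "nat \<Rightarrow> nat set \<Rightarrow> nat list list set" where
  "SSYT n L = {T.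
     (\<forall>c\<in>set T. sorted_wrt (<) c \<and> set c \<subseteq> {1..n} \<and> length c \<in> L) \<and>
     sorted_wrt (\<lambda>c c'. length c' \<le> length c \<and> (\<forall>i<length c'. c ! i \<le> c' ! i)) T}"

definition column_stratum :: "nat \<Rightarrow> nat \<Rightarrow> (nat \<Rightarrow> nat) \<Rightarrow> nat list \<Rightarrow> (nat \<Rightarrow> nat) set \<times> nat" where
  "column_stratum n m k c = (THE p. p \<in> flag_strata n m k \<and> column k p = c)"

end

theory Submission
  imports Defs
begin

text \<open>
 The strata are represented by their column sets. By the Garnir relations, which hold for minors, the
 standard monomials in the Pluecker coordinates span the coordinate ring. Degenerating one
 Schubert cell to the next shows that they are independent, on every stratum those whose columns
 are all below it. So the multicones of the strata are cut out by Pluecker coordinates, the extremal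
 function of a stratum generates the ideal of the union of the smaller strata, and all bonds are 1.

 Hence along a maximal chain the valuation of \<open>p\<^bsub>(\<theta>,i)\<^esub>\<close> is the unit vector of \<open>(\<theta>, i)\<close> if the
 chain contains \<open>(\<theta>, i)\<close>, and is lexicographically larger otherwise. As these valuations are
 multiplicative and ultrametric, the quasi-valuation of a function is the smallest tableau in its
 standard expansion, which determines the fan of monoids.
\<close>

text \<open>The definitions offer Zariski closures of orbits and discrete valuations given by
  description, neither of which can be computed with directly. For the strata the bridge is
  \<open>cone J\<close>, given by the vanishing of the coordinates whose column is not below J. That
  it is the multicone of the Schubert variety takes two arguments beyond the straightening law: a
  common zero of all multihomogeneous relations on flags is again a flag, rebuilt from its
  coordinates, and a point with some zero components is completed to one with none. For the
  valuations no dimension theory is used: an order of vanishing i is certified by an identity F * G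
  = ext p ^ i * C of functions on the stratum, where G and C do not vanish identically on the
  smaller stratum. Flags are represented by invertible matrices; an n-th root of the determinant
  leads back to determinant one, which is where algebraic closedness enters. Characteristic zero
  permits division by the number of block permutations in the exchange relation and supplies
  infinitely many parameter values on curves.\<close>

declare One_nat_def [simp del]

section \<open>The tableau order on column sets\<close>

text \<open>For columns \<open>c\<close>, \<open>c'\<close> this says that \<open>c\<close> may stand to the left of \<open>c'\<close> in a semistandard
 tableau. It is also the inclusion order of the strata.\<close>

definition tle :: "nat set \<Rightarrow> nat set \<Rightarrow> bool" where
 "tle J K \<longleftrightarrow> (\<forall>x. card (K \<inter> {..x}) \<le> card (J \<inter> {..x}))"

lemma tle_refl [simp]: "tle J J"
 by (simp add: tle_def)

lemma tle_trans: "tle J K \<Longrightarrow> tle K L \<Longrightarrow> tle J L"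
 unfolding tle_def by (meson order_trans)

lemma card_Int_atMost_Suc:
 fixes J :: "nat set"
 shows "card (J \<inter> {..Suc x}) = card (J \<inter> {..x}) + (if Suc x \<in> J then 1 else 0)"
proof (cases "Suc x \<in> J")
 case True
 hence "J \<inter> {..Suc x} = insert (Suc x) (J \<inter> {..x})"
  by (auto simp: le_Suc_eq)
 thus ?thesis using True by simp
next
 case False
 hence "J \<inter> {..Suc x} = J \<inter> {..x}"
  by (auto simp: le_Suc_eq)
 thus ?thesis using False by simp
qed

lemma card_Int_atMost_0: "card (J \<inter> {..0::nat}) = (if 0 \<in> J then 1 else 0)"
proof -
 have "J \<inter> {..0} = (if 0 \<in> J then {0} else {})" by auto
 thus ?thesis by simp
qed

lemma card_Int_atMost_inject:
 fixes J K :: "nat set"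
 assumes "\<And>x. card (J \<inter> {..x}) = card (K \<inter> {..x})"
 shows "J = K"
proof -
 have "x \<in> J \<longleftrightarrow> x \<in> K" for x
 proof (cases x)
  case 0
  thus ?thesis using assms[of 0] unfolding card_Int_atMost_0 by (simp split: if_splits)
 next
  case (Suc y)
  thus ?thesis using assms[of y] assms[of "Suc y"]
   by (auto simp: card_Int_atMost_Suc split: if_splits)
 qed
 thus ?thesis by blast
qed

lemma tle_antisym: "tle J K \<Longrightarrow> tle K J \<Longrightarrow> J = K"
 unfolding tle_def by (intro card_Int_atMost_inject) (meson order_antisym)

lemma tle_card:
 assumes "tle J K" "J \<subseteq> {1..n}" "K \<subseteq> {1..n}"
 shows "card K \<le> card J"
proof -
 have "K \<inter> {..n} = K" "J \<inter> {..n} = J" using assms by auto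
 thus ?thesis using assms(1) unfolding tle_def by metis
qed

text \<open>A map that does not increase entries carries the part of K up to x injectively into the
  part of J up to x. Most comparisons of columns are certified by such a map.\<close>

lemma tle_inj_on:
 assumes "inj_on \<phi> K" "\<phi> ` K \<subseteq> J" "\<And>y. y \<in> K \<Longrightarrow> \<phi> y \<le> y"
 shows "tle J K"
 unfolding tle_def
proof
 fix x
 have "card (K \<inter> {..x}) = card (\<phi> ` (K \<inter> {..x}))"
  using assms(1) by (intro card_image[symmetric]) (auto intro: inj_on_subset)
 also have "\<dots> \<le> card (J \<inter> {..x})"
  using assms(2,3) by (intro card_mono) (auto intro: le_trans)
 finally show "card (K \<inter> {..x}) \<le> card (J \<inter> {..x})" .
qed

text \<open>The order reverses inclusion, because longer columns stand further to the left.\<close>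

lemma tle_subset: "K \<subseteq> J \<Longrightarrow> tle J K"
 by (rule tle_inj_on[of id]) auto

text \<open>In a strictly increasing list the entries up to x fill an initial segment of positions,
  so counting them locates x among the rows. This translates between counts and rows.\<close>

lemma nth_le_iff_card:
 fixes c :: "nat list"
 assumes "sorted_wrt (<) c" "i < length c"
 shows "c ! i \<le> x \<longleftrightarrow> i < card (set c \<inter> {..x})"
proof -
 define I where "I = {i. i < length c \<and> c ! i \<le> x}"
 have "set c \<inter> {..x} = (!) c ` I"
  by (auto simp: I_def in_set_conv_nth)
 moreover have "inj_on ((!) c) I"
  using assms(1) by (auto simp: I_def inj_on_def strict_sorted_iff nth_eq_iff_index_eq)
 ultimately have card: "card (set c \<inter> {..x}) = card I"
  by (simp add: card_image)
 have fin: "finite I" by (simp add: I_def)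
 have down: "j \<in> I" if "i \<in> I" "j < i" for i j
  using that assms(1) by (auto simp: I_def dest: sorted_wrt_nth_less[of _ c j i])
 show ?thesis
 proof
  assume "c ! i \<le> x"
  hence "i \<in> I" using assms by (simp add: I_def)
  hence "{..i} \<subseteq> I" using down by (auto simp: le_less)
  from card_mono[OF fin this] show "i < card (set c \<inter> {..x})" by (simp add: card)
 next
  assume "i < card (set c \<inter> {..x})"
  show "c ! i \<le> x"
  proof (rule ccontr)
   assume "\<not> c ! i \<le> x"
   hence "I \<subseteq> {..<i}" using down[of _ i] by (auto simp: I_def) (metis linorder_neqE_nat)
   from card_mono[OF _ this] have "card I \<le> i" by simp
   with \<open>i < card (set c \<inter> {..x})\<close> card show False by simp
  qed
 qed
qed

text \<open>The right side is the row-wise condition on two columns in \<open>SSYT\<close>; the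
  counts avoid lists and row numbers.\<close>

lemma tle_lists_iff:
 assumes "sorted_wrt (<) c" "sorted_wrt (<) c'"
 shows "tle (set c) (set c') \<longleftrightarrow> length c' \<le> length c \<and> (\<forall>i<length c'. c ! i \<le> c' ! i)"
proof
 assume t: "tle (set c) (set c')"
 have dist: "distinct c" "distinct c'" using assms strict_sorted_iff by auto
 define N where "N = Max (set c \<union> set c' \<union> {0})"
 have sub: "set c \<inter> {..N} = set c" "set c' \<inter> {..N} = set c'"
  by (auto simp: N_def)
 have len: "length c' \<le> length c"
  using t sub dist unfolding tle_def by (metis distinct_card)
 moreover have "c ! i \<le> c' ! i" if "i < length c'" for i
 proof -
  have "i < card (set c' \<inter> {..c' ! i})" using nth_le_iff_card[OF assms(2) that] by blast
  also have "\<dots> \<le> card (set c \<inter> {..c' ! i})" using t by (simp add: tle_def)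
  finally show ?thesis using nth_le_iff_card[OF assms(1)] that len by simp
 qed
 ultimately show "length c' \<le> length c \<and> (\<forall>i<length c'. c ! i \<le> c' ! i)" by blast
next
 assume r: "length c' \<le> length c \<and> (\<forall>i<length c'. c ! i \<le> c' ! i)"
 show "tle (set c) (set c')"
  unfolding tle_def
 proof
  fix x
  show "card (set c' \<inter> {..x}) \<le> card (set c \<inter> {..x})"
  proof (rule ccontr)
   assume n: "\<not> ?thesis"
   \<comment> \<open>Row \<open>?i\<close> is the first one, counted from 0, in which c has no entry
     up to x; by assumption c' still has one there, against the row-wise comparison.\<close>
   let ?i = "card (set c \<inter> {..x})"
   have "card (set c' \<inter> {..x}) \<le> length c'"
    by (metis Int_lower1 List.finite_set card_length card_mono le_trans)
   hence i: "?i < length c'" using n by linarith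
   hence "c' ! ?i \<le> x" using nth_le_iff_card[OF assms(2) i] n by simp
   hence "c ! ?i \<le> x" using r i order_trans by blast
   thus False using nth_le_iff_card[OF assms(1), of ?i] i r by simp
  qed
 qed
qed

lemma card_set_take_Int:
 fixes c :: "nat list"
 assumes "sorted_wrt (<) c"
 shows "card (set (take l c) \<inter> {..x}) = min l (card (set c \<inter> {..x}))"
proof -
 have "sorted_wrt (<) (take l c)" by (simp add: assms sorted_wrt_take)
 have *: "i < card (set (take l c) \<inter> {..x}) \<longleftrightarrow> i < min l (card (set c \<inter> {..x}))" for i
 proof (cases "i < length (take l c)")
  case True
  thus ?thesis
   using nth_le_iff_card[OF assms, of i x] nth_le_iff_card[OF \<open>sorted_wrt (<) (take l c)\<close> True, of x]
   by simp
 next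
  case False
  have "card (set (take l c) \<inter> {..x}) \<le> length (take l c)"
   by (metis Int_lower1 List.finite_set card_length card_mono le_trans)
  moreover have "card (set c \<inter> {..x}) \<le> length c"
   by (metis Int_lower1 List.finite_set card_length card_mono le_trans)
  moreover have "card (set (take l c) \<inter> {..x}) \<le> card (set c \<inter> {..x})"
   by (intro card_mono) (auto dest: in_set_takeD)
  ultimately show ?thesis using False by auto
 qed
 show ?thesis using *[of "card (set (take l c) \<inter> {..x})"] *[of "min l (card (set c \<inter> {..x}))"]
  by (meson linorder_neqE_nat less_irrefl)
qed

text \<open>The counts of J never exceed \<open>card J\<close>, so only the first
  \<open>card J\<close> rows of K matter in the comparison with J.\<close>

lemma tle_take:
 assumes "tle K J" "finite K" "J \<subseteq> {1..n}" "card J \<le> l"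
 shows "tle (set (take l (sorted_list_of_set K))) J"
 unfolding tle_def
proof
 fix x
 have "card (J \<inter> {..x}) \<le> card J" using assms(3) by (intro card_mono) (auto intro: finite_subset)
 thus "card (J \<inter> {..x}) \<le> card (set (take l (sorted_list_of_set K)) \<inter> {..x})"
  using assms by (simp add: card_set_take_Int tle_def)
qed

text \<open>Complementing the counts with respect to n gives a natural number that strictly
  increases along \<open>tle\<close>. It is the induction measure for independence and the weight of
  the one-parameter torus.\<close>

definition rank_set :: "nat \<Rightarrow> nat set \<Rightarrow> nat" where
 "rank_set n J = (\<Sum>x\<in>{1..n}. n - card (J \<inter> {..x}))"

lemma rank_set_less:
 assumes "tle J K" "J \<noteq> K" "J \<subseteq> {1..n}" "K \<subseteq> {1..n}"
 shows "rank_set n J < rank_set n K"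
proof -
 have le: "card (K \<inter> {..x}) \<le> card (J \<inter> {..x})" "card (J \<inter> {..x}) \<le> n" for x
 proof -
  show "card (K \<inter> {..x}) \<le> card (J \<inter> {..x})" using assms by (simp add: tle_def)
  have "card (J \<inter> {..x}) \<le> card {1..n}" using assms by (intro card_mono) auto
  thus "card (J \<inter> {..x}) \<le> n" by simp
 qed
 obtain x where x: "card (K \<inter> {..x}) < card (J \<inter> {..x})"
  using assms le card_Int_atMost_inject by (metis le_neq_implies_less)
 \<comment> \<open>The sum ranges over 1..n only. Beyond n the counts are constant, so a position
   where they differ can be moved into that range.\<close>
 define y where "y = min x n"
 have "J \<inter> {..x} = J \<inter> {..y}" "K \<inter> {..x} = K \<inter> {..y}" using assms by (auto simp: y_def)
 with x have y: "card (K \<inter> {..y}) < card (J \<inter> {..y})" by simp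
 have "y \<noteq> 0"
 proof
  assume "y = 0"
  hence "J \<inter> {..y} = {}" using assms by auto
  with y show False by simp
 qed
 hence yn: "y \<in> {1..n}" by (simp add: y_def)
 show ?thesis unfolding rank_set_def
 proof (rule sum_strict_mono_ex1)
  show "\<forall>x\<in>{1..n}. n - card (J \<inter> {..x}) \<le> n - card (K \<inter> {..x})"
   using le by (auto intro: diff_le_mono2)
  show "\<exists>a\<in>{1..n}. n - card (J \<inter> {..a}) < n - card (K \<inter> {..a})"
   using y yn le(2)[of y] by (intro bexI[of _ y]) linarith+
 qed simp
qed

text \<open>Double counting: y is counted by exactly \<open>Suc n - y\<close> of the thresholds
  1..n. In this form the torus weight is a sum over the rows of a minor.\<close>

lemma sum_card_Int_atMost:
 assumes "J \<subseteq> {1..n}"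
 shows "(\<Sum>x\<in>{1..n}. card (J \<inter> {..x})) = (\<Sum>y\<in>J. Suc n - y)"
proof -
 have fin: "finite J" using assms finite_subset by blast
 have "(\<Sum>x\<in>{1..n}. card (J \<inter> {..x})) = (\<Sum>x\<in>{1..n}. \<Sum>y\<in>J. if y \<le> x then 1 else 0)"
 proof (rule sum.cong)
  fix x
  have "J \<inter> {..x} = {y\<in>J. y \<le> x}" by auto
  thus "card (J \<inter> {..x}) = (\<Sum>y\<in>J. if y \<le> x then 1 else 0)"
   using fin by (simp add: sum.If_cases Int_def)
 qed simp
 also have "\<dots> = (\<Sum>y\<in>J. \<Sum>x\<in>{1..n}. if y \<le> x then 1 else 0)" by (rule sum.swap)
 also have "\<dots> = (\<Sum>y\<in>J. Suc n - y)"
 proof (rule sum.cong)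
  fix y assume "y \<in> J"
  hence "{1..n} \<inter> {x. y \<le> x} = {y..n}" using assms by auto
  thus "(\<Sum>x\<in>{1..n}. if y \<le> x then 1 else 0) = Suc n - y"
   by (simp add: sum.If_cases)
 qed simp
 finally show ?thesis .
qed

section \<open>Permutations, cosets and maximal lifts\<close>

text \<open>A coset of a parabolic subgroup, described by the sets that its elements make of the
  initial segments. In this form inclusion of cosets and comparison by \<open>tle\<close> need no
  group operations.\<close>

definition flag_coset :: "nat \<Rightarrow> nat set \<Rightarrow> (nat \<Rightarrow> nat) \<Rightarrow> (nat \<Rightarrow> nat) set" where
 "flag_coset n D \<sigma> = {\<tau>. \<tau> permutes {1..n} \<and> (\<forall>i\<in>D. \<tau> ` {1..i} = \<sigma> ` {1..i})}"

lemma flag_coset_self: "\<sigma> permutes {1..n} \<Longrightarrow> \<sigma> \<in> flag_coset n D \<sigma>"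
 by (simp add: flag_coset_def)

lemma flag_coset_cong: "\<tau> \<in> flag_coset n D \<sigma> \<Longrightarrow> flag_coset n D \<tau> = flag_coset n D \<sigma>"
 by (auto simp: flag_coset_def)

lemma l_coset_weyl_par:
 assumes "\<sigma> permutes {1..n}"
 shows "\<sigma> <#\<^bsub>sym_group n\<^esub> weyl_par n D = flag_coset n D \<sigma>"
proof (intro Set.set_eqI iffI)
 fix \<tau> assume "\<tau> \<in> \<sigma> <#\<^bsub>sym_group n\<^esub> weyl_par n D"
 then obtain \<rho> where \<rho>: "\<rho> permutes {1..n}" "\<forall>i\<in>D. \<rho> ` {1..i} = {1..i}" "\<tau> = \<sigma> \<circ> \<rho>"
  by (auto simp: l_coset_def weyl_par_def sym_group_def)
 have "\<tau> ` {1..i} = \<sigma> ` {1..i}" if "i \<in> D" for i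
  unfolding \<rho>(3) image_comp[symmetric] using \<rho>(2) that by simp
 thus "\<tau> \<in> flag_coset n D \<sigma>"
  using permutes_compose[OF \<rho>(1) assms] \<rho>(3) unfolding flag_coset_def by simp
next
 fix \<tau> assume \<tau>: "\<tau> \<in> flag_coset n D \<sigma>"
 define \<rho> where "\<rho> = inv_into UNIV \<sigma> \<circ> \<tau>"
 have "\<rho> permutes {1..n}"
  unfolding \<rho>_def using \<tau> assms by (intro permutes_compose permutes_inv) (auto simp: flag_coset_def)
 moreover have "\<rho> ` {1..i} = {1..i}" if "i \<in> D" for i
 proof -
  have "\<rho> ` {1..i} = inv_into UNIV \<sigma> ` \<sigma> ` {1..i}"
   unfolding \<rho>_def image_comp[symmetric] using \<tau> that by (simp add: flag_coset_def)
  also have "\<dots> = {1..i}" using permutes_inj[OF assms] by (simp add: image_comp image_inv_f_f)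
  finally show ?thesis .
 qed
 moreover have "\<sigma> \<circ> \<rho> = \<tau>"
  unfolding \<rho>_def using permutes_surj[OF assms] by (simp add: fun_eq_iff surj_f_inv_f)
 ultimately show "\<tau> \<in> \<sigma> <#\<^bsub>sym_group n\<^esub> weyl_par n D"
  by (auto simp: l_coset_def weyl_par_def sym_group_def intro!: bexI[of _ \<rho>])
qed

lemma lcosets_weyl_par:
 "lcosets\<^bsub>sym_group n\<^esub> weyl_par n D = flag_coset n D ` {\<sigma>. \<sigma> permutes {1..n}}"
proof -
 have "lcosets\<^bsub>sym_group n\<^esub> weyl_par n D = (\<Union>\<sigma>\<in>{\<sigma>. \<sigma> permutes {1..n}}. {\<sigma> <#\<^bsub>sym_group n\<^esub> weyl_par n D})"
  by (simp add: LCOSETS_def sym_group_def)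
 thus ?thesis using l_coset_weyl_par by auto
qed

text \<open>Inversions of the old permutation inject into those of the new one, and the pair (a, b)
  is a new inversion outside the image.\<close>

lemma perm_length_transpose:
 assumes "\<sigma> permutes {1..n}" "a \<in> {1..n}" "b \<in> {1..n}" "a < b" "\<sigma> a < \<sigma> b"
 shows "perm_length n \<sigma> < perm_length n (\<sigma> \<circ> transpose a b)"
proof -
 let ?t = "transpose a b" and ?\<tau> = "\<sigma> \<circ> transpose a b"
 define A where "A = {(i, j). 1 \<le> i \<and> i < j \<and> j \<le> n \<and> \<sigma> j < \<sigma> i}"
 define B where "B = {(i, j). 1 \<le> i \<and> i < j \<and> j \<le> n \<and> ?\<tau> j < ?\<tau> i}"
 \<comment> \<open>Moving both positions by the transposition keeps the two values. If that reverses
   the order of the positions, one of them is a or b, and the pair itself is still an inversion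
   afterwards.\<close>
 define h where "h = (\<lambda>(i, j). if ?t i < ?t j then (?t i, ?t j) else (i, j))"
 have finB: "finite B"
  by (rule finite_subset[of _ "{1..n} \<times> {1..n}"]) (auto simp: B_def)
 have "inj_on h A"
 proof (rule inj_onI)
  fix z z' assume zz: "z \<in> A" "z' \<in> A" "h z = h z'"
  obtain i j i' j' where z: "z = (i, j)" "z' = (i', j')" by (cases z, cases z')
  have lt: "i < j" "i' < j'" using zz z by (auto simp: A_def)
  have tt: "?t (?t x) = x" for x by simp
  consider "?t i < ?t j" "?t i' < ?t j'" | "\<not> ?t i < ?t j" "\<not> ?t i' < ?t j'"
   | "?t i < ?t j" "\<not> ?t i' < ?t j'" | "\<not> ?t i < ?t j" "?t i' < ?t j'" by blast
  thus "z = z'"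
  proof cases
   case 1
   hence "?t i = ?t i'" "?t j = ?t j'" using zz z by (simp_all add: h_def)
   thus ?thesis using z tt by metis
  next
   case 2
   thus ?thesis using zz z by (simp add: h_def)
  next
   case 3
   hence "?t i = i'" "?t j = j'" using zz z by (simp_all add: h_def)
   thus ?thesis using 3 lt tt by metis
  next
   case 4
   hence "?t i' = i" "?t j' = j" using zz z by (simp_all add: h_def)
   thus ?thesis using 4 lt tt by metis
  qed
 qed
 moreover have "h ` A \<subseteq> B - {(a, b)}"
 proof
  fix z assume "z \<in> h ` A"
  then obtain i j where ij: "1 \<le> i" "i < j" "j \<le> n" "\<sigma> j < \<sigma> i" "z = h (i, j)"
   by (auto simp: A_def)
  have in_n: "?t x \<in> {1..n}" if "x \<in> {1..n}" for x
   using that assms by (simp add: transpose_def)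
  have tin: "?t i \<in> {1..n}" "?t j \<in> {1..n}" using in_n[of i] in_n[of j] ij by auto
  show "z \<in> B - {(a, b)}"
  proof (cases "?t i < ?t j")
   case True
   moreover have "(?t i, ?t j) \<noteq> (a, b)"
    using ij assms(4) by (metis Pair_inject less_asym transpose_apply_first transpose_apply_second transpose_involutory)
   ultimately show ?thesis using ij tin by (simp add: h_def B_def)
  next
   case False
   have "\<sigma> (?t j) < \<sigma> (?t i)"
   proof (cases "i = a \<or> i = b \<or> j = a \<or> j = b")
    case True
    with False show ?thesis using ij(2,4) assms(4,5) by (elim disjE) (simp_all add: transpose_def split: if_splits)
   next
    case other: False
    hence "?t i = i" "?t j = j" by simp_all
    with False ij show ?thesis by simp
   qed
   moreover have "(i, j) \<noteq> (a, b)" using ij assms by auto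
   ultimately show ?thesis using ij False by (simp add: h_def B_def)
  qed
 qed
 ultimately have "card A \<le> card (B - {(a, b)})"
  using finB by (intro card_inj_on_le[of h]) auto
 also have "\<dots> < card B"
  using finB assms by (intro card_Diff1_less) (auto simp: B_def)
 finally show ?thesis by (simp add: perm_length_def A_def B_def)
qed

lemma perm_length_le: "perm_length n \<sigma> \<le> n * n"
proof -
 have "perm_length n \<sigma> \<le> card ({1..n} \<times> {1..n})"
  unfolding perm_length_def by (intro card_mono) auto
 thus ?thesis by simp
qed

lemma tle_exchange:
 assumes "x \<in> J" "x < y"
 shows "tle J (insert y (J - {x}))"
 using assms by (intro tle_inj_on[of "\<lambda>z. if z = y then x else z"]) (auto simp: inj_on_def)

lemma image_transpose_atLeastAtMost:
 fixes \<sigma> :: "nat \<Rightarrow> nat"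
 assumes "inj \<sigma>" "1 \<le> a" "a < b"
 shows "(\<sigma> \<circ> transpose a b) ` {1..c} =
  (if a \<le> c \<and> c < b then insert (\<sigma> b) (\<sigma> ` {1..c} - {\<sigma> a}) else \<sigma> ` {1..c})"
proof (cases "a \<le> c \<and> c < b")
 case True
 hence "transpose a b ` {1..c} = insert b ({1..c} - {a})"
  using assms by (auto simp: transpose_def image_def)
 hence "(\<sigma> \<circ> transpose a b) ` {1..c} = insert (\<sigma> b) (\<sigma> ` ({1..c} - {a}))"
  unfolding image_comp[symmetric] by simp
 thus ?thesis using True assms(1) by (simp add: image_set_diff)
next
 case False
 hence "transpose a b ` {1..c} = {1..c}"
  using assms by (auto simp: transpose_def image_def)
 hence "(\<sigma> \<circ> transpose a b) ` {1..c} = \<sigma> ` {1..c}" unfolding image_comp[symmetric] by simp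
 thus ?thesis by (simp only: False if_False)
qed

text \<open>A transposition of a < b that raises the length cannot act on a descent, since undoing
  it would raise the length again. So a smaller value is replaced by a larger one in every initial
  segment that separates a from b.\<close>

lemma bruhat_step_tle:
 assumes "bruhat_step n \<sigma> \<tau>" "\<sigma> permutes {1..n}"
 shows "\<tau> permutes {1..n} \<and> tle (\<sigma> ` {1..c}) (\<tau> ` {1..c})"
proof -
 obtain a b where ab: "a \<in> {1..n}" "b \<in> {1..n}" "\<tau> = \<sigma> \<circ> transpose a b"
  and len: "perm_length n \<sigma> < perm_length n \<tau>"
  using assms(1) by (auto simp: bruhat_step_def)
 have "a \<noteq> b" using ab len by auto
 then obtain a b where ab: "a \<in> {1..n}" "b \<in> {1..n}" "\<tau> = \<sigma> \<circ> transpose a b" "a < b"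
  using ab by (metis linorder_neqE_nat transpose_commute)
 have perm: "\<tau> permutes {1..n}"
  unfolding ab(3) using ab assms(2) by (intro permutes_compose permutes_swap_id)
 have "\<sigma> a \<noteq> \<sigma> b" using ab(4) permutes_inj[OF assms(2)] by (auto dest: injD)
 moreover have "\<not> \<sigma> b < \<sigma> a"
 proof
  assume "\<sigma> b < \<sigma> a"
  hence "perm_length n \<tau> < perm_length n (\<tau> \<circ> transpose a b)"
   using ab by (intro perm_length_transpose[OF perm]) auto
  moreover have "\<tau> \<circ> transpose a b = \<sigma>" by (simp add: ab(3) comp_assoc)
  ultimately show False using len by simp
 qed
 ultimately have "\<sigma> a < \<sigma> b" by simp
 hence "tle (\<sigma> ` {1..c}) (\<tau> ` {1..c})"
  using image_transpose_atLeastAtMost[OF permutes_inj[OF assms(2)] _ ab(4), of c] ab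
  by (auto intro: tle_exchange)
 with perm show ?thesis by blast
qed

lemma bruhat_le_tle:
 assumes "bruhat_le n \<sigma> \<tau>" "\<sigma> permutes {1..n}"
 shows "\<tau> permutes {1..n} \<and> tle (\<sigma> ` {1..c}) (\<tau> ` {1..c})"
 using assms unfolding bruhat_le_def
proof (induction rule: rtranclp_induct)
 case (step \<rho> \<tau>)
 thus ?case using bruhat_step_tle[OF step(2), of c] tle_trans by blast
qed simp

lemma permutes_image_initial:
 assumes "\<sigma> permutes {1..n}" "c \<le> n"
 shows "\<sigma> ` {1..c} \<subseteq> {1..n}" "card (\<sigma> ` {1..c}) = c"
proof -
 have "{1..c} \<subseteq> {1..n}" using assms(2) by auto
 thus "\<sigma> ` {1..c} \<subseteq> {1..n}" using permutes_image[OF assms(1)] by blast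
 show "card (\<sigma> ` {1..c}) = c"
  using card_image[OF inj_on_subset[OF permutes_inj[OF assms(1)] subset_UNIV], of "{1..c}"] by simp
qed

lemma Int_atMost_eq_Diff: "M \<subseteq> {1..n} \<Longrightarrow> M \<inter> {..x} = M - {x<..n::nat}"
 by (auto simp: subset_iff not_le)

text \<open>If x reaches a value taken between positions k and c, all values above x occur among the
  first c positions, so the count up to x is the least possible for a set of c elements. For smaller
  x only the first k positions count, where the comparison is assumed.\<close>

lemma tle_image_decreasing:
 assumes \<sigma>: "\<sigma> permutes {1..n}" and dec: "\<And>a b. k < a \<Longrightarrow> a \<le> c \<Longrightarrow> c < b \<Longrightarrow> b \<le> n \<Longrightarrow> \<sigma> b < \<sigma> a"
  and c: "k \<le> c" "c \<le> n" and L: "L \<subseteq> {1..n}" "card L = c" "tle L (\<sigma> ` {1..k})"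
 shows "tle L (\<sigma> ` {1..c})"
 unfolding tle_def
proof
 fix x
 have inj: "inj \<sigma>" by (rule permutes_inj[OF \<sigma>])
 have fin: "finite L" using L finite_subset by blast
 show "card (\<sigma> ` {1..c} \<inter> {..x}) \<le> card (L \<inter> {..x})"
 proof (cases "\<exists>a\<in>{k<..c}. \<sigma> a \<le> x")
  case True
  then obtain a where a: "k < a" "a \<le> c" "\<sigma> a \<le> x" by auto
  have "{x<..n} \<subseteq> \<sigma> ` {1..c}"
  proof
   fix y assume y: "y \<in> {x<..n}"
   hence "y \<in> \<sigma> ` {1..n}" using permutes_image[OF \<sigma>] by auto
   then obtain t where t: "t \<in> {1..n}" "y = \<sigma> t" by auto
   have "t \<le> c"
   proof (rule ccontr)
    assume "\<not> t \<le> c"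
    hence "\<sigma> t < \<sigma> a" using a t by (intro dec) auto
    thus False using y t a by simp
   qed
   thus "y \<in> \<sigma> ` {1..c}" using t by auto
  qed
  hence "card (\<sigma> ` {1..c} \<inter> {..x}) = c - card {x<..n}"
   using permutes_image_initial[OF \<sigma> c(2)] by (simp add: Int_atMost_eq_Diff card_Diff_subset)
  also have "\<dots> \<le> card (L - {x<..n})"
   using L diff_card_le_card_Diff[of "{x<..n}" L] by simp
  also have "\<dots> = card (L \<inter> {..x})"
   using L by (simp add: Int_atMost_eq_Diff)
  finally show ?thesis .
 next
  case False
  have "{1..c} = {1..k} \<union> {k<..c}" using c by auto
  hence "\<sigma> ` {1..c} \<inter> {..x} = \<sigma> ` {1..k} \<inter> {..x}"
   using False by (auto simp: not_le)
  thus ?thesis using L by (simp add: tle_def)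
 qed
qed

text \<open>J in increasing order, followed by its complement in decreasing order. The second part
  makes the images of longer initial segments as large as possible; the first part makes the images
  of shorter ones truncations of the column J.\<close>

definition lift_perm :: "nat \<Rightarrow> nat set \<Rightarrow> nat \<Rightarrow> nat" where
 "lift_perm n J t = (if t \<in> {1..n}
   then (sorted_list_of_set J @ rev (sorted_list_of_set ({1..n} - J))) ! (t - 1) else t)"

lemma image_Suc_nth:
 assumes "c \<le> length w"
 shows "(\<lambda>t. w ! (t - 1)) ` {1..c} = set (take c w)"
proof -
 have "(\<lambda>t. w ! (t - 1)) ` {1..c} = (!) w ` {..<c}"
 proof -
  have "(\<lambda>t. t - 1) ` {1..c} = {..<c}"
  proof (intro Set.set_eqI iffI)
   fix y assume "y \<in> {..<c}"
   thus "y \<in> (\<lambda>t. t - 1) ` {1..c}" by (intro image_eqI[of _ _ "Suc y"]) auto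
  qed auto
  thus ?thesis by (metis image_image)
 qed
 also have "\<dots> = set (take c w)" using nth_image[OF assms] by (simp add: lessThan_atLeast0)
 finally show ?thesis .
qed

lemma lift_perm:
 assumes "J \<subseteq> {1..n}"
 shows lift_perm_permutes: "lift_perm n J permutes {1..n}"
  and lift_perm_image_take: "c \<le> card J \<Longrightarrow> lift_perm n J ` {1..c} = set (take c (sorted_list_of_set J))"
  and lift_perm_image: "lift_perm n J ` {1..card J} = J"
  and lift_perm_decreasing: "card J < a \<Longrightarrow> a < b \<Longrightarrow> b \<le> n \<Longrightarrow> lift_perm n J b < lift_perm n J a"
proof -
 define v where "v = sorted_list_of_set ({1..n} - J)"
 define w where "w = sorted_list_of_set J @ rev v"
 have fin: "finite J" using assms finite_subset by blast
 have lenv: "length v = n - card J" using assms by (simp add: v_def card_Diff_subset fin)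
 have cJ: "card J \<le> n" using card_mono[OF _ assms] by simp
 have len: "length w = n" using lenv cJ by (simp add: w_def)
 have dist: "distinct w" by (auto simp: w_def v_def fin)
 have set: "set w = {1..n}" using assms by (auto simp: w_def v_def fin)
 have im: "lift_perm n J ` {1..c} = set (take c w)" if "c \<le> n" for c
 proof -
  have "lift_perm n J ` {1..c} = (\<lambda>t. w ! (t - 1)) ` {1..c}"
   using that by (intro image_cong) (auto simp: lift_perm_def w_def v_def)
  thus ?thesis using image_Suc_nth[of c w] that len by simp
 qed
 show "lift_perm n J permutes {1..n}"
 proof (rule bij_imp_permutes)
  have "inj_on (lift_perm n J) {1..n}"
  proof (rule inj_onI)
   fix x y assume xy: "x \<in> {1..n}" "y \<in> {1..n}" "lift_perm n J x = lift_perm n J y"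
   hence "w ! (x - 1) = w ! (y - 1)" by (simp add: lift_perm_def w_def v_def)
   moreover have "x - 1 < length w" "y - 1 < length w" using xy len by auto
   ultimately have "x - 1 = y - 1" using dist nth_eq_iff_index_eq by blast
   thus "x = y" using xy by auto
  qed
  moreover have "lift_perm n J ` {1..n} = {1..n}" using im[of n] len set by simp
  ultimately show "bij_betw (lift_perm n J) {1..n} {1..n}" by (simp add: bij_betw_def)
 qed (auto simp: lift_perm_def)
 show "lift_perm n J ` {1..c} = set (take c (sorted_list_of_set J))" if "c \<le> card J" for c
  using im[of c] that cJ by (simp add: w_def)
 thus "lift_perm n J ` {1..card J} = J" using fin by simp
 show "lift_perm n J b < lift_perm n J a" if "card J < a" "a < b" "b \<le> n"
 proof -
  have *: "lift_perm n J t = v ! (n - t)" if "card J < t" "t \<le> n" for t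
  proof -
   have "lift_perm n J t = rev v ! (t - 1 - card J)"
    using that unfolding lift_perm_def v_def[symmetric] nth_append by auto
   also have "\<dots> = v ! (length v - Suc (t - 1 - card J))"
    using that lenv by (intro rev_nth) auto
   also have "length v - Suc (t - 1 - card J) = n - t" using that lenv by simp
   finally show ?thesis .
  qed
  have "v ! (n - b) < v ! (n - a)"
   using that lenv by (intro sorted_wrt_nth_less[of "(<)" v]) (auto simp: v_def)
  thus ?thesis using that *[of a] *[of b] by simp
 qed
qed

text \<open>Each of the two images is the largest set of its size that lies below the common image
  of 1..k, so they are below each other.\<close>

lemma image_decreasing_unique:
 fixes c k n :: nat
 assumes \<sigma>: "\<sigma> permutes {1..n}" "\<And>a b. k < a \<Longrightarrow> a < b \<Longrightarrow> b \<le> n \<Longrightarrow> \<sigma> b < \<sigma> a"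
  and \<tau>: "\<tau> permutes {1..n}" "\<And>a b. k < a \<Longrightarrow> a < b \<Longrightarrow> b \<le> n \<Longrightarrow> \<tau> b < \<tau> a"
  and eq: "\<sigma> ` {1..k} = \<tau> ` {1..k}" and c: "k \<le> c" "c \<le> n"
 shows "\<sigma> ` {1..c} = \<tau> ` {1..c}"
proof (rule tle_antisym)
 have *: "\<rho> ` {1..c} \<subseteq> {1..n}" "card (\<rho> ` {1..c}) = c" "tle (\<rho> ` {1..c}) (\<rho> ` {1..k})"
  if "\<rho> permutes {1..n}" for \<rho>
  using permutes_image_initial[OF that c(2)] c by (auto intro!: tle_subset)
 show "tle (\<sigma> ` {1..c}) (\<tau> ` {1..c})"
  by (rule tle_image_decreasing[OF \<tau>(1) _ c]) (use *[OF \<sigma>(1)] eq \<tau>(2) in auto)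
 show "tle (\<tau> ` {1..c}) (\<sigma> ` {1..c})"
  by (rule tle_image_decreasing[OF \<sigma>(1) _ c]) (use *[OF \<tau>(1)] eq \<sigma>(2) in auto)
qed

text \<open>The coset of \<open>lift_perm\<close> has the largest possible images, so nothing else
  lies above it. Any other preimage has an ascent across some c in D, and a transposition there
  leads to a different preimage above it.\<close>

lemma max_lift_flag_coset:
 assumes J: "J \<subseteq> {1..n}" and \<sigma>: "\<sigma> permutes {1..n}" "\<sigma> ` {1..card J} = J"
  and D: "card J \<in> D" "D \<subseteq> {card J..n}"
 shows "max_lift n D (flag_coset n {card J} \<sigma>) = flag_coset n D (lift_perm n J)"
proof -
 let ?k = "card J" and ?\<theta> = "flag_coset n {card J} \<sigma>" and ?\<rho> = "lift_perm n J"
 note \<rho> = lift_perm[OF J]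
 define L where "L = {\<tau> \<in> lcosets\<^bsub>sym_group n\<^esub> weyl_par n D. \<tau> \<subseteq> ?\<theta>}"
 have L: "T \<in> L \<longleftrightarrow> (\<exists>\<tau>. \<tau> permutes {1..n} \<and> \<tau> ` {1..?k} = J \<and> T = flag_coset n D \<tau>)" for T
 proof
  assume "T \<in> L"
  then obtain \<tau> where \<tau>: "\<tau> permutes {1..n}" "T = flag_coset n D \<tau>" "T \<subseteq> ?\<theta>"
   by (auto simp: L_def lcosets_weyl_par)
  hence "\<tau> \<in> ?\<theta>" using flag_coset_self by blast
  thus "\<exists>\<tau>. \<tau> permutes {1..n} \<and> \<tau> ` {1..?k} = J \<and> T = flag_coset n D \<tau>"
   using \<tau>(1,2) \<sigma>(2) by (intro exI[of _ \<tau>]) (simp add: flag_coset_def)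
 next
  assume "\<exists>\<tau>. \<tau> permutes {1..n} \<and> \<tau> ` {1..?k} = J \<and> T = flag_coset n D \<tau>"
  then obtain \<tau> where \<tau>: "\<tau> permutes {1..n}" "\<tau> ` {1..?k} = J" "T = flag_coset n D \<tau>" by blast
  hence "T \<subseteq> ?\<theta>" using D(1) \<sigma>(2) by (simp add: flag_coset_def subset_iff)
  thus "T \<in> L" using \<tau> by (simp add: L_def lcosets_weyl_par)
 qed
 have im: "\<tau> ` {1..c} \<subseteq> {1..n} \<and> card (\<tau> ` {1..c}) = c" if "\<tau> permutes {1..n}" "c \<in> D" for \<tau> c
 proof -
  have "c \<le> n" using that(2) D(2) by auto
  thus ?thesis using permutes_image_initial[OF that(1)] by simp
 qed
 have \<rho>max: "\<tau>' = flag_coset n D ?\<rho>" if \<tau>'L: "\<tau>' \<in> L" "coset_le n (flag_coset n D ?\<rho>) \<tau>'" for \<tau>'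
 proof -
  obtain \<alpha> \<beta> where ab: "\<alpha> \<in> flag_coset n D ?\<rho>" "\<beta> \<in> \<tau>'" "bruhat_le n \<alpha> \<beta>"
   using \<tau>'L(2) unfolding coset_le_def by blast
  obtain \<tau> where \<tau>: "\<tau> permutes {1..n}" "\<tau> ` {1..?k} = J" "\<tau>' = flag_coset n D \<tau>"
   using \<tau>'L(1) L by blast
  have \<alpha>: "\<alpha> permutes {1..n}" using ab by (simp add: flag_coset_def)
  have \<beta>: "\<beta> permutes {1..n}" "\<And>c. tle (\<alpha> ` {1..c}) (\<beta> ` {1..c})"
   using bruhat_le_tle[OF ab(3) \<alpha>] by auto
  have "\<beta> ` {1..c} = ?\<rho> ` {1..c}" if c: "c \<in> D" for c
  proof (rule tle_antisym)
   show "tle (?\<rho> ` {1..c}) (\<beta> ` {1..c})"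
    using \<beta>(2)[of c] ab c by (simp add: flag_coset_def)
   have "\<beta> ` {1..?k} = J" using ab \<tau> D by (simp add: flag_coset_def)
   moreover have "\<beta> ` {1..?k} \<subseteq> \<beta> ` {1..c}" using c D by (intro image_mono) auto
   ultimately have J\<beta>: "J \<subseteq> \<beta> ` {1..c}" by simp
   show "tle (\<beta> ` {1..c}) (?\<rho> ` {1..c})"
   proof (rule tle_image_decreasing[OF \<rho>(1), where k = ?k])
    show "?k \<le> c" "c \<le> n" using c D by auto
    show "\<beta> ` {1..c} \<subseteq> {1..n}" "card (\<beta> ` {1..c}) = c" using im[OF \<beta>(1) c] by auto
   qed (simp_all add: \<rho>(3,4) J\<beta> tle_subset)
  qed
  hence "\<beta> \<in> flag_coset n D ?\<rho>" using \<beta> by (simp add: flag_coset_def)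
  thus ?thesis using flag_coset_cong ab(2) \<tau>(3) by metis
 qed
 have \<rho>L: "flag_coset n D ?\<rho> \<in> L" using L \<rho> by blast
 have uniq: "T = flag_coset n D ?\<rho>" if T: "T \<in> L" "\<forall>\<tau>'\<in>L. coset_le n T \<tau>' \<longrightarrow> \<tau>' = T" for T
 proof (rule ccontr)
  assume ne: "T \<noteq> flag_coset n D ?\<rho>"
  obtain \<tau> where \<tau>: "\<tau> permutes {1..n}" "\<tau> ` {1..?k} = J" "T = flag_coset n D \<tau>"
   using T(1) L by blast
  have inj: "inj \<tau>" by (rule permutes_inj[OF \<tau>(1)])
  obtain c where c: "c \<in> D" "\<tau> ` {1..c} \<noteq> ?\<rho> ` {1..c}"
  proof -
   have "\<not> (\<forall>c\<in>D. \<tau> ` {1..c} = ?\<rho> ` {1..c})"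
   proof
    assume "\<forall>c\<in>D. \<tau> ` {1..c} = ?\<rho> ` {1..c}"
    hence "flag_coset n D \<tau> = flag_coset n D ?\<rho>" by (simp add: flag_coset_def)
    with ne \<tau>(3) show False by simp
   qed
   with that show ?thesis by blast
  qed
  \<comment> \<open>Without such an ascent the images of 1..c under both permutations would be
    maximal, hence equal. Positions a beyond \<open>?k\<close> are asked for so that the
    transposition does not change the image J.\<close>
  have "\<exists>a b. ?k < a \<and> a \<le> c \<and> c < b \<and> b \<le> n \<and> \<tau> a < \<tau> b"
  proof (rule ccontr)
   assume neg: "\<not> ?thesis"
   have J: "J \<subseteq> \<tau> ` {1..c}" "J \<subseteq> ?\<rho> ` {1..c}"
   proof -
    have "{1..?k} \<subseteq> {1..c}" using c(1) D(2) by auto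
    from image_mono[OF this, of \<tau>] image_mono[OF this, of ?\<rho>]
    show "J \<subseteq> \<tau> ` {1..c}" "J \<subseteq> ?\<rho> ` {1..c}"
     using \<tau>(2) \<rho>(3) by simp_all
   qed
   have "\<tau> ` {1..c} = ?\<rho> ` {1..c}"
   proof (rule tle_antisym)
    show "tle (\<tau> ` {1..c}) (?\<rho> ` {1..c})"
    proof (rule tle_image_decreasing[OF \<rho>(1), where k = ?k])
     show "?k \<le> c" "c \<le> n" using c D by auto
     show "\<tau> ` {1..c} \<subseteq> {1..n}" "card (\<tau> ` {1..c}) = c" using im[OF \<tau>(1) c(1)] by auto
    qed (simp_all add: \<rho>(3,4) J tle_subset)
    have dec: "\<tau> b < \<tau> a" if "?k < a" "a \<le> c" "c < b" "b \<le> n" for a b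
    proof -
     have "\<tau> a \<noteq> \<tau> b" using that inj by (simp add: inj_eq)
     moreover have "\<not> \<tau> a < \<tau> b" using neg that by blast
     ultimately show ?thesis by linarith
    qed
    show "tle (?\<rho> ` {1..c}) (\<tau> ` {1..c})"
    proof (rule tle_image_decreasing[OF \<tau>(1), where k = ?k])
     show "?k \<le> c" "c \<le> n" using c D by auto
     show "?\<rho> ` {1..c} \<subseteq> {1..n}" "card (?\<rho> ` {1..c}) = c" using im[OF \<rho>(1) c(1)] by auto
    qed (simp_all add: \<tau>(2) J dec tle_subset)
   qed
   with c show False by simp
  qed
  then obtain a b where ab: "?k < a" "a \<le> c" "c < b" "b \<le> n" "\<tau> a < \<tau> b" by blast
  let ?\<tau>' = "\<tau> \<circ> transpose a b"
  have perm: "?\<tau>' permutes {1..n}"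
   using ab \<tau>(1) by (intro permutes_compose permutes_swap_id) auto
  have im': "?\<tau>' ` {1..e} = (if a \<le> e \<and> e < b then insert (\<tau> b) (\<tau> ` {1..e} - {\<tau> a}) else \<tau> ` {1..e})" for e
   using ab by (intro image_transpose_atLeastAtMost[OF inj]) auto
  have "bruhat_step n \<tau> ?\<tau>'"
  proof -
   have "a \<in> {1..n}" "b \<in> {1..n}" using ab by auto
   thus ?thesis
    unfolding bruhat_step_def
    using perm_length_transpose[OF \<tau>(1) \<open>a \<in> _\<close> \<open>b \<in> _\<close>] ab
    by (intro conjI bexI[of _ a] bexI[of _ b]) auto
  qed
  hence "bruhat_le n \<tau> ?\<tau>'" by (simp add: bruhat_le_def)
  hence "coset_le n T (flag_coset n D ?\<tau>')"
   unfolding coset_le_def \<tau>(3) using flag_coset_self[OF \<tau>(1)] flag_coset_self[OF perm] by blast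
  moreover have "flag_coset n D ?\<tau>' \<in> L"
  proof -
   have "?\<tau>' ` {1..?k} = J" using im'[of ?k] ab \<tau>(2) by simp
   thus ?thesis using L perm by blast
  qed
  ultimately have "flag_coset n D ?\<tau>' = T" using T by blast
  hence "?\<tau>' \<in> flag_coset n D \<tau>" using \<tau>(3) flag_coset_self[OF perm] by blast
  hence "?\<tau>' ` {1..c} = \<tau> ` {1..c}" using c by (simp add: flag_coset_def)
  moreover have "\<tau> b \<in> ?\<tau>' ` {1..c}" unfolding im' using ab by simp
  ultimately have "\<tau> b \<in> \<tau> ` {1..c}" by (simp only:)
  hence "b \<in> {1..c}" using inj by (simp only: inj_image_mem_iff)
  thus False using ab by simp
 qed
 show ?thesis
  unfolding max_lift_def Let_def L_def[symmetric]
 proof (rule the_equality)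
  show "flag_coset n D ?\<rho> \<in> L \<and> (\<forall>\<tau>'\<in>L. coset_le n (flag_coset n D ?\<rho>) \<tau>' \<longrightarrow> \<tau>' = flag_coset n D ?\<rho>)"
   using \<rho>L \<rho>max by blast
 qed (use uniq in blast)
qed

section \<open>Minors and the Garnir relations\<close>

text \<open>Rows are a list, so that they may be permuted or repeated, as the exchange relations
  require; the columns are always the first ones.\<close>

definition mnr :: "(nat \<Rightarrow> nat \<Rightarrow> 'a::comm_ring_1) \<Rightarrow> nat list \<Rightarrow> 'a" where
 "mnr x L = det (mat (length L) (length L) (\<lambda>(i, j). x (L ! i) j))"

lemma mnr_leibniz:
 "mnr x L = (\<Sum>p | p permutes {0..<length L}. of_int (sign p) * (\<Prod>i = 0..<length L. x (L ! i) (p i)))"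
proof -
 have "p i < length L" if "p permutes {0..<length L}" "i < length L" for p i
  using permutes_in_image[OF that(1), of i] that(2) by simp
 thus ?thesis
  unfolding mnr_def by (subst det_def'[OF mat_carrier]) (auto intro!: sum.cong prod.cong)
qed

lemma mnr_permute:
 assumes "p permutes {..<length L}"
 shows "mnr x (permute_list p L) = of_int (sign p) * mnr x L"
proof -
 let ?n = "length L" and ?A = "mat (length L) (length L) (\<lambda>(i, j). x (L ! i) j)"
 have p: "p permutes {0..<?n}" using assms by (simp add: lessThan_atLeast0)
 have "p i < ?n" if "i < ?n" for i
  using permutes_in_image[OF p, of i] that by simp
 hence "mat ?n ?n (\<lambda>(i, j). x (permute_list p L ! i) j) = mat ?n ?n (\<lambda>(i, j). ?A $$ (p i, j))"
  by (intro eq_matI) (simp_all add: permute_list_nth[OF assms])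
 moreover have "?A \<in> carrier_mat ?n ?n" by simp
 ultimately show ?thesis
  using det_permute_rows[OF _ p, of ?A] by (simp add: mnr_def)
qed

text \<open>The exchange argument is applied to minors and, in the proof that limits of flags are
  flags, to the coordinates of a point not yet known to be a flag. This property is what they
  share.\<close>

definition alternating :: "(nat list \<Rightarrow> 'a::comm_ring_1) \<Rightarrow> bool" where
 "alternating P \<longleftrightarrow> (\<forall>L i j. i < length L \<and> j < length L \<and> i \<noteq> j \<longrightarrow>
   P (permute_list (transpose i j) L) = - P L)"

lemma alternating_mnr: "alternating (mnr x)"
 unfolding alternating_def
 by (auto simp: mnr_permute permutes_swap_id sign_swap_id)

lemma mnr_not_distinct:
 assumes "\<not> distinct L"
 shows "mnr x L = 0"
proof -
 obtain i j where ij: "i < length L" "j < length L" "i \<noteq> j" "L ! i = L ! j"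
  using assms by (auto simp: distinct_conv_nth)
 thus ?thesis
  unfolding mnr_def by (intro det_identical_rows[OF mat_carrier ij(3,1,2)]) (auto simp: Matrix.row_def)
qed

text \<open>For distinct entries this is the sign of the sorting permutation, written as a minor of
  an identity matrix. Multiplicativity of the determinant then gives \<open>mnr_sort\<close>, and
  alternation is inherited from minors.\<close>

definition list_sign :: "nat list \<Rightarrow> 'a::comm_ring_1" where
 "list_sign L = mnr (\<lambda>r c. if r = sorted_list_of_set (set L) ! c then 1 else 0) L"

lemma mnr_sort:
 assumes "distinct L"
 shows "mnr x L = list_sign L * mnr x (sorted_list_of_set (set L))"
proof -
 let ?S = "sorted_list_of_set (set L)" and ?n = "length L"
 have len: "length ?S = ?n" using assms by (simp add: distinct_card)
 define P :: "'a mat" where "P = mat ?n ?n (\<lambda>(i, j). if L ! i = ?S ! j then 1 else 0)"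
 define X where "X = mat ?n ?n (\<lambda>(i, j). x (?S ! i) j)"
 have "mat ?n ?n (\<lambda>(i, j). x (L ! i) j) = P * X"
 proof (rule eq_matI)
  fix i j assume ij: "i < dim_row (P * X)" "j < dim_col (P * X)"
  hence i: "i < ?n" and j: "j < ?n" by (auto simp: P_def X_def)
  hence "L ! i \<in> set ?S" by simp
  then obtain d where d: "d < ?n" "?S ! d = L ! i" using len by (metis in_set_conv_nth)
  have uniq: "L ! i = ?S ! e \<longleftrightarrow> e = d" if "e < ?n" for e
   using d that len nth_eq_iff_index_eq[of ?S e d] by (metis sorted_list_of_set.distinct_sorted_key_list_of_set)
  have "(P * X) $$ (i, j) = (\<Sum>e = 0..<?n. (if L ! i = ?S ! e then 1 else 0) * x (?S ! e) j)"
   using i j by (simp add: P_def X_def scalar_prod_def)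
  also have "\<dots> = (\<Sum>e = 0..<?n. if e = d then x (L ! i) j else 0)"
   using uniq d by (intro sum.cong) auto
  also have "\<dots> = x (L ! i) j" using d by simp
  finally show "mat ?n ?n (\<lambda>(i, j). x (L ! i) j) $$ (i, j) = (P * X) $$ (i, j)" using i j by simp
 qed (simp_all add: P_def X_def)
 hence "mnr x L = det P * det X"
  unfolding mnr_def using det_mult[of P ?n X] by (simp add: P_def X_def)
 moreover have "det P = list_sign L" by (simp add: P_def list_sign_def mnr_def)
 moreover have "det X = mnr x ?S" using len by (simp add: X_def mnr_def)
 ultimately show ?thesis by simp
qed

lemma list_sign_cases:
 assumes "distinct L"
 shows "list_sign L = (1::'a::comm_ring_1) \<or> list_sign L = (- 1::'a)"
proof -
 let ?S = "sorted_list_of_set (set L)"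
 let ?x = "\<lambda>r c. if r = ?S ! c then 1 else (0::'a)"
 have "mset L = mset ?S" using assms by (metis finite_set mset_set_set sorted_list_of_mset_set mset_sorted_list_of_multiset)
 then obtain p where p: "p permutes {..<length ?S}" "permute_list p ?S = L"
  by (rule mset_eq_permutation)
 have "mat (length ?S) (length ?S) (\<lambda>(i, j). ?x (?S ! i) j) = 1\<^sub>m (length ?S)"
  by (rule eq_matI) (auto simp: nth_eq_iff_index_eq)
 hence "mnr ?x ?S = 1" by (simp add: mnr_def)
 hence "list_sign L = (of_int (sign p) :: 'a)"
  unfolding list_sign_def using mnr_permute[OF p(1), of ?x] p(2) by simp
 thus ?thesis by (cases p rule: sign_cases) auto
qed

lemma alternating_list_sign: "alternating (\<lambda>L. if distinct L then list_sign L * f (set L) (length L) else 0)"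
 unfolding alternating_def
proof (intro allI impI)
 fix L :: "nat list" and i j
 assume ij: "i < length L \<and> j < length L \<and> i \<noteq> j"
 let ?L = "permute_list (transpose i j) L"
 have t: "transpose i j permutes {..<length L}" using ij by (simp add: permutes_swap_id)
 have m: "set ?L = set L" "distinct ?L \<longleftrightarrow> distinct L" "length ?L = length L"
  using t by simp_all
 have "list_sign ?L = - (list_sign L :: 'a)"
  using mnr_permute[OF t, of "\<lambda>r c. if r = sorted_list_of_set (set L) ! c then 1 else (0::'a)"] ij m
  by (simp add: list_sign_def sign_swap_id)
 thus "(if distinct ?L then list_sign ?L * f (set ?L) (length ?L) else 0) =
   - (if distinct L then list_sign L * f (set L) (length L) else 0)"
  using m by simp
qed

text \<open>N factors drawn from fewer than N columns repeat a column, and the alternating sum is a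
  determinant with two equal rows.\<close>

lemma sum_sign_prod_zero:
 fixes z :: "nat \<Rightarrow> nat \<Rightarrow> 'a::comm_ring_1"
 assumes "\<And>i. i < N \<Longrightarrow> \<kappa> i < a" "a < N"
 shows "(\<Sum>p | p permutes {0..<N}. of_int (sign p) * (\<Prod>i = 0..<N. z (p i) (\<kappa> i))) = 0"
proof -
 let ?A = "mat N N (\<lambda>(i, j). z j (\<kappa> i))"
 have "\<not> inj_on \<kappa> {..<N}"
 proof
  assume "inj_on \<kappa> {..<N}"
  hence "N \<le> card {..<a}"
   using assms(1) card_inj_on_le[of \<kappa> "{..<N}" "{..<a}"] by auto
  thus False using assms(2) by simp
 qed
 then obtain i j where ij: "i < N" "j < N" "i \<noteq> j" "\<kappa> i = \<kappa> j" by (auto simp: inj_on_def)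
 have "det ?A = 0"
  using ij by (intro det_identical_rows[OF mat_carrier ij(3,1,2)]) (auto simp: Matrix.row_def)
 moreover have "det ?A = (\<Sum>p | p permutes {0..<N}. of_int (sign p) * (\<Prod>i = 0..<N. z (p i) (\<kappa> i)))"
 proof -
  have "p i < N" if "p permutes {0..<N}" "i < N" for p i
   using permutes_in_image[OF that(1), of i] that(2) by simp
  thus ?thesis by (subst det_def'[OF mat_carrier]) (auto intro!: sum.cong prod.cong)
 qed
 ultimately show ?thesis by simp
qed

lemma prod_split_add:
 fixes f :: "nat \<Rightarrow> 'a::comm_monoid_mult"
 shows "(\<Prod>i = 0..<u + s. f i) = (\<Prod>i = 0..<u. f i) * (\<Prod>i = 0..<s. f (u + i))"
 by (induction s) (simp_all add: mult.assoc)

text \<open>Expand both minors over column permutations. For fixed column permutations, what remains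
  is an antisymmetrization of the rows in Y over the columns of the larger minor, and there are
  fewer such columns than rows.\<close>

lemma garnir_mnr:
 fixes x :: "nat \<Rightarrow> nat \<Rightarrow> 'a::comm_ring_1"
 assumes s: "s \<le> length Y" and a: "length X1 + s < length Y"
  and b: "length Y - s + length X2 \<le> length X1 + s"
 shows "(\<Sum>p | p permutes {..<length Y}. of_int (sign p) *
  (mnr x (X1 @ take s (permute_list p Y)) * mnr x (drop s (permute_list p Y) @ X2))) = 0"
proof -
 define u N where "u = length X1" and "N = length Y"
 define a b where "a = u + s" and "b = (N - s) + length X2"
 define PN Pa Pb where "PN = {p. p permutes {0..<N}}" and "Pa = {p. p permutes {0..<a}}" and "Pb = {p. p permutes {0..<b}}"
 define A where "A = (\<lambda>\<sigma>. of_int (sign \<sigma>) * (\<Prod>i = 0..<u. x (X1 ! i) (\<sigma> i)))"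
 define B where "B = (\<lambda>\<tau>. of_int (sign \<tau>) * (\<Prod>i = 0..<length X2. x (X2 ! i) (\<tau> (N - s + i))))"
 \<comment> \<open>The column used by the i-th place of Y: the first s places lie in the first
   minor, behind X1, the others at the start of the second.\<close>
 define \<kappa> where "\<kappa> = (\<lambda>\<sigma> \<tau> i. if i < s then \<sigma> (u + i) else \<tau> (i - s) :: nat)"
 define F where "F = (\<lambda>p \<sigma> \<tau>. \<Prod>i = 0..<N. x (Y ! p i) (\<kappa> \<sigma> \<tau> i))"
 have lt: "p i < N" if "p \<in> PN" "i < N" for p i
  using that permutes_in_image[of p "{0..<N}" i] by (simp add: PN_def)
 have G: "mnr x (X1 @ take s (permute_list p Y)) * mnr x (drop s (permute_list p Y) @ X2) =
   (\<Sum>\<sigma>\<in>Pa. \<Sum>\<tau>\<in>Pb. A \<sigma> * B \<tau> * F p \<sigma> \<tau>)" if p: "p \<in> PN" for p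
 proof -
  let ?Z = "permute_list p Y"
  have p': "p permutes {..<length Y}" using p by (simp add: PN_def N_def lessThan_atLeast0)
  have Z: "?Z ! i = Y ! p i" if "i < N" for i
   using permute_list_nth[OF p'] that by (simp add: N_def)
  have 1: "mnr x (X1 @ take s ?Z) = (\<Sum>\<sigma>\<in>Pa. A \<sigma> * (\<Prod>i = 0..<s. x (Y ! p i) (\<sigma> (u + i))))"
  proof -
   have len: "length (X1 @ take s ?Z) = a" using s by (simp add: a_def u_def)
   have "(\<Prod>i = 0..<a. x ((X1 @ take s ?Z) ! i) (\<sigma> i)) =
     (\<Prod>i = 0..<u. x (X1 ! i) (\<sigma> i)) * (\<Prod>i = 0..<s. x (Y ! p i) (\<sigma> (u + i)))" for \<sigma>
    unfolding a_def prod_split_add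
    using s Z by (intro arg_cong2[of _ _ _ _ "(*)"] prod.cong) (simp_all add: u_def nth_append N_def)
   thus ?thesis unfolding mnr_leibniz len by (simp add: Pa_def A_def mult.assoc)
  qed
  have 2: "mnr x (drop s ?Z @ X2) = (\<Sum>\<tau>\<in>Pb. B \<tau> * (\<Prod>i = 0..<N - s. x (Y ! p (s + i)) (\<tau> i)))"
  proof -
   have len: "length (drop s ?Z @ X2) = b" by (simp add: b_def N_def)
   have "(\<Prod>i = 0..<b. x ((drop s ?Z @ X2) ! i) (\<tau> i)) =
     (\<Prod>i = 0..<N - s. x (Y ! p (s + i)) (\<tau> i)) * (\<Prod>i = 0..<length X2. x (X2 ! i) (\<tau> (N - s + i)))" for \<tau>
    unfolding b_def prod_split_add
   proof (intro arg_cong2[of _ _ _ _ "(*)"] prod.cong refl)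
    fix i
    have "(drop s ?Z @ X2) ! (N - s + i) = X2 ! i"
     using nth_append_length_plus[of "drop s ?Z" X2 i] by (simp add: N_def)
    thus "x ((drop s ?Z @ X2) ! (N - s + i)) (\<tau> (N - s + i)) = x (X2 ! i) (\<tau> (N - s + i))"
     by (simp only:)
   next
    fix i assume "i \<in> {0..<N - s}"
    thus "x ((drop s ?Z @ X2) ! i) (\<tau> i) = x (Y ! p (s + i)) (\<tau> i)"
     using s Z[of "s + i"] by (simp add: nth_append N_def)
   qed
   thus ?thesis unfolding mnr_leibniz len by (simp add: Pb_def B_def mult_ac)
  qed
  have 3: "(\<Prod>i = 0..<s. x (Y ! p i) (\<sigma> (u + i))) * (\<Prod>i = 0..<N - s. x (Y ! p (s + i)) (\<tau> i)) = F p \<sigma> \<tau>"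
   for \<sigma> \<tau>
  proof -
   have "N = s + (N - s)" using s by (simp add: N_def)
   hence "F p \<sigma> \<tau> = (\<Prod>i = 0..<s + (N - s). x (Y ! p i) (\<kappa> \<sigma> \<tau> i))" by (simp add: F_def)
   thus ?thesis unfolding prod_split_add by (simp add: \<kappa>_def)
  qed
  show ?thesis unfolding 1 2 sum_product by (simp add: 3[symmetric] mult_ac)
 qed
 have zero: "(\<Sum>p\<in>PN. of_int (sign p) * F p \<sigma> \<tau>) = 0" if "\<sigma> \<in> Pa" "\<tau> \<in> Pb" for \<sigma> \<tau>
 proof -
  have \<sigma>: "\<sigma> i < a" if "i < a" for i
   using \<open>\<sigma> \<in> Pa\<close> permutes_in_image[of \<sigma> "{0..<a}" i] that by (simp add: Pa_def)
  have \<tau>: "\<tau> i < b" if "i < b" for i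
   using \<open>\<tau> \<in> Pb\<close> permutes_in_image[of \<tau> "{0..<b}" i] that by (simp add: Pb_def)
  have "b \<le> a" using b by (simp add: a_def b_def u_def N_def)
  have "\<kappa> \<sigma> \<tau> i < a" if "i < N" for i
  proof (cases "i < s")
   case True
   thus ?thesis using \<sigma>[of "u + i"] by (simp add: \<kappa>_def a_def)
  next
   case False
   hence "i - s < b" using that by (simp add: b_def)
   thus ?thesis using False \<tau>[of "i - s"] \<open>b \<le> a\<close> by (simp add: \<kappa>_def)
  qed
  moreover have "a < N" using a by (simp add: a_def u_def N_def)
  ultimately show ?thesis
   unfolding F_def PN_def by (rule sum_sign_prod_zero[where z = "\<lambda>r. x (Y ! r)"])
 qed
 have "(\<Sum>p\<in>PN. of_int (sign p) *
   (mnr x (X1 @ take s (permute_list p Y)) * mnr x (drop s (permute_list p Y) @ X2))) =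
  (\<Sum>p\<in>PN. \<Sum>\<sigma>\<in>Pa. \<Sum>\<tau>\<in>Pb. A \<sigma> * B \<tau> * (of_int (sign p) * F p \<sigma> \<tau>))"
  by (intro sum.cong) (simp_all add: G sum_distrib_left mult_ac)
 also have "\<dots> = (\<Sum>\<sigma>\<in>Pa. \<Sum>p\<in>PN. \<Sum>\<tau>\<in>Pb. A \<sigma> * B \<tau> * (of_int (sign p) * F p \<sigma> \<tau>))"
  by (rule sum.swap)
 also have "\<dots> = (\<Sum>\<sigma>\<in>Pa. \<Sum>\<tau>\<in>Pb. \<Sum>p\<in>PN. A \<sigma> * B \<tau> * (of_int (sign p) * F p \<sigma> \<tau>))"
  by (intro sum.cong refl sum.swap)
 also have "\<dots> = (\<Sum>\<sigma>\<in>Pa. \<Sum>\<tau>\<in>Pb. A \<sigma> * B \<tau> * (\<Sum>p\<in>PN. of_int (sign p) * F p \<sigma> \<tau>))"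
  by (simp only: sum_distrib_left)
 also have "\<dots> = 0" by (intro sum.neutral ballI) (simp add: zero)
 finally show ?thesis by (simp add: PN_def N_def lessThan_atLeast0)
qed

lemma alternating_block_swap:
 assumes alt: "alternating P" and Z: "length Z = N" "s \<le> N" and ab: "a \<noteq> b"
  "a < s \<and> b < s \<or> a \<in> {s..<N} \<and> b \<in> {s..<N}"
 shows "P (X1 @ take s (permute_list (transpose a b) Z)) * P (drop s (permute_list (transpose a b) Z) @ X2) =
  - (P (X1 @ take s Z) * P (drop s Z @ X2))"
proof -
 let ?Z = "permute_list (transpose a b) Z" and ?u = "length X1"
 have perm: "transpose a b permutes {..<length Z}"
  using ab Z by (intro permutes_swap_id) auto
 have Z': "?Z ! i = Z ! transpose a b i" if "i < N" for i
  using permute_list_nth[OF perm] that Z by simp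
 show ?thesis
 proof (cases "a < s \<and> b < s")
  case True
  have perm': "transpose (?u + a) (?u + b) permutes {..<length (X1 @ take s Z)}"
   using True Z by (intro permutes_swap_id) auto
  have 1: "X1 @ take s ?Z = permute_list (transpose (?u + a) (?u + b)) (X1 @ take s Z)"
  proof (rule nth_equalityI)
   fix i assume "i < length (X1 @ take s ?Z)"
   hence i: "i < length (X1 @ take s Z)" using Z by simp
   show "(X1 @ take s ?Z) ! i = permute_list (transpose (?u + a) (?u + b)) (X1 @ take s Z) ! i"
   proof (cases "i < ?u")
    case True
    hence "transpose (?u + a) (?u + b) i = i" by simp
    thus ?thesis using permute_list_nth[OF perm' i] True by (simp add: nth_append)
   next
    case False
    then obtain j where j: "i = ?u + j" using le_Suc_ex not_less by blast
    hence js: "j < s" using i Z by simp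
    have t: "transpose (?u + a) (?u + b) i = ?u + transpose a b j"
     by (auto simp: j transpose_def)
    have "transpose a b j < s" using js True by (simp add: transpose_def)
    thus ?thesis
     unfolding permute_list_nth[OF perm' i] t using js Z Z'[of j] by (simp add: j nth_append)
   qed
  qed simp
  have 2: "drop s ?Z = drop s Z"
  proof (rule nth_equalityI)
   fix i assume i: "i < length (drop s ?Z)"
   hence "transpose a b (s + i) = s + i" using True by simp
   thus "drop s ?Z ! i = drop s Z ! i" using i Z Z'[of "s + i"] by simp
  qed simp
  show ?thesis
   unfolding 1 2 using alt[unfolded alternating_def, rule_format, of "?u + a" "X1 @ take s Z" "?u + b"] True ab Z
   by simp
 next
  case False
  hence ab': "a \<in> {s..<N}" "b \<in> {s..<N}" using ab by auto
  then obtain a' b' where a'b': "a = s + a'" "b = s + b'" using le_Suc_ex by (metis atLeastLessThan_iff)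
  have lt: "a' < length (drop s Z @ X2)" "b' < length (drop s Z @ X2)" using ab' Z a'b' by auto
  have perm': "transpose a' b' permutes {..<length (drop s Z @ X2)}"
   using lt by (intro permutes_swap_id) auto
  have 1: "drop s ?Z @ X2 = permute_list (transpose a' b') (drop s Z @ X2)"
  proof (rule nth_equalityI)
   fix i assume "i < length (drop s ?Z @ X2)"
   hence i: "i < length (drop s Z @ X2)" using Z by simp
   show "(drop s ?Z @ X2) ! i = permute_list (transpose a' b') (drop s Z @ X2) ! i"
   proof (cases "i < N - s")
    case True
    have t: "transpose a b (s + i) = s + transpose a' b' i"
     by (auto simp: a'b' transpose_def)
    have "transpose a' b' i < N - s" using True ab' a'b' by (auto simp: transpose_def)
    thus ?thesis
     unfolding permute_list_nth[OF perm' i] using True Z Z'[of "s + i"] t by (simp add: nth_append)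
   next
    case False
    hence "transpose a' b' i = i" using ab' a'b' by (intro transpose_apply_other) auto
    thus ?thesis unfolding permute_list_nth[OF perm' i] using False Z by (simp add: nth_append)
   qed
  qed simp
  have 2: "take s ?Z = take s Z"
  proof (rule nth_equalityI)
   fix i assume i: "i < length (take s ?Z)"
   hence "transpose a b i = i" using ab' by (intro transpose_apply_other) auto
   thus "take s ?Z ! i = take s Z ! i" using i Z Z'[of i] by simp
  qed simp
  show ?thesis
   unfolding 1 2 using alt[unfolded alternating_def, rule_format, of a' "drop s Z @ X2" b'] lt ab a'b'
   by simp
 qed
qed

lemma alternating_block_perm:
 fixes P :: "nat list \<Rightarrow> 'a::comm_ring_1"
 assumes alt: "alternating P" and s: "s \<le> N" and p: "p permutes S" and S: "S = {..<s} \<or> S = {s..<N}"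
  and Z: "length Z = N"
 shows "of_int (sign p) * (P (X1 @ take s (permute_list p Z)) * P (drop s (permute_list p Z) @ X2)) =
  P (X1 @ take s Z) * P (drop s Z @ X2)"
proof -
 have fin: "finite S" using S by auto
 have sub: "S \<subseteq> {..<N}" using S s by auto
 from p fin Z show ?thesis
 proof (induction p arbitrary: Z rule: permutes_induct)
  case id
  thus ?case by simp
 next
  case (swap a b p)
  let ?Z = "permute_list (transpose a b) Z"
  have p': "p permutes {..<length Z}"
   using permutes_subset[OF swap.hyps(4) sub] swap.prems by simp
  have sgn: "sign (transpose a b \<circ> p) = - sign p"
   using swap.hyps sign_compose[of "transpose a b" p] permutes_imp_permutation[OF fin swap.hyps(4)]
   by (simp add: sign_swap_id permutation_swap_id)
  have "of_int (sign p) * (P (X1 @ take s (permute_list p ?Z)) * P (drop s (permute_list p ?Z) @ X2)) =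
    P (X1 @ take s ?Z) * P (drop s ?Z @ X2)"
   using swap.IH[of ?Z] swap.prems by simp
  also have "\<dots> = - (P (X1 @ take s Z) * P (drop s Z @ X2))"
   by (rule alternating_block_swap[OF alt swap.prems s]) (use swap.hyps S in auto)
  finally show ?case
   unfolding sgn permute_list_compose[OF p'] by (simp add: minus_equation_iff)
 qed
qed

text \<open>A permutation preserving the first block is a product of permutations of the two blocks,
  whose signs are cancelled by alternation. All these terms equal the original product and are
  collected on the left.\<close>

lemma garnir_exchange:
 fixes P :: "nat list \<Rightarrow> 'a::comm_ring_1"
 assumes alt: "alternating P" and s: "s \<le> length Y"
  and zero: "(\<Sum>p | p permutes {..<length Y}. of_int (sign p) *
   (P (X1 @ take s (permute_list p Y)) * P (drop s (permute_list p Y) @ X2))) = 0"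
 shows "of_nat (card {p. p permutes {..<length Y} \<and> p ` {..<s} = {..<s}}) *
   (P (X1 @ take s Y) * P (drop s Y @ X2)) =
  - (\<Sum>p | p permutes {..<length Y} \<and> p ` {..<s} \<noteq> {..<s}. of_int (sign p) *
   (P (X1 @ take s (permute_list p Y)) * P (drop s (permute_list p Y) @ X2)))"
proof -
 let ?N = "length Y"
 define G where "G = (\<lambda>p. of_int (sign p) * (P (X1 @ take s (permute_list p Y)) * P (drop s (permute_list p Y) @ X2)))"
 have stable: "G p = P (X1 @ take s Y) * P (drop s Y @ X2)"
  if p: "p permutes {..<?N}" "p ` {..<s} = {..<s}" for p
 proof -
  define p1 p2 where "p1 = (\<lambda>i. if i < s then p i else i)" and "p2 = (\<lambda>i. if i < s then i else p i)"
  have inj: "inj p" by (rule permutes_inj[OF p(1)])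
  have im2: "p ` {s..<?N} = {s..<?N}"
  proof -
   have e: "{s..<?N} = {..<?N} - {..<s}" by auto
   show ?thesis unfolding e image_set_diff[OF inj] permutes_image[OF p(1)] p(2) ..
  qed
  have p1: "p1 permutes {..<s}"
  proof (rule bij_imp_permutes)
   have "p1 ` {..<s} = p ` {..<s}" by (rule image_cong) (auto simp: p1_def)
   moreover have "inj_on p1 {..<s}" using inj by (auto simp: p1_def inj_on_def)
   ultimately show "bij_betw p1 {..<s} {..<s}" using p(2) by (simp add: bij_betw_def)
  qed (simp add: p1_def)
  have p2: "p2 permutes {s..<?N}"
  proof (rule bij_imp_permutes)
   have "p2 ` {s..<?N} = p ` {s..<?N}" by (rule image_cong) (auto simp: p2_def)
   moreover have "inj_on p2 {s..<?N}" using inj by (auto simp: p2_def inj_on_def)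
   ultimately show "bij_betw p2 {s..<?N} {s..<?N}" using im2 by (simp add: bij_betw_def)
   show "p2 i = i" if "i \<notin> {s..<?N}" for i
    using that permutes_not_in[OF p(1), of i] by (auto simp: p2_def)
  qed
  have comp: "p = p1 \<circ> p2"
  proof
   fix i
   show "p i = (p1 \<circ> p2) i"
   proof (cases "i < s")
    case False
    have "\<not> p i < s"
    proof
     assume "p i < s"
     hence "p i \<in> p ` {..<s}" using p(2) by simp
     hence "i \<in> {..<s}" using inj by (simp only: inj_image_mem_iff)
     with False show False by simp
    qed
    thus ?thesis using False by (simp add: p1_def p2_def)
   qed (simp add: p1_def p2_def)
  qed
  have p2': "p2 permutes {..<length Y}" by (rule permutes_subset[OF p2]) auto
  have sgn: "sign p = sign p1 * sign p2"
   unfolding comp using permutes_imp_permutation[OF _ p1] permutes_imp_permutation[OF _ p2] by (simp add: sign_compose)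
  have "G p = of_int (sign p1) * (of_int (sign p2) * (P (X1 @ take s (permute_list p2 (permute_list p1 Y))) *
    P (drop s (permute_list p2 (permute_list p1 Y)) @ X2)))"
   unfolding G_def sgn by (simp add: comp permute_list_compose[OF p2'] mult.assoc)
  also have "\<dots> = of_int (sign p1) * (P (X1 @ take s (permute_list p1 Y)) * P (drop s (permute_list p1 Y) @ X2))"
   by (subst alternating_block_perm[OF alt s p2]) simp_all
  also have "\<dots> = P (X1 @ take s Y) * P (drop s Y @ X2)"
   by (subst alternating_block_perm[OF alt s p1]) simp_all
  finally show ?thesis .
 qed
 have fin: "finite {p. p permutes {..<?N}}" by (simp add: finite_permutations)
 have "0 = (\<Sum>p | p permutes {..<?N}. G p)" using zero by (simp add: G_def)
 also have "\<dots> = (\<Sum>p\<in>{p. p permutes {..<?N} \<and> p ` {..<s} = {..<s}} \<union> {p. p permutes {..<?N} \<and> p ` {..<s} \<noteq> {..<s}}. G p)"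
  by (rule sum.cong) auto
 also have "\<dots> = (\<Sum>p | p permutes {..<?N} \<and> p ` {..<s} = {..<s}. G p) + (\<Sum>p | p permutes {..<?N} \<and> p ` {..<s} \<noteq> {..<s}. G p)"
  by (rule sum.union_disjoint) (auto intro: finite_subset[OF _ fin])
 also have "(\<Sum>p | p permutes {..<?N} \<and> p ` {..<s} = {..<s}. G p) =
   of_nat (card {p. p permutes {..<?N} \<and> p ` {..<s} = {..<s}}) * (P (X1 @ take s Y) * P (drop s Y @ X2))"
  by (simp add: stable)
 finally show ?thesis by (simp add: G_def eq_neg_iff_add_eq_0)
qed

lemma card_block_perms_pos: "0 < card {p. p permutes {..<N::nat} \<and> p ` {..<s} = {..<s}}"
proof -
 have "id \<in> {p. p permutes {..<N} \<and> p ` {..<s} = {..<s}}" by (simp add: permutes_id)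
 moreover have "finite {p. p permutes {..<N} \<and> p ` {..<s} = {..<s}}"
  by (rule finite_subset[of _ "{p. p permutes {..<N}}"]) (auto simp: finite_permutations)
 ultimately show ?thesis by (metis card_gt_0_iff empty_iff)
qed

text \<open>The places that leave the first block and those that enter it are equally many; pairing
  them, each entry is replaced by a smaller one.\<close>

lemma sum_list_take_permute_less:
 fixes Y :: "nat list"
 assumes p: "p permutes {..<length Y}" and s: "s \<le> length Y" and ne: "p ` {..<s} \<noteq> {..<s}"
  and less: "\<And>i j. i < s \<Longrightarrow> s \<le> j \<Longrightarrow> j < length Y \<Longrightarrow> Y ! j < Y ! i"
 shows "sum_list (take s (permute_list p Y)) < sum_list (take s Y)"
proof -
 let ?S = "{..<s}" and ?T = "p ` {..<s}"
 have inj: "inj_on p ?S" using permutes_inj[OF p] by (rule inj_on_subset) simp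
 have Tsub: "?T \<subseteq> {..<length Y}" using permutes_image[OF p] s by (metis image_mono lessThan_subset_iff)
 have fin: "finite ?T" by simp
 have cT: "card ?T = s" using card_image[OF inj] by simp
 have 1: "sum_list (take s (permute_list p Y)) = (\<Sum>j\<in>?T. Y ! j)"
 proof -
  have "sum_list (take s (permute_list p Y)) = (\<Sum>i\<in>?S. Y ! p i)"
   using s by (simp add: sum_list_sum_nth permute_list_nth[OF p] lessThan_atLeast0 min_absorb2)
  also have "\<dots> = (\<Sum>j\<in>?T. Y ! j)" using sum.reindex[OF inj, of "(!) Y"] by simp
  finally show ?thesis .
 qed
 have 2: "sum_list (take s Y) = (\<Sum>j\<in>?S. Y ! j)"
  using s by (simp add: sum_list_sum_nth lessThan_atLeast0 min_absorb2)
 have card: "card (?T - ?S) = card (?S - ?T)"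
  using cT by (simp add: card_Diff_subset_Int Int_commute)
 have "?T - ?S \<noteq> {}"
 proof
  assume "?T - ?S = {}"
  hence "?T \<subseteq> ?S" by blast
  hence "?T = ?S" using cT by (intro card_subset_eq) auto
  with ne show False by simp
 qed
 obtain h where h: "bij_betw h (?T - ?S) (?S - ?T)"
  using finite_same_card_bij[OF _ _ card] by auto
 have "(\<Sum>j\<in>?T - ?S. Y ! j) < (\<Sum>j\<in>?T - ?S. Y ! h j)"
 proof (rule sum_strict_mono)
  fix j assume j: "j \<in> ?T - ?S"
  hence "h j \<in> ?S - ?T" using h by (auto simp: bij_betw_def)
  thus "Y ! j < Y ! h j" using j Tsub by (intro less) auto
 qed (use \<open>?T - ?S \<noteq> {}\<close> in auto)
 also have "\<dots> = (\<Sum>j\<in>?S - ?T. Y ! j)" using h by (simp add: sum.reindex_bij_betw)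
 finally have "(\<Sum>j\<in>?T \<inter> ?S. Y ! j) + (\<Sum>j\<in>?T - ?S. Y ! j) < (\<Sum>j\<in>?S \<inter> ?T. Y ! j) + (\<Sum>j\<in>?S - ?T. Y ! j)"
  by (simp add: Int_commute)
 thus ?thesis
  unfolding 1 2 by (simp add: sum.Int_Diff[OF fin, of _ ?S, symmetric] sum.Int_Diff[of ?S _ ?T, symmetric])
qed

text \<open>The Garnir relation at a row t that violates semistandardness. The exchanged entries, c
  from row t on and d up to row t, number one more than the length of c, and every one taken from d
  is smaller than every one taken from c. So each other term has a left column of smaller sum, while
  the total sum is unchanged.\<close>

lemma straighten_pair:
 fixes c d :: "nat list" and n t :: nat
 assumes c: "sorted_wrt (<) c" "set c \<subseteq> {1..n}" and d: "sorted_wrt (<) d" "set d \<subseteq> {1..n}"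
  and len: "length d \<le> length c" and t: "t < length d" "d ! t < c ! t"
 shows "\<exists>(I :: (nat \<Rightarrow> nat) set) (q :: (nat \<Rightarrow> nat) \<Rightarrow> 'k::field_char_0) C D. finite I \<and>
  (\<forall>p\<in>I. sorted_wrt (<) (C p) \<and> set (C p) \<subseteq> {1..n} \<and> length (C p) = length c \<and>
    sorted_wrt (<) (D p) \<and> set (D p) \<subseteq> {1..n} \<and> length (D p) = length d \<and>
    sum_list (C p) < sum_list c \<and> sum_list (C p) + sum_list (D p) = sum_list c + sum_list d) \<and>
  (\<forall>x. mnr x c * mnr x d = (\<Sum>p\<in>I. q p * (mnr x (C p) * mnr x (D p))))"
proof -
 define X1 X2 Y s where "X1 = take t c" and "X2 = drop (Suc t) d"
  and "Y = drop t c @ take (Suc t) d" and "s = length c - t"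
 let ?N = "length Y"
 have N: "?N = length c + 1" "s \<le> ?N" "length X1 + s < ?N" "?N - s + length X2 \<le> length X1 + s"
  using t len by (auto simp: Y_def s_def X1_def X2_def)
 have cd: "X1 @ take s Y = c" "drop s Y @ X2 = d"
  using t len by (auto simp: Y_def s_def X1_def X2_def)
 define Z where "Z = (\<lambda>p. permute_list p Y)"
 define c' d' where "c' = (\<lambda>p. X1 @ take s (Z p))" and "d' = (\<lambda>p. drop s (Z p) @ X2)"
 define I where "I = {p. p permutes {..<?N} \<and> p ` {..<s} \<noteq> {..<s} \<and> distinct (c' p) \<and> distinct (d' p)}"
 define C D where "C = (\<lambda>p. sorted_list_of_set (set (c' p)))" and "D = (\<lambda>p. sorted_list_of_set (set (d' p)))"
 define M :: 'k where "M = of_nat (card {p. p permutes {..<?N} \<and> p ` {..<s} = {..<s}})"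
 \<comment> \<open>The rows of each term are sorted at the cost of a sign, and the relation is
   divided by the number M of permutations that preserve the block.\<close>
 define q :: "(nat \<Rightarrow> nat) \<Rightarrow> 'k" where "q = (\<lambda>p. - (of_int (sign p) * list_sign (c' p) * list_sign (d' p)) / M)"
 have M: "M \<noteq> 0" using card_block_perms_pos[of ?N s] by (simp add: M_def)
 have finI: "finite I"
  by (rule finite_subset[of _ "{p. p permutes {..<?N}}"]) (auto simp: I_def finite_permutations)
 have less: "Y ! j < Y ! i" if "i < s" "s \<le> j" "j < ?N" for i j
 proof -
  have i: "Y ! i = c ! (t + i)" using that t len by (simp add: Y_def s_def nth_append)
  have j: "Y ! j = d ! (j - s)" using that t len by (simp add: Y_def s_def nth_append)
  have "d ! (j - s) \<le> d ! t"
  proof (cases "j - s = t")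
   case False
   thus ?thesis using that N t by (intro less_imp_le sorted_wrt_nth_less[OF d(1)]) (auto simp: s_def)
  qed simp
  also have "\<dots> < c ! t" by (rule t(2))
  also have "\<dots> \<le> c ! (t + i)"
  proof (cases "i = 0")
   case False
   thus ?thesis using that by (intro less_imp_le sorted_wrt_nth_less[OF c(1)]) (auto simp: s_def)
  qed simp
  finally show ?thesis by (simp add: i j)
 qed
 have props: "sorted_wrt (<) (C p) \<and> set (C p) \<subseteq> {1..n} \<and> length (C p) = length c \<and>
    sorted_wrt (<) (D p) \<and> set (D p) \<subseteq> {1..n} \<and> length (D p) = length d \<and>
    sum_list (C p) < sum_list c \<and> sum_list (C p) + sum_list (D p) = sum_list c + sum_list d" if "p \<in> I" for p
 proof -
  have p: "p permutes {..<?N}" "p ` {..<s} \<noteq> {..<s}" and dist: "distinct (c' p)" "distinct (d' p)"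
   using that by (auto simp: I_def)
  have mset: "mset (Z p) = mset Y" unfolding Z_def by (rule mset_permute_list[OF p(1)])
  hence "set (Z p) = set Y" by (metis set_mset_mset)
  moreover have "set Y \<subseteq> {1..n}" using c d by (auto simp: Y_def dest: in_set_takeD in_set_dropD)
  ultimately have sub: "set (c' p) \<subseteq> {1..n}" "set (d' p) \<subseteq> {1..n}"
   using c d by (auto simp: c'_def d'_def X1_def X2_def dest: in_set_takeD in_set_dropD)
  have len': "length (c' p) = length c" "length (d' p) = length d"
   using t len by (auto simp: c'_def d'_def X1_def X2_def Z_def Y_def s_def)
  have sums: "sum_list (C p) = sum_list (c' p)" "sum_list (D p) = sum_list (d' p)"
   using dist by (simp_all add: C_def D_def distinct_sum_list_conv_Sum)
  have "sum_list (c' p) < sum_list (X1 @ take s Y)"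
   using sum_list_take_permute_less[OF p(1) N(2) p(2) less] by (simp add: c'_def Z_def)
  moreover have "sum_list (c' p) + sum_list (d' p) = sum_list c + sum_list d"
  proof -
   have "sum_list (c' p) + sum_list (d' p) = sum_list X1 + sum_list (take s (Z p) @ drop s (Z p)) + sum_list X2"
    by (simp only: c'_def d'_def sum_list_append)
   also have "\<dots> = sum_list X1 + sum_list (take s Y @ drop s Y) + sum_list X2"
    using mset by (simp add: sum_mset_sum_list[symmetric])
   also have "\<dots> = sum_list c + sum_list d"
    unfolding cd[symmetric] by (simp only: sum_list_append)
   finally show ?thesis .
  qed
  ultimately show ?thesis
   using sub len' sums dist cd(1) by (simp add: C_def D_def distinct_card)
 qed
 have eq: "mnr x c * mnr x d = (\<Sum>p\<in>I. q p * (mnr x (C p) * mnr x (D p)))" for x :: "nat \<Rightarrow> nat \<Rightarrow> 'k"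
 proof -
  let ?G = "\<lambda>p. of_int (sign p) * (mnr x (c' p) * mnr x (d' p))"
  have "M * (mnr x c * mnr x d) = - (\<Sum>p | p permutes {..<?N} \<and> p ` {..<s} \<noteq> {..<s}. ?G p)"
   using garnir_exchange[OF alternating_mnr N(2) garnir_mnr[OF N(2-4), of x]]
   by (simp only: cd c'_def d'_def Z_def M_def)
  also have "(\<Sum>p | p permutes {..<?N} \<and> p ` {..<s} \<noteq> {..<s}. ?G p) = (\<Sum>p\<in>I. ?G p)"
  proof (rule sum.mono_neutral_right)
   show "finite {p. p permutes {..<?N} \<and> p ` {..<s} \<noteq> {..<s}}"
    by (rule finite_subset[of _ "{p. p permutes {..<?N}}"]) (auto simp: finite_permutations)
   show "\<forall>p\<in>{p. p permutes {..<?N} \<and> p ` {..<s} \<noteq> {..<s}} - I. ?G p = 0"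
   proof
    fix p assume "p \<in> {p. p permutes {..<?N} \<and> p ` {..<s} \<noteq> {..<s}} - I"
    hence "\<not> distinct (c' p) \<or> \<not> distinct (d' p)" by (auto simp: I_def)
    thus "?G p = 0" by (elim disjE) (simp_all add: mnr_not_distinct)
   qed
   show "I \<subseteq> {p. p permutes {..<?N} \<and> p ` {..<s} \<noteq> {..<s}}" unfolding I_def by blast
  qed
  also have "- (\<Sum>p\<in>I. ?G p) = M * (\<Sum>p\<in>I. q p * (mnr x (C p) * mnr x (D p)))"
   unfolding sum_distrib_left sum_negf[symmetric]
  proof (rule sum.cong)
   fix p assume "p \<in> I"
   hence "mnr x (c' p) = list_sign (c' p) * mnr x (C p)" "mnr x (d' p) = list_sign (d' p) * mnr x (D p)"
    unfolding C_def D_def by (auto simp: I_def intro!: mnr_sort)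
   thus "- ?G p = M * (q p * (mnr x (C p) * mnr x (D p)))"
    using M by (simp add: q_def)
  qed simp
  finally show ?thesis using M by simp
 qed
 have "finite I \<and> (\<forall>p\<in>I. sorted_wrt (<) (C p) \<and> set (C p) \<subseteq> {1..n} \<and> length (C p) = length c \<and>
    sorted_wrt (<) (D p) \<and> set (D p) \<subseteq> {1..n} \<and> length (D p) = length d \<and>
    sum_list (C p) < sum_list c \<and> sum_list (C p) + sum_list (D p) = sum_list c + sum_list d) \<and>
  (\<forall>x. mnr x c * mnr x d = (\<Sum>p\<in>I. q p * (mnr x (C p) * mnr x (D p))))"
  using finI props eq by (intro conjI ballI allI) simp_all
 thus ?thesis by (intro exI)
qed

section \<open>Standard monomials span\<close>

text \<open>\<open>submatrix\<close> enumerates the chosen rows through \<open>pick\<close>; this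
  identifies that enumeration with the sorted list.\<close>

lemma pick_set_sorted:
 assumes "sorted_wrt (<) S" "r < length S"
 shows "pick (set S) r = S ! r"
proof -
 have "{a \<in> set S. a < S ! r} = (!) S ` {..<r}"
 proof (intro equalityI subsetI)
  fix a assume a: "a \<in> {a \<in> set S. a < S ! r}"
  then obtain i where i: "i < length S" "a = S ! i" by (auto simp: in_set_conv_nth)
  have "i < r"
  proof (rule ccontr)
   assume "\<not> i < r"
   hence "S ! r \<le> S ! i"
    using assms(1) i by (cases "i = r") (auto dest: sorted_wrt_nth_less[of _ S r i])
   with a i show False by simp
  qed
  thus "a \<in> (!) S ` {..<r}" using i by auto
 next
  fix a assume "a \<in> (!) S ` {..<r}"
  then obtain i where "i < r" "a = S ! i" by auto
  thus "a \<in> {a \<in> set S. a < S ! r}"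
   using sorted_wrt_nth_less[OF assms(1), of i r] assms(2) by simp
 qed
 moreover have "inj_on ((!) S) {..<r}"
  using assms by (auto simp: inj_on_def strict_sorted_iff nth_eq_iff_index_eq)
 ultimately have "card {a \<in> set S. a < S ! r} = r" by (simp add: card_image)
 thus ?thesis using pick_card_in_set[of "S ! r" "set S"] assms(2) by simp
qed

text \<open>Rows are numbered from 1, like the entries of a tableau, and columns from 0, like
  positions in the matrix.\<close>

definition entry :: "'k mat \<Rightarrow> nat \<Rightarrow> nat \<Rightarrow> 'k" where
 "entry g r c = g $$ (r - 1, c)"

lemma wedge_cols_eq:
 assumes g: "g \<in> carrier_mat n n"
 shows "wedge_cols n i g J =
  (if J \<subseteq> {1..n} \<and> card J = i then mnr (entry g) (sorted_list_of_set J) else 0)"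
proof (cases "J \<subseteq> {1..n} \<and> card J = i")
 case True
 let ?L = "sorted_list_of_set J" and ?I = "(\<lambda>j. j - 1) ` J"
 have fin: "finite J" using True finite_subset by blast
 have i: "i \<le> n" using True card_mono[of "{1..n}" J] by simp
 have J1: "1 \<le> x \<and> x \<le> n" if "x \<in> J" for x using True that by auto
 have inj: "inj_on (\<lambda>j. j - 1) J"
 proof (rule inj_onI)
  fix x y assume "x \<in> J" "y \<in> J" "x - 1 = y - 1"
  thus "x = y" using J1[of x] J1[of y] by linarith
 qed
 define S where "S = map (\<lambda>j. j - 1) ?L"
 have S: "sorted_wrt (<) S"
  unfolding S_def sorted_wrt_map
 proof (rule sorted_wrt_mono_rel)
  show "sorted_wrt (<) ?L" by simp
  show "x - 1 < y - 1" if "x \<in> set ?L" "y \<in> set ?L" "x < y" for x y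
   using that fin J1[of x] J1[of y] by auto
 qed
 have setS: "set S = ?I" using fin by (simp add: S_def)
 have rows: "{a. a < dim_row g \<and> a \<in> ?I} = ?I"
 proof -
  have "x - 1 < dim_row g" if "x \<in> J" for x using J1[OF that] g by auto
  thus ?thesis by auto
 qed
 have colset: "{a. a < dim_col g \<and> a \<in> {..<i}} = {..<i}" using i g by auto
 have lenL: "length ?L = i" using True by simp
 have "submatrix g ?I {..<i} = mat i i (\<lambda>(r, c). entry g (?L ! r) c)"
 proof (rule eq_matI)
  fix r c assume "r < dim_row (mat i i (\<lambda>(r, c). entry g (?L ! r) c))" "c < dim_col (mat i i (\<lambda>(r, c). entry g (?L ! r) c))"
  hence rc: "r < i" "c < i" by auto
  have "pick ?I r = ?L ! r - 1"
   using pick_set_sorted[OF S, of r, unfolded setS] rc lenL by (simp add: S_def)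
  moreover have "pick {..<i} c = c"
   using pick_card_in_set[of c "{..<i}"] rc
   by (metis (no_types, lifting) Collect_cong card_Collect_less_nat lessThan_iff less_trans)
  moreover have "submatrix g ?I {..<i} $$ (r, c) = g $$ (pick ?I r, pick {..<i} c)"
   by (rule submatrix_index) (use rc True in \<open>simp_all add: rows colset card_image[OF inj] del: lessThan_iff\<close>)
  ultimately show "submatrix g ?I {..<i} $$ (r, c) = mat i i (\<lambda>(r, c). entry g (?L ! r) c) $$ (r, c)"
   using rc by (simp add: entry_def)
 qed (use True in \<open>simp_all add: dim_submatrix rows colset card_image[OF inj] del: lessThan_iff\<close>)
 thus ?thesis using True lenL by (simp add: wedge_cols_def mnr_def)
qed (auto simp: wedge_cols_def)

text \<open>Columns further to the left weigh more, so an exchange that moves part of the sum from a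
  column to its right neighbour lowers the weight.\<close>

definition weight_list :: "nat set list \<Rightarrow> nat" where
 "weight_list T = (\<Sum>i<length T. (length T - i) * \<Sum>(T ! i))"

lemma weight_list_Cons: "weight_list (J # T) = Suc (length T) * \<Sum>J + weight_list T"
 by (simp add: weight_list_def sum.lessThan_Suc_shift del: sum.lessThan_Suc)

lemma weight_list_append_less:
 "length T' = length T \<Longrightarrow> weight_list T' < weight_list T \<Longrightarrow> weight_list (U @ T') < weight_list (U @ T)"
 by (induction U) (simp_all add: weight_list_Cons)

lemma finite_transpose_sum: "finite (A :: nat set) \<Longrightarrow> sum_list (sorted_list_of_set A) = \<Sum>A"
 by (simp add: distinct_sum_list_conv_Sum)

type_synonym 'k fpoint = "(nat set, 'k) mpoint"

locale flag_setup =
 fixes n m :: nat and k :: "nat \<Rightarrow> nat"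
 assumes m: "1 \<le> m" and k1: "1 \<le> k 1" and k_mono: "strict_mono_on {1..m} k" and kn: "k m \<le> n - 1"
begin

lemma k_inj: "inj_on k {1..m}"
 using k_mono by (rule strict_mono_on_imp_inj_on)

lemma k_le_iff: "i \<in> {1..m} \<Longrightarrow> j \<in> {1..m} \<Longrightarrow> k i \<le> k j \<longleftrightarrow> i \<le> j"
 using k_mono by (rule strict_mono_on_less_eq)

lemma k_bounds: "i \<in> {1..m} \<Longrightarrow> 1 \<le> k i \<and> k i \<le> n - 1"
 using k_le_iff[of 1 i] k_le_iff[of i m] m k1 kn by (auto intro: le_trans)

lemma n_ge_2: "2 \<le> n"
 using k_bounds[of 1] m by auto

lemma k_less_n: "i \<in> {1..m} \<Longrightarrow> k i < n"
 using k_bounds[of i] n_ge_2 by auto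

definition idx :: "nat set \<Rightarrow> nat" where
 "idx J = inv_into {1..m} k (card J)"

definition csets :: "nat set set" where
 "csets = {J. J \<subseteq> {1..n} \<and> card J \<in> k ` {1..m}}"

lemma finite_csets: "finite csets"
 by (rule finite_subset[of _ "Pow {1..n}"]) (auto simp: csets_def)

lemma csets_finite: "J \<in> csets \<Longrightarrow> finite J"
 by (auto simp: csets_def intro: finite_subset)

lemma csets_sub: "J \<in> csets \<Longrightarrow> J \<subseteq> {1..n}"
 by (simp add: csets_def)

lemma idx: "J \<in> csets \<Longrightarrow> idx J \<in> {1..m}" "J \<in> csets \<Longrightarrow> k (idx J) = card J"
 unfolding csets_def idx_def using inv_into_into[of "card J" k "{1..m}"] f_inv_into_f[of "card J" k "{1..m}"] by auto

lemma idx_eq: "i \<in> {1..m} \<Longrightarrow> card J = k i \<Longrightarrow> idx J = i"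
 unfolding idx_def using k_inj by (simp add: inv_into_f_f)

lemma csetsI: "J \<subseteq> {1..n} \<Longrightarrow> i \<in> {1..m} \<Longrightarrow> card J = k i \<Longrightarrow> J \<in> csets"
 unfolding csets_def by blast

lemma tle_idx: "J \<in> csets \<Longrightarrow> K \<in> csets \<Longrightarrow> tle J K \<Longrightarrow> idx K \<le> idx J"
 using tle_card[of J K n] csets_sub idx[of J] idx[of K] k_le_iff[of "idx K" "idx J"] by auto

definition crd :: "nat set \<Rightarrow> 'k fpoint \<Rightarrow> 'k" where
 "crd J v = v (idx J) J"

definition mon :: "nat set list \<Rightarrow> ('k::comm_ring_1) fpoint \<Rightarrow> 'k" where
 "mon T v = (\<Prod>J\<leftarrow>T. crd J v)"

lemma mon_simps [simp]: "mon [] v = 1" "mon (J # T) v = crd J v * mon T v" "mon (T @ U) v = mon T v * mon U v"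
 by (simp_all add: mon_def)

lemma mon_mset: "mset T = mset U \<Longrightarrow> mon T v = mon U v"
 unfolding mon_def by (metis mset_map prod_mset_prod_list)

lemma mon_zero_iff: "mon T (v :: ('k::idom) fpoint) = 0 \<longleftrightarrow> (\<exists>J\<in>set T. crd J v = 0)"
 by (induction T) auto

text \<open>The coefficients \<open>c j\<close> may vanish, which produces the points of the
  multicone with zero components.\<close>

definition flag_vec :: "nat set \<Rightarrow> (nat \<Rightarrow> 'k) \<Rightarrow> 'k::comm_ring_1 mat \<Rightarrow> 'k fpoint" where
 "flag_vec I c g = (\<lambda>j J. if j \<in> I then c j * wedge_cols n (k j) g J else 0)"

text \<open>The multicone of the partial flag variety, parametrized by invertible matrices instead
  of those of determinant one; the equality is \<open>multicone_flags\<close>.\<close>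

definition tot :: "('k::comm_ring_1) fpoint set" where
 "tot = {flag_vec {1..m} c g | c g. g \<in> carrier_mat n n \<and> det g \<noteq> 0}"

lemma crd_flag_vec:
 assumes "g \<in> carrier_mat n n" "J \<in> csets"
 shows "crd J (flag_vec I c g) =
  (if idx J \<in> I then c (idx J) * mnr (entry g) (sorted_list_of_set J) else 0)"
 using assms idx[OF assms(2)] csets_sub[OF assms(2)] by (simp add: crd_def flag_vec_def wedge_cols_eq)

definition std :: "nat set list set" where
 "std = {T. set T \<subseteq> csets \<and> sorted_wrt tle T}"

definition spanned :: "(('k::comm_ring_1) fpoint \<Rightarrow> 'k) \<Rightarrow> bool" where
 "spanned F \<longleftrightarrow> (\<exists>E q. finite E \<and> E \<subseteq> std \<and> (\<forall>v\<in>tot. F v = (\<Sum>T\<in>E. q T * mon T v)))"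

lemma spanned_cong: "spanned F \<Longrightarrow> (\<And>v. v \<in> tot \<Longrightarrow> G v = F v) \<Longrightarrow> spanned G"
 unfolding spanned_def by simp

lemma spanned_std: "T \<in> std \<Longrightarrow> spanned (mon T)"
 unfolding spanned_def by (intro exI[of _ "{T}"] exI[of _ "\<lambda>_. 1"]) simp

lemma spanned_zero: "spanned (\<lambda>v. 0)"
 unfolding spanned_def by (intro exI[of _ "{}"] exI[of _ "\<lambda>_. 0"]) simp

lemma spanned_scale: "spanned F \<Longrightarrow> spanned (\<lambda>v. a * F v)"
 unfolding spanned_def
proof (elim exE conjE)
 fix E q assume "finite E" "E \<subseteq> std" "\<forall>v\<in>tot. F v = (\<Sum>T\<in>E. q T * mon T v)"
 thus "\<exists>E q. finite E \<and> E \<subseteq> std \<and> (\<forall>v\<in>tot. a * F v = (\<Sum>T\<in>E. q T * mon T v))"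
  by (intro exI[of _ E] exI[of _ "\<lambda>T. a * q T"]) (simp add: sum_distrib_left mult.assoc)
qed

lemma spanned_add:
 assumes "spanned F" "spanned G"
 shows "spanned (\<lambda>v. F v + G v)"
proof -
 obtain E q where E: "finite E" "E \<subseteq> std" "\<forall>v\<in>tot. F v = (\<Sum>T\<in>E. q T * mon T v)"
  using assms(1) unfolding spanned_def by blast
 obtain E' q' where E': "finite E'" "E' \<subseteq> std" "\<forall>v\<in>tot. G v = (\<Sum>T\<in>E'. q' T * mon T v)"
  using assms(2) unfolding spanned_def by blast
 define r where "r = (\<lambda>T. (if T \<in> E then q T else 0) + (if T \<in> E' then q' T else 0))"
 have "F v + G v = (\<Sum>T\<in>E \<union> E'. r T * mon T v)" if "v \<in> tot" for v
 proof -
  have "(\<Sum>T\<in>E. q T * mon T v) = (\<Sum>T\<in>E \<union> E'. (if T \<in> E then q T else 0) * mon T v)"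
   using E(1) E'(1) by (intro sum.mono_neutral_cong_left) auto
  moreover have "(\<Sum>T\<in>E'. q' T * mon T v) = (\<Sum>T\<in>E \<union> E'. (if T \<in> E' then q' T else 0) * mon T v)"
   using E(1) E'(1) by (intro sum.mono_neutral_cong_left) auto
  ultimately show ?thesis
   using E(3) E'(3) that by (simp add: r_def sum.distrib distrib_right)
 qed
 thus ?thesis
  unfolding spanned_def using E E' by (intro exI[of _ "E \<union> E'"] exI[of _ r]) auto
qed

lemma spanned_sum: "(\<And>i. i \<in> A \<Longrightarrow> spanned (F i)) \<Longrightarrow> spanned (\<lambda>v. \<Sum>i\<in>A. F i v)"
 by (induction A rule: infinite_finite_induct) (simp_all add: spanned_zero spanned_add)

text \<open>The relation among minors is homogeneous: all left columns have the length of J and all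
  right ones that of K, so the coefficients of the point factor out and it holds on the whole
  multicone.\<close>

lemma mon_straighten_step:
 fixes U V :: "nat set list"
 assumes JK: "J \<in> csets" "K \<in> csets" "card K \<le> card J" "\<not> tle J K"
 shows "\<exists>(I :: (nat \<Rightarrow> nat) set) (q :: (nat \<Rightarrow> nat) \<Rightarrow> 'k::field_char_0) C D. finite I \<and>
  (\<forall>p\<in>I. C p \<in> csets \<and> card (C p) = card J \<and> D p \<in> csets \<and> card (D p) = card K \<and>
    \<Sum>(C p) < \<Sum>J \<and> \<Sum>(C p) + \<Sum>(D p) = \<Sum>J + \<Sum>K) \<and>
  (\<forall>v\<in>tot. crd J v * crd K v = (\<Sum>p\<in>I. q p * (crd (C p) v * crd (D p) v)))"
proof -
 let ?c = "sorted_list_of_set J" and ?d = "sorted_list_of_set K"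
 have fin: "finite J" "finite K" using JK csets_finite by auto
 have cd: "sorted_wrt (<) ?c" "set ?c \<subseteq> {1..n}" "sorted_wrt (<) ?d" "set ?d \<subseteq> {1..n}" "length ?d \<le> length ?c"
  using JK fin csets_sub by auto
 obtain t where t: "t < length ?d" "?d ! t < ?c ! t"
  using tle_lists_iff[OF cd(1,3)] JK(4) cd(5) fin by (auto simp: not_le)
 obtain I q C D where I: "finite (I :: (nat \<Rightarrow> nat) set)"
  and props: "\<And>p. p \<in> I \<Longrightarrow> sorted_wrt (<) (C p) \<and> set (C p) \<subseteq> {1..n} \<and> length (C p) = length ?c \<and>
    sorted_wrt (<) (D p) \<and> set (D p) \<subseteq> {1..n} \<and> length (D p) = length ?d \<and>
    sum_list (C p) < sum_list ?c \<and> sum_list (C p) + sum_list (D p) = sum_list ?c + sum_list ?d"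
  and eq: "\<And>x :: nat \<Rightarrow> nat \<Rightarrow> 'k. mnr x ?c * mnr x ?d = (\<Sum>p\<in>I. q p * (mnr x (C p) * mnr x (D p)))"
  using straighten_pair[OF cd(1-5) t, where 'k = 'k] 
  by - (elim exE conjE, rule that, assumption, erule (1) bspec, erule spec)
 have P: "set (C p) \<in> csets \<and> card (set (C p)) = card J \<and> set (D p) \<in> csets \<and> card (set (D p)) = card K \<and>
    \<Sum>(set (C p)) < \<Sum>J \<and> \<Sum>(set (C p)) + \<Sum>(set (D p)) = \<Sum>J + \<Sum>K"
   "sorted_list_of_set (set (C p)) = C p" "sorted_list_of_set (set (D p)) = D p" if "p \<in> I" for p
 proof -
  have dist: "distinct (C p)" "distinct (D p)" "sorted (C p)" "sorted (D p)"
   using props[OF that] by (auto simp: strict_sorted_iff)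
  hence sums: "sum_list (C p) = \<Sum>(set (C p))" "sum_list (D p) = \<Sum>(set (D p))"
   by (simp_all add: distinct_sum_list_conv_Sum)
  have cards: "card (set (C p)) = card J" "card (set (D p)) = card K"
   using props[OF that] dist by (auto simp: distinct_card)
  show "set (C p) \<in> csets \<and> card (set (C p)) = card J \<and> set (D p) \<in> csets \<and> card (set (D p)) = card K \<and>
    \<Sum>(set (C p)) < \<Sum>J \<and> \<Sum>(set (C p)) + \<Sum>(set (D p)) = \<Sum>J + \<Sum>K"
   using props[OF that] cards sums fin JK by (auto simp: csets_def finite_transpose_sum)
  show "sorted_list_of_set (set (C p)) = C p" "sorted_list_of_set (set (D p)) = D p"
   using dist by (simp_all add: sorted_list_of_set.idem_if_sorted_distinct)
 qed
 have "crd J v * crd K v = (\<Sum>p\<in>I. q p * (crd (set (C p)) v * crd (set (D p)) v))" if v: "v \<in> tot" for v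
 proof -
  obtain c g where g: "g \<in> carrier_mat n n" "v = flag_vec {1..m} c g" using v by (auto simp: tot_def)
  have crd: "crd L v = c (idx L) * mnr (entry g) (sorted_list_of_set L)" if "L \<in> csets" for L
   using crd_flag_vec[OF g(1) that] idx[OF that] g(2) by auto
  have idx: "idx L = idx L'" if "card L = card L'" for L L' using that by (simp add: idx_def)
  have "crd J v * crd K v = c (idx J) * c (idx K) * (mnr (entry g) ?c * mnr (entry g) ?d)"
   using crd JK by simp
  also have "\<dots> = (\<Sum>p\<in>I. q p * (c (idx J) * mnr (entry g) (C p) * (c (idx K) * mnr (entry g) (D p))))"
   unfolding eq by (simp add: sum_distrib_left mult_ac)
  also have "\<dots> = (\<Sum>p\<in>I. q p * (crd (set (C p)) v * crd (set (D p)) v))"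
  proof (rule sum.cong)
   fix p assume p: "p \<in> I"
   have "idx (set (C p)) = idx J" "idx (set (D p)) = idx K" using P(1)[OF p] by (auto intro: idx)
   thus "q p * (c (idx J) * mnr (entry g) (C p) * (c (idx K) * mnr (entry g) (D p))) =
     q p * (crd (set (C p)) v * crd (set (D p)) v)"
    using crd P[OF p] by simp
  qed simp
  finally show ?thesis .
 qed
 thus ?thesis
  using I P(1) by (intro exI[of _ I] exI[of _ q] exI[of _ "\<lambda>p. set (C p)"] exI[of _ "\<lambda>p. set (D p)"] conjI ballI) auto
qed

text \<open>Straighten any adjacent pair that violates the order. This stops because the weight
  drops: the total of the pair is kept while its left column, which weighs more, loses.\<close>

lemma spanned_mon_sorted:
 assumes "set T \<subseteq> csets" "sorted_wrt (\<lambda>J K. card K \<le> card J) T"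
 shows "spanned (mon T :: ('k::field_char_0) fpoint \<Rightarrow> 'k)"
 using assms
proof (induction "weight_list T" arbitrary: T rule: less_induct)
 case less
 show ?case
 proof (cases "sorted_wrt tle T")
  case True
  thus ?thesis using less.prems by (intro spanned_std) (simp add: std_def)
 next
  case False
  have "transp tle" by (rule transpI) (rule tle_trans)
  then obtain i where i: "Suc i < length T" "\<not> tle (T ! i) (T ! Suc i)"
   using False by (auto simp: sorted_wrt_iff_nth_Suc_transp)
  define U V J K where "U = take i T" and "V = drop (Suc (Suc i)) T" and "J = T ! i" and "K = T ! Suc i"
  have T: "T = U @ J # K # V"
   using i by (simp add: U_def V_def J_def K_def Cons_nth_drop_Suc)
  have "J \<in> csets" "K \<in> csets" "card K \<le> card J"
   using less.prems unfolding T by (auto simp: sorted_wrt_append)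
  moreover have "\<not> tle J K" using i by (simp add: J_def K_def)
  ultimately have JK: "J \<in> csets" "K \<in> csets" "card K \<le> card J" "\<not> tle J K" by blast+
  obtain I :: "(nat \<Rightarrow> nat) set" and q :: "(nat \<Rightarrow> nat) \<Rightarrow> 'k" and C D where I: "finite I"
   and P: "\<And>p. p \<in> I \<Longrightarrow> C p \<in> csets \<and> card (C p) = card J \<and> D p \<in> csets \<and> card (D p) = card K \<and>
    \<Sum>(C p) < \<Sum>J \<and> \<Sum>(C p) + \<Sum>(D p) = \<Sum>J + \<Sum>K"
   and eq: "\<And>v. v \<in> tot \<Longrightarrow> crd J v * crd K v = (\<Sum>p\<in>I. q p * (crd (C p) v * crd (D p) v))"
   using mon_straighten_step[OF JK, where 'k = 'k]
   by - (elim exE conjE, rule that, assumption, erule (1) bspec, erule (1) bspec)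
  have "spanned (mon (U @ C p # D p # V) :: 'k fpoint \<Rightarrow> 'k)" if p: "p \<in> I" for p
  proof (rule less.hyps)
   let ?S = "\<Sum>(C p)" and ?R = "\<Sum>(D p)"
   have "weight_list (C p # D p # V) < weight_list (J # K # V)"
   proof -
    have "Suc (Suc (length V)) * ?S + Suc (length V) * ?R = ?S + Suc (length V) * (?S + ?R)"
     by (simp add: algebra_simps)
    also have "\<dots> < \<Sum>J + Suc (length V) * (\<Sum>J + \<Sum>K)" using P[OF p] by simp
    also have "\<dots> = Suc (Suc (length V)) * \<Sum>J + Suc (length V) * \<Sum>K"
     by (simp add: algebra_simps)
    finally show ?thesis by (simp add: weight_list_Cons)
   qed
   thus "weight_list (U @ C p # D p # V) < weight_list T"
    unfolding T by (intro weight_list_append_less) simp_all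
   show "set (U @ C p # D p # V) \<subseteq> csets" using P[OF p] less.prems(1) unfolding T by auto
   show "sorted_wrt (\<lambda>J K. card K \<le> card J) (U @ C p # D p # V)"
    using P[OF p] less.prems(2) unfolding T by (auto simp: sorted_wrt_append)
  qed
  hence "spanned (\<lambda>v :: 'k fpoint. \<Sum>p\<in>I. q p * mon (U @ C p # D p # V) v)"
   by (intro spanned_sum spanned_scale)
  thus ?thesis
  proof (rule spanned_cong)
   fix v :: "'k fpoint" assume "v \<in> tot"
   have "mon T v = mon U v * mon V v * (crd J v * crd K v)" by (simp add: T mult_ac)
   also have "\<dots> = (\<Sum>p\<in>I. q p * mon (U @ C p # D p # V) v)"
    unfolding eq[OF \<open>v \<in> tot\<close>] by (simp add: sum_distrib_left mult_ac)
   finally show "mon T v = (\<Sum>p\<in>I. q p * mon (U @ C p # D p # V) v)" .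
  qed
 qed
qed

lemma spanned_mon:
 assumes "set T \<subseteq> csets"
 shows "spanned (mon T :: ('k::field_char_0) fpoint \<Rightarrow> 'k)"
proof -
 let ?T = "rev (sort_key card T)"
 have "sorted_wrt (\<lambda>J K. card K \<le> card J) ?T"
  using sorted_sort_key[of card T] by (simp add: sorted_wrt_rev sorted_wrt_map)
 hence "spanned (mon ?T :: 'k fpoint \<Rightarrow> 'k)"
  using assms by (intro spanned_mon_sorted) auto
 thus ?thesis by (rule spanned_cong) (intro mon_mset, simp)
qed

lemma spanned_mult:
 fixes F G :: "('k::field_char_0) fpoint \<Rightarrow> 'k"
 assumes "spanned F" "spanned G"
 shows "spanned (\<lambda>v. F v * G v)"
proof -
 obtain E q where E: "finite E" "E \<subseteq> std" "\<forall>v\<in>tot. F v = (\<Sum>T\<in>E. q T * mon T v)"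
  using assms(1) unfolding spanned_def by blast
 obtain E' q' where E': "finite E'" "E' \<subseteq> std" "\<forall>v\<in>tot. G v = (\<Sum>T\<in>E'. q' T * mon T v)"
  using assms(2) unfolding spanned_def by blast
 have "spanned (\<lambda>v. \<Sum>T\<in>E. \<Sum>T'\<in>E'. (q T * q' T') * mon (T @ T') v)"
  using E(2) E'(2) by (intro spanned_sum spanned_scale spanned_mon) (auto simp: std_def)
 thus ?thesis
 proof (rule spanned_cong)
  fix v :: "'k fpoint" assume "v \<in> tot"
  thus "F v * G v = (\<Sum>T\<in>E. \<Sum>T'\<in>E'. (q T * q' T') * mon (T @ T') v)"
   by (simp only: E(3)[rule_format] E'(3)[rule_format] sum_product) (simp add: mult_ac)
 qed
qed

lemma spanned_polyfun:
 fixes F :: "('k::field_char_0) fpoint \<Rightarrow> 'k"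
 assumes "polyfun F"
 shows "spanned F"
 using assms
proof induction
 case (poly_const c)
 have "spanned (\<lambda>v. c * mon [] v)" by (intro spanned_scale spanned_mon) simp
 thus ?case by (simp del: mon_simps add: mon_def)
next
 case (poly_coord j b)
 show ?case
 proof (cases "j \<in> {1..m} \<and> b \<subseteq> {1..n} \<and> card b = k j")
  case True
  hence b: "b \<in> csets" "idx b = j" by (auto intro: csetsI idx_eq)
  have "spanned (mon [b] :: 'k fpoint \<Rightarrow> 'k)" using b by (intro spanned_mon) simp
  thus ?thesis by (rule spanned_cong) (simp add: crd_def b)
 next
  case False
  \<comment> \<open>Coordinates that do not belong to any exterior power of the product are zero on
    every flag.\<close>
  have "v j b = 0" if v: "v \<in> tot" for v :: "'k fpoint"
  proof -
   obtain c g where "v = flag_vec {1..m} c g" using v unfolding tot_def by blast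
   hence "v j b = (if j \<in> {1..m} then c j * wedge_cols n (k j) g b else 0)"
    by (simp add: flag_vec_def)
   moreover have "j \<in> {1..m} \<Longrightarrow> wedge_cols n (k j) g b = 0"
    using False unfolding wedge_cols_def by (simp only: if_False simp_thms)
   ultimately show ?thesis by simp
  qed
  thus ?thesis by (intro spanned_cong[OF spanned_zero]) simp
 qed
qed (simp_all add: spanned_add spanned_mult)

end

section \<open>Polynomial curves\<close>

text \<open>Closures are handled through curves: a polynomial in t that vanishes off a finite set
  vanishes at the special parameter too, and finitely many non-zero polynomials are simultaneously
  non-zero somewhere. Both rest on the field being infinite.\<close>

definition is_poly :: "('k::comm_ring_1 \<Rightarrow> 'k) \<Rightarrow> bool" where
 "is_poly f \<longleftrightarrow> (\<exists>p. \<forall>t. f t = poly p t)"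

lemma is_poly_const [intro]: "is_poly (\<lambda>t. c)"
 unfolding is_poly_def by (intro exI[of _ "[:c:]"]) simp

lemma is_poly_id [intro]: "is_poly (\<lambda>t. t)"
 unfolding is_poly_def by (intro exI[of _ "[:0, 1:]"]) simp

lemma is_poly_add [intro]: "is_poly f \<Longrightarrow> is_poly g \<Longrightarrow> is_poly (\<lambda>t. f t + g t)"
 unfolding is_poly_def
proof (elim exE)
 fix p q assume "\<forall>t. f t = poly p t" "\<forall>t. g t = poly q t"
 thus "\<exists>r. \<forall>t. f t + g t = poly r t" by (intro exI[of _ "p + q"]) simp
qed

lemma is_poly_mult [intro]: "is_poly f \<Longrightarrow> is_poly g \<Longrightarrow> is_poly (\<lambda>t. f t * g t)"
 unfolding is_poly_def
proof (elim exE)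
 fix p q assume "\<forall>t. f t = poly p t" "\<forall>t. g t = poly q t"
 thus "\<exists>r. \<forall>t. f t * g t = poly r t" by (intro exI[of _ "p * q"]) simp
qed

lemma is_poly_power [intro]: "is_poly f \<Longrightarrow> is_poly (\<lambda>t. f t ^ e)"
 by (induction e) auto

lemma is_poly_if [intro]: "is_poly f \<Longrightarrow> is_poly g \<Longrightarrow> is_poly (\<lambda>t. if P then f t else g t)"
 by (cases P) simp_all

lemma is_poly_sum [intro]: "(\<And>i. i \<in> A \<Longrightarrow> is_poly (f i)) \<Longrightarrow> is_poly (\<lambda>t. \<Sum>i\<in>A. f i t)"
 by (induction A rule: infinite_finite_induct) auto

lemma is_poly_prod [intro]: "(\<And>i. i \<in> A \<Longrightarrow> is_poly (f i)) \<Longrightarrow> is_poly (\<lambda>t. \<Prod>i\<in>A. f i t)"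
 by (induction A rule: infinite_finite_induct) auto

lemma is_poly_polyfun:
 assumes "polyfun F" "\<And>j b. is_poly (\<lambda>t. \<gamma> t j b)"
 shows "is_poly (\<lambda>t. F (\<gamma> t))"
 using assms(1) by induction (auto intro: assms(2))

lemma is_poly_mnr: "(\<And>r c. is_poly (\<lambda>t. x t r c)) \<Longrightarrow> is_poly (\<lambda>t. mnr (x t) L)"
 unfolding mnr_leibniz by (intro is_poly_sum is_poly_mult is_poly_const is_poly_prod)

lemma is_poly_finite_zeros:
 fixes f :: "'k::field_char_0 \<Rightarrow> 'k"
 assumes "is_poly f" "f a \<noteq> 0"
 shows "finite {t. f t = 0}"
proof -
 obtain p where p: "\<And>t. f t = poly p t" using assms(1) unfolding is_poly_def by blast
 hence "p \<noteq> 0" using assms(2) by auto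
 thus ?thesis using p by (simp add: poly_roots_finite)
qed

lemma is_poly_zero_at:
 fixes f :: "'k::field_char_0 \<Rightarrow> 'k"
 assumes "is_poly f" "finite A" "\<And>t. t \<notin> A \<Longrightarrow> f t = 0"
 shows "f a = 0"
proof (rule ccontr)
 assume "f a \<noteq> 0"
 hence "finite {t. f t = 0}" using assms(1) by (rule is_poly_finite_zeros[rotated])
 hence "finite (A \<union> {t. f t = 0})" using assms(2) by simp
 moreover have "A \<union> {t. f t = 0} = UNIV" using assms(3) by auto
 ultimately show False using infinite_UNIV_char_0[where 'a = 'k] by simp
qed

lemma avoid_zeros:
 fixes f g h :: "'k::field_char_0 \<Rightarrow> 'k"
 assumes "is_poly f" "f a \<noteq> 0" "is_poly g" "g b \<noteq> 0" "is_poly h" "h c \<noteq> 0"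
 shows "\<exists>t. f t \<noteq> 0 \<and> g t \<noteq> 0 \<and> h t \<noteq> 0"
proof -
 have "finite ({t. f t = 0} \<union> {t. g t = 0} \<union> {t. h t = 0})"
  using assms by (auto intro: is_poly_finite_zeros)
 hence "{t. f t = 0} \<union> {t. g t = 0} \<union> {t. h t = 0} \<noteq> UNIV"
  using infinite_UNIV_char_0[where 'a = 'k] by metis
 thus ?thesis by blast
qed

section \<open>Column operations on minors\<close>

lemma mnr_cong:
 "(\<And>r c. r \<in> set L \<Longrightarrow> c < length L \<Longrightarrow> x r c = y r c) \<Longrightarrow> mnr x L = mnr y L"
 unfolding mnr_def by (intro arg_cong[of _ _ det] eq_matI) auto

lemma mnr_mult_right:
 assumes "\<And>r c. r \<in> set L \<Longrightarrow> c < length L \<Longrightarrow> y r c = (\<Sum>d = 0..<length L. x r d * e d c)"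
 shows "mnr y L = mnr x L * det (mat (length L) (length L) (\<lambda>(d, c). e d c))"
proof -
 let ?l = "length L"
 have "mat ?l ?l (\<lambda>(i, j). y (L ! i) j) = mat ?l ?l (\<lambda>(i, j). x (L ! i) j) * mat ?l ?l (\<lambda>(d, c). e d c)"
  by (rule eq_matI) (simp_all add: assms scalar_prod_def)
 thus ?thesis
  unfolding mnr_def using det_mult[of "mat ?l ?l (\<lambda>(i, j). x (L ! i) j)" ?l "mat ?l ?l (\<lambda>(d, c). e d c)"] by simp
qed

text \<open>Right multiplication by a triangular matrix with diagonal entry u at b and 1
  elsewhere.\<close>

lemma mnr_col_scale:
 assumes "\<And>r. r \<in> set L \<Longrightarrow> y r b = s * x r a + u * x r b" "\<And>r c. r \<in> set L \<Longrightarrow> c \<noteq> b \<Longrightarrow> y r c = x r c"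
  and "a < b" "b < length L"
 shows "mnr y L = u * mnr x L"
proof -
 let ?l = "length L"
 define e where "e = (\<lambda>d c. if c = b then (if d = a then s else if d = b then u else 0) else if d = c then 1 else 0)"
 have "y r c = (\<Sum>d = 0..<?l. x r d * e d c)" if "r \<in> set L" "c < ?l" for r c
 proof (cases "c = b")
  case True
  have "(\<Sum>d = 0..<?l. x r d * e d c) = (\<Sum>d = 0..<?l. (if d = a then s * x r d else 0) + (if d = b then u * x r d else 0))"
   using assms(3) True by (intro sum.cong) (auto simp: e_def)
  also have "\<dots> = s * x r a + u * x r b" using assms(3,4) by (simp add: sum.distrib)
  finally show ?thesis using assms(1)[OF that(1)] True by simp
 next
  case False
  have "(\<Sum>d = 0..<?l. x r d * e d c) = (\<Sum>d = 0..<?l. if d = c then x r d else 0)"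
   using False by (intro sum.cong) (auto simp: e_def)
  thus ?thesis using assms(2)[OF that(1) False] that(2) by simp
 qed
 hence "mnr y L = mnr x L * det (mat ?l ?l (\<lambda>(d, c). e d c))" by (rule mnr_mult_right)
 also have "det (mat ?l ?l (\<lambda>(d, c). e d c)) = u"
 proof -
  have "upper_triangular (mat ?l ?l (\<lambda>(d, c). e d c))"
   using assms(3) by (auto simp: upper_triangular_def e_def)
  hence "det (mat ?l ?l (\<lambda>(d, c). e d c)) = prod_list (diag_mat (mat ?l ?l (\<lambda>(d, c). e d c)))"
   by (rule det_upper_triangular) (rule mat_carrier)
  also have "diag_mat (mat ?l ?l (\<lambda>(d, c). e d c)) = map (\<lambda>d. if d = b then u else 1) [0..<?l]"
   using assms(3) by (auto simp: diag_mat_def e_def)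
  also have "prod_list \<dots> = (\<Prod>d\<in>{0..<?l}. if d = b then u else 1)"
   by (subst prod.distinct_set_conv_list[symmetric]) simp_all
  also have "\<dots> = u" using assms(4) by simp
  finally show ?thesis .
 qed
 finally show ?thesis by (simp add: mult.commute)
qed

lemma mnr_permute_cols:
 assumes q: "q permutes {0..<length L}"
 shows "mnr (\<lambda>r c. y r (q c)) L = of_int (sign q) * mnr y L"
proof -
 let ?l = "length L"
 let ?A = "mat ?l ?l (\<lambda>(i, j). y (L ! j) i)"
 have lt: "q i < ?l" if "i < ?l" for i using permutes_in_image[OF q, of i] that by simp
 have 1: "mat ?l ?l (\<lambda>(i, j). y (L ! i) (q j)) = transpose_mat (mat ?l ?l (\<lambda>(i, j). ?A $$ (q i, j)))"
  by (rule eq_matI) (auto simp: lt)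
 have 2: "mat ?l ?l (\<lambda>(i, j). y (L ! i) j) = transpose_mat ?A"
  by (rule eq_matI) auto
 have A: "?A \<in> carrier_mat ?l ?l" by simp
 have "det (transpose_mat (mat ?l ?l (\<lambda>(i, j). ?A $$ (q i, j)))) = of_int (sign q) * det (transpose_mat ?A)"
  using det_permute_rows[OF A q] det_transpose[OF A] det_transpose[of "mat ?l ?l (\<lambda>(i, j). ?A $$ (q i, j))" ?l] by simp
 thus ?thesis unfolding mnr_def 1 2 .
qed

lemma mnr_nonzeroD:
 fixes x :: "nat \<Rightarrow> nat \<Rightarrow> 'a::idom"
 assumes "mnr x L \<noteq> 0"
 shows "\<exists>p. p permutes {0..<length L} \<and> (\<forall>i<length L. x (L ! i) (p i) \<noteq> 0)"
proof (rule ccontr)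
 assume neg: "\<not> ?thesis"
 have "(\<Prod>i = 0..<length L. x (L ! i) (p i)) = 0" if p: "p permutes {0..<length L}" for p
 proof -
  obtain i where "i < length L" "x (L ! i) (p i) = 0" using neg p by blast
  thus ?thesis by (intro prod_zero) auto
 qed
 hence "mnr x L = 0" unfolding mnr_leibniz by (intro sum.neutral) simp
 with assms show False by simp
qed

text \<open>Inverting the matching sends an element of K to the row matched with its column, and
  that row is at most as large. Applied to a non-zero Leibniz term, this yields the vanishing
  statements for triangular matrices.\<close>

lemma tle_permuted:
 assumes L: "distinct L" and p: "p permutes {0..<length L}"
  and f: "inj_on f {0..<length L}" "f ` {0..<length L} = K" and le: "\<And>i. i < length L \<Longrightarrow> L ! i \<le> f (p i)"
 shows "tle (set L) K"
proof -
 let ?S = "{0..<length L}"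
 define h where "h = the_inv_into ?S (f \<circ> p)"
 have inj: "inj_on (f \<circ> p) ?S"
  using comp_inj_on[of p ?S f] f(1) permutes_inj_on[OF p] permutes_image[OF p] by simp
 have im: "(f \<circ> p) ` ?S = K"
  unfolding image_comp[symmetric] permutes_image[OF p] by (rule f(2))
 have h: "h y \<in> ?S \<and> f (p (h y)) = y" if "y \<in> K" for y
 proof -
  have y: "y \<in> (f \<circ> p) ` ?S" unfolding im by (rule that)
  have "h y \<in> ?S" unfolding h_def by (rule the_inv_into_into[OF inj y subset_refl])
  moreover have "(f \<circ> p) (h y) = y" unfolding h_def by (rule f_the_inv_into_f[OF inj y])
  ultimately show ?thesis by simp
 qed
 show ?thesis
 proof (rule tle_inj_on[of "\<lambda>y. L ! h y"])
  show "inj_on (\<lambda>y. L ! h y) K"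
  proof (rule inj_onI)
   fix y z assume yz: "y \<in> K" "z \<in> K" "L ! h y = L ! h z"
   have "h y < length L" "h z < length L" using h[OF yz(1)] h[OF yz(2)] by auto
   hence "h y = h z" using nth_eq_iff_index_eq[OF L, of "h y" "h z"] yz(3) by blast
   hence "f (p (h y)) = f (p (h z))" by (rule arg_cong)
   thus "y = z" using h[OF yz(1)] h[OF yz(2)] by simp
  qed
  show "(\<lambda>y. L ! h y) ` K \<subseteq> set L"
  proof (rule image_subsetI)
   fix y assume "y \<in> K"
   thus "L ! h y \<in> set L" using h[of y] by simp
  qed
  show "L ! h y \<le> y" if "y \<in> K" for y using le[of "h y"] h[OF that] by simp
 qed
qed

section \<open>Open Schubert cells and their degenerations\<close>

text \<open>Take x as the first place where the counts of M exceed those of J, and y as the next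
  place where they agree. In between M has an element to spare, so x may be moved up to y.\<close>

lemma exists_tle_exchange:
 assumes sub: "M \<subseteq> {1..n}" "J \<subseteq> {1..n}" and card: "card M = card J" and tle: "tle M J" and ne: "M \<noteq> J"
 shows "\<exists>x y. x \<in> M \<and> y \<notin> M \<and> x < y \<and> y \<le> n \<and> tle (insert y (M - {x})) J"
proof -
 have fin: "finite M" using sub finite_subset by blast
 have le: "card (J \<inter> {..z}) \<le> card (M \<inter> {..z})" for z using tle by (simp add: tle_def)
 have "\<exists>z. card (J \<inter> {..z}) < card (M \<inter> {..z})"
 proof (rule ccontr)
  assume "\<not> ?thesis"
  hence "card (M \<inter> {..z}) = card (J \<inter> {..z})" for z using le[of z] by (simp add: not_less le_antisym)
  hence "M = J" by (rule card_Int_atMost_inject)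
  with ne show False by simp
 qed
 define x where "x = (LEAST z. card (J \<inter> {..z}) < card (M \<inter> {..z}))"
 have x: "card (J \<inter> {..x}) < card (M \<inter> {..x})"
  unfolding x_def by (rule LeastI_ex) fact
 have x_min: "card (J \<inter> {..z}) = card (M \<inter> {..z})" if "z < x" for z
  using not_less_Least[of z "\<lambda>z. card (J \<inter> {..z}) < card (M \<inter> {..z})"] that le[of z] unfolding x_def by simp
 have big: "card (J \<inter> {..z}) = card (M \<inter> {..z})" if "n \<le> z" for z
 proof -
  have "J \<inter> {..z} = J" "M \<inter> {..z} = M" using sub that by auto
  thus ?thesis using card by simp
 qed
 have xn: "x < n" using big[of x] x by (cases "x < n") auto
 have x1: "x \<noteq> 0"
 proof
  assume "x = 0"
  hence "M \<inter> {..x} = {}" using sub by auto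
  with x show False by simp
 qed
 then obtain x' where x': "x = Suc x'" using not0_implies_Suc by blast
 have xM: "x \<in> M"
  using x x_min[of x'] by (auto simp: x' card_Int_atMost_Suc split: if_splits)
 define y where "y = (LEAST z. x < z \<and> card (J \<inter> {..z}) = card (M \<inter> {..z}))"
 have y: "x < y" "card (J \<inter> {..y}) = card (M \<inter> {..y})"
  using LeastI[of "\<lambda>z. x < z \<and> card (J \<inter> {..z}) = card (M \<inter> {..z})" n] xn big unfolding y_def by auto
 have yn: "y \<le> n" unfolding y_def by (rule Least_le) (simp add: xn big)
 have between: "card (J \<inter> {..z}) < card (M \<inter> {..z})" if "x \<le> z" "z < y" for z
 proof (cases "z = x")
  case False
  hence "\<not> (x < z \<and> card (J \<inter> {..z}) = card (M \<inter> {..z}))"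
   using not_less_Least[of z "\<lambda>z. x < z \<and> card (J \<inter> {..z}) = card (M \<inter> {..z})"] that(2) unfolding y_def by simp
  thus ?thesis using that(1) False le[of z] by simp
 qed (simp add: x)
 obtain y' where y': "y = Suc y'" using y(1) less_imp_Suc_add by blast
 have yM: "y \<notin> M"
  using y between[of y'] by (auto simp: y' card_Int_atMost_Suc split: if_splits)
 have "tle (insert y (M - {x})) J"
  unfolding tle_def
 proof
  fix z
  show "card (J \<inter> {..z}) \<le> card (insert y (M - {x}) \<inter> {..z})"
  proof (cases "x \<le> z")
   case False
   hence "insert y (M - {x}) \<inter> {..z} = M \<inter> {..z}" using y(1) by auto
   thus ?thesis using le[of z] by simp
  next
   case xz: True
   have d: "card (M \<inter> {..z} - {x}) = card (M \<inter> {..z}) - 1"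
    using xM xz fin by simp
   show ?thesis
   proof (cases "y \<le> z")
    case True
    have "insert y (M - {x}) \<inter> {..z} = insert y (M \<inter> {..z} - {x})" using True by auto
    moreover have "card (insert y (M \<inter> {..z} - {x})) = Suc (card (M \<inter> {..z} - {x}))"
     using yM fin by simp
    ultimately show ?thesis using d le[of z] by simp
   next
    case False
    hence "insert y (M - {x}) \<inter> {..z} = M \<inter> {..z} - {x}" by auto
    thus ?thesis using d between[of z] xz False by simp
   qed
  qed
 qed
 thus ?thesis using xM yM y(1) yn by blast
qed

text \<open>An invertible upper triangular matrix as a function with both indices starting at 1, so
  that permutations of 1..n act on its columns directly.\<close>

definition upper_fun :: "nat \<Rightarrow> (nat \<Rightarrow> nat \<Rightarrow> 'k::comm_ring_1) \<Rightarrow> bool" where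
 "upper_fun n b \<longleftrightarrow> (\<forall>r c. c < r \<longrightarrow> b r c = 0) \<and> (\<forall>r\<in>{1..n}. b r r \<noteq> 0)"

text \<open>The product of the matrix b with a permutation matrix; for triangular b it represents a
  point of a Bruhat cell.\<close>

definition perm_cols :: "nat \<Rightarrow> (nat \<Rightarrow> nat) \<Rightarrow> (nat \<Rightarrow> nat \<Rightarrow> 'k::comm_ring_1) \<Rightarrow> 'k mat" where
 "perm_cols n \<sigma> b = mat n n (\<lambda>(r, c). b (Suc r) (\<sigma> (Suc c)))"

definition perm_matrix :: "nat \<Rightarrow> (nat \<Rightarrow> nat) \<Rightarrow> 'k::comm_ring_1 mat" where
 "perm_matrix n \<sigma> = mat n n (\<lambda>(r, c). if Suc r = \<sigma> (Suc c) then 1 else 0)"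

lemma perm_cols_carrier [simp]: "perm_cols n \<sigma> b \<in> carrier_mat n n"
 by (simp add: perm_cols_def)

lemma perm_matrix_carrier [simp]: "perm_matrix n \<sigma> \<in> carrier_mat n n"
 by (simp add: perm_matrix_def)

lemma entry_perm_cols: "r \<in> {1..n} \<Longrightarrow> c < n \<Longrightarrow> entry (perm_cols n \<sigma> b) r c = b r (\<sigma> (Suc c))"
 by (auto simp: entry_def perm_cols_def)

lemma permutes_Suc_lt: "\<sigma> permutes {1..n} \<Longrightarrow> c < n \<Longrightarrow> \<exists>e<n. \<sigma> (Suc c) = Suc e"
 using permutes_in_image[of \<sigma> "{1..n}" "Suc c"] by (auto intro!: exI[of _ "\<sigma> (Suc c) - 1"])

lemma mult_perm_matrix:
 assumes \<sigma>: "\<sigma> permutes {1..n}" and B: "B \<in> carrier_mat n n"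
 shows "B * perm_matrix n \<sigma> = mat n n (\<lambda>(r, c). B $$ (r, \<sigma> (Suc c) - 1))"
proof (rule eq_matI)
 fix r c assume "r < dim_row (mat n n (\<lambda>(r, c). B $$ (r, \<sigma> (Suc c) - 1)))"
  "c < dim_col (mat n n (\<lambda>(r, c). B $$ (r, \<sigma> (Suc c) - 1)))"
 hence rc: "r < n" "c < n" by auto
 obtain e where e: "e < n" "\<sigma> (Suc c) = Suc e" using permutes_Suc_lt[OF \<sigma> rc(2)] by blast
 have "(B * perm_matrix n \<sigma>) $$ (r, c) = (\<Sum>d = 0..<n. B $$ (r, d) * (if Suc d = \<sigma> (Suc c) then 1 else 0))"
  using rc B by (simp add: perm_matrix_def scalar_prod_def)
 also have "\<dots> = (\<Sum>d = 0..<n. if d = e then B $$ (r, d) else 0)" by (rule sum.cong) (auto simp: e)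
 also have "\<dots> = B $$ (r, e)" using e by simp
 finally show "(B * perm_matrix n \<sigma>) $$ (r, c) = mat n n (\<lambda>(r, c). B $$ (r, \<sigma> (Suc c) - 1)) $$ (r, c)"
  using rc e by simp
qed (use B in \<open>auto simp: perm_matrix_def\<close>)

lemma perm_cols_eq_mult:
 assumes "\<sigma> permutes {1..n}"
 shows "perm_cols n \<sigma> b = mat n n (\<lambda>(r, c). b (Suc r) (Suc c)) * perm_matrix n \<sigma>"
proof -
 have "mat n n (\<lambda>(r, c). mat n n (\<lambda>(r, c). b (Suc r) (Suc c)) $$ (r, \<sigma> (Suc c) - 1)) = perm_cols n \<sigma> b"
 proof (rule eq_matI)
  fix r c assume "r < dim_row (perm_cols n \<sigma> b)" "c < dim_col (perm_cols n \<sigma> b)"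
  hence rc: "r < n" "c < n" by (auto simp: perm_cols_def)
  obtain e where e: "e < n" "\<sigma> (Suc c) = Suc e" using permutes_Suc_lt[OF assms rc(2)] by blast
  show "mat n n (\<lambda>(r, c). mat n n (\<lambda>(r, c). b (Suc r) (Suc c)) $$ (r, \<sigma> (Suc c) - 1)) $$ (r, c) = perm_cols n \<sigma> b $$ (r, c)"
   using rc e by (simp add: perm_cols_def)
 qed (auto simp: perm_cols_def)
 thus ?thesis using mult_perm_matrix[OF assms, of "mat n n (\<lambda>(r, c). b (Suc r) (Suc c))"] by simp
qed

lemma det_perm_matrix_nonzero:
 assumes "\<sigma> permutes {1..n}"
 shows "det (perm_matrix n \<sigma>) \<noteq> (0 :: 'k::field)"
proof -
 let ?\<tau> = "inv_into UNIV \<sigma>"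
 have \<tau>: "?\<tau> permutes {1..n}" by (rule permutes_inv[OF assms])
 have "perm_matrix n \<sigma> * perm_matrix n ?\<tau> = (1\<^sub>m n :: 'k mat)"
  unfolding mult_perm_matrix[OF \<tau> perm_matrix_carrier]
 proof (rule eq_matI)
  fix r c assume "r < dim_row (1\<^sub>m n :: 'k mat)" "c < dim_col (1\<^sub>m n :: 'k mat)"
  hence rc: "r < n" "c < n" by auto
  obtain e where e: "e < n" "?\<tau> (Suc c) = Suc e" using permutes_Suc_lt[OF \<tau> rc(2)] by blast
  have "\<sigma> (Suc e) = Suc c" using permutes_inverses(1)[OF assms, of "Suc c"] e(2) by simp
  thus "mat n n (\<lambda>(r, c). perm_matrix n \<sigma> $$ (r, ?\<tau> (Suc c) - 1)) $$ (r, c) = (1\<^sub>m n :: 'k mat) $$ (r, c)"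
   using rc e by (simp add: perm_matrix_def)
 qed auto
 hence "det (perm_matrix n \<sigma>) * det (perm_matrix n ?\<tau>) = (1 :: 'k)"
  using det_mult[OF perm_matrix_carrier[of n \<sigma>] perm_matrix_carrier[of n ?\<tau>], where 'a = 'k] by simp
 thus ?thesis by auto
qed

lemma det_upper_fun:
 fixes b :: "nat \<Rightarrow> nat \<Rightarrow> 'k::field"
 assumes "upper_fun n b"
 shows "det (mat n n (\<lambda>(r, c). b (Suc r) (Suc c))) \<noteq> 0"
proof -
 let ?B = "mat n n (\<lambda>(r, c). b (Suc r) (Suc c))"
 have "upper_triangular ?B" using assms by (auto simp: upper_triangular_def upper_fun_def)
 hence "det ?B = prod_list (diag_mat ?B)" by (rule det_upper_triangular) (rule mat_carrier)
 moreover have "0 \<notin> set (diag_mat ?B)"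
  using assms by (auto simp: diag_mat_def upper_fun_def)
 ultimately show ?thesis by (simp add: prod_list_zero_iff)
qed

lemma det_perm_cols:
 fixes b :: "nat \<Rightarrow> nat \<Rightarrow> 'k::field"
 assumes "\<sigma> permutes {1..n}" "upper_fun n b"
 shows "det (perm_cols n \<sigma> b) \<noteq> 0"
 unfolding perm_cols_eq_mult[OF assms(1)]
 using det_upper_fun[OF assms(2)] det_perm_matrix_nonzero[OF assms(1), where 'k = 'k]
  det_mult[of "mat n n (\<lambda>(r, c). b (Suc r) (Suc c))" n "perm_matrix n \<sigma>"] by simp

lemma mnr_perm_cols:
 assumes "set L \<subseteq> {1..n}" "length L \<le> n"
 shows "mnr (entry (perm_cols n \<sigma> b)) L = mnr (\<lambda>r c. b r (\<sigma> (Suc c))) L"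
 by (rule mnr_cong) (use assms in \<open>auto intro!: entry_perm_cols\<close>)

text \<open>An entry of a triangular matrix is non-zero only if its row is at most its column, so a
  non-zero Leibniz term matches every row with a column label at least as large.\<close>

lemma mnr_upper_tle:
 fixes b :: "nat \<Rightarrow> nat \<Rightarrow> 'k::idom"
 assumes \<sigma>: "\<sigma> permutes {1..n}" and b: "\<And>r c. c < r \<Longrightarrow> b r c = 0"
  and L: "distinct L" and nz: "mnr (\<lambda>r c. b r (\<sigma> (Suc c))) L \<noteq> 0"
 shows "tle (set L) (\<sigma> ` {1..length L})"
proof -
 obtain p where p: "p permutes {0..<length L}" "\<forall>i<length L. b (L ! i) (\<sigma> (Suc (p i))) \<noteq> 0"
  using mnr_nonzeroD[OF nz] by blast
 show ?thesis
 proof (rule tle_permuted[of L p "\<lambda>c. \<sigma> (Suc c)" "\<sigma> ` {1..length L}", OF L p(1)])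
  show "inj_on (\<lambda>c. \<sigma> (Suc c)) {0..<length L}"
  proof (rule inj_onI)
   fix c d assume "\<sigma> (Suc c) = \<sigma> (Suc d)"
   thus "c = d" using injD[OF permutes_inj[OF \<sigma>]] by blast
  qed
  have "Suc ` {0..<length L} = {1..length L}"
   by (simp add: image_Suc_atLeastLessThan atLeastLessThanSuc_atLeastAtMost One_nat_def)
  thus "(\<lambda>c. \<sigma> (Suc c)) ` {0..<length L} = \<sigma> ` {1..length L}"
   using image_image[of \<sigma> Suc "{0..<length L}"] by simp
  show "L ! i \<le> \<sigma> (Suc (p i))" if "i < length L" for i
   using p(2)[rule_format, OF that] b[of "\<sigma> (Suc (p i))" "L ! i"] by (cases "L ! i \<le> \<sigma> (Suc (p i))") auto
 qed
qed

text \<open>The two column sequences enumerate the same set in different order, so one sign relates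
  their minors for all b and L at once.\<close>

lemma mnr_same_column_span:
 assumes \<sigma>: "\<sigma> permutes {1..n}" and \<tau>: "\<tau> permutes {1..n}" and eq: "\<sigma> ` {1..i} = \<tau> ` {1..i}" and i: "i \<le> n"
 shows "\<exists>\<epsilon>. \<epsilon> \<noteq> (0 :: 'k::field_char_0) \<and>
  (\<forall>b L. length L = i \<longrightarrow> mnr (\<lambda>r c. b r (\<sigma> (Suc c))) L = \<epsilon> * mnr (\<lambda>r c. b r (\<tau> (Suc c))) L)"
proof -
 define q where "q = (\<lambda>c. if c < i then inv_into UNIV \<tau> (\<sigma> (Suc c)) - 1 else c)"
 have q: "q c < i \<and> \<tau> (Suc (q c)) = \<sigma> (Suc c)" if "c < i" for c
 proof -
  have "\<sigma> (Suc c) \<in> \<sigma> ` {1..i}" by (rule imageI) (use that in simp)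
  hence "\<sigma> (Suc c) \<in> \<tau> ` {1..i}" by (simp only: eq)
  then obtain t where t: "t \<in> {1..i}" "\<sigma> (Suc c) = \<tau> t" by auto
  hence "q c = t - 1" using that permutes_inverses(2)[OF \<tau>, of t] by (simp add: q_def)
  thus ?thesis using t by auto
 qed
 have inj: "inj_on q {0..<i}"
 proof (rule inj_onI)
  fix c d assume cd: "c \<in> {0..<i}" "d \<in> {0..<i}" "q c = q d"
  have "\<sigma> (Suc c) = \<tau> (Suc (q c))" "\<sigma> (Suc d) = \<tau> (Suc (q d))"
   using q[THEN conjunct2, symmetric] cd(1,2) by auto
  hence "\<sigma> (Suc c) = \<sigma> (Suc d)" using cd(3) by metis
  thus "c = d" using permutes_inj[OF \<sigma>] by (simp add: inj_eq)
 qed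
 have sub: "q ` {0..<i} \<subseteq> {0..<i}" using q by auto
 have perm: "q permutes {0..<i}"
 proof (rule bij_imp_permutes)
  show "bij_betw q {0..<i} {0..<i}"
   using inj endo_inj_surj[OF _ sub inj] by (simp add: bij_betw_def)
 qed (simp add: q_def)
 have "mnr (\<lambda>r c. b r (\<sigma> (Suc c))) L = of_int (sign q) * mnr (\<lambda>r c. b r (\<tau> (Suc c))) L"
  if "length L = i" for L and b :: "nat \<Rightarrow> nat \<Rightarrow> 'k"
 proof -
  have "mnr (\<lambda>r c. b r (\<sigma> (Suc c))) L = mnr (\<lambda>r c. b r (\<tau> (Suc (q c)))) L"
  proof (rule mnr_cong)
   fix r c assume "c < length L"
   hence "\<tau> (Suc (q c)) = \<sigma> (Suc c)" using q[of c] that by simp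
   thus "b r (\<sigma> (Suc c)) = b r (\<tau> (Suc (q c)))" by simp
  qed
  also have "\<dots> = of_int (sign q) * mnr (\<lambda>r c. b r (\<tau> (Suc c))) L"
   using mnr_permute_cols[of q L "\<lambda>r c. b r (\<tau> (Suc c))"] perm that by simp
  finally show ?thesis .
 qed
 moreover have "of_int (sign q) \<noteq> (0 :: 'k)" by (simp add: sign_def)
 ultimately show ?thesis by blast
qed

context flag_setup
begin

text \<open>The multicone over a Bruhat cell in the product with index set I. Since coefficients may
  vanish, it contains the cells of the same permutation for smaller index sets.\<close>

definition cell :: "nat set \<Rightarrow> (nat \<Rightarrow> nat) \<Rightarrow> ('k::comm_ring_1) fpoint set" where
 "cell I \<sigma> = {flag_vec I c (perm_cols n \<sigma> b) | c b. upper_fun n b}"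

definition open_cell :: "nat set \<Rightarrow> ('k::comm_ring_1) fpoint set" where
 "open_cell J = cell {idx J..m} (lift_perm n J)"

lemma flag_vec_cong:
 assumes "\<And>j J. j \<in> I \<Longrightarrow> J \<subseteq> {1..n} \<Longrightarrow> card J = k j \<Longrightarrow>
  c j * wedge_cols n (k j) g J = c' j * wedge_cols n (k j) g' J"
 shows "flag_vec I c g = flag_vec I c' g'"
proof (intro ext)
 fix j J
 show "flag_vec I c g j J = flag_vec I c' g' j J"
 proof (cases "j \<in> I \<and> J \<subseteq> {1..n} \<and> card J = k j")
  case True
  thus ?thesis using assms by (simp add: flag_vec_def)
 next
  case False
  thus ?thesis by (auto simp: flag_vec_def wedge_cols_def)
 qed
qed

lemma wedge_perm_cols:
 assumes "J \<subseteq> {1..n}" "card J = i"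
 shows "wedge_cols n i (perm_cols n \<sigma> b) J = mnr (\<lambda>r c. b r (\<sigma> (Suc c))) (sorted_list_of_set J)"
proof -
 have "finite J" using assms finite_subset by blast
 moreover have "card J \<le> n" using card_mono[OF _ assms(1)] by simp
 ultimately show ?thesis
  using assms by (simp add: wedge_cols_eq mnr_perm_cols)
qed

lemma flag_vec_restrict:
 assumes "I' \<subseteq> I"
 shows "flag_vec I' c g = flag_vec I (\<lambda>j. if j \<in> I' then c j else 0) g"
 using assms by (intro ext) (auto simp: flag_vec_def)

lemma cell_mono: "I' \<subseteq> I \<Longrightarrow> cell I' \<sigma> \<subseteq> cell I \<sigma>"
 unfolding cell_def using flag_vec_restrict by blast

lemma cell_sub_tot:
 fixes v :: "('k::field) fpoint"
 assumes "v \<in> cell I \<sigma>" "I \<subseteq> {1..m}" "\<sigma> permutes {1..n}"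
 shows "v \<in> tot"
proof -
 obtain c b where v: "upper_fun n b" "v = flag_vec I c (perm_cols n \<sigma> b)"
  using assms(1) unfolding cell_def by blast
 have "v = flag_vec {1..m} (\<lambda>j. if j \<in> I then c j else 0) (perm_cols n \<sigma> b)"
  unfolding v(2) by (rule flag_vec_restrict[OF assms(2)])
 thus ?thesis
  unfolding tot_def using det_perm_cols[OF assms(3) v(1)] perm_cols_carrier by blast
qed

lemma lift_perm_facts:
 assumes "J \<in> csets"
 shows "lift_perm n J permutes {1..n}" "lift_perm n J ` {1..card J} = J"
  "c \<le> card J \<Longrightarrow> lift_perm n J ` {1..c} = set (take c (sorted_list_of_set J))"
  "card J < a \<Longrightarrow> a < b \<Longrightarrow> b \<le> n \<Longrightarrow> lift_perm n J b < lift_perm n J a"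
 using lift_perm[OF csets_sub[OF assms]] by blast+

lemma open_cell_sub_tot:
 fixes v :: "('k::field) fpoint"
 shows "v \<in> open_cell J \<Longrightarrow> J \<in> csets \<Longrightarrow> v \<in> tot"
 unfolding open_cell_def using idx(1)[of J] lift_perm_facts(1)[of J]
 by (elim cell_sub_tot) auto

text \<open>Triangularity puts K below the image of \<open>{1..card K}\<close>, and that image
  contains J.\<close>

lemma crd_cell_nonzero:
 fixes v :: "('k::idom) fpoint"
 assumes v: "v \<in> cell {idx J..m} \<sigma>" and \<sigma>: "\<sigma> permutes {1..n}" "\<sigma> ` {1..card J} = J"
  and K: "K \<in> csets" and J: "J \<in> csets" and nz: "crd K v \<noteq> 0"
 shows "tle K J"
proof -
 obtain c b where b: "upper_fun n b" "v = flag_vec {idx J..m} c (perm_cols n \<sigma> b)"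
  using v unfolding cell_def by blast
 have finK: "finite K" by (rule csets_finite[OF K])
 have nz': "idx K \<in> {idx J..m}" "mnr (\<lambda>r c. b r (\<sigma> (Suc c))) (sorted_list_of_set K) \<noteq> 0"
  using nz b(2) crd_flag_vec[OF perm_cols_carrier K, of "{idx J..m}" c \<sigma> b] idx(2)[OF K] csets_sub[OF K] k_less_n[OF idx(1)[OF K]]
  by (auto simp: mnr_perm_cols finK split: if_splits)
 have b0: "b r c = 0" if "c < r" for r c using b(1) that by (simp add: upper_fun_def)
 have "tle (set (sorted_list_of_set K)) (\<sigma> ` {1..length (sorted_list_of_set K)})"
  using nz'(2) by (intro mnr_upper_tle[OF \<sigma>(1), of b] b0) auto
 hence "tle K (\<sigma> ` {1..card K})" using finK by simp
 moreover have "card J \<le> card K"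
  using k_le_iff[of "idx J" "idx K"] nz'(1) idx[OF J] idx[OF K] by auto
 hence "\<sigma> ` {1..card J} \<subseteq> \<sigma> ` {1..card K}" by (intro image_mono) auto
 hence "tle (\<sigma> ` {1..card K}) J" unfolding \<sigma>(2) by (rule tle_subset)
 ultimately show ?thesis by (rule tle_trans)
qed

lemma crd_open_cell:
 fixes v :: "('k::idom) fpoint"
 assumes "v \<in> open_cell J" "J \<in> csets" "K \<in> csets" "crd K v \<noteq> 0"
 shows "tle K J"
 using assms crd_cell_nonzero[of v J "lift_perm n J" K] lift_perm_facts[of J] unfolding open_cell_def by blast

text \<open>For the identity matrix b the columns of \<open>lift_perm\<close> start with the sorted
  elements of J, so the minor on the rows J is that of an identity matrix.\<close>

lemma crd_open_cell_self:
 assumes J: "J \<in> csets"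
 shows "\<exists>v\<in>open_cell J. crd J (v :: ('k::field) fpoint) \<noteq> 0"
proof -
 let ?b = "\<lambda>r c. if r = c then 1 else (0 :: 'k)"
 let ?v = "flag_vec {idx J..m} (\<lambda>_. 1) (perm_cols n (lift_perm n J) ?b)"
 let ?L = "sorted_list_of_set J"
 have fin: "finite J" by (rule csets_finite[OF J])
 have cJ: "card J < n" using k_less_n[OF idx(1)[OF J]] idx(2)[OF J] by simp
 have "upper_fun n ?b" by (simp add: upper_fun_def)
 hence "?v \<in> open_cell J" unfolding open_cell_def cell_def by blast
 moreover have "crd J ?v = mnr (\<lambda>r c. ?b r (lift_perm n J (Suc c))) ?L"
  using crd_flag_vec[OF perm_cols_carrier J, of "{idx J..m}" "\<lambda>_. 1" "lift_perm n J" ?b]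
   idx(1)[OF J] csets_sub[OF J] cJ by (simp add: mnr_perm_cols fin)
 moreover have "mat (length ?L) (length ?L) (\<lambda>(i, j). ?b (?L ! i) (lift_perm n J (Suc j))) = 1\<^sub>m (length ?L)"
 proof (rule eq_matI)
  fix i j assume ij: "i < dim_row (1\<^sub>m (length ?L) :: 'k mat)" "j < dim_col (1\<^sub>m (length ?L) :: 'k mat)"
  hence "lift_perm n J (Suc j) = ?L ! j" using cJ by (simp add: lift_perm_def nth_append)
  thus "mat (length ?L) (length ?L) (\<lambda>(i, j). ?b (?L ! i) (lift_perm n J (Suc j))) $$ (i, j) = 1\<^sub>m (length ?L) $$ (i, j)"
   using ij by (simp add: nth_eq_iff_index_eq)
 qed auto
 hence "mnr (\<lambda>r c. ?b r (lift_perm n J (Suc c))) ?L = 1" by (simp add: mnr_def)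
 ultimately show ?thesis by (intro bexI[of _ ?v]) simp_all
qed

lemma is_poly_flag_vec:
 assumes "\<And>j. is_poly (\<lambda>t. c t j)" "\<And>r e. is_poly (\<lambda>t. x t r e)" "\<And>t. g t \<in> carrier_mat n n"
  "\<And>t r e. r \<in> {1..n} \<Longrightarrow> e < n \<Longrightarrow> entry (g t) r e = x t r e"
 shows "is_poly (\<lambda>t. flag_vec I (c t) (g t) j J)"
proof (cases "j \<in> I \<and> J \<subseteq> {1..n} \<and> card J = k j")
 case True
 have "finite J" using True finite_subset by blast
 moreover have "card J \<le> n" using card_mono[of "{1..n}" J] True by simp
 ultimately have "mnr (entry (g t)) (sorted_list_of_set J) = mnr (x t) (sorted_list_of_set J)" for t
  using True by (intro mnr_cong assms(4)) auto
 hence "flag_vec I (c t) (g t) j J = c t j * mnr (x t) (sorted_list_of_set J)" for t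
  using True by (simp add: flag_vec_def wedge_cols_eq[OF assms(3)])
 thus ?thesis by (simp add: is_poly_mult assms(1) is_poly_mnr assms(2))
next
 case False
 hence "flag_vec I (c t) (g t) j J = 0" for t by (auto simp: flag_vec_def wedge_cols_def)
 thus ?thesis by (simp add: is_poly_const)
qed

text \<open>The segment between two points of a cell meets every non-empty principal open subset.\<close>

lemma cell_irreducible:
 fixes F G :: "('k::field_char_0) fpoint \<Rightarrow> 'k"
 assumes F: "polyfun F" "u \<in> cell I \<sigma>" "F u \<noteq> 0" and G: "polyfun G" "w \<in> cell I \<sigma>" "G w \<noteq> 0"
 shows "\<exists>v\<in>cell I \<sigma>. F v \<noteq> 0 \<and> G v \<noteq> 0"
proof -
 obtain c b where u: "upper_fun n b" "u = flag_vec I c (perm_cols n \<sigma> b)"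
  using F(2) unfolding cell_def by blast
 obtain c' b' where w: "upper_fun n b'" "w = flag_vec I c' (perm_cols n \<sigma> b')"
  using G(2) unfolding cell_def by blast
 define B where "B = (\<lambda>t r e. (1 + (- 1) * t) * b r e + t * b' r e :: 'k)"
 define C where "C = (\<lambda>t j. (1 + (- 1) * t) * c j + t * c' j :: 'k)"
 define \<gamma> where "\<gamma> = (\<lambda>t. flag_vec I (C t) (perm_cols n \<sigma> (B t)))"
 \<comment> \<open>The product of the diagonal entries; its non-vanishing keeps the point of the
   segment inside the cell.\<close>
 define h where "h = (\<lambda>t. \<Prod>r\<in>{1..n}. B t r r)"
 have \<gamma>: "is_poly (\<lambda>t. \<gamma> t j J)" for j J
  unfolding \<gamma>_def
 proof (rule is_poly_flag_vec)
  show "is_poly (\<lambda>t. B t r (\<sigma> (Suc e)))" for r e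
   unfolding B_def by (intro is_poly_add is_poly_mult is_poly_const is_poly_id)
  show "is_poly (\<lambda>t. C t j)" for j
   unfolding C_def by (intro is_poly_add is_poly_mult is_poly_const is_poly_id)
 qed (simp_all add: entry_perm_cols)
 have h: "is_poly h" unfolding h_def B_def
  by (intro is_poly_prod is_poly_add is_poly_mult is_poly_const is_poly_id)
 have "\<gamma> 0 = u" "\<gamma> 1 = w" by (simp_all add: \<gamma>_def B_def C_def u w)
 moreover have "h 0 \<noteq> 0" using u(1) by (simp add: h_def B_def upper_fun_def)
 ultimately have nz: "F (\<gamma> 0) \<noteq> 0" "G (\<gamma> 1) \<noteq> 0" "h 0 \<noteq> 0" using F(3) G(3) by simp_all
 have FG: "is_poly (\<lambda>t. F (\<gamma> t))" "is_poly (\<lambda>t. G (\<gamma> t))"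
  by (rule is_poly_polyfun[OF F(1)], rule \<gamma>, rule is_poly_polyfun[OF G(1)], rule \<gamma>)
 obtain t where t: "F (\<gamma> t) \<noteq> 0" "G (\<gamma> t) \<noteq> 0" "h t \<noteq> 0"
  using avoid_zeros[OF FG(1) nz(1) FG(2) nz(2) h nz(3)] by blast
 have "upper_fun n (B t)"
  using u(1) w(1) t(3) by (auto simp: upper_fun_def B_def h_def)
 hence "\<gamma> t \<in> cell I \<sigma>" unfolding \<gamma>_def cell_def by blast
 with t show ?thesis by blast
qed

text \<open>One-parameter degeneration: \<open>t \<mapsto> \<beta> \<cdot> (1 + t E) \<cdot> \<sigma>\<close> lies in the cell of \<open>\<sigma> \<circ> (a b)\<close> for
 \<open>t \<noteq> 0\<close> and meets the cell of \<open>\<sigma>\<close> at \<open>t = 0\<close>.\<close>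

lemma cell_degenerate:
 fixes F :: "('k::field_char_0) fpoint \<Rightarrow> 'k"
 assumes F: "polyfun F" "\<And>v. v \<in> cell I (\<sigma> \<circ> transpose a b) \<Longrightarrow> F v = 0"
  and \<sigma>: "\<sigma> permutes {1..n}" and ab: "1 \<le> a" "a < b" "b \<le> n" "\<sigma> a < \<sigma> b"
  and I: "I \<subseteq> {1..m}" and v: "v \<in> cell I \<sigma>"
 shows "F v = 0"
proof -
 obtain c \<beta> where \<beta>: "upper_fun n \<beta>" "v = flag_vec I c (perm_cols n \<sigma> \<beta>)"
  using v unfolding cell_def by blast
 let ?\<tau> = "\<sigma> \<circ> transpose a b"
 have inj: "\<sigma> x = \<sigma> y \<longleftrightarrow> x = y" for x y using permutes_inj[OF \<sigma>] by (rule inj_eq)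
 define x where "x = (\<lambda>t r e. \<beta> r (\<sigma> (Suc e)) + (if Suc e = a then t * \<beta> r (\<sigma> b) else 0 :: 'k))"
 define g where "g = (\<lambda>t. mat n n (\<lambda>(r, e). x t (Suc r) e))"
 define \<gamma> where "\<gamma> = (\<lambda>t. flag_vec I c (g t))"
 have g: "g t \<in> carrier_mat n n" for t by (simp add: g_def)
 have ent: "entry (g t) r e = x t r e" if "r \<in> {1..n}" "e < n" for t r e
  using that by (auto simp: entry_def g_def)
 have poly: "is_poly (\<lambda>t. F (\<gamma> t))"
 proof (rule is_poly_polyfun[OF F(1)])
  show "is_poly (\<lambda>t. \<gamma> t j J)" for j J
   unfolding \<gamma>_def
  proof (rule is_poly_flag_vec[OF _ _ g ent])
   show "is_poly (\<lambda>t. x t r e)" for r e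
    unfolding x_def by (intro is_poly_add is_poly_const is_poly_if is_poly_mult is_poly_id)
  qed auto
 qed
 have "F (\<gamma> t) = 0" if t: "t \<notin> {0}" for t
 proof -
  have t0: "t \<noteq> 0" using t by simp
  \<comment> \<open>Column a of the curve becomes column \<open>\<sigma> b\<close> of a triangular
    matrix. It stays triangular because \<open>\<sigma> a < \<sigma> b\<close>, and invertible
    because t is not zero.\<close>
  define \<beta>' where "\<beta>' = (\<lambda>r e. if e = \<sigma> b then t * \<beta> r (\<sigma> b) + \<beta> r (\<sigma> a) else \<beta> r e)"
  have up: "upper_fun n \<beta>'"
  proof -
   have "\<beta> r (\<sigma> b) = 0 \<and> \<beta> r (\<sigma> a) = 0" if "\<sigma> b < r" for r
    using \<beta>(1) that ab(4) by (auto simp: upper_fun_def)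
   moreover have "\<beta> (\<sigma> b) (\<sigma> a) = 0" using \<beta>(1) ab(4) by (auto simp: upper_fun_def)
   ultimately show ?thesis
    using \<beta>(1) t0 by (auto simp: upper_fun_def \<beta>'_def)
  qed
  \<comment> \<open>Minors that contain column b differ by the factor - 1 / t, because the column of
    \<open>\<sigma> b\<close> is recovered as the difference of the new columns a and b divided by
    t. The factor goes into the coefficients.\<close>
  define c' where "c' = (\<lambda>j. if b \<le> k j then c j * (- (1 / t)) else c j)"
  have "\<gamma> t = flag_vec I c' (perm_cols n ?\<tau> \<beta>')"
   unfolding \<gamma>_def
  proof (rule flag_vec_cong)
   fix j J assume j: "j \<in> I" and J: "J \<subseteq> {1..n}" "card J = k j"
   let ?L = "sorted_list_of_set J"
   let ?y = "\<lambda>r e. \<beta>' r (?\<tau> (Suc e))"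
   have fin: "finite J" using J finite_subset by blast
   have kn: "k j < n" using k_less_n j I by blast
   have 1: "wedge_cols n (k j) (g t) J = mnr (x t) ?L"
    using J fin kn by (simp add: wedge_cols_eq[OF g]) (intro mnr_cong ent, auto)
   have 2: "wedge_cols n (k j) (perm_cols n ?\<tau> \<beta>') J = mnr ?y ?L"
    using J by (rule wedge_perm_cols)
   have y: "?y r e = (if Suc e = a then t * \<beta> r (\<sigma> b) + \<beta> r (\<sigma> a) else if Suc e = b then \<beta> r (\<sigma> a)
     else \<beta> r (\<sigma> (Suc e)))" for r e
    using ab by (auto simp: \<beta>'_def transpose_def inj)
   have xa: "x t r e = (if Suc e = a then t * \<beta> r (\<sigma> b) + \<beta> r (\<sigma> a) else \<beta> r (\<sigma> (Suc e)))" for r e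
    by (simp add: x_def)
   show "c j * wedge_cols n (k j) (g t) J = c' j * wedge_cols n (k j) (perm_cols n ?\<tau> \<beta>') J"
   proof (cases "b \<le> k j")
    case True
    have "mnr (x t) ?L = - (1 / t) * mnr ?y ?L"
    proof (rule mnr_col_scale[where a = "a - 1" and b = "b - 1" and s = "1 / t"])
     show "a - 1 < b - 1" "b - 1 < length ?L" using ab True J fin by auto
     show "x t r (b - 1) = 1 / t * ?y r (a - 1) + - (1 / t) * ?y r (b - 1)" for r
      unfolding y xa using ab t0 by (simp add: field_simps)
     show "x t r e = ?y r e" if "e \<noteq> b - 1" for r e
      unfolding y xa using ab that by auto
    qed
    thus ?thesis unfolding 1 2 using True by (simp add: c'_def)
   next
    case False
    have "mnr (x t) ?L = mnr ?y ?L"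
    proof (rule mnr_cong)
     fix r e assume "e < length ?L"
     hence "Suc e \<noteq> b" using False J by auto
     thus "x t r e = ?y r e" unfolding y xa by simp
    qed
    thus ?thesis unfolding 1 2 using False by (simp add: c'_def)
   qed
  qed
  hence "\<gamma> t \<in> cell I ?\<tau>" unfolding cell_def using up by blast
  thus ?thesis by (rule F(2))
 qed
 hence "F (\<gamma> 0) = 0" using is_poly_zero_at[OF poly, of "{0}" 0] by simp
 moreover have "\<gamma> 0 = v"
 proof -
  have "g 0 = perm_cols n \<sigma> \<beta>" by (rule eq_matI) (simp_all add: g_def x_def perm_cols_def)
  thus ?thesis by (simp add: \<gamma>_def \<beta>(2))
 qed
 ultimately show ?thesis by simp
qed

text \<open>Equal images of the initial segments change the minors of each relevant size by one
  sign, which the coefficients absorb.\<close>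

lemma cell_same_flags:
 fixes v :: "('k::field_char_0) fpoint"
 assumes \<sigma>: "\<sigma> permutes {1..n}" and \<tau>: "\<tau> permutes {1..n}" and I: "I \<subseteq> {1..m}"
  and eq: "\<And>j. j \<in> I \<Longrightarrow> \<sigma> ` {1..k j} = \<tau> ` {1..k j}" and v: "v \<in> cell I \<sigma>"
 shows "v \<in> cell I \<tau>"
proof -
 obtain c b where b: "upper_fun n b" "v = flag_vec I c (perm_cols n \<sigma> b)"
  using v unfolding cell_def by blast
 have "\<exists>\<epsilon>. \<forall>L. length L = k j \<longrightarrow> mnr (\<lambda>r c. b r (\<sigma> (Suc c))) L = \<epsilon> * mnr (\<lambda>r c. b r (\<tau> (Suc c))) L"
  if j: "j \<in> I" for j
 proof -
  have "k j \<le> n" using k_less_n[of j] j I by auto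
  then obtain \<epsilon> :: 'k where \<epsilon>: "\<forall>b L. length L = k j \<longrightarrow>
    mnr (\<lambda>r c. b r (\<sigma> (Suc c))) L = \<epsilon> * mnr (\<lambda>r c. b r (\<tau> (Suc c))) L"
   using mnr_same_column_span[OF \<sigma> \<tau> eq[OF j], where 'k = 'k] by blast
  show ?thesis by (rule exI[of _ \<epsilon>]) (intro allI impI \<epsilon>[rule_format])
 qed
 hence "\<forall>j\<in>I. \<exists>\<epsilon>. \<forall>L. length L = k j \<longrightarrow>
   mnr (\<lambda>r c. b r (\<sigma> (Suc c))) L = \<epsilon> * mnr (\<lambda>r c. b r (\<tau> (Suc c))) L" by (rule ballI)
 from bchoice[OF this] obtain \<epsilon> where "\<forall>j\<in>I. \<forall>L. length L = k j \<longrightarrow>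
   mnr (\<lambda>r c. b r (\<sigma> (Suc c))) L = \<epsilon> j * mnr (\<lambda>r c. b r (\<tau> (Suc c))) L" by (elim exE)
 note \<epsilon> = this[rule_format]
 have "v = flag_vec I (\<lambda>j. c j * \<epsilon> j) (perm_cols n \<tau> b)"
  unfolding b(2)
 proof (rule flag_vec_cong)
  fix j J assume j: "j \<in> I" and J: "J \<subseteq> {1..n}" "card J = k j"
  hence "length (sorted_list_of_set J) = k j" by simp
  from \<epsilon>[OF j this] show "c j * wedge_cols n (k j) (perm_cols n \<sigma> b) J = c j * \<epsilon> j * wedge_cols n (k j) (perm_cols n \<tau> b) J"
   unfolding wedge_perm_cols[OF J] by simp
 qed
 thus ?thesis unfolding cell_def using b(1) by blast
qed

text \<open>Climb from sigma by length-increasing transpositions that keep the image of the first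
  \<open>card J\<close> positions below J, and carry the vanishing back with
  \<open>cell_degenerate\<close>. Ascents behind position \<open>card J\<close> do not affect that
  image; once there are none, either the image is J and sigma has the flags of
  \<open>lift_perm n J\<close>, or an exchange moves the image up.\<close>

lemma open_cell_dense:
 fixes F :: "('k::field_char_0) fpoint \<Rightarrow> 'k"
 assumes F: "polyfun F" "\<And>v. v \<in> open_cell J \<Longrightarrow> F v = 0" and J: "J \<in> csets"
  and \<sigma>: "\<sigma> permutes {1..n}" "tle (\<sigma> ` {1..card J}) J" and v: "v \<in> cell {idx J..m} \<sigma>"
 shows "F v = 0"
 using \<sigma> v
proof (induction "n * n - perm_length n \<sigma>" arbitrary: \<sigma> v rule: less_induct)
 case less
 let ?k = "card J" and ?I = "{idx J..m}"
 note \<sigma> = less.prems(1,2)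
 have I: "?I \<subseteq> {1..m}" using idx(1)[OF J] by auto
 have kn: "?k < n" "1 \<le> ?k" using k_less_n[OF idx(1)[OF J]] k_bounds[OF idx(1)[OF J]] idx(2)[OF J] by simp_all
 have step: "F v = 0" if ab: "1 \<le> a" "a < b" "b \<le> n" "\<sigma> a < \<sigma> b"
  and t: "tle ((\<sigma> \<circ> transpose a b) ` {1..?k}) J" for a b
 proof (rule cell_degenerate[OF F(1) _ \<sigma>(1) ab I less.prems(3)])
  fix w :: "'k fpoint" assume w: "w \<in> cell ?I (\<sigma> \<circ> transpose a b)"
  have ab': "a \<in> {1..n}" "b \<in> {1..n}" using ab by auto
  have "perm_length n \<sigma> < perm_length n (\<sigma> \<circ> transpose a b)"
   by (rule perm_length_transpose[OF \<sigma>(1) ab' ab(2,4)])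
  hence "n * n - perm_length n (\<sigma> \<circ> transpose a b) < n * n - perm_length n \<sigma>"
   using perm_length_le[of n "\<sigma> \<circ> transpose a b"] by linarith
  moreover have "\<sigma> \<circ> transpose a b permutes {1..n}"
   using ab' \<sigma>(1) by (intro permutes_compose permutes_swap_id)
  ultimately show "F w = 0" using less.hyps t w by blast
 qed
 have im: "(\<sigma> \<circ> transpose a b) ` {1..?k} =
  (if a \<le> ?k \<and> ?k < b then insert (\<sigma> b) (\<sigma> ` {1..?k} - {\<sigma> a}) else \<sigma> ` {1..?k})" if "1 \<le> a" "a < b" for a b
  by (rule image_transpose_atLeastAtMost[OF permutes_inj[OF \<sigma>(1)] that])
 show ?case
 proof (cases "\<exists>a b. ?k < a \<and> a < b \<and> b \<le> n \<and> \<sigma> a < \<sigma> b")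
  case True
  then obtain a b where ab: "?k < a" "a < b" "b \<le> n" "\<sigma> a < \<sigma> b" by blast
  thus ?thesis using im[of a b] \<sigma>(2) kn by (intro step[of a b]) auto
 next
  case no_ascent: False
  have dec: "\<sigma> b < \<sigma> a" if "?k < a" "a < b" "b \<le> n" for a b
  proof -
   have "\<sigma> a \<noteq> \<sigma> b" using that injD[OF permutes_inj[OF \<sigma>(1)], of a b] by auto
   thus ?thesis using no_ascent that by (meson linorder_neqE_nat)
  qed
  show ?thesis
  proof (cases "\<sigma> ` {1..?k} = J")
   case True
   have "\<sigma> ` {1..k j} = lift_perm n J ` {1..k j}" if "j \<in> ?I" for j
   proof (rule image_decreasing_unique[OF \<sigma>(1) dec lift_perm_facts(1,4)[OF J]])
    show "\<sigma> ` {1..?k} = lift_perm n J ` {1..?k}" using True lift_perm_facts(2)[OF J] by simp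
    show "?k \<le> k j" using that I k_le_iff[OF idx(1)[OF J], of j] idx(2)[OF J] by auto
    show "k j \<le> n" using k_less_n[of j] that I by auto
   qed
   hence "v \<in> open_cell J"
    unfolding open_cell_def using cell_same_flags[OF \<sigma>(1) lift_perm_facts(1)[OF J] I _ less.prems(3)] by blast
   thus ?thesis by (rule F(2))
  next
   case False
   have sub: "\<sigma> ` {1..?k} \<subseteq> {1..n}" "card (\<sigma> ` {1..?k}) = ?k"
    using permutes_image_initial[OF \<sigma>(1), of ?k] kn by auto
   obtain x y where xy: "x \<in> \<sigma> ` {1..?k}" "y \<notin> \<sigma> ` {1..?k}" "x < y" "y \<le> n"
     "tle (insert y (\<sigma> ` {1..?k} - {x})) J"
    using exists_tle_exchange[OF sub(1) csets_sub[OF J] sub(2) \<sigma>(2) False] by blast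
   obtain a where a: "a \<in> {1..?k}" "x = \<sigma> a" using xy(1) by blast
   have "y \<in> \<sigma> ` {1..n}" using xy(1,3,4) sub(1) permutes_image[OF \<sigma>(1)] by fastforce
   then obtain b where b: "b \<in> {1..n}" "y = \<sigma> b" by blast
   have "?k < b"
   proof (rule ccontr)
    assume "\<not> ?k < b"
    hence "y \<in> \<sigma> ` {1..?k}" using b by auto
    with xy(2) show False by blast
   qed
   thus ?thesis using im[of a b] a b xy by (intro step[of a b]) auto
  qed
 qed
qed

text \<open>The image of the first \<open>card J\<close> positions under
  \<open>lift_perm n K\<close> consists of the smallest entries of K and is still below J, so the
  density result for J covers the cell of K.\<close>

lemma open_cell_closure:
 fixes F :: "('k::field_char_0) fpoint \<Rightarrow> 'k"
 assumes F: "polyfun F" "\<And>v. v \<in> open_cell J \<Longrightarrow> F v = 0" and J: "J \<in> csets" and K: "K \<in> csets"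
  and tle: "tle K J" and v: "v \<in> open_cell K"
 shows "F v = 0"
proof (rule open_cell_dense[OF F J lift_perm_facts(1)[OF K]])
 have "card J \<le> card K" by (rule tle_card[OF tle csets_sub[OF K] csets_sub[OF J]])
 thus "tle (lift_perm n K ` {1..card J}) J"
  using tle_take[OF tle csets_finite[OF K] csets_sub[OF J] order_refl] lift_perm_facts(3)[OF K] by simp
 have "{idx K..m} \<subseteq> {idx J..m}" using tle_idx[OF K J tle] by auto
 thus "v \<in> cell {idx J..m} (lift_perm n K)" using v cell_mono unfolding open_cell_def by blast
qed

end

section \<open>Independence of standard monomials and closed Schubert cones\<close>

lemma polyfun_sum: "(\<And>i. i \<in> A \<Longrightarrow> polyfun (F i)) \<Longrightarrow> polyfun (\<lambda>v. \<Sum>i\<in>A. F i v)"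
 by (induction A rule: infinite_finite_induct) (auto intro: polyfun.intros)

lemma polyfun_power: "polyfun F \<Longrightarrow> polyfun (\<lambda>v. F v ^ e)"
 by (induction e) (auto intro: polyfun.intros)

lemma polyfun_scale: "polyfun F \<Longrightarrow> polyfun (\<lambda>v. c * F v)"
 by (rule poly_mult[OF poly_const])

lemma mnr_row_scale: "mnr (\<lambda>r c. a r * x r c) L = (\<Prod>i = 0..<length L. a (L ! i)) * mnr x L"
 unfolding mnr_leibniz sum_distrib_left prod.distrib by (rule sum.cong) (simp_all add: mult_ac)

lemma det_eq_mnr:
 assumes "g \<in> carrier_mat n n"
 shows "det g = mnr (entry g) [1..<Suc n]"
proof -
 have "mat n n (\<lambda>(i, j). entry g ([1..<Suc n] ! i) j) = g"
  using assms by (intro eq_matI) (simp_all add: entry_def del: upt_Suc)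
 thus ?thesis by (simp add: mnr_def del: upt_Suc)
qed

context flag_setup
begin

lemma polyfun_crd: "polyfun (crd J)"
 unfolding crd_def[abs_def] by (rule poly_coord)

lemma polyfun_mon: "polyfun (mon T :: ('k::comm_ring_1) fpoint \<Rightarrow> 'k)"
proof (induction T)
 case Nil
 thus ?case by (simp add: mon_def[abs_def] poly_const)
next
 case (Cons J T)
 hence "polyfun (\<lambda>v :: 'k fpoint. crd J v * mon T v)" by (intro poly_mult polyfun_crd)
 moreover have "mon (J # T) = (\<lambda>v :: 'k fpoint. crd J v * mon T v)" by (rule ext) simp
 ultimately show ?case by simp
qed

lemma open_cell_irreducible:
 fixes F G :: "('k::field_char_0) fpoint \<Rightarrow> 'k"
 assumes "polyfun F" "u \<in> open_cell J" "F u \<noteq> 0" "polyfun G" "w \<in> open_cell J" "G w \<noteq> 0"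
 shows "\<exists>v\<in>open_cell J. F v \<noteq> 0 \<and> G v \<noteq> 0"
 using assms unfolding open_cell_def by (rule cell_irreducible)

lemma zero_in_open_cell: "(0 :: ('k::comm_ring_1) fpoint) \<in> open_cell J"
proof -
 let ?b = "\<lambda>r c. if r = c then 1 else (0 :: 'k)"
 have "(0 :: 'k fpoint) = flag_vec {idx J..m} (\<lambda>_. 0) (perm_cols n (lift_perm n J) ?b)"
  by (intro ext) (simp add: flag_vec_def)
 moreover have "upper_fun n ?b" by (simp add: upper_fun_def)
 ultimately show ?thesis unfolding open_cell_def cell_def by blast
qed

lemma mon_zero: "mon T (0 :: ('k::idom) fpoint) = (if T = [] then 1 else 0)"
 by (cases T) (simp_all add: crd_def)

lemma mon_open_cell_zero:
 fixes v :: "('k::idom) fpoint"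
 assumes "v \<in> open_cell J" "J \<in> csets" "set T \<subseteq> csets" "\<not> (\<forall>K\<in>set T. tle K J)"
 shows "mon T v = 0"
 using assms crd_open_cell[OF assms(1,2)] unfolding mon_zero_iff by blast

lemma std_le_last:
 assumes "T \<in> std" "T \<noteq> []" "K \<in> set T"
 shows "tle K (last T)"
proof -
 have "sorted_wrt tle (butlast T @ [last T])" "K \<in> set (butlast T @ [last T])"
  using assms by (simp_all add: std_def)
 thus ?thesis by (auto simp: sorted_wrt_append simp del: append_butlast_last_id)
qed

lemma rank_set_csets_less:
 "tle K J \<Longrightarrow> K \<noteq> J \<Longrightarrow> K \<in> csets \<Longrightarrow> J \<in> csets \<Longrightarrow> rank_set n K < rank_set n J"
 using rank_set_less csets_sub by blast

text \<open>Induction on J and, for fixed J, on the total number of columns. The empty tableau is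
  isolated at the point 0. A tableau ending in K other than J is isolated on the open cell of K, to
  which the vanishing extends and where every monomial with a column not below K is zero. The
  remaining monomials are all divisible by the coordinate of J; it can be cancelled because the cell
  is irreducible, and the tableaux get shorter.\<close>

lemma std_independent:
 fixes q :: "nat set list \<Rightarrow> 'k::field_char_0"
 assumes "J \<in> csets" "finite E" "E \<subseteq> std" "\<And>T K. T \<in> E \<Longrightarrow> K \<in> set T \<Longrightarrow> tle K J"
  "\<And>v. v \<in> open_cell J \<Longrightarrow> (\<Sum>T\<in>E. q T * mon T v) = 0" "T \<in> E"
 shows "q T = 0"
 using assms
proof (induction "rank_set n J" arbitrary: J E q T rule: less_induct)
 case outer: less
 note J = outer.prems(1)
 from outer.prems(2-) show ?case
 proof (induction "\<Sum>T\<in>E. length T" arbitrary: E q T rule: less_induct)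
  case inner: less
  note fin = inner.prems(1) and E = inner.prems(2) and le = inner.prems(3) and zero = inner.prems(4)
  have E_csets: "set T \<subseteq> csets" if "T \<in> E" for T using E that by (auto simp: std_def)
  have nil: "q [] = 0" if "[] \<in> E"
  proof -
   have "(\<Sum>T\<in>E. q T * mon T (0 :: 'k fpoint)) = (\<Sum>T\<in>E. if T = [] then q [] else 0)"
    by (rule sum.cong) (simp_all add: mon_zero)
   thus ?thesis using zero[OF zero_in_open_cell] that fin by simp
  qed
  have small: "q T = 0" if T: "T \<in> E" "T \<noteq> []" "last T \<noteq> J" for T
  proof -
   define K where "K = last T"
   define E' where "E' = {T \<in> E. \<forall>L\<in>set T. tle L K}"
   have K: "K \<in> csets" "tle K J" "K \<noteq> J"
    using E_csets[OF T(1)] le[OF T(1) last_in_set[OF T(2)]] last_in_set[OF T(2)] T(3) by (auto simp: K_def)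
   have sumE': "(\<Sum>T\<in>E'. q T * mon T v) = 0" if v: "v \<in> open_cell K" for v
   proof -
    have "polyfun (\<lambda>v. \<Sum>T\<in>E. q T * mon T v)"
     by (intro polyfun_sum polyfun_scale polyfun_mon)
    hence "(\<Sum>T\<in>E. q T * mon T v) = 0"
     by (rule open_cell_closure[OF _ zero J K(1,2) v])
    moreover have "(\<Sum>T\<in>E'. q T * mon T v) = (\<Sum>T\<in>E. q T * mon T v)"
    proof (rule sum.mono_neutral_left[OF fin])
     show "E' \<subseteq> E" by (auto simp: E'_def)
     show "\<forall>T\<in>E - E'. q T * mon T v = 0"
     proof
      fix T assume T': "T \<in> E - E'"
      hence "\<not> (\<forall>L\<in>set T. tle L K)" by (simp add: E'_def)
      hence "mon T v = 0" using mon_open_cell_zero[OF v K(1)] E_csets T' by blast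
      thus "q T * mon T v = 0" by simp
     qed
    qed
    ultimately show ?thesis by simp
   qed
   have "T \<in> E'" using T E std_le_last by (auto simp: E'_def K_def)
   moreover have "finite E'" "E' \<subseteq> std" "\<And>T L. T \<in> E' \<Longrightarrow> L \<in> set T \<Longrightarrow> tle L K"
    using fin E by (auto simp: E'_def)
   moreover have "rank_set n K < rank_set n J" using rank_set_csets_less[OF K(2,3,1) J] .
   ultimately show ?thesis using outer.hyps[OF _ K(1), of E' q T] sumE' by blast
  qed
  define E1 where "E1 = {T \<in> E. T \<noteq> [] \<and> last T = J}"
  define E2 where "E2 = butlast ` E1"
  define q2 where "q2 = (\<lambda>T. q (T @ [J]))"
  have bl: "butlast T @ [J] = T" if "T \<in> E1" for T
   using that append_butlast_last_id[of T] by (simp add: E1_def)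
  have inj: "inj_on butlast E1" by (rule inj_onI) (metis bl)
  have finE1: "finite E1" using fin by (simp add: E1_def)
  have big: "q T = 0" if T: "T \<in> E1" for T
  proof -
   have sum2: "crd J v * (\<Sum>T\<in>E2. q2 T * mon T v) = 0" if v: "v \<in> open_cell J" for v
   proof -
    have "(\<Sum>T\<in>E. q T * mon T v) = (\<Sum>T\<in>E1. q T * mon T v)"
    proof (rule sum.mono_neutral_right[OF fin])
     show "E1 \<subseteq> E" by (auto simp: E1_def)
     show "\<forall>T\<in>E - E1. q T * mon T v = 0" using nil small by (auto simp: E1_def)
    qed
    also have "\<dots> = (\<Sum>T\<in>E1. crd J v * (q2 (butlast T) * mon (butlast T) v))"
    proof (rule sum.cong)
     fix T assume "T \<in> E1"
     hence "mon T v = mon (butlast T) v * crd J v" by (metis bl mon_simps(1-3) mult_1_right)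
     thus "q T * mon T v = crd J v * (q2 (butlast T) * mon (butlast T) v)"
      using bl[OF \<open>T \<in> E1\<close>] by (simp add: q2_def)
    qed simp
    also have "\<dots> = crd J v * (\<Sum>T\<in>E2. q2 T * mon T v)"
     unfolding E2_def by (simp add: sum.reindex[OF inj] sum_distrib_left)
    finally show ?thesis using zero[OF v] by simp
   qed
   have poly2: "polyfun (\<lambda>v. \<Sum>T\<in>E2. q2 T * mon T v :: 'k)"
    by (intro polyfun_sum polyfun_scale polyfun_mon)
   obtain u :: "'k fpoint" where u: "u \<in> open_cell J" "crd J u \<noteq> 0"
    using crd_open_cell_self[OF J] by blast
   have zero2: "(\<Sum>T\<in>E2. q2 T * mon T v) = 0" if v: "v \<in> open_cell J" for v
   proof (rule ccontr)
    assume "(\<Sum>T\<in>E2. q2 T * mon T v) \<noteq> 0"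
    from open_cell_irreducible[OF polyfun_crd u poly2 v this] sum2 show False by auto
   qed
   have less: "(\<Sum>T\<in>E2. length T) < (\<Sum>T\<in>E. length T)"
   proof -
    have "(\<Sum>T\<in>E2. length T) = (\<Sum>T\<in>E1. length (butlast T))"
     unfolding E2_def by (simp add: sum.reindex[OF inj])
    also have "\<dots> < (\<Sum>T\<in>E1. length T)"
     using T finE1 by (intro sum_strict_mono) (auto simp: E1_def)
    also have "\<dots> \<le> (\<Sum>T\<in>E. length T)"
     using fin by (intro sum_mono2) (auto simp: E1_def)
    finally show ?thesis .
   qed
   have "E2 \<subseteq> std"
   proof
    fix T' assume "T' \<in> E2"
    then obtain T where T: "T \<in> E1" "T' = butlast T" by (auto simp: E2_def)
    hence "T' @ [J] \<in> std" using bl E by (auto simp: E1_def)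
    thus "T' \<in> std" by (simp add: std_def sorted_wrt_append)
   qed
   moreover have "tle L J" if "T' \<in> E2" "L \<in> set T'" for T' L
    using that le by (auto simp: E2_def E1_def dest: in_set_butlastD)
   moreover have "butlast T \<in> E2" "finite E2" using T finE1 by (auto simp: E2_def)
   ultimately have "q2 (butlast T) = 0"
    using inner.hyps[OF less, of q2 "butlast T"] zero2 by blast
   thus ?thesis using bl[OF T] by (simp add: q2_def)
  qed
  show ?case
   using nil small[OF inner.prems(5)] big[of T] inner.prems(5) by (cases "T = []") (auto simp: E1_def)
 qed
qed

text \<open>A candidate for the multicone of the stratum, given by equations;
  \<open>scone_eq_cone\<close> identifies the two.\<close>

definition cone :: "nat set \<Rightarrow> ('k::comm_ring_1) fpoint set" where
 "cone J = {v \<in> tot. \<forall>K\<in>csets. crd K v \<noteq> 0 \<longrightarrow> tle K J}"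

lemma open_cell_sub_cone:
 fixes v :: "('k::field) fpoint"
 shows "J \<in> csets \<Longrightarrow> v \<in> open_cell J \<Longrightarrow> v \<in> cone J"
 unfolding cone_def using open_cell_sub_tot crd_open_cell by blast

lemma mon_cone_zero:
 fixes v :: "('k::idom) fpoint"
 assumes "v \<in> cone J" "set T \<subseteq> csets" "\<not> (\<forall>K\<in>set T. tle K J)"
 shows "mon T v = 0"
 using assms unfolding mon_zero_iff cone_def by blast

text \<open>One expansion serves all strata simultaneously: on \<open>cone J\<close> every monomial
  with a column not below J vanishes.\<close>

lemma cone_expansion:
 fixes F :: "('k::field_char_0) fpoint \<Rightarrow> 'k"
 assumes "polyfun F"
 shows "\<exists>E q. finite E \<and> E \<subseteq> std \<and> (\<forall>v\<in>tot. F v = (\<Sum>T\<in>E. q T * mon T v)) \<and>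
  (\<forall>J. \<forall>v\<in>cone J. F v = (\<Sum>T\<in>{T\<in>E. \<forall>K\<in>set T. tle K J}. q T * mon T v))"
proof -
 obtain E q where E: "finite E" "E \<subseteq> std" "\<forall>v\<in>tot. F v = (\<Sum>T\<in>E. q T * mon T v)"
  using spanned_polyfun[OF assms] unfolding spanned_def by blast
 have "F v = (\<Sum>T\<in>{T\<in>E. \<forall>K\<in>set T. tle K J}. q T * mon T v)" if v: "v \<in> cone J" for J v
 proof -
  have "F v = (\<Sum>T\<in>E. q T * mon T v)" using E(3) v by (simp add: cone_def)
  also have "\<dots> = (\<Sum>T\<in>{T\<in>E. \<forall>K\<in>set T. tle K J}. q T * mon T v)"
  proof (rule sum.mono_neutral_right[OF E(1)])
   show "\<forall>T\<in>E - {T\<in>E. \<forall>K\<in>set T. tle K J}. q T * mon T v = 0"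
   proof
    fix T assume T: "T \<in> E - {T\<in>E. \<forall>K\<in>set T. tle K J}"
    hence "set T \<subseteq> csets" using E(2) by (auto simp: std_def)
    moreover have "\<not> (\<forall>K\<in>set T. tle K J)" using T by simp
    ultimately have "mon T v = 0" using mon_cone_zero[OF v] by blast
    thus "q T * mon T v = 0" by simp
   qed
  qed auto
  finally show ?thesis .
 qed
 with E show ?thesis by (intro exI[of _ E] exI[of _ q] conjI allI ballI) simp_all
qed

lemma cone_coefficient_zero:
 fixes q :: "nat set list \<Rightarrow> 'k::field_char_0"
 assumes "J \<in> csets" "finite E" "E \<subseteq> std"
  and "\<And>v. v \<in> open_cell J \<Longrightarrow> (\<Sum>T\<in>{T\<in>E. \<forall>K\<in>set T. tle K J}. q T * mon T v) = 0"
  and "T \<in> E" "\<And>K. K \<in> set T \<Longrightarrow> tle K J"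
 shows "q T = 0"
 by (rule std_independent[OF assms(1), where E = "{T\<in>E. \<forall>K\<in>set T. tle K J}"]) (use assms in auto)

text \<open>A function that vanishes on the open cell has, by independence, no coefficient at any
  tableau below J, and no other tableaux survive on the cone. So the equations of the cone describe
  the closure of the cell.\<close>

lemma cone_dense:
 fixes F :: "('k::field_char_0) fpoint \<Rightarrow> 'k"
 assumes F: "polyfun F" "\<And>v. v \<in> open_cell J \<Longrightarrow> F v = 0" and J: "J \<in> csets" and v: "v \<in> cone J"
 shows "F v = 0"
proof -
 obtain E q where E: "finite E" "E \<subseteq> std"
  and eq': "\<forall>J. \<forall>v\<in>cone J. F v = (\<Sum>T\<in>{T\<in>E. \<forall>K\<in>set T. tle K J}. q T * mon T v)"
  using cone_expansion[OF F(1)] by - (elim exE conjE, rule that)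
 note eq = eq'[rule_format]
 have "(\<Sum>T\<in>{T\<in>E. \<forall>K\<in>set T. tle K J}. q T * mon T w) = 0" if w: "w \<in> open_cell J" for w :: "'k fpoint"
  using eq[OF open_cell_sub_cone[OF J w]] F(2)[OF w] by simp
 hence "q T = 0" if "T \<in> E" "\<forall>K\<in>set T. tle K J" for T
  using cone_coefficient_zero[OF J E] that by blast
 thus ?thesis unfolding eq[OF v] by (intro sum.neutral) auto
qed

lemma cone_irreducible:
 fixes F G :: "('k::field_char_0) fpoint \<Rightarrow> 'k"
 assumes J: "J \<in> csets" and "polyfun F" "u \<in> cone J" "F u \<noteq> 0" "polyfun G" "w \<in> cone J" "G w \<noteq> 0"
 shows "\<exists>v\<in>cone J. F v * G v \<noteq> 0"
proof -
 obtain u' :: "'k fpoint" where "u' \<in> open_cell J" "F u' \<noteq> 0" using cone_dense[OF assms(2) _ J assms(3)] assms(4) by blast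
 moreover obtain w' :: "'k fpoint" where "w' \<in> open_cell J" "G w' \<noteq> 0" using cone_dense[OF assms(5) _ J assms(6)] assms(7) by blast
 ultimately obtain v :: "'k fpoint" where "v \<in> open_cell J" "F v \<noteq> 0" "G v \<noteq> 0"
  using open_cell_irreducible[OF assms(2) _ _ assms(5)] by blast
 thus ?thesis using open_cell_sub_cone[OF J] by (intro bexI[of _ v]) auto
qed

lemma crd_cone_nonzero_iff:
 assumes "J \<in> csets" "K \<in> csets"
 shows "(\<exists>v\<in>cone J. crd K (v :: ('k::field) fpoint) \<noteq> 0) \<longleftrightarrow> tle K J"
proof
 assume "tle K J"
 obtain v :: "'k fpoint" where v: "v \<in> open_cell K" "crd K v \<noteq> 0"
  using crd_open_cell_self[OF assms(2)] by blast
 hence "v \<in> tot" "\<And>L. L \<in> csets \<Longrightarrow> crd L v \<noteq> 0 \<Longrightarrow> tle L J"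
  using open_cell_sub_tot[OF v(1) assms(2)] crd_open_cell[OF v(1) assms(2)] tle_trans[OF _ \<open>tle K J\<close>] by blast+
 thus "\<exists>v\<in>cone J. crd K (v :: 'k fpoint) \<noteq> 0"
  using v(2) by (intro bexI[of _ v]) (simp_all add: cone_def)
qed (use assms in \<open>auto simp: cone_def\<close>)

lemma cone_subset_iff:
 assumes "J \<in> csets" "K \<in> csets"
 shows "(cone K :: ('k::field) fpoint set) \<subseteq> cone J \<longleftrightarrow> tle K J"
proof
 assume "tle K J"
 thus "(cone K :: ('k::field) fpoint set) \<subseteq> cone J"
  unfolding cone_def using tle_trans by blast
next
 assume sub: "(cone K :: ('k::field) fpoint set) \<subseteq> cone J"
 obtain v :: "'k fpoint" where "v \<in> cone K" "crd K v \<noteq> 0"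
  using crd_cone_nonzero_iff[OF assms(2,2), where 'k = 'k] by auto
 with sub show "tle K J" using crd_cone_nonzero_iff[OF assms, where 'k = 'k] by blast
qed

lemma zero_in_cone: "J \<in> csets \<Longrightarrow> (0 :: ('k::field) fpoint) \<in> cone J"
 by (rule open_cell_sub_cone[OF _ zero_in_open_cell])

text \<open>Vanishing on the smaller cones removes every non-empty tableau below J whose last column
  is not J, and the value at 0 removes the empty one. All remaining monomials contain the coordinate
  of J as a factor.\<close>

lemma boundary_ideal:
 fixes F :: "('k::field_char_0) fpoint \<Rightarrow> 'k"
 assumes F: "polyfun F" "F 0 = 0" and J: "J \<in> csets"
  and zero: "\<And>K v. K \<in> csets \<Longrightarrow> tle K J \<Longrightarrow> K \<noteq> J \<Longrightarrow> v \<in> cone K \<Longrightarrow> F v = 0"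
 shows "\<exists>G. polyfun G \<and> (\<forall>v\<in>cone J. F v = crd J v * G v)"
proof -
 obtain E q where E: "finite E" "E \<subseteq> std" and tot': "\<forall>v\<in>tot. F v = (\<Sum>T\<in>E. q T * mon T v)"
  and eq': "\<forall>J. \<forall>v\<in>cone J. F v = (\<Sum>T\<in>{T\<in>E. \<forall>K\<in>set T. tle K J}. q T * mon T v)"
  using cone_expansion[OF F(1)] by - (elim exE conjE, rule that)
 note tot = tot'[rule_format] and eq = eq'[rule_format]
 have nil: "q [] = 0" if "[] \<in> E"
 proof -
  have "F 0 = (\<Sum>T\<in>E. q T * mon T (0 :: 'k fpoint))"
  proof (rule tot)
   show "(0 :: 'k fpoint) \<in> tot" using zero_in_cone[OF J] unfolding cone_def by blast
  qed
  also have "\<dots> = (\<Sum>T\<in>E. if T = [] then q [] else 0)" by (rule sum.cong) (simp_all add: mon_zero)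
  finally show ?thesis using F(2) that E(1) by simp
 qed
 have small: "q T = 0" if T: "T \<in> E" "T \<noteq> []" "last T \<noteq> J" "\<forall>K\<in>set T. tle K J" for T
 proof -
  have K: "last T \<in> csets" "tle (last T) J" 
   using T(4) last_in_set[OF T(2)] T(1) E(2) by (auto simp: std_def)
  have "(\<Sum>T\<in>{T'\<in>E. \<forall>K\<in>set T'. tle K (last T)}. q T * mon T v) = 0" if v: "v \<in> open_cell (last T)" for v :: "'k fpoint"
   using eq[OF open_cell_sub_cone[OF K(1) v]] zero[OF K T(3) open_cell_sub_cone[OF K(1) v]] by simp
  moreover have "T \<in> std" using T(1) E(2) by blast
  ultimately show ?thesis
   using cone_coefficient_zero[OF K(1) E _ T(1), of q] std_le_last[OF _ T(2)] by blast
 qed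
 define E1 where "E1 = {T \<in> E. T \<noteq> [] \<and> last T = J \<and> (\<forall>K\<in>set T. tle K J)}"
 define G where "G = (\<lambda>v :: 'k fpoint. \<Sum>T\<in>E1. q T * mon (butlast T) v)"
 have "polyfun G" unfolding G_def by (intro polyfun_sum polyfun_scale polyfun_mon)
 moreover have "F v = crd J v * G v" if v: "v \<in> cone J" for v
 proof -
  have "F v = (\<Sum>T\<in>E1. q T * mon T v)"
   unfolding eq[OF v]
  proof (rule sum.mono_neutral_right)
   show "\<forall>T\<in>{T\<in>E. \<forall>K\<in>set T. tle K J} - E1. q T * mon T v = 0"
    using nil small by (auto simp: E1_def)
  qed (use E(1) in \<open>auto simp: E1_def\<close>)
  also have "\<dots> = (\<Sum>T\<in>E1. crd J v * (q T * mon (butlast T) v))"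
  proof (rule sum.cong)
   fix T assume "T \<in> E1"
   hence "butlast T @ [J] = T" using append_butlast_last_id[of T] by (simp add: E1_def)
   hence "mon T v = mon (butlast T) v * crd J v" by (metis mon_simps(1-3) mult_1_right)
   thus "q T * mon T v = crd J v * (q T * mon (butlast T) v)" by simp
  qed simp
  also have "\<dots> = crd J v * G v" by (simp add: G_def sum_distrib_left)
  finally show ?thesis .
 qed
 ultimately show ?thesis by blast
qed

text \<open>A one-parameter subgroup under which the weight of the extremal function strictly increases
 along the order of the strata.\<close>

definition torus :: "'k::field \<Rightarrow> 'k fpoint \<Rightarrow> 'k fpoint" where
 "torus t v = (\<lambda>j J. t ^ rank_set n J * v j J)"

lemma crd_torus: "crd J (torus t v) = t ^ rank_set n J * crd J v"
 by (simp add: crd_def torus_def)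

lemma rank_set_add:
 assumes "J \<subseteq> {1..n}"
 shows "rank_set n J + (\<Sum>y\<in>J. Suc n - y) = n * n"
proof -
 have "card (J \<inter> {..x}) \<le> n" for x
  using card_mono[of "{1..n}" "J \<inter> {..x}"] assms by auto
 hence "rank_set n J + (\<Sum>x\<in>{1..n}. card (J \<inter> {..x})) = (\<Sum>x\<in>{1..n}. n)"
  unfolding rank_set_def sum.distrib[symmetric] by (intro sum.cong) auto
 thus ?thesis using sum_card_Int_atMost[OF assms] by simp
qed

lemma torus_tot:
 fixes v :: "('k::field) fpoint"
 assumes t: "t \<noteq> 0" and v: "v \<in> tot"
 shows "torus t v \<in> tot"
proof -
 obtain c g where g: "g \<in> carrier_mat n n" "det g \<noteq> 0" "v = flag_vec {1..m} c g"
  using v unfolding tot_def by blast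
 \<comment> \<open>Row r is scaled by a negative power of t. On the minor J the exponents add up to
   the sum in \<open>sum_card_Int_atMost\<close>; the factor \<open>t ^ (n * n)\<close> in the
   coefficients below turns this into the non-negative weight \<open>rank_set n J\<close>.\<close>
 define a where "a = (\<lambda>r. (1 / t) ^ (Suc n - r))"
 define g' where "g' = mat n n (\<lambda>(r, e). a (Suc r) * g $$ (r, e))"
 have g': "g' \<in> carrier_mat n n" by (simp add: g'_def)
 have ent: "entry g' r e = a r * entry g r e" if "r \<in> {1..n}" "e < n" for r e
  using that by (auto simp: entry_def g'_def)
 have mnr: "mnr (entry g') L = (\<Prod>i = 0..<length L. a (L ! i)) * mnr (entry g) L"
  if "set L \<subseteq> {1..n}" "length L \<le> n" for L
 proof -
  have "mnr (entry g') L = mnr (\<lambda>r e. a r * entry g r e) L"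
   using that by (intro mnr_cong ent) auto
  thus ?thesis by (simp add: mnr_row_scale)
 qed
 have a0: "a r \<noteq> 0" for r using t by (simp add: a_def)
 have "det g' \<noteq> 0"
 proof -
  have "mnr (entry g') [1..<Suc n] = (\<Prod>i = 0..<length [1..<Suc n]. a ([1..<Suc n] ! i)) * mnr (entry g) [1..<Suc n]"
   by (rule mnr) auto
  moreover have "(\<Prod>i = 0..<length [1..<Suc n]. a ([1..<Suc n] ! i)) \<noteq> 0" using a0 by (simp del: upt_Suc)
  ultimately show ?thesis using g(2) unfolding det_eq_mnr[OF g'] det_eq_mnr[OF g(1)] by (simp del: upt_Suc)
 qed
 moreover have "torus t v = flag_vec {1..m} (\<lambda>j. t ^ (n * n) * c j) g'"
 proof (intro ext)
  fix j J
  show "torus t v j J = flag_vec {1..m} (\<lambda>j. t ^ (n * n) * c j) g' j J"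
  proof (cases "j \<in> {1..m} \<and> J \<subseteq> {1..n} \<and> card J = k j")
   case True
   let ?L = "sorted_list_of_set J"
   have fin: "finite J" using True finite_subset by blast
   have "card J \<le> n" using card_mono[of "{1..n}" J] True by simp
   hence "mnr (entry g') ?L = (\<Prod>i = 0..<length ?L. a (?L ! i)) * mnr (entry g) ?L"
    using True fin by (intro mnr) auto
   also have "(\<Prod>i = 0..<length ?L. a (?L ! i)) = (\<Prod>y\<in>J. a y)"
    using prod.distinct_set_conv_list[of ?L a] fin by (simp add: prod.list_conv_set_nth)
   also have "\<dots> = (1 / t) ^ (\<Sum>y\<in>J. Suc n - y)" by (simp add: a_def power_sum)
   finally have mL: "mnr (entry g') ?L = (1 / t) ^ (\<Sum>y\<in>J. Suc n - y) * mnr (entry g) ?L" .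
   have "t ^ (n * n) * mnr (entry g') ?L = t ^ rank_set n J * mnr (entry g) ?L"
   proof -
    have "t ^ (n * n) = t ^ rank_set n J * t ^ (\<Sum>y\<in>J. Suc n - y)"
     using rank_set_add[of J] True by (simp add: power_add[symmetric])
    moreover have "t ^ e * (1 / t) ^ e = 1" for e using t by (simp add: power_mult_distrib[symmetric])
    hence "t ^ rank_set n J * (t ^ (\<Sum>y\<in>J. Suc n - y) * (1 / t) ^ (\<Sum>y\<in>J. Suc n - y)) = t ^ rank_set n J"
     by simp
    ultimately show ?thesis unfolding mL by (metis mult.assoc)
   qed
   thus ?thesis
    using True by (simp add: torus_def g(3) flag_vec_def wedge_cols_eq g(1) g')
  next
   case False
   thus ?thesis by (auto simp: torus_def g(3) flag_vec_def wedge_cols_def)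
  qed
 qed
 ultimately show ?thesis unfolding tot_def using g' by blast
qed

lemma torus_cone:
 fixes v :: "('k::field) fpoint"
 assumes "t \<noteq> 0" "v \<in> cone J"
 shows "torus t v \<in> cone J"
 using assms torus_tot[OF assms(1)] by (auto simp: cone_def crd_torus)

lemma is_poly_torus: "is_poly (\<lambda>t. torus t v j J)"
 unfolding torus_def by (intro is_poly_mult is_poly_power is_poly_id is_poly_const)

end

section \<open>Partial flag varieties are closed\<close>

lemma mhom_scale: "mhom d F \<Longrightarrow> mhom d (\<lambda>v. c * F v)"
 using mhom_mult[OF mhom_const] by fastforce

lemma mhom_sum: "finite A \<Longrightarrow> A \<noteq> {} \<Longrightarrow> (\<And>i. i \<in> A \<Longrightarrow> mhom d (F i)) \<Longrightarrow> mhom d (\<lambda>v. \<Sum>i\<in>A. F i v)"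
 by (induction A rule: finite_ne_induct) (auto intro: mhom_add)

lemma mhom_prod: "finite A \<Longrightarrow> (\<And>i. i \<in> A \<Longrightarrow> mhom (d i) (F i)) \<Longrightarrow> mhom (\<Sum>i\<in>A. d i) (\<lambda>v. \<Prod>i\<in>A. F i v)"
 by (induction A rule: finite_induct) (auto intro: mhom_const mhom_mult)

lemma mhom_diff: "mhom d F \<Longrightarrow> mhom d G \<Longrightarrow> mhom d (\<lambda>v. F v - G v :: 'k::comm_ring_1)"
 using mhom_add[OF _ mhom_scale, of d F G "- 1"] by simp

lemma polyfun_mhom: "mhom d F \<Longrightarrow> polyfun F"
 by (induction rule: mhom.induct) (auto intro: polyfun.intros)

text \<open>Laplace expansion along row c; the cofactors do not involve the row number put
  there.\<close>

lemma mnr_update_row: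
 assumes "c < length A"
 shows "\<exists>C. \<forall>r. mnr x (A[c := r]) = (\<Sum>d = 0..<length A. x r d * C d)"
proof -
 let ?l = "length A" and ?M = "\<lambda>r. mat (length A) (length A) (\<lambda>(i, j). x (A[c := r] ! i) j)"
 have cof: "cofactor (?M r) c d = cofactor (?M 0) c d" if "d < ?l" for r d
 proof -
  have "mat_delete (?M r) c d = mat_delete (?M 0) c d"
  proof (rule eq_matI)
   fix i j assume "i < dim_row (mat_delete (?M 0) c d)" "j < dim_col (mat_delete (?M 0) c d)"
   hence ij: "i < ?l - 1" "j < ?l - 1" by (simp_all add: mat_delete_def)
   define i' where "i' = (if i < c then i else Suc i)"
   have i': "i' < ?l" "i' \<noteq> c" using ij by (auto simp: i'_def)
   have "A[c := r] ! i' = A[c := 0] ! i'" using i'(2) by simp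
   thus "mat_delete (?M r) c d $$ (i, j) = mat_delete (?M 0) c d $$ (i, j)"
    using ij i'(1) by (simp add: mat_delete_def i'_def[symmetric])
  qed (simp_all add: mat_delete_def)
  thus ?thesis by (simp add: cofactor_def)
 qed
 have "mnr x (A[c := r]) = (\<Sum>d = 0..<?l. x r d * cofactor (?M 0) c d)" for r
 proof -
  have "mnr x (A[c := r]) = (\<Sum>d<?l. ?M r $$ (c, d) * cofactor (?M r) c d)"
   using laplace_expansion_row[of "?M r" ?l c] assms by (simp add: mnr_def)
  also have "\<dots> = (\<Sum>d = 0..<?l. x r d * cofactor (?M 0) c d)"
  proof (rule sum.cong)
   fix d assume "d \<in> {0..<?l}"
   hence d: "d < ?l" by simp
   show "?M r $$ (c, d) * cofactor (?M r) c d = x r d * cofactor (?M 0) c d"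
    unfolding cof[OF d, of r] using assms d by simp
  qed (simp add: lessThan_atLeast0)
  finally show ?thesis .
 qed
 thus ?thesis by blast
qed

lemma mnr_lower_triangular:
 assumes "\<And>r c. r < c \<Longrightarrow> c < length L \<Longrightarrow> y (L ! r) c = 0"
 shows "mnr y L = (\<Prod>c = 0..<length L. y (L ! c) c)"
proof -
 let ?A = "mat (length L) (length L) (\<lambda>(i, j). y (L ! i) j)"
 have "det ?A = prod_list (diag_mat ?A)"
  by (rule det_lower_triangular[of "length L"]) (use assms in auto)
 also have "diag_mat ?A = map (\<lambda>c. y (L ! c) c) [0..<length L]"
  by (auto simp: diag_mat_def)
 also have "prod_list \<dots> = (\<Prod>c = 0..<length L. y (L ! c) c)"
  by (subst prod.distinct_set_conv_list[symmetric]) simp_all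
 finally show ?thesis by (simp add: mnr_def)
qed

lemma list_sign_sorted:
 assumes "sorted_wrt (<) L"
 shows "list_sign L = (1 :: 'a::comm_ring_1)"
proof -
 have L: "sorted L" "distinct L" using assms by (auto simp: strict_sorted_iff)
 have S: "sorted_list_of_set (set L) = L" using L by (simp add: sorted_list_of_set.idem_if_sorted_distinct)
 have "mat (length L) (length L) (\<lambda>(i, j). if L ! i = L ! j then 1 else (0 :: 'a)) = 1\<^sub>m (length L)"
  by (rule eq_matI) (auto simp: nth_eq_iff_index_eq[OF L(2)])
 thus ?thesis unfolding list_sign_def mnr_def S by simp
qed

lemma permutes_lessThan_Suc_fix:
 assumes p: "p permutes {..<Suc s}" and "p s = s"
 shows "p ` {..<s} = {..<s}"
proof -
 have e: "{..<s} = {..<Suc s} - {s}" by auto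
 show ?thesis
  unfolding e image_set_diff[OF permutes_inj[OF p]] permutes_image[OF p] using assms(2) by simp
qed

context flag_setup
begin

text \<open>The coordinate of a point as an alternating function of an ordered list of rows, so that
  exchange relations can be written for points that need not be flags.\<close>

definition pl :: "('k::comm_ring_1) fpoint \<Rightarrow> nat list \<Rightarrow> 'k" where
 "pl v L = (if distinct L then list_sign L * crd (set L) v else 0)"

lemma alternating_pl: "alternating (pl v)"
 using alternating_list_sign[of "\<lambda>A l. crd A v"] by (simp add: pl_def[abs_def])

lemma pl_not_distinct: "\<not> distinct L \<Longrightarrow> pl v L = 0"
 by (simp add: pl_def)

lemma pl_nonzero: "pl v L \<noteq> 0 \<Longrightarrow> distinct L \<and> crd (set L) v \<noteq> 0"
 by (auto simp: pl_def split: if_splits)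

lemma pl_nonzeroI: "distinct L \<Longrightarrow> crd (set L) v \<noteq> 0 \<Longrightarrow> pl v (L) \<noteq> (0 :: 'k::field)"
 using list_sign_cases[of L, where 'a = 'k] by (auto simp: pl_def)

lemma pl_flag_vec:
 assumes g: "g \<in> carrier_mat n n" and j: "j \<in> I" "I \<subseteq> {1..m}" and L: "set L \<subseteq> {1..n}" "length L = k j"
 shows "pl (flag_vec I c g) L = c j * mnr (entry g) L"
proof (cases "distinct L")
 case True
 have card: "card (set L) = k j" using True L by (simp add: distinct_card)
 have jm: "j \<in> {1..m}" using j by blast
 have "set L \<in> csets" by (rule csetsI[OF L(1) jm card])
 moreover have "idx (set L) = j" by (rule idx_eq[OF jm card])
 ultimately show ?thesis
  using True j crd_flag_vec[OF g, of "set L" I c] mnr_sort[OF True, of "entry g"] by (simp add: pl_def mult_ac)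
qed (simp add: pl_not_distinct mnr_not_distinct)

lemma mhom_pl:
 assumes "j \<in> {1..m}" "length L = k j"
 shows "mhom (evec j) (\<lambda>v :: ('k::comm_ring_1) fpoint. pl v L)"
proof (cases "distinct L")
 case True
 hence "idx (set L) = j" using assms idx_eq by (simp add: distinct_card)
 hence "(\<lambda>v :: 'k fpoint. pl v L) = (\<lambda>v. list_sign L * v j (set L))"
  using True by (simp add: pl_def crd_def fun_eq_iff)
 thus ?thesis using mhom_scale[OF mhom_coord] by metis
next
 case False
 hence "(\<lambda>v :: 'k fpoint. pl v L) = (\<lambda>v. 0 * v j {})" by (simp add: pl_def fun_eq_iff)
 thus ?thesis using mhom_scale[OF mhom_coord] by metis
qed

text \<open>Membership in the Zariski closure of the flags, stated through the relations that hold
  on all of them.\<close>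

definition flag_limit :: "nat set \<Rightarrow> ('k::comm_ring_1) fpoint \<Rightarrow> bool" where
 "flag_limit I w \<longleftrightarrow> (\<forall>d F. mhom d F \<longrightarrow>
   (\<forall>c g. g \<in> carrier_mat n n \<longrightarrow> det g \<noteq> 0 \<longrightarrow> F (flag_vec I c g) = 0) \<longrightarrow> F w = 0)"

lemma flag_limitD:
 "flag_limit I w \<Longrightarrow> mhom d F \<Longrightarrow> (\<And>c g. g \<in> carrier_mat n n \<Longrightarrow> F (flag_vec I c g) = 0) \<Longrightarrow> F w = 0"
 unfolding flag_limit_def by blast

definition minimal_coord :: "('k::comm_ring_1) fpoint \<Rightarrow> nat \<Rightarrow> nat set \<Rightarrow> bool" where
 "minimal_coord w j J \<longleftrightarrow> J \<subseteq> {1..n} \<and> card J = k j \<and> w j J \<noteq> 0 \<and>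
   (\<forall>K. K \<subseteq> {1..n} \<longrightarrow> card K = k j \<longrightarrow> w j K \<noteq> 0 \<longrightarrow> \<Sum>J \<le> \<Sum>K)"

text \<open>By the Garnir relation exchanging \<open>x\<close> with an element of \<open>J\<close>, one of the two new coordinates
 would have a smaller sum.\<close>

lemma minimal_coords_nested:
 fixes w :: "('k::field_char_0) fpoint"
 assumes lim: "flag_limit I w" and I: "I \<subseteq> {1..m}" and ij: "i \<in> I" "j \<in> I" "i \<le> j"
  and J: "minimal_coord w j J" and K: "minimal_coord w i K"
 shows "K \<subseteq> J"
proof
 fix x assume xK: "x \<in> K"
 show "x \<in> J"
 proof (rule ccontr)
  assume xJ: "x \<notin> J"
  have J': "J \<subseteq> {1..n}" "card J = k j" "w j J \<noteq> 0" and K': "K \<subseteq> {1..n}" "card K = k i" "w i K \<noteq> 0"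
   using J K by (auto simp: minimal_coord_def)
  have fin: "finite J" "finite K" using J' K' finite_subset by blast+
  have ijm: "i \<in> {1..m}" "j \<in> {1..m}" using ij I by auto
  define Y where "Y = sorted_list_of_set J @ [x]"
  define X2 where "X2 = sorted_list_of_set (K - {x})"
  let ?s = "k j"
  have lenY: "length Y = Suc ?s" using J' by (simp add: Y_def)
  have lenX2: "Suc (length X2) = k i" using K'(2) card_Suc_Diff1[OF fin(2) xK] by (simp only: X2_def length_sorted_list_of_set)
  have setY: "set Y = insert x J" "distinct Y" using fin xJ by (auto simp: Y_def)
  have setX2: "set X2 = K - {x}" using fin by (simp add: X2_def)
  have kij: "k i \<le> k j" using k_le_iff[OF ijm] ij by simp
  have len: "?s \<le> length Y" "length [] + ?s < length Y" "length Y - ?s + length X2 \<le> length [] + ?s"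
   using lenY lenX2 kij by auto
  \<comment> \<open>The Garnir sum for the rows J and x against the rest of K, with nothing fixed in
    the first factor. It vanishes on flags, hence at w.\<close>
  define G where "G = (\<lambda>v :: 'k fpoint. \<Sum>p | p permutes {..<length Y}. of_int (sign p) *
   (pl v ([] @ take ?s (permute_list p Y)) * pl v (drop ?s (permute_list p Y) @ X2)))"
  have lenZ: "length ([] @ take ?s (permute_list p Y)) = k j" "length (drop ?s (permute_list p Y) @ X2) = k i" for p
   using lenY lenX2 by auto
  have "mhom (evec j + evec i) G"
   unfolding G_def
  proof (intro mhom_sum mhom_scale mhom_mult mhom_pl)
   show "finite {p. p permutes {..<length Y}}" by (simp add: finite_permutations)
   show "{p. p permutes {..<length Y}} \<noteq> {}" using permutes_id by blast
  qed (use lenZ ijm in auto)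
  moreover have "G (flag_vec I c g) = 0" if g: "g \<in> carrier_mat n n" for c g
  proof -
   have "G (flag_vec I c g) = (\<Sum>p | p permutes {..<length Y}. c j * c i * (of_int (sign p) *
    (mnr (entry g) ([] @ take ?s (permute_list p Y)) * mnr (entry g) (drop ?s (permute_list p Y) @ X2))))"
    unfolding G_def
   proof (rule sum.cong)
    fix p assume "p \<in> {p. p permutes {..<length Y}}"
    hence "set (permute_list p Y) = set Y" by simp
    hence "set ([] @ take ?s (permute_list p Y)) \<subseteq> {1..n}" "set (drop ?s (permute_list p Y) @ X2) \<subseteq> {1..n}"
     using setY setX2 J' K' xK by (auto dest!: in_set_takeD in_set_dropD)
    thus "of_int (sign p) * (pl (flag_vec I c g) ([] @ take ?s (permute_list p Y)) *
      pl (flag_vec I c g) (drop ?s (permute_list p Y) @ X2)) = c j * c i * (of_int (sign p) *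
    (mnr (entry g) ([] @ take ?s (permute_list p Y)) * mnr (entry g) (drop ?s (permute_list p Y) @ X2)))"
     by (simp only: pl_flag_vec[OF g ij(2) I _ lenZ(1)] pl_flag_vec[OF g ij(1) I _ lenZ(2)] mult_ac)
   qed simp
   also have "\<dots> = 0" unfolding sum_distrib_left[symmetric] garnir_mnr[OF len] by simp
   finally show ?thesis .
  qed
  ultimately have "G w = 0" by (rule flag_limitD[OF lim])
  hence ex: "of_nat (card {p. p permutes {..<length Y} \<and> p ` {..<?s} = {..<?s}}) *
    (pl w ([] @ take ?s Y) * pl w (drop ?s Y @ X2)) =
   - (\<Sum>p | p permutes {..<length Y} \<and> p ` {..<?s} \<noteq> {..<?s}. of_int (sign p) *
    (pl w ([] @ take ?s (permute_list p Y)) * pl w (drop ?s (permute_list p Y) @ X2)))"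
   unfolding G_def by (rule garnir_exchange[OF alternating_pl len(1)])
  have crd: "crd L w = w j' L" if "card L = k j'" "j' \<in> {1..m}" for L j'
   using idx_eq[OF that(2,1)] by (simp add: crd_def)
  have a1: "pl w ([] @ take ?s Y) \<noteq> 0"
   using J' fin crd[OF J'(2) ijm(2)] by (intro pl_nonzeroI) (simp_all add: Y_def)
  have a2: "pl w (drop ?s Y @ X2) \<noteq> 0"
  proof -
   have "set (drop ?s Y @ X2) = K" "distinct (drop ?s Y @ X2)"
    using J' setX2 xK fin by (auto simp: Y_def X2_def)
   thus ?thesis using K' crd[OF K'(2) ijm(1)] by (intro pl_nonzeroI) simp_all
  qed
  have a3: "(of_nat (card {p. p permutes {..<length Y} \<and> p ` {..<?s} = {..<?s}}) :: 'k) \<noteq> 0"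
   using card_block_perms_pos[of "length Y" ?s] by simp
  have "(\<Sum>p | p permutes {..<length Y} \<and> p ` {..<?s} \<noteq> {..<?s}. of_int (sign p) *
    (pl w ([] @ take ?s (permute_list p Y)) * pl w (drop ?s (permute_list p Y) @ X2))) \<noteq> 0" (is "?sum \<noteq> 0")
  proof
   assume "?sum = 0"
   from ex[unfolded this minus_zero] show False by (simp only: mult_eq_0_iff a1 a2 a3 simp_thms)
  qed
  then obtain p where p': "p \<in> {p. p permutes {..<length Y} \<and> p ` {..<?s} \<noteq> {..<?s}}"
   and nz': "of_int (sign p) * (pl w ([] @ take ?s (permute_list p Y)) * pl w (drop ?s (permute_list p Y) @ X2)) \<noteq> 0"
   by (rule sum.not_neutral_contains_not_neutral)
  have p: "p permutes {..<length Y}" "p ` {..<?s} \<noteq> {..<?s}" using p' by blast+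
  have nz: "pl w ([] @ take ?s (permute_list p Y)) \<noteq> 0" "pl w (drop ?s (permute_list p Y) @ X2) \<noteq> 0"
   using nz' by (simp_all only: mult_eq_0_iff de_Morgan_disj simp_thms)
  define Z where "Z = permute_list p Y"
  define y where "y = Z ! ?s"
  have lenZ': "length Z = Suc ?s" by (simp add: Z_def lenY)
  have Z: "Z = take ?s Z @ [y]" "drop ?s Z = [y]"
  proof -
   show d: "drop ?s Z = [y]" using Cons_nth_drop_Suc[of ?s Z] lenZ' by (simp add: y_def)
   show "Z = take ?s Z @ [y]" using append_take_drop_id[of ?s Z] unfolding d by simp
  qed
  have setZ: "set Z = insert x J" "distinct Z"
   using p(1) setY by (simp_all add: Z_def)
  \<comment> \<open>A permutation that does not preserve the block takes x out of the last place, so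
    the row y that gets into the second factor is an element of J.\<close>
  have "p ?s \<noteq> ?s" using permutes_lessThan_Suc_fix[of p ?s] p lenY by auto
  moreover have "p ?s < Suc ?s" using permutes_in_image[OF p(1), of ?s] lenY by simp
  ultimately have ps: "p ?s < ?s" by simp
  have "y = Y ! p ?s" using permute_list_nth[OF p(1), of ?s] lenY by (simp add: y_def Z_def)
  also have "\<dots> = sorted_list_of_set J ! p ?s" using ps J' by (simp add: Y_def nth_append)
  also have "\<dots> \<in> J" using ps J' fin nth_mem[of "p ?s" "sorted_list_of_set J"] by simp
  finally have yJ: "y \<in> J" .
  have "set (take ?s Z) = insert x J - {y}"
  proof -
   have "set Z = insert y (set (take ?s Z))" by (subst Z(1)) simp
   moreover have "y \<notin> set (take ?s Z)" using setZ(2) by (subst (asm) Z(1)) simp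
   ultimately show ?thesis using setZ(1) by auto
  qed
  hence nz1: "crd (insert x J - {y}) w \<noteq> 0" using pl_nonzero[OF nz(1)] by (simp add: Z_def)
  have nz2: "crd (insert y (K - {x})) w \<noteq> 0" and yX2: "y \<notin> K - {x}"
   using pl_nonzero[OF nz(2)] unfolding Z_def[symmetric] Z(2) using setX2 by auto
  have c1: "card (insert x J - {y}) = k j" using fin xJ yJ J'(2) by simp
  have c2: "card (insert y (K - {x})) = k i" 
   using card_insert_disjoint[OF finite_Diff[OF fin(2)] yX2] card_Suc_Diff1[OF fin(2) xK] K'(2) by (simp only:)
  have "\<Sum>J \<le> \<Sum>(insert x J - {y})"
  proof -
   have "insert x J - {y} \<subseteq> {1..n}" using J'(1) K'(1) xK by blast
   thus ?thesis using J nz1 crd[OF c1 ijm(2)] c1 unfolding minimal_coord_def by metis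
  qed
  also have "\<Sum>(insert x J - {y}) + y = x + \<Sum>J"
  proof -
   have "insert x J - {y} = insert x (J - {y})" using xJ yJ by auto
   thus ?thesis using fin xJ sum.remove[OF fin(1) yJ, of "\<lambda>z. z"] by simp
  qed
  finally have "y \<le> x" by simp
  have "\<Sum>K \<le> \<Sum>(insert y (K - {x}))"
  proof -
   have "insert y (K - {x}) \<subseteq> {1..n}" using J'(1) K'(1) yJ by blast
   thus ?thesis using K nz2 crd[OF c2 ijm(1)] c2 unfolding minimal_coord_def by metis
  qed
  also have "\<Sum>(insert y (K - {x})) + x = y + \<Sum>K"
   using fin yX2 xK sum.remove[OF fin(2) xK, of "\<lambda>z. z"] by simp
  finally have "x \<le> y" by simp
  with \<open>y \<le> x\<close> yJ xJ show False by simp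
 qed
qed

end

text \<open>Append at each step the elements of the next set that are new. With rows listed in this
  order the matrix built in \<open>flag_closed\<close> is triangular.\<close>

lemma nested_enumeration:
 fixes J :: "nat \<Rightarrow> nat set"
 assumes "i \<le> q" "\<And>j. i \<le> j \<Longrightarrow> j \<le> q \<Longrightarrow> finite (J j)" "\<And>j l. i \<le> j \<Longrightarrow> j \<le> l \<Longrightarrow> l \<le> q \<Longrightarrow> J j \<subseteq> J l"
 shows "\<exists>L. distinct L \<and> set L = J q \<and> (\<forall>j. i \<le> j \<longrightarrow> j \<le> q \<longrightarrow> set (take (card (J j)) L) = J j)"
 using assms
proof (induction q rule: dec_induct)
 case base
 thus ?case by (intro exI[of _ "sorted_list_of_set (J i)"]) (auto dest: le_antisym)
next
 case (step q)
 have "\<exists>L. distinct L \<and> set L = J q \<and> (\<forall>j. i \<le> j \<longrightarrow> j \<le> q \<longrightarrow> set (take (card (J j)) L) = J j)"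
  by (rule step.IH) (use step.prems in auto)
 then obtain L where L: "distinct L" "set L = J q" "\<forall>j. i \<le> j \<longrightarrow> j \<le> q \<longrightarrow> set (take (card (J j)) L) = J j"
  by blast
 have fin: "finite (J (Suc q))" using step.prems(1)[of "Suc q"] step.hyps by simp
 have sub: "J q \<subseteq> J (Suc q)" using step.prems(2)[of q "Suc q"] step.hyps by simp
 let ?L = "L @ sorted_list_of_set (J (Suc q) - J q)"
 have set: "set ?L = J (Suc q)" "distinct ?L" using L fin sub by auto
 have "set (take (card (J j)) ?L) = J j" if j: "i \<le> j" "j \<le> Suc q" for j
 proof (cases "j = Suc q")
  case True
  hence "card (J j) = length ?L" using set by (metis distinct_card)
  hence "take (card (J j)) ?L = ?L" by simp
  thus ?thesis using set True by simp
 next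
  case False
  hence "j \<le> q" using j by simp
  hence "J j \<subseteq> J q" "finite (J q)" using step.prems[of j] step.prems(1)[of q] step.prems(2)[of j q] j step.hyps by auto
  hence "card (J j) \<le> length L" using L(1,2) card_mono[of "J q" "J j"] by (metis distinct_card)
  hence "take (card (J j)) ?L = take (card (J j)) L" by simp
  moreover have "set (take (card (J j)) L) = J j" using L(3) j \<open>j \<le> q\<close> by blast
  ultimately show ?thesis by (simp only:)
 qed
 with set show ?case by (intro exI[of _ ?L]) blast
qed

lemma mnr_sorted_nonzero:
 fixes x :: "nat \<Rightarrow> nat \<Rightarrow> 'k::idom"
 assumes "distinct L" "mnr x L \<noteq> 0"
 shows "mnr x (sorted_list_of_set (set L)) \<noteq> 0"
 using mnr_sort[OF assms(1), of x] assms(2) by auto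

context flag_setup
begin

lemma mhom_mnr:
 fixes U :: "('k::comm_ring_1) fpoint \<Rightarrow> nat \<Rightarrow> nat \<Rightarrow> 'k"
 assumes "\<And>r c. c < length R \<Longrightarrow> mhom (d c) (\<lambda>v. U v r c)"
 shows "mhom (\<Sum>c\<in>{0..<length R}. d c) (\<lambda>v. mnr (U v) R)"
 unfolding mnr_leibniz
proof (intro mhom_sum mhom_scale)
 show "finite {p. p permutes {0..<length R}}" by (simp add: finite_permutations)
 show "{p. p permutes {0..<length R}} \<noteq> {}" using permutes_id by blast
 fix p assume "p \<in> {p. p permutes {0..<length R}}"
 hence p: "p permutes {0..<length R}" by simp
 have "mhom (\<Sum>i\<in>{0..<length R}. d (p i)) (\<lambda>v. \<Prod>i = 0..<length R. U v (R ! i) (p i))"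
 proof (rule mhom_prod)
  fix i assume "i \<in> {0..<length R}"
  hence "p i < length R" using permutes_in_image[OF p, of i] by simp
  thus "mhom (d (p i)) (\<lambda>v. U v (R ! i) (p i))" by (rule assms)
 qed simp
 moreover have "(\<Sum>i\<in>{0..<length R}. d (p i)) = (\<Sum>c\<in>{0..<length R}. d c)"
  using sum.permute[OF p, of d] by (simp add: o_def)
 ultimately show "mhom (\<Sum>c\<in>{0..<length R}. d c) (\<lambda>v. \<Prod>i = 0..<length R. U v (R ! i) (p i))" by simp
qed

text \<open>The columns of the matrix \<open>U\<close> are Pluecker coordinates with one row exchanged; its minors are the
 Pluecker coordinates of \<open>w\<close> up to a non-zero factor.\<close>

lemma flag_closed:
 fixes w :: "('k::field_char_0) fpoint"
 assumes lim: "flag_limit {i..m} w" and i: "i \<in> {1..m}"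
  and V: "\<And>j. j \<in> {i..m} \<Longrightarrow> w j \<in> ext_power n (k j) \<and> w j \<noteq> 0" and out: "\<And>j. j \<notin> {i..m} \<Longrightarrow> w j = 0"
 shows "\<exists>c g. g \<in> carrier_mat n n \<and> det g \<noteq> 0 \<and> w = flag_vec {i..m} c g"
proof -
 let ?I = "{i..m}"
 have I: "?I \<subseteq> {1..m}" using i by auto
 have "\<exists>J. minimal_coord w j J" if j: "j \<in> ?I" for j
 proof -
  obtain K0 where "w j K0 \<noteq> 0" using V[OF j] by (auto simp: fun_eq_iff)
  hence "K0 \<subseteq> {1..n} \<and> card K0 = k j \<and> w j K0 \<noteq> 0" using V[OF j] unfolding ext_power_def by blast
  thus ?thesis
   unfolding minimal_coord_def
   using ex_has_least_nat[of "\<lambda>K. K \<subseteq> {1..n} \<and> card K = k j \<and> w j K \<noteq> 0" K0 "\<lambda>K. \<Sum>K"] by blast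
 qed
 hence "\<forall>j\<in>?I. \<exists>J. minimal_coord w j J" by (rule ballI)
 from bchoice[OF this] obtain J where "\<forall>j\<in>?I. minimal_coord w j (J j)" by (elim exE)
 note J = this[rule_format]
 have J': "J j \<subseteq> {1..n}" "card (J j) = k j" "w j (J j) \<noteq> 0" "finite (J j)" if "j \<in> ?I" for j
  using J[OF that] finite_subset[of "J j" "{1..n}"] by (auto simp: minimal_coord_def)
 obtain L where L: "distinct L" "set L = J m" "\<forall>j. i \<le> j \<longrightarrow> j \<le> m \<longrightarrow> set (take (card (J j)) L) = J j"
 proof -
  have "J j \<subseteq> J l" if "i \<le> j" "j \<le> l" "l \<le> m" for j l
   by (rule minimal_coords_nested[OF lim I _ _ that(2) J J]) (use that in auto)
  hence "\<exists>L. distinct L \<and> set L = J m \<and> (\<forall>j. i \<le> j \<longrightarrow> j \<le> m \<longrightarrow> set (take (card (J j)) L) = J j)"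
   by (intro nested_enumeration) (use i J'(4) in auto)
  thus thesis by (elim exE conjE) (rule that)
 qed
 define Ls where "Ls = L @ sorted_list_of_set ({1..n} - J m)"
 have mI: "m \<in> ?I" using i by auto
 have Ls: "distinct Ls" "set Ls = {1..n}" using L J'(1)[OF mI] by (auto simp: Ls_def)
 have lenLs: "length Ls = n" using Ls distinct_card[of Ls] by simp
 have lenL: "length L = k m" using L(1,2) J'(2)[OF mI] distinct_card[of L] by simp
 have kjm: "k j \<le> k m" if "j \<in> ?I" for j using k_le_iff[of j m] that I mI by auto
 have kjn: "k j < n" if "j \<in> ?I" for j using k_less_n[of j] that I by blast
 have setA: "set (take (k j) Ls) = J j" if "j \<in> ?I" for j
  using L(3) J'(2)[OF that] that kjm[OF that] lenL by (auto simp: Ls_def)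
 \<comment> \<open>The first index whose subspace has dimension above c. Column c is built from the
   coordinates of this index, so on a flag it lies in that subspace and in all larger ones.\<close>
 define jc where "jc = (\<lambda>c. LEAST j. j \<in> ?I \<and> c < k j)"
 have jc: "jc c \<in> ?I \<and> c < k (jc c) \<and> jc c \<le> j" if "j \<in> ?I" "c < k j" for j c
  unfolding jc_def using LeastI[of "\<lambda>j. j \<in> ?I \<and> c < k j" j] Least_le[of "\<lambda>j. j \<in> ?I \<and> c < k j" j] that by blast
 define A where "A = (\<lambda>c. take (k (jc c)) Ls)"
 define U where "U = (\<lambda>v :: 'k fpoint. \<lambda>r c. pl v ((A c)[c := r]))"
 define Q where "Q = (\<lambda>(v :: 'k fpoint) j. \<Prod>c\<in>{0..<k j}. pl v (A c))"
 have A: "length (A c) = k (jc c)" "c < k (jc c)" "k (jc c) \<le> k j" "k (jc c) < n" "jc c \<in> {1..m}" "jc c \<in> ?I"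
  if "j \<in> ?I" "c < k j" for j c
  using jc[OF that] kjn[of "jc c"] lenLs k_le_iff[of "jc c" j] I that by (auto simp: A_def)
 have setAc: "set ((A c)[c := r]) \<subseteq> {1..n}" if "r \<in> {1..n}" for c r
  using set_update_subset_insert[of "A c" c r] set_take_subset[of "k (jc c)" Ls] that Ls by (auto simp: A_def)
 have tri: "U v (Ls ! r) c = (if r = c then pl v (A c) else 0)"
  if "j \<in> ?I" "c < k j" "r < k (jc c)" for v r c j
 proof (cases "r = c")
  case True
  hence "Ls ! r = A c ! c" using A(2)[OF that(1,2)] by (simp add: A_def)
  thus ?thesis using True by (simp add: U_def)
 next
  case False
  have "Ls ! r = A c ! r" using that(3) by (simp add: A_def)
  hence "(A c)[c := Ls ! r] ! c = (A c)[c := Ls ! r] ! r"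
   using False A(1,2)[OF that(1,2)] that(3) by simp
  hence "\<not> distinct ((A c)[c := Ls ! r])"
   using False A(1,2)[OF that(1,2)] that(3) by (metis length_list_update nth_eq_iff_index_eq)
  thus ?thesis using False by (simp add: U_def pl_not_distinct)
 qed
 have mnrU: "mnr (U v) (take (k j) Ls) = Q v j" if j: "j \<in> ?I" for v j
 proof -
  have len: "length (take (k j) Ls) = k j" using kjn[OF j] lenLs by simp
  have "mnr (U v) (take (k j) Ls) = (\<Prod>c = 0..<k j. U v (take (k j) Ls ! c) c)"
  proof (subst mnr_lower_triangular)
   fix r c assume rc: "r < c" "c < length (take (k j) Ls)"
   hence c: "c < k j" using len by simp
   have "r < k (jc c)" using A(2)[OF j c] rc(1) by simp
   thus "U v (take (k j) Ls ! r) c = 0" using tri[OF j c, of r v] rc c by simp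
  qed (simp only: len)
  also have "\<dots> = Q v j" unfolding Q_def
  proof (rule prod.cong)
   fix c assume "c \<in> {0..<k j}"
   hence c: "c < k j" by simp
   thus "U v (take (k j) Ls ! c) c = pl v (A c)" using tri[OF j c A(2)[OF j c], of v] by simp
  qed simp
  finally show ?thesis .
 qed
 \<comment> \<open>On a flag with matrix x the first \<open>k j\<close> columns of U are those of x
   times a square matrix M of cofactors, so all their minors change by the same factor. The
   resulting identity is multihomogeneous and therefore passes to w.\<close>
 have ident: "pl w R * Q w j = pl w (take (k j) Ls) * mnr (U w) R"
  if j: "j \<in> ?I" and R: "set R \<subseteq> {1..n}" "length R = k j" for j R
 proof -
  let ?R0 = "take (k j) Ls"
  define F where "F = (\<lambda>v :: 'k fpoint. pl v R * Q v j - pl v ?R0 * mnr (U v) R)"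
  have jm: "j \<in> {1..m}" using j I by blast
  have R0: "set ?R0 \<subseteq> {1..n}" "length ?R0 = k j" using Ls set_take_subset[of "k j" Ls] kjn[OF j] lenLs by auto
  have "mhom (evec j + (\<Sum>c\<in>{0..<k j}. evec (jc c))) F"
   unfolding F_def
  proof (intro mhom_diff mhom_mult mhom_pl[OF jm])
   show "mhom (\<Sum>c\<in>{0..<k j}. evec (jc c)) (\<lambda>v :: 'k fpoint. Q v j)"
    unfolding Q_def using A[OF j] by (intro mhom_prod mhom_pl) auto
   have "mhom (\<Sum>c\<in>{0..<length R}. evec (jc c)) (\<lambda>v :: 'k fpoint. mnr (U v) R)"
    unfolding U_def using A[OF j] R(2) by (intro mhom_mnr mhom_pl) auto
   thus "mhom (\<Sum>c\<in>{0..<k j}. evec (jc c)) (\<lambda>v :: 'k fpoint. mnr (U v) R)"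
    using R(2) by simp
  qed (use R R0 in auto)
  moreover have "F (flag_vec ?I c' g) = 0" if g: "g \<in> carrier_mat n n" for c' g
  proof -
   let ?v = "flag_vec ?I c' g" and ?x = "entry g"
   have "\<exists>C. \<forall>r. mnr ?x ((A c)[c := r]) = (\<Sum>d = 0..<length (A c). ?x r d * C d)" if "c < k j" for c
    by (rule mnr_update_row) (use A[OF j that] in simp)
   hence "\<forall>c\<in>{..<k j}. \<exists>C. \<forall>r. mnr ?x ((A c)[c := r]) = (\<Sum>d = 0..<length (A c). ?x r d * C d)"
    by blast
   from bchoice[OF this] obtain C where
    "\<forall>c\<in>{..<k j}. \<forall>r. mnr ?x ((A c)[c := r]) = (\<Sum>d = 0..<length (A c). ?x r d * C c d)"
    by (elim exE)
   hence C: "mnr ?x ((A c)[c := r]) = (\<Sum>d = 0..<length (A c). ?x r d * C c d)" if "c < k j" for c r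
    using that by (elim ballE allE) auto
   define M where "M = (\<lambda>d c. if d < k (jc c) then c' (jc c) * C c d else 0)"
   have U: "U ?v r c = (\<Sum>d = 0..<k j. ?x r d * M d c)" if "r \<in> {1..n}" and c: "c < k j" for r c
   proof -
    have "U ?v r c = c' (jc c) * mnr ?x ((A c)[c := r])"
     unfolding U_def using A[OF j c] setAc[OF that(1)] by (intro pl_flag_vec[OF g _ I]) auto
    also have "\<dots> = (\<Sum>d = 0..<k (jc c). ?x r d * M d c)"
     unfolding C[OF c] A(1)[OF j c] sum_distrib_left by (rule sum.cong) (simp_all add: M_def mult_ac)
    also have "\<dots> = (\<Sum>d = 0..<k j. ?x r d * M d c)"
     using A(3)[OF j c] by (intro sum.mono_neutral_left) (auto simp: M_def)
    finally show ?thesis .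
   qed
   have mult: "mnr (U ?v) R' = mnr ?x R' * det (mat (k j) (k j) (\<lambda>(d, c). M d c))"
    if R': "set R' \<subseteq> {1..n}" "length R' = k j" for R'
    by (rule mnr_mult_right[of R' "U ?v" ?x M, unfolded R'(2)]) (rule U, use R'(1) in blast, assumption)
   have "pl ?v R = c' j * mnr ?x R" "pl ?v ?R0 = c' j * mnr ?x ?R0"
    by (rule pl_flag_vec[OF g j I R], rule pl_flag_vec[OF g j I R0])
   thus ?thesis
    unfolding F_def mnrU[OF j, symmetric] mult[OF R] mult[OF R0] by simp
  qed
  ultimately have "F w = 0" by (rule flag_limitD[OF lim])
  thus ?thesis by (simp add: F_def)
 qed
 have crd: "crd K w = w j K" if "card K = k j" "j \<in> ?I" for K j
  using idx_eq[of j K] that I by (auto simp: crd_def)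
 have plA: "pl w (take (k j) Ls) \<noteq> 0" if j: "j \<in> ?I" for j
  using J'[OF j] setA[OF j] crd[OF J'(2)[OF j] j] Ls(1) by (intro pl_nonzeroI) simp_all
 have Q: "Q w j \<noteq> 0" if j: "j \<in> ?I" for j
  unfolding Q_def A_def using plA A(6)[OF j] by simp
 \<comment> \<open>The remaining columns are the unit vectors of the remaining rows of
   \<open>Ls\<close>; in the row order \<open>Ls\<close> the matrix is then triangular with non-zero
   diagonal.\<close>
 define g where "g = mat n n (\<lambda>(r, c). if c < k m then U w (Suc r) c else if Suc r = Ls ! c then 1 else 0)"
 have g: "g \<in> carrier_mat n n" by (simp add: g_def)
 have ent: "entry g r c = (if c < k m then U w r c else if r = Ls ! c then 1 else 0)" if "r \<in> {1..n}" "c < n" for r c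
  using that by (auto simp: entry_def g_def)
 have "det g \<noteq> 0"
 proof -
  have LsI: "Ls ! r \<in> {1..n}" if "r < n" for r using that Ls(2) lenLs nth_mem[of r Ls] by simp
  have "mnr (entry g) Ls = (\<Prod>c = 0..<length Ls. entry g (Ls ! c) c)"
  proof (rule mnr_lower_triangular)
   fix r c assume rc: "r < c" "c < length Ls"
   hence n: "r < n" "c < n" using lenLs by auto
   show "entry g (Ls ! r) c = 0"
   proof (cases "c < k m")
    case True
    hence "r < k (jc c)" using A(2)[OF mI True] rc by simp
    thus ?thesis using tri[OF mI True, of r w] rc(1) True ent[OF LsI[OF n(1)] n(2)] by simp
   next
    case False
    have "Ls ! r \<noteq> Ls ! c" using nth_eq_iff_index_eq[OF Ls(1), of r c] rc by simp
    thus ?thesis using False ent[OF LsI[OF n(1)] n(2)] by simp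
   qed
  qed
  moreover have "entry g (Ls ! c) c \<noteq> 0" if "c < n" for c
  proof (cases "c < k m")
   case True
   thus ?thesis
    using tri[OF mI True A(2)[OF mI True], of w] ent[OF LsI[OF that] that] plA[OF A(6)[OF mI True]] by (simp add: A_def)
  qed (use ent[OF LsI[OF that] that] in simp)
  ultimately have "mnr (entry g) Ls \<noteq> 0" using lenLs by simp
  hence "mnr (entry g) (sorted_list_of_set {1..n}) \<noteq> 0"
   using mnr_sorted_nonzero[OF Ls(1)] Ls(2) by simp
  moreover have "sorted_list_of_set {1..n} = [1..<Suc n]"
   using sorted_list_of_set_range[of 1 "Suc n"] by (simp add: atLeastLessThanSuc_atLeastAtMost)
  ultimately show ?thesis unfolding det_eq_mnr[OF g] by simp
 qed
 moreover have "w = flag_vec ?I (\<lambda>j. pl w (take (k j) Ls) / Q w j) g"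
 proof (intro ext)
  fix j K
  show "w j K = flag_vec ?I (\<lambda>j. pl w (take (k j) Ls) / Q w j) g j K"
  proof (cases "j \<in> ?I \<and> K \<subseteq> {1..n} \<and> card K = k j")
   case True
   let ?R = "sorted_list_of_set K"
   have j: "j \<in> ?I" and fin: "finite K" using True finite_subset by blast+
   have R: "set ?R \<subseteq> {1..n}" "length ?R = k j" using True fin by auto
   have "pl w ?R = w j K"
    using list_sign_sorted[of ?R, where 'a = 'k] fin crd[of K j] True by (simp add: pl_def)
   hence "w j K * Q w j = pl w (take (k j) Ls) * mnr (U w) ?R" using ident[OF j R] by simp
   moreover have "mnr (entry g) ?R = mnr (U w) ?R"
   proof (rule mnr_cong)
    fix r c assume rc: "r \<in> set ?R" "c < length ?R"
    hence "r \<in> {1..n}" "c < k m" "c < n" using R kjm[OF j] kjn[OF j] by auto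
    thus "entry g r c = U w r c" using ent by simp
   qed
   ultimately show ?thesis
    using True Q[OF j] by (simp add: flag_vec_def wedge_cols_eq[OF g] field_simps)
  next
   case False
   hence "w j K = 0"
   proof (cases "j \<in> ?I")
    case True
    hence "w j \<in> ext_power n (k j)" using V by blast
    thus ?thesis using False True unfolding ext_power_def by blast
   qed (use out in simp)
   moreover have "flag_vec ?I (\<lambda>j. pl w (take (k j) Ls) / Q w j) g j K = 0"
    using False by (auto simp: flag_vec_def wedge_cols_def)
   ultimately show ?thesis by simp
  qed
 qed
 ultimately show ?thesis using g by blast
qed

end

section \<open>The multicones of the strata\<close>

text \<open>Laplace expansion along the last column, so that the smaller minor again uses the first
  columns.\<close>

lemma mnr_delete_nonzero:
 fixes x :: "nat \<Rightarrow> nat \<Rightarrow> 'k::idom"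
 assumes "mnr x L \<noteq> 0" "L \<noteq> []"
 shows "\<exists>i<length L. mnr x (take i L @ drop (Suc i) L) \<noteq> 0"
proof (rule ccontr)
 assume neg: "\<not> ?thesis"
 obtain l where l: "length L = Suc l" using assms(2) by (cases L) auto
 let ?A = "mat (Suc l) (Suc l) (\<lambda>(i, j). x (L ! i) j)"
 have "cofactor ?A i l = 0" if i: "i < Suc l" for i
 proof -
  let ?L = "take i L @ drop (Suc i) L"
  have len: "length ?L = l" using i l by simp
  have "mat_delete ?A i l = mat l l (\<lambda>(i, j). x (?L ! i) j)"
  proof (rule eq_matI)
   fix r c assume "r < dim_row (mat l l (\<lambda>(i, j). x (?L ! i) j))" "c < dim_col (mat l l (\<lambda>(i, j). x (?L ! i) j))"
   hence rc: "r < l" "c < l" by auto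
   have "?L ! r = L ! (if r < i then r else Suc r)" using rc i l by (simp add: nth_append)
   thus "mat_delete ?A i l $$ (r, c) = mat l l (\<lambda>(i, j). x (?L ! i) j) $$ (r, c)"
    using rc by (simp add: mat_delete_def)
  qed (simp_all add: mat_delete_def)
  hence "det (mat_delete ?A i l) = mnr x ?L" unfolding mnr_def len by (rule arg_cong)
  also have "\<dots> = 0" using neg i l by simp
  finally show ?thesis by (simp add: cofactor_def)
 qed
 hence "det ?A = 0"
  using laplace_expansion_column[of ?A "Suc l" l] by simp
 hence "mnr x L = 0" unfolding mnr_def l .
 with assms(1) show False by simp
qed

lemma mnr_sub_nonzero:
 fixes x :: "nat \<Rightarrow> nat \<Rightarrow> 'k::idom"
 assumes "finite J" "mnr x (sorted_list_of_set J) \<noteq> 0" "l \<le> card J"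
 shows "\<exists>K\<subseteq>J. card K = l \<and> mnr x (sorted_list_of_set K) \<noteq> 0"
 using assms
proof (induction "card J - l" arbitrary: J)
 case 0
 thus ?case by (intro exI[of _ J]) simp
next
 case (Suc e)
 let ?L = "sorted_list_of_set J"
 have ne: "?L \<noteq> []" using Suc by auto
 obtain i where i: "i < length ?L" "mnr x (take i ?L @ drop (Suc i) ?L) \<noteq> 0"
  using mnr_delete_nonzero[OF Suc.prems(2) ne] by blast
 let ?M = "take i ?L @ drop (Suc i) ?L"
 have eq: "?L = take i ?L @ ?L ! i # drop (Suc i) ?L" using i(1) by (rule id_take_nth_drop)
 have dist: "distinct (take i ?L @ ?L ! i # drop (Suc i) ?L)" unfolding eq[symmetric] by simp
 have set: "set (take i ?L @ ?L ! i # drop (Suc i) ?L) = J" unfolding eq[symmetric] using Suc.prems(1) by simp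
 have sub: "set ?M \<subseteq> J" using set by auto
 have nz: "mnr x (sorted_list_of_set (set ?M)) \<noteq> 0"
  by (rule mnr_sorted_nonzero) (use dist i(2) in auto)
 have card: "card (set ?M) = card J - 1"
  using distinct_card[of ?M] dist i(1) by simp
 have e: "e = card (set ?M) - l" "l \<le> card (set ?M)" using Suc.hyps(2) card by linarith+
 obtain K where "K \<subseteq> set ?M" "card K = l" "mnr x (sorted_list_of_set K) \<noteq> 0"
  using Suc.hyps(1)[OF e(1) finite_set nz e(2)] by blast
 with sub show ?case by blast
qed

lemma proj_pointD:
 fixes w w' :: "('k::field) fpoint"
 assumes "proj_point I w = proj_point I w'" "j \<in> I"
 shows "\<exists>c. c \<noteq> 0 \<and> w j = (\<lambda>b. c * w' j b)"
proof -
 have "w j \<in> {(\<lambda>b. c * w j b) | c. c \<noteq> 0}" by (intro CollectI exI[of _ 1]) simp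
 also have "\<dots> = {(\<lambda>b. c * w' j b) | c. c \<noteq> 0}"
  using fun_cong[OF assms(1), of j] assms(2) by (simp add: proj_point_def)
 finally show ?thesis by blast
qed

lemma proj_pointI:
 fixes w w' :: "('k::field) fpoint"
 assumes "\<And>j. j \<in> I \<Longrightarrow> \<exists>c. c \<noteq> 0 \<and> w j = (\<lambda>b. c * w' j b)"
 shows "proj_point I w = proj_point I w'"
proof
 fix j
 show "proj_point I w j = proj_point I w' j"
 proof (cases "j \<in> I")
  case True
  then obtain a where a: "a \<noteq> 0" "w j = (\<lambda>b. a * w' j b)" using assms by blast
  have "{(\<lambda>b. c * w j b) | c. c \<noteq> 0} = {(\<lambda>b. c * w' j b) | c. c \<noteq> 0}"
  proof (intro equalityI subsetI)
   fix f assume "f \<in> {(\<lambda>b. c * w j b) | c. c \<noteq> 0}"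
   then obtain c where "c \<noteq> 0" "f = (\<lambda>b. c * w j b)" by blast
   hence "c * a \<noteq> 0" "f = (\<lambda>b. (c * a) * w' j b)" using a by (simp_all add: mult.assoc)
   thus "f \<in> {(\<lambda>b. c * w' j b) | c. c \<noteq> 0}" by blast
  next
   fix f assume "f \<in> {(\<lambda>b. c * w' j b) | c. c \<noteq> 0}"
   then obtain c where "c \<noteq> 0" "f = (\<lambda>b. c * w' j b)" by blast
   hence "c / a \<noteq> 0" "f = (\<lambda>b. (c / a) * w j b)" using a by simp_all
   thus "f \<in> {(\<lambda>b. c * w j b) | c. c \<noteq> 0}" by blast
  qed
  thus ?thesis using True by (simp add: proj_point_def)
 qed (simp add: proj_point_def)
qed

lemma exists_root:
 fixes a :: "'k::alg_closed_field"
 assumes "0 < n"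
 shows "\<exists>x. x ^ n = a"
 using nth_root_exists[of n a] assms by blast

lemma wedge_cols_smult:
 fixes g :: "'k::field mat"
 assumes g: "g \<in> carrier_mat n n"
 shows "wedge_cols n i (a \<cdot>\<^sub>m g) J = a ^ i * wedge_cols n i g J"
proof (cases "J \<subseteq> {1..n} \<and> card J = i")
 case True
 let ?L = "sorted_list_of_set J"
 have "finite J" "card J \<le> n" using True finite_subset card_mono[of "{1..n}" J] by auto
 hence "mnr (entry (a \<cdot>\<^sub>m g)) ?L = mnr (\<lambda>r c. a * entry g r c) ?L"
 proof (intro mnr_cong)
  fix r c assume "r \<in> set ?L" "c < length ?L"
  hence "r \<in> {1..n}" "c < n" using True \<open>finite J\<close> \<open>card J \<le> n\<close> by auto
  hence "r - 1 < n" "c < n" by auto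
  thus "entry (a \<cdot>\<^sub>m g) r c = a * entry g r c" using g by (simp add: entry_def)
 qed
 also have "\<dots> = a ^ i * mnr (entry g) ?L"
  using mnr_row_scale[of "\<lambda>_. a" "entry g" ?L] True by simp
 finally show ?thesis using True g by (simp add: wedge_cols_eq smult_carrier_mat)
qed (auto simp: wedge_cols_def)

text \<open>Divide by an n-th root of the determinant. On the multicone the scalar is absorbed by
  the coefficients.\<close>

lemma scale_to_SL:
 fixes g :: "'k::alg_closed_field mat"
 assumes "0 < n" and g: "g \<in> carrier_mat n n" "det g \<noteq> 0"
 shows "\<exists>a. a \<noteq> 0 \<and> a \<cdot>\<^sub>m g \<in> SL n"
proof -
 obtain x where x: "x ^ n = det g" using exists_root[OF assms(1)] by blast
 have "x \<noteq> 0"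
 proof
  assume "x = 0"
  hence "det g = 0" using x assms(1) by (simp add: zero_power)
  with g(2) show False by simp
 qed
 have "(1 / x) \<cdot>\<^sub>m g \<in> SL n"
  using g x \<open>x \<noteq> 0\<close> by (simp add: SL_def power_one_over field_simps)
 thus ?thesis using \<open>x \<noteq> 0\<close> by (intro exI[of _ "1 / x"]) simp
qed

lemma wedge_cols_ext_power: "wedge_cols n i g \<in> ext_power n i"
 by (simp add: ext_power_def wedge_cols_def)

text \<open>The full determinant is a non-zero minor, and deleting the last column together with a
  suitable row keeps it non-zero.\<close>

lemma wedge_cols_nonzero:
 fixes g :: "'k::field mat"
 assumes g: "g \<in> carrier_mat n n" "det g \<noteq> 0" and i: "i \<le> n"
 shows "wedge_cols n i g \<noteq> 0"
proof -
 have "sorted_list_of_set {1..n} = [1..<Suc n]"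
  using sorted_list_of_set_range[of 1 "Suc n"] by (simp add: atLeastLessThanSuc_atLeastAtMost)
 hence "mnr (entry g) (sorted_list_of_set {1..n}) \<noteq> 0" using g(2) unfolding det_eq_mnr[OF g(1)] by simp
 then obtain K where K: "K \<subseteq> {1..n}" "card K = i" "mnr (entry g) (sorted_list_of_set K) \<noteq> 0"
  using mnr_sub_nonzero[of "{1..n}" "entry g" i] i by auto
 hence "wedge_cols n i g K \<noteq> 0" by (simp add: wedge_cols_eq[OF g(1)])
 thus ?thesis by auto
qed

lemma borel_weyl_perm_cols:
 fixes b :: "'k::field mat"
 assumes \<sigma>: "\<sigma> permutes {1..n}" and b: "b \<in> borel n" and s: "s \<in> weyl_reps n \<sigma>"
 shows "\<exists>\<beta>. upper_fun n \<beta> \<and> b * s = perm_cols n \<sigma> \<beta>"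
proof -
 let ?\<tau> = "inv_into UNIV \<sigma>"
 have bc: "b \<in> carrier_mat n n" "det b = 1" "upper_triangular b" using b by (auto simp: borel_def SL_def)
 have sc: "s \<in> carrier_mat n n" using s by (auto simp: weyl_reps_def SL_def)
 have s_iff: "s $$ (i, j) \<noteq> 0 \<longleftrightarrow> Suc i = \<sigma> (Suc j)" if "i < n" "j < n" for i j
  using s that by (auto simp: weyl_reps_def)
 \<comment> \<open>The non-zero entry of s in row e sits in the column that sigma sends to e.
   Scaling column e of b by it absorbs all coefficients of s.\<close>
 define \<beta> where "\<beta> = (\<lambda>r e. if r \<in> {1..n} \<and> e \<in> {1..n}
  then b $$ (r - 1, e - 1) * s $$ (e - 1, ?\<tau> e - 1) else 0)"
 have diag: "b $$ (r, r) \<noteq> 0" if "r < n" for r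
 proof
  assume b0: "b $$ (r, r) = 0"
  have "b $$ (r, r) \<in> set (diag_mat b)"
   unfolding diag_mat_def set_map by (rule imageI) (use that bc(1) in simp)
  hence "prod_list (diag_mat b) = 0" unfolding b0 by (simp add: prod_list_zero_iff)
  moreover have "prod_list (diag_mat b) = 1" using det_upper_triangular[OF bc(3,1)] bc(2) by simp
  ultimately show False by (metis zero_neq_one)
 qed
 have "upper_fun n \<beta>"
  unfolding upper_fun_def
 proof (intro conjI allI impI ballI)
  fix r c :: nat assume "c < r"
  thus "\<beta> r c = 0"
  proof (cases "r \<in> {1..n} \<and> c \<in> {1..n}")
   case True
   hence "c - 1 < r - 1" "r - 1 < dim_row b" using \<open>c < r\<close> bc(1) by auto
   hence "b $$ (r - 1, c - 1) = 0" using bc(3) unfolding upper_triangular_def by blast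
   thus ?thesis by (simp add: \<beta>_def)
  next
   case False
   thus ?thesis by (simp only: \<beta>_def if_False)
  qed
 next
  fix r assume r: "r \<in> {1..n}"
  have "?\<tau> r \<in> {1..n}" using permutes_in_image[OF permutes_inv[OF \<sigma>], of r] r by simp
  moreover have "\<sigma> (?\<tau> r) = r" by (rule permutes_inverses(1)[OF \<sigma>])
  moreover have "r - 1 < n" "Suc (r - 1) = r" using r by auto
  moreover have "?\<tau> r - 1 < n" "Suc (?\<tau> r - 1) = ?\<tau> r" using \<open>?\<tau> r \<in> {1..n}\<close> by auto
  ultimately have "s $$ (r - 1, ?\<tau> r - 1) \<noteq> 0" using s_iff[of "r - 1" "?\<tau> r - 1"] by simp
  thus "\<beta> r r \<noteq> 0" using diag[OF \<open>r - 1 < n\<close>] r by (simp add: \<beta>_def)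
 qed
 moreover have "b * s = perm_cols n \<sigma> \<beta>"
 proof (rule eq_matI)
  fix r c assume "r < dim_row (perm_cols n \<sigma> \<beta>)" "c < dim_col (perm_cols n \<sigma> \<beta>)"
  hence rc: "r < n" "c < n" by (auto simp: perm_cols_def)
  obtain e where e: "e < n" "\<sigma> (Suc c) = Suc e" using permutes_Suc_lt[OF \<sigma> rc(2)] by blast
  have te: "?\<tau> (Suc e) = Suc c" unfolding e(2)[symmetric] by (rule permutes_inverses(2)[OF \<sigma>])
  have "(b * s) $$ (r, c) = (\<Sum>d = 0..<n. b $$ (r, d) * s $$ (d, c))"
   using rc bc(1) sc by (simp add: scalar_prod_def)
  also have "\<dots> = (\<Sum>d = 0..<n. if d = e then b $$ (r, d) * s $$ (d, c) else 0)"
  proof (rule sum.cong)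
   fix d assume "d \<in> {0..<n}"
   thus "b $$ (r, d) * s $$ (d, c) = (if d = e then b $$ (r, d) * s $$ (d, c) else 0)"
    using s_iff[of d c] rc e by auto
  qed simp
  also have "\<dots> = b $$ (r, e) * s $$ (e, c)" using e by simp
  finally show "(b * s) $$ (r, c) = perm_cols n \<sigma> \<beta> $$ (r, c)"
   using rc e te by (simp add: perm_cols_def \<beta>_def)
 qed (use bc sc in \<open>auto simp: perm_cols_def\<close>)
 ultimately show ?thesis by blast
qed

text \<open>The triangular factor and the permutation matrix are brought to determinant one
  separately, whence the scalar a.\<close>

lemma perm_cols_borel_weyl:
 fixes \<beta> :: "nat \<Rightarrow> nat \<Rightarrow> 'k::alg_closed_field"
 assumes n: "0 < n" and \<sigma>: "\<sigma> permutes {1..n}" and \<beta>: "upper_fun n \<beta>"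
 shows "\<exists>b s a. b \<in> borel n \<and> s \<in> weyl_reps n \<sigma> \<and> a \<noteq> 0 \<and> b * s = a \<cdot>\<^sub>m perm_cols n \<sigma> \<beta>"
proof -
 let ?B = "mat n n (\<lambda>(r, c). \<beta> (Suc r) (Suc c))"
 let ?P = "perm_matrix n \<sigma> :: 'k mat"
 have B: "?B \<in> carrier_mat n n" by simp
 obtain a where a: "a \<noteq> 0" "a \<cdot>\<^sub>m ?B \<in> SL n" using scale_to_SL[OF n B det_upper_fun[OF \<beta>]] by blast
 obtain c where c: "c \<noteq> 0" "c \<cdot>\<^sub>m ?P \<in> SL n"
  using scale_to_SL[OF n perm_matrix_carrier det_perm_matrix_nonzero[OF \<sigma>]] by blast
 have "a \<cdot>\<^sub>m ?B \<in> borel n"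
  using a(2) \<beta> by (auto simp: borel_def upper_triangular_def upper_fun_def)
 moreover have "c \<cdot>\<^sub>m ?P \<in> weyl_reps n \<sigma>"
  using c by (auto simp: weyl_reps_def perm_matrix_def)
 moreover have "(a \<cdot>\<^sub>m ?B) * (c \<cdot>\<^sub>m ?P) = (a * c) \<cdot>\<^sub>m perm_cols n \<sigma> \<beta>"
  unfolding perm_cols_eq_mult[OF \<sigma>]
  by (rule eq_matI) (auto simp: perm_matrix_def scalar_prod_def sum_distrib_left mult_ac)
 moreover have "a * c \<noteq> 0" using a(1) c(1) by simp
 ultimately show ?thesis by blast
qed

section \<open>Points of the multicone as flags\<close>

context flag_setup
begin

abbreviation str :: "((nat \<Rightarrow> nat) set \<times> nat, nat set, 'k::comm_ring_1) stratification" where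
 "str \<equiv> flag_stratification n m k"

lemma n_pos: "0 < n"
 using n_ge_2 by simp

lemma flag_vec_in: "j \<in> I \<Longrightarrow> flag_vec I c g j J = c j * wedge_cols n (k j) g J"
 unfolding flag_vec_def by (simp only: if_True)

lemma flag_vec_out: "j \<notin> I \<Longrightarrow> flag_vec I c g j J = 0"
 unfolding flag_vec_def by (simp only: if_False)

lemma flag_vec_smult:
 fixes g :: "'k::field mat"
 assumes "g \<in> carrier_mat n n"
 shows "flag_vec I c (a \<cdot>\<^sub>m g) = flag_vec I (\<lambda>j. c j * a ^ k j) g"
 by (intro ext) (simp add: flag_vec_def wedge_cols_smult[OF assms])

lemma flag_vec_nonzero:
 fixes g :: "'k::field mat"
 assumes g: "g \<in> carrier_mat n n" "det g \<noteq> 0" and I: "I \<subseteq> {1..m}" and c: "\<And>j. j \<in> I \<Longrightarrow> c j \<noteq> 0"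
 shows "flag_vec I c g \<in> nonzero_tuples (\<lambda>j. ext_power n (k j)) I"
proof -
 have "flag_vec I c g j \<in> ext_power n (k j) \<and> flag_vec I c g j \<noteq> 0" if j: "j \<in> I" for j
 proof -
  have "k j \<le> n" using k_less_n[of j] j I by auto
  then obtain J where J: "wedge_cols n (k j) g J \<noteq> 0" using wedge_cols_nonzero[OF g] by (auto simp: fun_eq_iff)
  hence "flag_vec I c g j J \<noteq> 0" using j c by (simp add: flag_vec_def)
  hence "flag_vec I c g j \<noteq> 0" by auto
  moreover have "flag_vec I c g j \<in> ext_power n (k j)"
   using wedge_cols_ext_power[of n "k j" g] j by (auto simp: ext_power_def flag_vec_def)
  ultimately show ?thesis by blast
 qed
 thus ?thesis by (auto simp: nonzero_tuples_def flag_vec_def fun_eq_iff)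
qed

lemma proj_point_flag_vec:
 fixes g :: "'k::field mat"
 assumes "\<And>j. j \<in> I \<Longrightarrow> c j \<noteq> 0"
 shows "proj_point I (flag_vec I c g) = flag_point n k I g"
 unfolding flag_point_def
proof (rule proj_pointI)
 fix j assume j: "j \<in> I"
 thus "\<exists>a. a \<noteq> 0 \<and> flag_vec I c g j = (\<lambda>b. a * (if j \<in> I then wedge_cols n (k j) g else 0) b)"
  using assms by (intro exI[of _ "c j"]) (auto simp: flag_vec_def)
qed

lemma proj_point_eq_flag_point:
 fixes w :: "('k::field) fpoint"
 assumes "proj_point I w = flag_point n k I g" "\<And>j. j \<notin> I \<Longrightarrow> w j = 0"
 shows "\<exists>c. (\<forall>j\<in>I. c j \<noteq> 0) \<and> w = flag_vec I c g"
proof -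
 have "\<forall>j\<in>I. \<exists>c. c \<noteq> 0 \<and> w j = (\<lambda>b. c * wedge_cols n (k j) g b)"
 proof
  fix j assume j: "j \<in> I"
  show "\<exists>c. c \<noteq> 0 \<and> w j = (\<lambda>b. c * wedge_cols n (k j) g b)"
   using proj_pointD[OF assms(1)[unfolded flag_point_def] j] j by simp
 qed
 from bchoice[OF this] obtain c where c: "\<forall>j\<in>I. c j \<noteq> 0 \<and> w j = (\<lambda>b. c j * wedge_cols n (k j) g b)" by (elim exE)
 have "w = flag_vec I c g"
 proof (intro ext)
  fix j b
  show "w j b = flag_vec I c g j b"
   using c assms(2)[of j] by (cases "j \<in> I") (simp_all add: flag_vec_def)
 qed
 with c show ?thesis by blast
qed

lemma multicone_flags:
 "multicone (\<lambda>j. ext_power n (k j)) {1..m} (flag_variety n k {1..m}) = (tot :: ('k::alg_closed_field) fpoint set)"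
proof (intro equalityI subsetI)
 fix v :: "'k fpoint"
 assume "v \<in> multicone (\<lambda>j. ext_power n (k j)) {1..m} (flag_variety n k {1..m})"
 then obtain w where w: "w \<in> nonzero_tuples (\<lambda>j. ext_power n (k j)) {1..m}" "proj_point {1..m} w \<in> flag_variety n k {1..m}"
  and v: "\<forall>j\<in>{1..m}. \<exists>c. v j = (\<lambda>b. c * w j b)" "\<forall>j. j \<notin> {1..m} \<longrightarrow> v j = 0"
  unfolding multicone_def by blast
 obtain g where g: "g \<in> SL n" "proj_point {1..m} w = flag_point n k {1..m} g"
  using w(2) unfolding flag_variety_def by blast
 have "\<And>j. j \<notin> {1..m} \<Longrightarrow> w j = 0" using w(1) unfolding nonzero_tuples_def by blast
 then obtain c where c: "w = flag_vec {1..m} c g" using proj_point_eq_flag_point[OF g(2)] by blast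
 from bchoice[OF v(1)] obtain a where a: "\<forall>j\<in>{1..m}. v j = (\<lambda>b. a j * w j b)" by (elim exE)
 have "v = flag_vec {1..m} (\<lambda>j. a j * c j) g"
 proof (intro ext)
  fix j b
  show "v j b = flag_vec {1..m} (\<lambda>j. a j * c j) g j b"
  proof (cases "j \<in> {1..m}")
   case True
   thus ?thesis using a by (simp add: c flag_vec_in[OF True])
  next
   case False
   hence "v j = 0" using v(2) by blast
   thus ?thesis by (simp only: flag_vec_out[OF False] zero_fun_apply)
  qed
 qed
 moreover have "g \<in> carrier_mat n n" "det g \<noteq> 0" using g(1) by (auto simp: SL_def)
 ultimately show "v \<in> tot" unfolding tot_def by blast
next
 fix v :: "'k fpoint"
 assume "v \<in> tot"
 then obtain c g where g: "g \<in> carrier_mat n n" "det g \<noteq> 0" and v: "v = flag_vec {1..m} c g"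
  unfolding tot_def by blast
 obtain a where a: "a \<noteq> 0" "a \<cdot>\<^sub>m g \<in> SL n" using scale_to_SL[OF n_pos g] by blast
 let ?w = "flag_vec {1..m} (\<lambda>_. 1) g"
 have "?w \<in> nonzero_tuples (\<lambda>j. ext_power n (k j)) {1..m}" using flag_vec_nonzero[OF g] by simp
 moreover have "proj_point {1..m} ?w \<in> flag_variety n k {1..m}"
 proof -
  have "flag_point n k {1..m} (a \<cdot>\<^sub>m g) = proj_point {1..m} (flag_vec {1..m} (\<lambda>j. inverse (a ^ k j)) (a \<cdot>\<^sub>m g))"
   using a(1) by (intro proj_point_flag_vec[symmetric]) simp
  also have "flag_vec {1..m} (\<lambda>j. inverse (a ^ k j)) (a \<cdot>\<^sub>m g) = ?w"
   using a(1) by (simp add: flag_vec_smult[OF g(1)])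
  finally show ?thesis unfolding flag_variety_def using a(2) by (metis image_eqI)
 qed
 moreover have "\<forall>j\<in>{1..m}. \<exists>e. v j = (\<lambda>b. e * ?w j b)" "\<forall>j. j \<notin> {1..m} \<longrightarrow> v j = 0"
  by (auto simp: v flag_vec_def fun_eq_iff)
 ultimately show "v \<in> multicone (\<lambda>j. ext_power n (k j)) {1..m} (flag_variety n k {1..m})"
  unfolding multicone_def by blast
qed

text \<open>Multihomogeneity as a scaling law with one scalar per component. The finiteness of the
  support of d is proved along, since components are indexed by all natural numbers.\<close>

lemma mhom_scale_point:
 fixes F :: "('b, 'k::field) mpoint \<Rightarrow> 'k"
 assumes "mhom d F"
 shows "finite {j. d j \<noteq> 0} \<and> F (\<lambda>j b. c j * v j b) = (\<Prod>j\<in>{j. d j \<noteq> 0}. c j ^ d j) * F v"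
 using assms
proof induction
 case (mhom_coord j b)
 have "{j'. (evec j :: nat \<Rightarrow> nat) j' \<noteq> 0} = {j}" by (auto simp: evec_def)
 thus ?case by (simp add: evec_def)
next
 case (mhom_mult d F e G)
 let ?S = "\<lambda>d. {j. d j \<noteq> (0 :: nat)}"
 have fin: "finite (?S d)" "finite (?S e)" using mhom_mult.IH by auto
 have S: "?S (d + e) = ?S d \<union> ?S e" by (auto simp: plus_fun_def)
 have "(\<Prod>j\<in>?S (d + e). c j ^ (d + e) j) = (\<Prod>j\<in>?S d \<union> ?S e. c j ^ d j) * (\<Prod>j\<in>?S d \<union> ?S e. c j ^ e j)"
  unfolding S by (simp add: plus_fun_def power_add prod.distrib)
 also have "(\<Prod>j\<in>?S d \<union> ?S e. c j ^ d j) = (\<Prod>j\<in>?S d. c j ^ d j)"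
  using fin by (intro prod.mono_neutral_right) auto
 also have "(\<Prod>j\<in>?S d \<union> ?S e. c j ^ e j) = (\<Prod>j\<in>?S e. c j ^ e j)"
  using fin by (intro prod.mono_neutral_right) auto
 finally show ?case using mhom_mult.IH fin unfolding S by (simp add: mult_ac)
qed (simp_all add: zero_fun_def distrib_left)

text \<open>A point \<open>(c\<^sub>j v\<^sub>j)\<close> of the multicone may have \<open>c\<^sub>j = 0\<close>. If \<open>j\<^sub>0\<close> is the first index with
 \<open>c\<^sub>j \<noteq> 0\<close>, column operations on the first \<open>k\<^sub>j\<^sub>0\<close> columns turn the flag into one all of whose
 Pluecker coordinates satisfy the Schubert conditions.\<close>

lemma cone_flag_lift:
 fixes v :: "('k::field_char_0) fpoint"
 assumes J: "J \<in> csets" and v: "v \<in> cone J" and j0: "j0 \<in> {idx J..m}" "v j0 \<noteq> 0"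
  "\<And>j. j \<in> {idx J..m} \<Longrightarrow> v j \<noteq> 0 \<Longrightarrow> j0 \<le> j"
 shows "\<exists>c g. g \<in> carrier_mat n n \<and> det g \<noteq> 0 \<and> v = flag_vec {idx J..m} c g \<and>
  flag_vec {idx J..m} (\<lambda>_. 1) g \<in> cone J"
proof -
 let ?I = "{idx J..m}"
 have I: "?I \<subseteq> {1..m}" using idx(1)[OF J] by auto
 have j0m: "j0 \<in> {1..m}" using j0(1) I by blast
 obtain c g where g: "g \<in> carrier_mat n n" "det g \<noteq> 0" and vg: "v = flag_vec {1..m} c g"
  using v unfolding cone_def tot_def by blast
 have cone: "tle K J" if "K \<in> csets" "crd K v \<noteq> 0" for K using v that by (simp add: cone_def)
 let ?x = "entry g"
 have c0: "c j0 \<noteq> 0" using j0(2) by (auto simp: vg flag_vec_def fun_eq_iff split: if_splits)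
 define P where "P = (\<lambda>K. K \<subseteq> {1..n} \<and> card K = k j0 \<and> mnr ?x (sorted_list_of_set K) \<noteq> 0)"
 have P_tle: "tle K J" if "P K" for K
 proof (rule cone)
  show K: "K \<in> csets" using that j0m by (auto simp: P_def intro: csetsI)
  show "crd K v \<noteq> 0"
   unfolding vg crd_flag_vec[OF g(1) K] using that c0 idx_eq[OF j0m, of K] j0m by (simp add: P_def)
 qed
 have "k j0 \<le> n" using k_less_n[OF j0m] by simp
 obtain K0 where K0: "P K0"
 proof -
  obtain K where "wedge_cols n (k j0) g K \<noteq> 0" using wedge_cols_nonzero[OF g \<open>k j0 \<le> n\<close>] by (auto simp: fun_eq_iff)
  hence "P K" unfolding P_def wedge_cols_eq[OF g(1)] by (auto split: if_splits)
  thus thesis by (rule that)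
 qed
 have fin: "finite {\<Sum>K | K. P K}"
  by (rule finite_subset[of _ "sum (\<lambda>x. x) ` Pow {1..n}"]) (auto simp: P_def)
 \<comment> \<open>Among the row sets with a non-zero minor on the first \<open>k j0\<close>
   columns, one with the largest sum: the pivots of an upper triangular column echelon form.\<close>
 obtain M where M: "P M" "\<And>K. P K \<Longrightarrow> \<Sum>K \<le> \<Sum>M"
 proof -
  have "Max {\<Sum>K | K. P K} \<in> {\<Sum>K | K. P K}" using K0 fin by (intro Max_in) auto
  then obtain M where "P M" "\<Sum>M = Max {\<Sum>K | K. P K}" by auto
  thus thesis using fin Max_ge by (intro that[of M]) auto
 qed
 let ?l = "k j0"
 define L where "L = sorted_list_of_set M"
 have finM: "finite M" and MI: "M \<subseteq> {1..n}" using M(1) finite_subset by (auto simp: P_def)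
 have L: "sorted_wrt (<) L" "distinct L" "set L = M" "length L = ?l" using M(1) finM by (auto simp: L_def P_def)
 define U where "U = (\<lambda>r c. mnr ?x (L[c := r]))"
 have "\<forall>c\<in>{..<?l}. \<exists>C. \<forall>r. U r c = (\<Sum>d = 0..<?l. ?x r d * C d)"
  unfolding U_def using mnr_update_row[of _ L ?x] L(4) by auto
 from bchoice[OF this] obtain C where C: "\<forall>c\<in>{..<?l}. \<forall>r. U r c = (\<Sum>d = 0..<?l. ?x r d * C c d)" by (elim exE)
 define a where "a = det (mat ?l ?l (\<lambda>(d, c). C c d))"
 have UL: "U (L ! r) c = (if r = c then mnr ?x L else 0)" if "r < ?l" "c < ?l" for r c
 proof (cases "r = c")
  case False
  hence "L[c := L ! r] ! c = L[c := L ! r] ! r" using that L by simp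
  hence "\<not> distinct (L[c := L ! r])"
   using False that L(4) by (metis length_list_update nth_eq_iff_index_eq)
  thus ?thesis using False by (simp add: U_def mnr_not_distinct)
 qed (use that L(4) in \<open>simp add: U_def\<close>)
 have mL: "mnr ?x L \<noteq> 0" using M(1) by (simp add: P_def L_def)
 \<comment> \<open>A non-zero entry of U below the pivot would be a non-zero minor on a set of
   larger sum.\<close>
 have U_tri: "U r c = 0" if c: "c < ?l" and r: "r \<in> {1..n}" "L ! c < r" for r c
 proof (cases "r \<in> M")
  case True
  then obtain e where e: "e < ?l" "r = L ! e" using L by (metis in_set_conv_nth)
  hence "e \<noteq> c" using r(2) by auto
  thus ?thesis using UL[OF e(1) c] e(2) by simp
 next
  case False
  show ?thesis
  proof (rule ccontr)
   assume nz: "U r c \<noteq> 0"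
   have cM: "L ! c \<in> M" using c L nth_mem[of c L] by simp
   have set: "set (L[c := r]) = insert r (M - {L ! c})"
    using set_update_distinct[OF L(2), of c r] c L by simp
   have dist: "distinct (L[c := r])" using nz mnr_not_distinct[of "L[c := r]" ?x] by (auto simp: U_def)
   have "P (insert r (M - {L ! c}))"
    unfolding P_def
   proof (intro conjI)
    show "insert r (M - {L ! c}) \<subseteq> {1..n}" using MI r(1) by blast
    show "card (insert r (M - {L ! c})) = ?l" using distinct_card[OF dist] L(4) unfolding set by simp
    show "mnr ?x (sorted_list_of_set (insert r (M - {L ! c}))) \<noteq> 0"
     using mnr_sorted_nonzero[OF dist, of ?x] nz unfolding set U_def .
   qed
   hence "\<Sum>(insert r (M - {L ! c})) \<le> \<Sum>M" by (rule M(2))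
   moreover have "\<Sum>(insert r (M - {L ! c})) = r + \<Sum>(M - {L ! c})" using False finM by simp
   moreover have "\<Sum>M = L ! c + \<Sum>(M - {L ! c})" using sum.remove[OF finM cM, of "\<lambda>x. x"] .
   ultimately show False using r(2) by simp
  qed
 qed
 have multl: "mnr (\<lambda>r c. if c < ?l then U r c else ?x r c) R = mnr ?x R * a" if R: "?l \<le> length R" for R
 proof -
  let ?N = "length R"
  define e where "e = (\<lambda>d c. if c < ?l then if d < ?l then C c d else 0 else if d = c then 1 else 0)"
  have "mnr (\<lambda>r c. if c < ?l then U r c else ?x r c) R = mnr ?x R * det (mat ?N ?N (\<lambda>(d, c). e d c))"
  proof (rule mnr_mult_right)
   fix r c assume c: "c < ?N"
   show "(if c < ?l then U r c else ?x r c) = (\<Sum>d = 0..<?N. ?x r d * e d c)"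
   proof (cases "c < ?l")
    case True
    hence "U r c = (\<Sum>d = 0..<?l. ?x r d * e d c)" using C by (simp add: e_def)
    also have "\<dots> = (\<Sum>d = 0..<?N. ?x r d * e d c)"
     using R True by (intro sum.mono_neutral_left) (auto simp: e_def)
    finally show ?thesis using True by simp
   next
    case False
    have "(\<Sum>d = 0..<?N. ?x r d * e d c) = (\<Sum>d = 0..<?N. if d = c then ?x r d else 0)"
     using False by (intro sum.cong) (auto simp: e_def)
    thus ?thesis using False c by simp
   qed
  qed
  \<comment> \<open>The operation acts on the first \<open>?l\<close> columns by the cofactors C and
    leaves the others alone, so every minor of size at least \<open>?l\<close> is multiplied by
    a.\<close>
  also have "mat ?N ?N (\<lambda>(d, c). e d c) =
    four_block_mat (mat ?l ?l (\<lambda>(d, c). C c d)) (0\<^sub>m ?l (?N - ?l)) (0\<^sub>m (?N - ?l) ?l) (1\<^sub>m (?N - ?l))"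
   by (rule eq_matI) (use R in \<open>auto simp: e_def\<close>)
  also have "det \<dots> = det (mat ?l ?l (\<lambda>(d, c). C c d)) * det (1\<^sub>m (?N - ?l))"
   by (rule det_four_block_mat_upper_right_zero) auto
  finally show ?thesis by (simp add: a_def)
 qed
 have a0: "a \<noteq> 0"
 proof -
  have "mnr (\<lambda>r c. if c < ?l then U r c else ?x r c) L = (\<Prod>c = 0..<length L. if c < ?l then U (L ! c) c else ?x (L ! c) c)"
   by (rule mnr_lower_triangular) (simp add: UL L(4))
  also have "\<dots> \<noteq> 0" using mL by (simp add: UL L(4))
  finally show ?thesis using multl[of L] L(4) by auto
 qed
 define g' where "g' = mat n n (\<lambda>(r, c). if c < ?l then U (Suc r) c else g $$ (r, c))"
 have g': "g' \<in> carrier_mat n n" by (simp add: g'_def)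
 have ent: "entry g' r c = (if c < ?l then U r c else ?x r c)" if "r \<in> {1..n}" "c < n" for r c
  using that by (auto simp: entry_def g'_def)
 have mnr': "mnr (entry g') R = mnr ?x R * a" if "set R \<subseteq> {1..n}" "length R \<le> n" "?l \<le> length R" for R
 proof -
  have "mnr (entry g') R = mnr (\<lambda>r c. if c < ?l then U r c else ?x r c) R"
   using that by (intro mnr_cong ent) auto
  thus ?thesis using multl[OF that(3)] by simp
 qed
 have det: "det g' \<noteq> 0"
 proof -
  have "mnr (entry g') [1..<Suc n] = mnr ?x [1..<Suc n] * a"
   using \<open>?l \<le> n\<close> by (intro mnr') auto
  thus ?thesis using g(2) a0 unfolding det_eq_mnr[OF g'] det_eq_mnr[OF g(1)] by simp
 qed
 \<comment> \<open>Components before \<open>j0\<close> vanish by the choice of \<open>j0\<close>;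
   the others see the column operation only as the factor a.\<close>
 have v_eq: "v = flag_vec ?I (\<lambda>j. if j0 \<le> j then c j / a else 0) g'"
 proof (intro ext)
  fix j K
  show "v j K = flag_vec ?I (\<lambda>j. if j0 \<le> j then c j / a else 0) g' j K"
  proof (cases "j \<in> {1..m} \<and> K \<subseteq> {1..n} \<and> card K = k j")
   case True
   hence K: "K \<in> csets" "idx K = j" by (auto intro: csetsI idx_eq)
   have finK: "finite K" by (rule csets_finite[OF K(1)])
   consider "j \<notin> ?I" | "j \<in> ?I" "\<not> j0 \<le> j" | "j \<in> ?I" "j0 \<le> j" by blast
   thus ?thesis
   proof cases
    case 1
    hence "\<not> tle K J" using tle_idx[OF K(1) J] True K(2) by auto
    hence "v j K = 0" using cone[OF K(1)] K(2) by (auto simp: crd_def)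
    thus ?thesis by (simp only: flag_vec_out[OF 1])
   next
    case 2
    hence "v j = 0" using j0(3)[of j] by blast
    thus ?thesis using 2 by (simp add: flag_vec_def)
   next
    case 3
    have "?l \<le> k j" "k j < n" using 3 True k_le_iff[OF j0m, of j] k_less_n[of j] by auto
    hence "mnr (entry g') (sorted_list_of_set K) = mnr ?x (sorted_list_of_set K) * a"
     using True finK by (intro mnr') auto
    thus ?thesis using 3 True a0 by (simp add: vg flag_vec_def wedge_cols_eq g(1) g')
   qed
  next
   case False
   thus ?thesis using I by (auto simp: vg flag_vec_def wedge_cols_def)
  qed
 qed
 have idxl: "card J \<le> k j" if "j \<in> ?I" for j
  using that idx[OF J] k_le_iff[OF idx(1)[OF J], of j] I by auto
 have "flag_vec ?I (\<lambda>_. 1) g' \<in> cone J"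
  unfolding cone_def
 proof (intro CollectI conjI ballI impI)
  show "flag_vec ?I (\<lambda>_. 1) g' \<in> tot"
   unfolding tot_def flag_vec_restrict[OF I] using g' det by blast
  fix K assume K: "K \<in> csets" "crd K (flag_vec ?I (\<lambda>_. 1) g') \<noteq> 0"
  have finK: "finite K" and KI: "K \<subseteq> {1..n}" using csets_finite[OF K(1)] csets_sub[OF K(1)] by auto
  have idxK: "idx K \<in> ?I" and mK: "mnr (entry g') (sorted_list_of_set K) \<noteq> 0"
   using K(2) unfolding crd_flag_vec[OF g' K(1)] by (auto split: if_splits)
  have cK: "card K = k (idx K)" "card K < n" using idx[OF K(1)] k_less_n[of "idx K"] by auto
  show "tle K J"
  \<comment> \<open>A large K contains \<open>?l\<close> rows with a non-zero minor, to which the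
    conditions on v apply. For smaller K triangularity compares K with the first pivots, which are
    themselves below J.\<close>
  proof (cases "j0 \<le> idx K")
   case True
   hence "?l \<le> card K" using k_le_iff[OF j0m idx(1)[OF K(1)]] cK by simp
   hence "mnr ?x (sorted_list_of_set K) \<noteq> 0"
    using mK mnr'[of "sorted_list_of_set K"] KI finK cK by auto
   then obtain K' where K': "K' \<subseteq> K" "card K' = ?l" "mnr ?x (sorted_list_of_set K') \<noteq> 0"
    using mnr_sub_nonzero[OF finK _ \<open>?l \<le> card K\<close>] by blast
   hence "tle K' J" using KI by (intro P_tle) (auto simp: P_def)
   thus ?thesis using tle_subset[OF K'(1)] tle_trans by blast
  next
   case False
   hence le: "card K \<le> ?l" using k_le_iff[OF idx(1)[OF K(1)] j0m] cK by simp
   let ?R = "sorted_list_of_set K"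
   obtain p where p: "p permutes {0..<length ?R}" "\<forall>i<length ?R. entry g' (?R ! i) (p i) \<noteq> 0"
    using mnr_nonzeroD[OF mK] by blast
   have "tle (set ?R) (set (take (card K) L))"
   proof (rule tle_permuted[where f = "\<lambda>c. L ! c", OF _ p(1)])
    show "inj_on ((!) L) {0..<length ?R}"
     using le L(2,4) by (auto simp: inj_on_def nth_eq_iff_index_eq)
    show "(!) L ` {0..<length ?R} = set (take (card K) L)"
     using nth_image[of "card K" L] le L(4) by simp
    show "?R ! i \<le> L ! p i" if i: "i < length ?R" for i
    proof (rule ccontr)
     assume "\<not> ?R ! i \<le> L ! p i"
     moreover have pi: "p i < card K" using permutes_in_image[OF p(1), of i] i by simp
     moreover have Ri: "?R ! i \<in> {1..n}" using nth_mem[OF i] finK KI by auto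
     ultimately have "U (?R ! i) (p i) = 0" using le by (intro U_tri) auto
     moreover have "entry g' (?R ! i) (p i) = U (?R ! i) (p i)" using ent[OF Ri, of "p i"] pi le cK by simp
     ultimately show False using p(2) i by simp
    qed
   qed simp
   hence "tle K (set (take (card K) L))" using finK by simp
   moreover have "tle (set (take (card K) L)) J"
    unfolding L_def using tle_take[OF P_tle[OF M(1)] finM csets_sub[OF J]] idxl[OF idxK] cK(1) by simp
   ultimately show ?thesis by (rule tle_trans)
  qed
 qed
 thus ?thesis using g' det v_eq by blast
qed

end

section \<open>Column sets and the equations of the strata\<close>

context flag_setup
begin

lemma strataD:
 assumes "p \<in> flag_strata n m k"
 obtains \<sigma> where "snd p \<in> {1..m}" "\<sigma> permutes {1..n}" "fst p = flag_coset n {k (snd p)} \<sigma>"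
  "column_set k p = \<sigma> ` {1..k (snd p)}"
proof -
 obtain \<theta> i where p: "p = (\<theta>, i)" by (cases p)
 have i: "i \<in> {1..m}" and "\<theta> \<in> lcosets\<^bsub>sym_group n\<^esub> weyl_par n {k i}"
  using assms by (auto simp: flag_strata_def p)
 then obtain \<sigma> where \<sigma>: "\<sigma> permutes {1..n}" "\<theta> = flag_coset n {k i} \<sigma>"
  by (auto simp: lcosets_weyl_par)
 have "(\<Union>\<tau>\<in>\<theta>. \<tau> ` {1..k i}) = \<sigma> ` {1..k i}"
  using flag_coset_self[OF \<sigma>(1), of "{k i}"] unfolding \<sigma>(2) by (auto simp: flag_coset_def)
 thus thesis using that[of \<sigma>] i \<sigma> by (simp add: p column_set_def)
qed

lemma column_set_csets:
 assumes "p \<in> flag_strata n m k"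
 shows "column_set k p \<in> csets" "card (column_set k p) = k (snd p)" "idx (column_set k p) = snd p"
proof -
 obtain \<sigma> where \<sigma>: "snd p \<in> {1..m}" "\<sigma> permutes {1..n}" "column_set k p = \<sigma> ` {1..k (snd p)}"
  using strataD[OF assms] by metis
 have "k (snd p) \<le> n" using k_less_n[OF \<sigma>(1)] by simp
 note im = permutes_image_initial[OF \<sigma>(2) this]
 show c: "card (column_set k p) = k (snd p)" unfolding \<sigma>(3) by (rule im(2))
 show "column_set k p \<in> csets" using im(1) \<sigma>(1) c by (intro csetsI) (auto simp: \<sigma>(3))
 show "idx (column_set k p) = snd p" by (rule idx_eq[OF \<sigma>(1) c])
qed

lemma bij_column_set: "bij_betw (column_set k) (flag_strata n m k) csets"
 unfolding bij_betw_def
proof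
 show "inj_on (column_set k) (flag_strata n m k)"
 proof (rule inj_onI)
  fix p q assume p: "p \<in> flag_strata n m k" and q: "q \<in> flag_strata n m k" and eq: "column_set k p = column_set k q"
  have snd: "snd p = snd q" using column_set_csets(3)[OF p] column_set_csets(3)[OF q] eq by simp
  obtain \<sigma> where \<sigma>: "fst p = flag_coset n {k (snd p)} \<sigma>" "column_set k p = \<sigma> ` {1..k (snd p)}"
   using strataD[OF p] by metis
  obtain \<tau> where \<tau>: "fst q = flag_coset n {k (snd q)} \<tau>" "column_set k q = \<tau> ` {1..k (snd q)}"
   using strataD[OF q] by metis
  have "fst p = fst q" unfolding \<sigma>(1) \<tau>(1) flag_coset_def using \<sigma>(2) \<tau>(2) eq snd by simp
  with snd show "p = q" by (simp add: prod_eq_iff)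
 qed
 show "column_set k ` flag_strata n m k = csets"
 proof (intro equalityI subsetI)
  fix J assume J: "J \<in> csets"
  define p where "p = (flag_coset n {card J} (lift_perm n J), idx J)"
  have p: "p \<in> flag_strata n m k"
   using idx[OF J] lift_perm_facts(1)[OF J] by (auto simp: p_def flag_strata_def lcosets_weyl_par)
  obtain \<sigma> where \<sigma>: "\<sigma> permutes {1..n}" "fst p = flag_coset n {k (snd p)} \<sigma>" "column_set k p = \<sigma> ` {1..k (snd p)}"
   using strataD[OF p] by metis
  have "\<sigma> \<in> fst p" unfolding \<sigma>(2) by (rule flag_coset_self[OF \<sigma>(1)])
  hence "\<sigma> ` {1..card J} = J" using lift_perm_facts(2)[OF J] by (simp add: p_def flag_coset_def)
  hence "column_set k p = J" using \<sigma>(3) idx(2)[OF J] by (simp add: p_def)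
  with p show "J \<in> column_set k ` flag_strata n m k" by blast
 qed (auto simp: column_set_csets)
qed

lemma max_lift_strata:
 assumes p: "p \<in> flag_strata n m k"
 shows "max_lift n (k ` {snd p..m}) (fst p) =
  flag_coset n (k ` {snd p..m}) (lift_perm n (column_set k p))"
proof -
 obtain \<sigma> where \<sigma>: "snd p \<in> {1..m}" "\<sigma> permutes {1..n}" "fst p = flag_coset n {k (snd p)} \<sigma>"
  "column_set k p = \<sigma> ` {1..k (snd p)}"
  by (rule strataD[OF p])
 note c = column_set_csets[OF p]
 have "k j \<in> {k (snd p)..n}" if "j \<in> {snd p..m}" for j
  using that k_le_iff[OF \<sigma>(1), of j] k_less_n[of j] \<sigma>(1) by auto
 hence D: "card (column_set k p) \<in> k ` {snd p..m}" "k ` {snd p..m} \<subseteq> {card (column_set k p)..n}"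
  using \<sigma>(1) c(2) by auto
 show ?thesis
  using max_lift_flag_coset[OF csets_sub[OF c(1)] \<sigma>(2) _ D] \<sigma>(3,4) c(2) by simp
qed

lemma schubert_cell_points:
 fixes w :: "('k::alg_closed_field) fpoint"
 assumes p: "p \<in> flag_strata n m k" and J: "J = column_set k p"
  and b: "b \<in> borel n" and \<sigma>: "\<sigma> \<in> flag_coset n (k ` {idx J..m}) (lift_perm n J)" and s: "s \<in> weyl_reps n \<sigma>"
  and K: "K \<in> csets" and nz: "crd K (flag_vec {idx J..m} c (b * s) :: 'k fpoint) \<noteq> 0"
 shows "tle K J"
proof -
 have Jc: "J \<in> csets" using column_set_csets[OF p] J by simp
 have \<sigma>': "\<sigma> permutes {1..n}" using \<sigma> by (simp add: flag_coset_def)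
 have "card J \<in> k ` {idx J..m}" using idx[OF Jc] by (intro image_eqI[of _ _ "idx J"]) auto
 hence "\<sigma> ` {1..card J} = lift_perm n J ` {1..card J}"
  using \<sigma> unfolding flag_coset_def by blast
 hence im: "\<sigma> ` {1..card J} = J" unfolding lift_perm_facts(2)[OF Jc] .
 obtain \<beta> where \<beta>: "upper_fun n \<beta>" "b * s = perm_cols n \<sigma> \<beta>"
  using borel_weyl_perm_cols[OF \<sigma>' b s] by blast
 have "flag_vec {idx J..m} c (b * s) \<in> cell {idx J..m} \<sigma>"
  unfolding cell_def \<beta>(2) using \<beta>(1) by blast
 from crd_cell_nonzero[OF this \<sigma>' im K Jc nz] show ?thesis .
qed

text \<open>A point of the Schubert variety satisfies every multihomogeneous relation of its cell,
  in particular those of flags and those defining the cone, so it is a flag subject to the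
  conditions. Conversely a point of the cone is lifted to one with non-zero components, as the
  multicone demands, and density puts the lift into the closure.\<close>

lemma scone_eq_cone:
 assumes p: "p \<in> flag_strata n m k"
 shows "scone str p = (cone (column_set k p) :: ('k::{alg_closed_field, field_char_0}) fpoint set)"
proof -
 define J where "J = column_set k p"
 have J: "J \<in> csets" "idx J = snd p" using column_set_csets[OF p] by (simp_all add: J_def)
 let ?I = "{idx J..m}" and ?V = "\<lambda>j. ext_power n (k j) :: (nat set \<Rightarrow> 'k) set"
 let ?\<tau> = "flag_coset n (k ` ?I) (lift_perm n J)"
 let ?S = "{flag_point n k ?I (b * s) | b s. b \<in> borel n \<and> (\<exists>\<sigma>\<in>?\<tau>. s \<in> weyl_reps n \<sigma>)} :: (nat \<Rightarrow> (nat set \<Rightarrow> 'k) set) set"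
 have I: "?I \<subseteq> {1..m}" using idx(1)[OF J(1)] by auto
 have "scone str p = multicone ?V ?I (schubert_variety n k ?I (max_lift n (k ` ?I) (fst p)))"
  by (simp add: flag_stratification_def Let_def case_prod_beta J(2))
 also have "max_lift n (k ` ?I) (fst p) = ?\<tau>" 
  using max_lift_strata[OF p] unfolding J_def[symmetric] J(2) .
 also have "multicone ?V ?I (schubert_variety n k ?I ?\<tau>) = multicone ?V ?I (zariski_closure ?V ?I ?S)"
  by (simp add: schubert_variety_def)
 also have "\<dots> = cone J"
 proof (intro equalityI subsetI)
  fix v assume "v \<in> multicone ?V ?I (zariski_closure ?V ?I ?S)"
  then obtain w' where w': "proj_point ?I w' \<in> zariski_closure ?V ?I ?S"
   and v: "\<forall>j\<in>?I. \<exists>c. v j = (\<lambda>b. c * w' j b)" "\<forall>j. j \<notin> ?I \<longrightarrow> v j = 0"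
   unfolding multicone_def by blast
  obtain w where ww': "proj_point ?I w' = proj_point ?I w" and w: "w \<in> nonzero_tuples ?V ?I"
   and clos: "\<forall>d F. mhom d F \<and> (\<forall>u\<in>nonzero_tuples ?V ?I. proj_point ?I u \<in> ?S \<longrightarrow> F u = 0) \<longrightarrow> F w = 0"
   using w' unfolding zariski_closure_def by blast
  have S_flag: "\<exists>c b s \<sigma>. u = flag_vec ?I c (b * s) \<and> b \<in> borel n \<and> \<sigma> \<in> ?\<tau> \<and> s \<in> weyl_reps n \<sigma>"
   if u: "u \<in> nonzero_tuples ?V ?I" "proj_point ?I u \<in> ?S" for u
  proof -
   obtain b s \<sigma> where bs: "proj_point ?I u = flag_point n k ?I (b * s)" "b \<in> borel n" "\<sigma> \<in> ?\<tau>" "s \<in> weyl_reps n \<sigma>"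
    using u(2) by blast
   have "\<And>j. j \<notin> ?I \<Longrightarrow> u j = 0" using u(1) unfolding nonzero_tuples_def by blast
   then obtain c where "u = flag_vec ?I c (b * s)" using proj_point_eq_flag_point[OF bs(1)] by blast
   with bs show ?thesis by blast
  qed
  have "flag_limit ?I w"
   unfolding flag_limit_def
  proof (intro allI impI)
   fix d and F :: "'k fpoint \<Rightarrow> 'k"
   assume F: "mhom d F" "\<forall>c g. g \<in> carrier_mat n n \<longrightarrow> det g \<noteq> 0 \<longrightarrow> F (flag_vec ?I c g) = 0"
   have "F u = 0" if u: "u \<in> nonzero_tuples ?V ?I" "proj_point ?I u \<in> ?S" for u
   proof -
    obtain c b s \<sigma> where bs: "u = flag_vec ?I c (b * s)" "b \<in> borel n" "s \<in> weyl_reps n \<sigma>"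
     using S_flag[OF u] by blast
    have "b * s \<in> carrier_mat n n" "det (b * s) = 1"
     using bs(2,3) det_mult[of b n s] by (auto simp: borel_def weyl_reps_def SL_def)
    thus ?thesis using F(2) bs(1) by simp
   qed
   thus "F w = 0" using clos F(1) by blast
  qed
  moreover have "\<And>j. j \<in> ?I \<Longrightarrow> w j \<in> ?V j \<and> w j \<noteq> 0" "\<And>j. j \<notin> ?I \<Longrightarrow> w j = 0"
   using w unfolding nonzero_tuples_def by blast+
  ultimately obtain c g where g: "g \<in> carrier_mat n n" "det g \<noteq> 0" "w = flag_vec ?I c g"
   using flag_closed[of "idx J" w] idx(1)[OF J(1)] by blast
  have tle_w: "tle K J" if K: "K \<in> csets" "crd K w \<noteq> 0" for K
  proof (rule ccontr)
   assume neg: "\<not> tle K J"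
   have "mhom (evec (idx K)) (crd K :: 'k fpoint \<Rightarrow> 'k)"
    unfolding crd_def[abs_def] by (rule mhom_coord)
   moreover have "crd K u = 0" if u: "u \<in> nonzero_tuples ?V ?I" "proj_point ?I u \<in> ?S" for u
   proof -
    obtain c b s \<sigma> where bs: "u = flag_vec ?I c (b * s)" "b \<in> borel n" "\<sigma> \<in> ?\<tau>" "s \<in> weyl_reps n \<sigma>"
     using S_flag[OF u] by blast
    thus ?thesis using schubert_cell_points[OF p J_def bs(2,3,4) K(1), of c] neg by blast
   qed
   ultimately have "crd K w = 0" using clos by blast
   with K(2) show False by simp
  qed
  have "\<forall>j\<in>?I. \<exists>a. v j = (\<lambda>b. a * w j b)"
  proof
   fix j assume j: "j \<in> ?I"
   obtain a where a: "v j = (\<lambda>b. a * w' j b)" using v(1) j by blast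
   obtain e where e: "w' j = (\<lambda>b. e * w j b)" using proj_pointD[OF ww' j] by blast
   show "\<exists>a. v j = (\<lambda>b. a * w j b)" by (rule exI[of _ "a * e"]) (simp add: a e mult.assoc)
  qed
  from bchoice[OF this] obtain a where a: "\<forall>j\<in>?I. v j = (\<lambda>b. a j * w j b)" by (elim exE)
  have vw: "v j b = (if j \<in> ?I then a j * w j b else 0)" for j b
   using a v(2)[rule_format, of j] by (cases "j \<in> ?I") (simp_all only: if_True if_False simp_thms zero_fun_apply)
  have "v = flag_vec ?I (\<lambda>j. a j * c j) g"
   by (intro ext) (simp add: vw g(3) flag_vec_def)
  hence "v \<in> tot" unfolding tot_def flag_vec_restrict[OF I] using g(1,2) by blast
  moreover have "tle K J" if K: "K \<in> csets" "crd K v \<noteq> 0" for K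
   using tle_w[OF K(1)] K(2) unfolding crd_def vw by (auto split: if_splits)
  ultimately show "v \<in> cone J" by (simp add: cone_def)
 next
  fix v :: "'k fpoint" assume v: "v \<in> cone J"
  have out: "v j = 0" if "j \<notin> ?I" for j
  proof
   fix K
   have "v \<in> tot" using v by (simp add: cone_def)
   then obtain c g where vg: "v = flag_vec {1..m} c g" unfolding tot_def by blast
   show "v j K = 0 K"
   proof (cases "j \<in> {1..m} \<and> K \<subseteq> {1..n} \<and> card K = k j")
    case True
    hence K: "K \<in> csets" "idx K = j" by (auto intro: csetsI idx_eq)
    hence "\<not> tle K J" using tle_idx[OF K(1) J(1)] that True by auto
    hence "crd K v = 0" using v K(1) unfolding cone_def by blast
    thus ?thesis by (simp add: crd_def K(2))
   next
    case False
    thus ?thesis by (auto simp: vg flag_vec_def wedge_cols_def)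
   qed
  qed
  have "\<exists>c g. g \<in> carrier_mat n n \<and> det g \<noteq> 0 \<and> v = flag_vec ?I c g \<and> flag_vec ?I (\<lambda>_. 1) g \<in> cone J"
  proof (cases "\<exists>j\<in>?I. v j \<noteq> 0")
   case True
   define j0 where "j0 = (LEAST j. j \<in> ?I \<and> v j \<noteq> 0)"
   have "j0 \<in> ?I \<and> v j0 \<noteq> 0" unfolding j0_def by (rule LeastI_ex) (use True in blast)
   moreover have "j0 \<le> j" if "j \<in> ?I" "v j \<noteq> 0" for j unfolding j0_def using that by (intro Least_le) blast
   ultimately show ?thesis using cone_flag_lift[OF J(1) v, of j0] by blast
  next
   case False
   hence v0: "v = 0" using out by (metis ext zero_fun_apply)
   define \<beta> :: "nat \<Rightarrow> nat \<Rightarrow> 'k" where "\<beta> = (\<lambda>r c. if r = c then 1 else 0)"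
   have \<beta>: "upper_fun n \<beta>" by (simp add: \<beta>_def upper_fun_def)
   let ?g = "perm_cols n (lift_perm n J) \<beta>"
   have "flag_vec ?I (\<lambda>_. 1) ?g \<in> open_cell J" unfolding open_cell_def cell_def using \<beta> by blast
   hence "flag_vec ?I (\<lambda>_. 1) ?g \<in> cone J" by (rule open_cell_sub_cone[OF J(1)])
   moreover have "v = flag_vec ?I (\<lambda>_. 0) ?g" unfolding v0 by (intro ext) (simp add: flag_vec_def)
   ultimately show ?thesis
    using perm_cols_carrier[of n "lift_perm n J" \<beta>] det_perm_cols[OF lift_perm_facts(1)[OF J(1)] \<beta>] by blast
  qed
  then obtain c g where g: "g \<in> carrier_mat n n" "det g \<noteq> 0" "v = flag_vec ?I c g"
   and wc: "flag_vec ?I (\<lambda>_. 1) g \<in> cone J" by blast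
  let ?w = "flag_vec ?I (\<lambda>_. 1) g"
  have wn: "?w \<in> nonzero_tuples ?V ?I" using flag_vec_nonzero[OF g(1,2) I] by simp
  \<comment> \<open>F is only known to vanish where all components are non-zero. Multihomogeneity
    extends this to the whole open cell, whose points may have zero coefficients.\<close>
  have "F ?w = 0" if F: "mhom d F" "\<forall>u\<in>nonzero_tuples ?V ?I. proj_point ?I u \<in> ?S \<longrightarrow> F u = 0" for d F
  proof (rule cone_dense[OF polyfun_mhom[OF F(1)] _ J(1) wc])
   fix u :: "'k fpoint" assume "u \<in> open_cell J"
   then obtain a \<beta> where \<beta>: "upper_fun n \<beta>" "u = flag_vec ?I a (perm_cols n (lift_perm n J) \<beta>)"
    unfolding open_cell_def cell_def by blast
   let ?\<sigma> = "lift_perm n J" let ?g = "perm_cols n ?\<sigma> \<beta>"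
   have \<sigma>: "?\<sigma> permutes {1..n}" by (rule lift_perm_facts(1)[OF J(1)])
   obtain b s e where bs: "b \<in> borel n" "s \<in> weyl_reps n ?\<sigma>" "e \<noteq> 0" "b * s = e \<cdot>\<^sub>m ?g"
    using perm_cols_borel_weyl[OF n_pos \<sigma> \<beta>(1)] by blast
   let ?u = "flag_vec ?I (\<lambda>_. 1) ?g"
   have "?u \<in> nonzero_tuples ?V ?I"
    using flag_vec_nonzero[OF perm_cols_carrier det_perm_cols[OF \<sigma> \<beta>(1)] I] by simp
   moreover have "proj_point ?I ?u \<in> ?S"
   proof -
    have "?u = flag_vec ?I (\<lambda>j. inverse (e ^ k j)) (b * s)"
     unfolding bs(4) flag_vec_smult[OF perm_cols_carrier] using bs(3) by simp
    hence "proj_point ?I ?u = flag_point n k ?I (b * s)"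
     using proj_point_flag_vec[of ?I "\<lambda>j. inverse (e ^ k j)" "b * s"] bs(3) by simp
    moreover have "?\<sigma> \<in> ?\<tau>" by (rule flag_coset_self[OF \<sigma>])
    ultimately show ?thesis using bs(1,2) by blast
   qed
   ultimately have "F ?u = 0" using F(2) by blast
   moreover have "u = (\<lambda>j b. a j * ?u j b)" unfolding \<beta>(2) by (intro ext) (simp add: flag_vec_def)
   ultimately show "F u = 0" using mhom_scale_point[OF F(1), of a ?u] by simp
  qed
  hence "proj_point ?I ?w \<in> zariski_closure ?V ?I ?S"
   unfolding zariski_closure_def using wn by blast
  moreover have "\<forall>j\<in>?I. \<exists>a. v j = (\<lambda>b. a * ?w j b)" unfolding g(3) by (auto simp: flag_vec_def)
  ultimately show "v \<in> multicone ?V ?I (zariski_closure ?V ?I ?S)"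
   unfolding multicone_def using wn out by blast
 qed
 finally show ?thesis by (simp add: J_def)
qed

lemma total_str: "total str = (tot :: ('k::alg_closed_field) fpoint set)"
 by (simp add: flag_stratification_def Let_def multicone_flags)

lemma strata_str: "strata str = flag_strata n m k" "nfac str = m"
 by (simp_all add: flag_stratification_def Let_def)

lemma extremal_str:
 assumes "p \<in> flag_strata n m k"
 shows "extremal str p = (restr tot (crd (column_set k p)) :: ('k::alg_closed_field) fpoint \<Rightarrow> 'k)"
 using column_set_csets(3)[OF assms]
 by (simp add: flag_stratification_def Let_def multicone_flags crd_def[abs_def])

end

section \<open>Valuations along maximal chains\<close>

text \<open>The properties of flags on which the valuations depend. \<open>boundary\<close> says
  that the extremal function generates the ideal of the smaller strata, which forces all bonds to be
  1; the action \<open>tor\<close> with its increasing weights bounds the orders of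
  vanishing.\<close>

locale seshadri =
 fixes S :: "('a, 'b, 'k::field_char_0) stratification"
  and ext :: "'a \<Rightarrow> ('b, 'k) mpoint \<Rightarrow> 'k" and wt :: "'a \<Rightarrow> nat"
  and tor :: "'k \<Rightarrow> ('b, 'k) mpoint \<Rightarrow> ('b, 'k) mpoint" and top :: 'a
 assumes finite_strata: "finite (strata S)"
  and irreducible: "\<And>p F G u w. p \<in> strata S \<Longrightarrow> polyfun F \<Longrightarrow> polyfun G \<Longrightarrow> u \<in> scone S p \<Longrightarrow> F u \<noteq> 0 \<Longrightarrow>
   w \<in> scone S p \<Longrightarrow> G w \<noteq> 0 \<Longrightarrow> \<exists>v\<in>scone S p. F v * G v \<noteq> 0"
  and polyfun_ext: "\<And>p. p \<in> strata S \<Longrightarrow> polyfun (ext p)"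
  and extremal_eq: "\<And>p. p \<in> strata S \<Longrightarrow> extremal S p = restr (total S) (ext p)"
  and zero_in_scone: "\<And>p. p \<in> strata S \<Longrightarrow> 0 \<in> scone S p"
  and ext_zero: "\<And>p. p \<in> strata S \<Longrightarrow> ext p 0 = 0"
  and ext_nonzero_iff: "\<And>p q. p \<in> strata S \<Longrightarrow> q \<in> strata S \<Longrightarrow> (\<exists>v\<in>scone S p. ext q v \<noteq> 0) \<longleftrightarrow> str_le S q p"
  and boundary: "\<And>p F. p \<in> strata S \<Longrightarrow> polyfun F \<Longrightarrow> F 0 = 0 \<Longrightarrow>
   (\<And>q v. q \<in> strata S \<Longrightarrow> str_less S q p \<Longrightarrow> v \<in> scone S q \<Longrightarrow> F v = 0) \<Longrightarrow>
   \<exists>G. polyfun G \<and> (\<forall>v\<in>scone S p. F v = ext p v * G v)"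
  and le_antisym: "\<And>p q. p \<in> strata S \<Longrightarrow> q \<in> strata S \<Longrightarrow> str_le S p q \<Longrightarrow> str_le S q p \<Longrightarrow> p = q"
  and wt_less: "\<And>p q. p \<in> strata S \<Longrightarrow> q \<in> strata S \<Longrightarrow> str_less S q p \<Longrightarrow> wt q < wt p"
  and wt_pos: "\<And>p. p \<in> strata S \<Longrightarrow> 0 < wt p"
  and tor_scone: "\<And>p t v. p \<in> strata S \<Longrightarrow> t \<noteq> 0 \<Longrightarrow> v \<in> scone S p \<Longrightarrow> tor t v \<in> scone S p"
  and tor_ext: "\<And>p t v. p \<in> strata S \<Longrightarrow> ext p (tor t v) = t ^ wt p * ext p v"
  and tor_one: "\<And>v. tor 1 v = v"
  and tor_poly: "\<And>v j b. is_poly (\<lambda>t. tor t v j b)"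
  and top: "top \<in> strata S" "scone S top = total S"
  and le_top: "\<And>p. p \<in> strata S \<Longrightarrow> str_le S p top"
begin

text \<open>Not vanishing identically on a stratum means being invertible at its generic
  point.\<close>

definition nz :: "'a option \<Rightarrow> (('b, 'k) mpoint \<Rightarrow> 'k) \<Rightarrow> bool" where
 "nz q F \<longleftrightarrow> (\<exists>v\<in>scone' S q. F v \<noteq> 0)"

definition covers :: "'a \<Rightarrow> 'a option \<Rightarrow> bool" where
 "covers p q \<longleftrightarrow> p \<in> strata S \<and> (case q of
   None \<Rightarrow> \<forall>x\<in>strata S. \<not> str_less S x p
  | Some q \<Rightarrow> q \<in> strata S \<and> str_less S q p \<and> (\<forall>x\<in>strata S. str_less S q x \<longrightarrow> \<not> str_less S x p))"

lemma le_trans: "str_le S p q \<Longrightarrow> str_le S q r \<Longrightarrow> str_le S p r"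
 unfolding str_le_def by blast

lemma le_refl [simp]: "str_le S p p"
 by (simp add: str_le_def)

lemma less_trans: "p \<in> strata S \<Longrightarrow> q \<in> strata S \<Longrightarrow> str_less S p q \<Longrightarrow> str_less S q r \<Longrightarrow> str_less S p r"
 unfolding str_less_def by (auto dest: le_trans intro: le_antisym)

lemma covers_strata: "covers p q \<Longrightarrow> p \<in> strata S" "covers p (Some q') \<Longrightarrow> q' \<in> strata S"
 by (auto simp: covers_def)

definition strat :: "'a option \<Rightarrow> bool" where
 "strat q \<longleftrightarrow> (case q of None \<Rightarrow> True | Some p \<Rightarrow> p \<in> strata S)"

lemma strat_simps [simp]: "strat None" "strat (Some p) \<longleftrightarrow> p \<in> strata S"
 by (simp_all add: strat_def)

lemma covers_strat: "covers p q \<Longrightarrow> strat q"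
 by (cases q) (auto simp: covers_def)

lemma nz_mult:
 assumes "strat q" "polyfun F" "polyfun G" "nz q F" "nz q G"
 shows "nz q (\<lambda>v. F v * G v)"
proof (cases q)
 case None
 thus ?thesis using assms by (auto simp: nz_def)
next
 case (Some p)
 thus ?thesis using assms irreducible[of p F G] unfolding nz_def by (simp del: mult_eq_0_iff) blast
qed

lemma nz_power: "strat q \<Longrightarrow> polyfun F \<Longrightarrow> nz q F \<Longrightarrow> nz q (\<lambda>v. F v ^ e)"
proof (induction e)
 case 0
 thus ?case by (auto simp: nz_def)
next
 case (Suc e)
 thus ?case using nz_mult[of q F "\<lambda>v. F v ^ e"] polyfun_power by auto
qed

lemma nz_cong: "nz q F \<Longrightarrow> (\<And>v. v \<in> scone' S q \<Longrightarrow> F v = G v) \<Longrightarrow> nz q G"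
 unfolding nz_def by (elim bexE) (rule bexI, simp_all)

lemma nz_multD: "nz q (\<lambda>v. F v * G v) \<Longrightarrow> nz q F \<and> nz q G"
 unfolding nz_def by auto

lemma nz_const: "c \<noteq> 0 \<Longrightarrow> strat q \<Longrightarrow> nz q (\<lambda>v. c)"
 unfolding nz_def using zero_in_scone by (cases q) auto

lemma scone_mono: "covers p q \<Longrightarrow> scone' S q \<subseteq> scone S p"
 using zero_in_scone by (cases q) (auto simp: covers_def str_less_def str_le_def)

lemma nz_mono: "covers p q \<Longrightarrow> nz q F \<Longrightarrow> nz (Some p) F"
 unfolding nz_def using scone_mono by fastforce

lemma nz_ext: "p \<in> strata S \<Longrightarrow> nz (Some p) (ext p)"
 using ext_nonzero_iff[of p p] by (simp add: nz_def)

lemma ext_below: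
 assumes "covers p q" "v \<in> scone' S q"
 shows "ext p v = 0"
proof (cases q)
 case None
 thus ?thesis using assms ext_zero covers_strata by auto
next
 case (Some q')
 hence "q' \<in> strata S" "str_less S q' p" "p \<in> strata S" using assms by (auto simp: covers_def)
 thus ?thesis
  using ext_nonzero_iff[of q' p] assms(2) Some le_antisym[of p q'] by (auto simp: str_less_def)
qed

lemma cancel_ext:
 assumes p: "p \<in> strata S" and FG: "polyfun F" "polyfun G"
  and eq: "\<And>v. v \<in> scone S p \<Longrightarrow> ext p v ^ i * F v = ext p v ^ i * G v" and v: "v \<in> scone S p"
 shows "F v = G v"
proof (rule ccontr)
 assume "F v \<noteq> G v"
 let ?H = "\<lambda>v. F v + (- 1) * G v"
 have H: "polyfun ?H" by (intro poly_add polyfun_scale FG)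
 have "nz (Some p) ?H" using v \<open>F v \<noteq> G v\<close> by (auto simp: nz_def)
 hence "nz (Some p) (\<lambda>v. ext p v ^ i * ?H v)"
  using p by (intro nz_mult nz_power polyfun_power polyfun_ext H nz_ext) auto
 then obtain w where "w \<in> scone S p" "ext p w ^ i * (F w + (- 1) * G w) \<noteq> 0" by (auto simp: nz_def)
 thus False using eq[of w] by (simp add: distrib_left)
qed

text \<open>F has order i along q: up to the fraction C / G, which is a unit there, it is a power of
  the uniformizer \<open>ext p\<close>. Cleared of denominators, this is an identity of functions on
  p.\<close>

definition dec :: "'a \<Rightarrow> 'a option \<Rightarrow> (('b, 'k) mpoint \<Rightarrow> 'k) \<Rightarrow> nat \<Rightarrow>
  (('b, 'k) mpoint \<Rightarrow> 'k) \<Rightarrow> (('b, 'k) mpoint \<Rightarrow> 'k) \<Rightarrow> bool" where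
 "dec p q F i G C \<longleftrightarrow> polyfun G \<and> polyfun C \<and> nz q G \<and> nz q C \<and>
   (\<forall>v\<in>scone S p. F v * G v = ext p v ^ i * C v)"

text \<open>The localization at the stratum \<open>q\<close> below \<open>p\<close> has the extremal function of \<open>p\<close> as
 uniformizer: multiply by the extremal function of \<open>q\<close>, which vanishes on all other strata
 below \<open>p\<close>.\<close>

lemma covers_ideal:
 assumes cov: "covers p q"
 shows "\<exists>s l. polyfun s \<and> nz q s \<and> nz (Some p) s \<and> l < wt p \<and> (\<forall>t v. s (tor t v) = t ^ l * s v) \<and>
  (\<forall>F. polyfun F \<longrightarrow> \<not> nz q F \<longrightarrow> (\<exists>C. polyfun C \<and> (\<forall>v\<in>scone S p. F v * s v = ext p v * C v)))"
proof (cases q)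
 case None
 have p: "p \<in> strata S" by (rule covers_strata(1)[OF cov])
 have "\<exists>C. polyfun C \<and> (\<forall>v\<in>scone S p. F v * 1 = ext p v * C v)" if "polyfun F" "\<not> nz q F" for F
  using boundary[OF p that(1)] that(2) cov None by (auto simp: nz_def covers_def)
 moreover have "nz q (\<lambda>_. 1)" "nz (Some p) (\<lambda>_. 1)" using p None by (auto intro: nz_const)
 moreover have "0 < wt p" by (rule wt_pos[OF p])
 ultimately show ?thesis
  by (intro exI[of _ "\<lambda>_. 1"] exI[of _ 0]) (auto intro: poly_const)
next
 case (Some q')
 have p: "p \<in> strata S" and q: "q' \<in> strata S" and less: "str_less S q' p"
  and between: "\<And>x. x \<in> strata S \<Longrightarrow> str_less S q' x \<Longrightarrow> \<not> str_less S x p"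
  using cov Some by (auto simp: covers_def)
 have "\<exists>C. polyfun C \<and> (\<forall>v\<in>scone S p. F v * ext q' v = ext p v * C v)" if F: "polyfun F" "\<not> nz q F" for F
 proof (rule boundary[OF p])
  show "polyfun (\<lambda>v. F v * ext q' v)" by (intro poly_mult F polyfun_ext q)
  show "F 0 * ext q' 0 = 0" using ext_zero[OF q] by simp
  fix x v assume x: "x \<in> strata S" "str_less S x p" "v \<in> scone S x"
  show "F v * ext q' v = 0"
  proof (cases "str_le S q' x")
   case True
   hence "x = q'" using between[OF x(1)] x(2) by (auto simp: str_less_def)
   thus ?thesis using F(2) x(3) Some by (auto simp: nz_def)
  next
   case False
   thus ?thesis using ext_nonzero_iff[OF x(1) q] x(3) by auto
  qed
 qed
 moreover have "nz q (ext q')" using nz_ext[OF q] Some by simp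
 moreover have "nz (Some p) (ext q')" using nz_mono[OF cov] \<open>nz q (ext q')\<close> by blast
 ultimately show ?thesis
  using wt_less[OF p q less] tor_ext[OF q] polyfun_ext[OF q]
  by (intro exI[of _ "ext q'"] exI[of _ "wt q'"]) auto
qed

text \<open>The order of vanishing along \<open>q\<close> is finite: \<open>ext p\<close> has larger torus weight than the
 denominator \<open>s\<close>, so \<open>F * s ^ i = ext p ^ i * C\<close> bounds \<open>i\<close> by the degree of \<open>F\<close> on a torus orbit.\<close>

lemma dec_exists:
 assumes cov: "covers p q" and F: "polyfun F" "nz (Some p) F"
 shows "\<exists>i G C. dec p q F i G C"
proof (rule ccontr)
 assume neg: "\<not> ?thesis"
 have p: "p \<in> strata S" by (rule covers_strata(1)[OF cov])
 have sq: "strat q" by (rule covers_strat[OF cov])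
 obtain s l where s: "polyfun s" "nz q s" "nz (Some p) s" "l < wt p" "\<forall>t v. s (tor t v) = t ^ l * s v"
  and ideal: "\<forall>F. polyfun F \<longrightarrow> \<not> nz q F \<longrightarrow> (\<exists>C. polyfun C \<and> (\<forall>v\<in>scone S p. F v * s v = ext p v * C v))"
  using covers_ideal[OF cov] by - (elim exE conjE, rule that)
 \<comment> \<open>Without a decomposition every quotient C vanishes on q, so F can be divided by
   \<open>ext p\<close> again and again, at the cost of one factor s each time.\<close>
 have div: "\<exists>C. polyfun C \<and> (\<forall>v\<in>scone S p. F v * s v ^ i = ext p v ^ i * C v)" for i
 proof (induction i)
  case 0
  thus ?case using F by (intro exI[of _ F]) simp
 next
  case (Suc i)
  then obtain C where C: "polyfun C" "\<forall>v\<in>scone S p. F v * s v ^ i = ext p v ^ i * C v" by blast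
  have "\<not> nz q C"
  proof
   assume "nz q C"
   hence "dec p q F i (\<lambda>v. s v ^ i) C"
    unfolding dec_def using C nz_power[OF sq s(1,2)] polyfun_power[OF s(1)] by blast
   with neg show False by blast
  qed
  then obtain D where D: "polyfun D" "\<forall>v\<in>scone S p. C v * s v = ext p v * D v" using ideal C(1) by blast
  have "F v * s v ^ Suc i = ext p v ^ Suc i * D v" if v: "v \<in> scone S p" for v
  proof -
   have "F v * s v ^ Suc i = ext p v ^ i * (C v * s v)" using C(2) v by (simp add: mult.assoc[symmetric] mult.commute)
   also have "\<dots> = ext p v ^ Suc i * D v" using D(2) v by simp
   finally show ?thesis .
  qed
  with D(1) show ?case by blast
 qed
 have "nz (Some p) (\<lambda>v. F v * s v)" using p F s by (intro nz_mult) auto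
 then obtain v where v: "v \<in> scone S p" "F v \<noteq> 0" "s v \<noteq> 0" by (auto simp: nz_def)
 obtain P where P: "\<And>t. F (tor t v) = poly P t"
  using is_poly_polyfun[OF F(1), of "\<lambda>t. tor t v"] tor_poly unfolding is_poly_def by blast
 have P1: "poly P 1 \<noteq> 0" using P[of 1] v(2) tor_one by simp
 \<comment> \<open>After cancelling the power of t coming from s, the factor
   \<open>ext p ^ i\<close> still contributes at least i powers of t, more than the degree of F
   along the orbit of v.\<close>
 define i where "i = Suc (degree P)"
 obtain C where C: "polyfun C" "\<forall>v\<in>scone S p. F v * s v ^ i = ext p v ^ i * C v" using div by blast
 obtain Q where Q: "\<And>t. C (tor t v) = poly Q t"
  using is_poly_polyfun[OF C(1), of "\<lambda>t. tor t v"] tor_poly unfolding is_poly_def by blast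
 define e where "e = i * (wt p - l)"
 let ?D = "smult (s v ^ i) P - monom (ext p v ^ i) e * Q"
 have "poly ?D t = 0" if t: "t \<noteq> 0" for t
 proof -
  have "F (tor t v) * s (tor t v) ^ i = ext p (tor t v) ^ i * C (tor t v)"
   using C(2) tor_scone[OF p t v(1)] by blast
  hence "poly P t * (t ^ (l * i) * s v ^ i) = t ^ (wt p * i) * ext p v ^ i * poly Q t"
   by (simp add: P Q s(5) tor_ext[OF p] power_mult_distrib power_mult)
  moreover have "wt p * i = l * i + e" using s(4) by (simp add: e_def algebra_simps diff_mult_distrib2)
  ultimately have "t ^ (l * i) * (poly P t * s v ^ i) = t ^ (l * i) * (t ^ e * ext p v ^ i * poly Q t)"
   by (simp add: power_add mult_ac)
  hence "poly P t * s v ^ i = t ^ e * ext p v ^ i * poly Q t" using t by simp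
  thus ?thesis by (simp add: poly_monom mult_ac)
 qed
 hence D: "{t. poly ?D t = 0} \<supseteq> UNIV - {0}" by blast
 have "?D = 0"
 proof (rule ccontr)
  assume "?D \<noteq> 0"
  hence "finite {t. poly ?D t = 0}" by (rule poly_roots_finite)
  hence "finite (UNIV - {0 :: 'k})" using D finite_subset by blast
  thus False using infinite_UNIV_char_0[where 'a = 'k] by simp
 qed
 hence eq: "smult (s v ^ i) P = monom (ext p v ^ i) e * Q" by simp
 have P0: "P \<noteq> 0" using P1 by auto
 hence "smult (s v ^ i) P \<noteq> 0" using v(3) by simp
 hence nzero: "monom (ext p v ^ i) e \<noteq> 0" "Q \<noteq> 0" unfolding eq by auto
 have "degree P = degree (monom (ext p v ^ i) e * Q)" unfolding eq[symmetric] using v(3) by simp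
 also have "\<dots> = e + degree Q" using nzero by (simp add: degree_mult_eq degree_monom_eq)
 finally have "e \<le> degree P" by simp
 moreover have "i * 1 \<le> e" unfolding e_def using s(4) by (intro mult_le_mono) auto
 ultimately show False by (simp add: i_def)
qed

text \<open>If the orders differed, cancelling the smaller power of \<open>ext p\<close> would
  equate a product of two functions not vanishing on q with a multiple of \<open>ext p\<close>,
  which is zero there.\<close>

lemma dec_unique:
 assumes cov: "covers p q" and F: "polyfun F" "nz (Some p) F"
  and d: "dec p q F i G C" "dec p q F i' G' C'"
 shows "i = i' \<and> (\<forall>v\<in>scone S p. C v * G' v = C' v * G v)"
proof -
 have p: "p \<in> strata S" by (rule covers_strata(1)[OF cov])
 have sq: "strat q" by (rule covers_strat[OF cov])
 have aux: "i' \<le> i"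
  if d: "dec p q F i G C" "dec p q F i' G' C'" for i i' G C G' C'
 proof (rule ccontr)
  assume "\<not> i' \<le> i"
  then obtain e where e: "i' = i + Suc e" using less_imp_Suc_add[of i i'] by auto
  have P: "polyfun G" "polyfun C" "polyfun G'" "polyfun C'" "nz q C" "nz q G'" using d by (auto simp: dec_def)
  have "C v * G' v = ext p v ^ Suc e * (C' v * G v)" if v: "v \<in> scone S p" for v
  proof (rule cancel_ext[OF p _ _ _ v])
   show "polyfun (\<lambda>v. C v * G' v)" "polyfun (\<lambda>v. ext p v ^ Suc e * (C' v * G v))"
    by (intro poly_mult polyfun_power polyfun_ext P p)+
   fix v assume v: "v \<in> scone S p"
   have "ext p v ^ i * (C v * G' v) = F v * G v * G' v" using d(1) v by (simp add: dec_def mult.assoc)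
   also have "\<dots> = F v * G' v * G v" by (simp add: mult_ac)
   also have "\<dots> = ext p v ^ i' * C' v * G v" using d(2) v by (simp add: dec_def)
   also have "\<dots> = ext p v ^ i * (ext p v ^ Suc e * (C' v * G v))" by (simp add: e power_add mult_ac)
   finally show "ext p v ^ i * (C v * G' v) = ext p v ^ i * (ext p v ^ Suc e * (C' v * G v))" .
  qed
  hence "C v * G' v = 0" if "v \<in> scone' S q" for v
   using that ext_below[OF cov that] scone_mono[OF cov] by fastforce
  thus False using nz_mult[OF sq P(2,3,5,6)] by (auto simp: nz_def)
 qed
 have ii: "i = i'" using aux[OF d] aux[OF d(2,1)] by simp
 have P: "polyfun G" "polyfun C" "polyfun G'" "polyfun C'" using d by (auto simp: dec_def)
 have "C v * G' v = C' v * G v" if v: "v \<in> scone S p" for v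
 proof (rule cancel_ext[OF p _ _ _ v])
  show "polyfun (\<lambda>v. C v * G' v)" "polyfun (\<lambda>v. C' v * G v)" by (intro poly_mult P)+
  fix v assume v: "v \<in> scone S p"
  have "ext p v ^ i * (C v * G' v) = (F v * G v) * G' v" using d(1) v by (simp add: dec_def mult.assoc)
  also have "\<dots> = (F v * G' v) * G v" by (simp add: mult_ac)
  also have "\<dots> = ext p v ^ i * (C' v * G v)" using d(2) v by (simp add: dec_def ii mult.assoc)
  finally show "ext p v ^ i * (C v * G' v) = ext p v ^ i * (C' v * G v)" .
 qed
 with ii show ?thesis by blast
qed

lemma dec_mult:
 assumes "strat q" "dec p q F i G C" "dec p q F' i' G' C'"
 shows "dec p q (\<lambda>v. F v * F' v) (i + i') (\<lambda>v. G v * G' v) (\<lambda>v. C v * C' v)"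
proof -
 have "F v * F' v * (G v * G' v) = ext p v ^ (i + i') * (C v * C' v)" if "v \<in> scone S p" for v
 proof -
  have "F v * F' v * (G v * G' v) = (F v * G v) * (F' v * G' v)" by (simp add: mult_ac)
  also have "\<dots> = (ext p v ^ i * C v) * (ext p v ^ i' * C' v)" using assms that by (simp add: dec_def)
  finally show ?thesis by (simp add: power_add mult_ac)
 qed
 thus ?thesis using assms unfolding dec_def by (auto intro!: poly_mult nz_mult)
qed

end

section \<open>Values along saturated chains\<close>

context seshadri
begin

fun head :: "'a list \<Rightarrow> 'a option" where
 "head [] = None"
| "head (p # ps) = Some p"

fun saturated :: "'a list \<Rightarrow> bool" where
 "saturated [] \<longleftrightarrow> True"
| "saturated (p # ps) \<longleftrightarrow> covers p (head ps) \<and> saturated ps"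

text \<open>Chains are listed in decreasing order here. As \<open>F * G = ext p ^ i * C\<close> with \<open>G\<close> and \<open>C\<close> not
 vanishing on the next stratum, the valuation of \<open>F\<close> there is \<open>i\<close>, and \<open>C / G\<close> is the next
 function of the sequence.\<close>

fun cval :: "'a list \<Rightarrow> (('b, 'k) mpoint \<Rightarrow> 'k) \<Rightarrow> 'a \<Rightarrow> rat" where
 "cval [] F = 0"
| "cval (p # ps) F = (let (i, G, C) = SOME (i, G, C). dec p (head ps) F i G C
   in (\<lambda>x. of_nat i * evec p x) + cval ps C - cval ps G)"

lemma saturated_strat: "saturated ps \<Longrightarrow> strat (head ps)"
 by (cases ps) (auto simp: covers_def)

lemma saturated_strata: "saturated ps \<Longrightarrow> set ps \<subseteq> strata S"
 by (induction ps) (auto simp: covers_def)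

lemma covers_head_less:
 assumes "covers p (head ps)" "saturated ps" "q \<in> set ps"
 shows "str_less S q p"
 using assms
proof (induction ps arbitrary: p)
 case (Cons x ps)
 have x: "x \<in> strata S" "str_less S x p" using Cons.prems(1) by (auto simp: covers_def)
 show ?case
 proof (cases "q = x")
  case False
  hence "str_less S q x" using Cons by auto
  moreover have "q \<in> strata S" using Cons.prems saturated_strata by fastforce
  ultimately show ?thesis using x less_trans by blast
 qed (use x in simp)
qed simp

lemma cval_supp: "x \<notin> set ps \<Longrightarrow> cval ps F x = 0"
proof (induction ps arbitrary: F)
 case (Cons p ps)
 thus ?case by (cases "SOME (i, G, C). dec p (head ps) F i G C") (simp add: evec_def)
qed simp

lemma cval_step_choice:
 assumes cov: "covers p (head ps)" and F: "polyfun F" "nz (Some p) F"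
 obtains i G C where "dec p (head ps) F i G C"
  "cval (p # ps) F = (\<lambda>x. of_nat i * evec p x) + cval ps C - cval ps G"
proof -
 obtain i0 G0 C0 where "dec p (head ps) F i0 G0 C0"
  using dec_exists[OF cov F] by - (elim exE, rule that)
 hence ex: "\<exists>y. case y of (i, G, C) \<Rightarrow> dec p (head ps) F i G C"
  by (intro exI[of _ "(i0, G0, C0)"]) simp
 define y where "y = (SOME (i, G, C). dec p (head ps) F i G C)"
 obtain i G C where y: "y = (i, G, C)" by (cases y)
 have "dec p (head ps) F i G C" using someI_ex[OF ex] unfolding y_def[symmetric] y by simp
 moreover have "cval (p # ps) F = (\<lambda>x. of_nat i * evec p x) + cval ps C - cval ps G"
  unfolding cval.simps(2) y_def[symmetric] y by simp
 ultimately show thesis by (rule that)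
qed

declare cval.simps(2) [simp del]

text \<open>Multiplicativity on a chain needs independence of the choice of \<open>(i, G, C)\<close> one step further
 up, hence the joint induction.\<close>

definition well_behaved :: "'a list \<Rightarrow> bool" where
 "well_behaved ps \<longleftrightarrow> (\<forall>F G. polyfun F \<longrightarrow> polyfun G \<longrightarrow> nz (head ps) F \<longrightarrow> nz (head ps) G \<longrightarrow>
   cval ps (\<lambda>v. F v * G v) = cval ps F + cval ps G) \<and>
  (\<forall>F G. polyfun F \<longrightarrow> polyfun G \<longrightarrow> nz (head ps) F \<longrightarrow> (\<forall>v\<in>scone' S (head ps). F v = G v) \<longrightarrow>
   cval ps F = cval ps G) \<and>
  (\<forall>p F i G C. covers p (head ps) \<longrightarrow> polyfun F \<longrightarrow> nz (Some p) F \<longrightarrow> dec p (head ps) F i G C \<longrightarrow>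
   cval (p # ps) F = (\<lambda>x. of_nat i * evec p x) + cval ps C - cval ps G)"

lemma saturated_well_behaved: "saturated ps \<Longrightarrow> well_behaved ps"
proof (induction ps)
 case Nil
 have "cval [p] F = (\<lambda>x. of_nat i * evec p x) + cval [] C - cval [] G"
  if cov: "covers p None" and F: "polyfun F" "nz (Some p) F" and d: "dec p None F i G C" for p F i G C
 proof -
  have cov0: "covers p (head [])" using cov by simp
  obtain i' G' C' where d': "dec p (head []) F i' G' C'"
   "cval [p] F = (\<lambda>x. of_nat i' * evec p x) + cval [] C' - cval [] G'"
   by (rule cval_step_choice[OF cov0 F])
  have d2: "dec p None F i' G' C'" using d'(1) by simp
  have ii: "i = i'" by (rule conjunct1[OF dec_unique[OF cov F d d2]])
  show ?thesis unfolding d'(2) ii by simp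
 qed
 thus ?case by (simp add: well_behaved_def)
next
 case (Cons p ps)
 have cov: "covers p (head ps)" and sat: "saturated ps" using Cons.prems by auto
 have sq: "strat (head ps)" by (rule saturated_strat[OF sat])
 have mult: "polyfun F \<Longrightarrow> polyfun G \<Longrightarrow> nz (head ps) F \<Longrightarrow> nz (head ps) G \<Longrightarrow>
   cval ps (\<lambda>v. F v * G v) = cval ps F + cval ps G" for F G
  using Cons.IH[OF sat] unfolding well_behaved_def by blast
 have step: "polyfun F \<Longrightarrow> nz (Some p) F \<Longrightarrow> dec p (head ps) F i G C \<Longrightarrow>
   cval (p # ps) F = (\<lambda>x. of_nat i * evec p x) + cval ps C - cval ps G" for F i G C
  using Cons.IH[OF sat] cov unfolding well_behaved_def by blast
 have p: "p \<in> strata S" by (rule covers_strata(1)[OF cov])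
 have mult': "cval (p # ps) (\<lambda>v. F v * G v) = cval (p # ps) F + cval (p # ps) G"
  if F: "polyfun F" "nz (Some p) F" and G: "polyfun G" "nz (Some p) G" for F G
 proof -
  obtain i A C where dF: "dec p (head ps) F i A C"
   "cval (p # ps) F = (\<lambda>x. of_nat i * evec p x) + cval ps C - cval ps A"
   by (rule cval_step_choice[OF cov F])
  obtain j B D where dG: "dec p (head ps) G j B D"
   "cval (p # ps) G = (\<lambda>x. of_nat j * evec p x) + cval ps D - cval ps B"
   by (rule cval_step_choice[OF cov G])
  have d: "dec p (head ps) (\<lambda>v. F v * G v) (i + j) (\<lambda>v. A v * B v) (\<lambda>v. C v * D v)"
   by (rule dec_mult[OF sq dF(1) dG(1)])
  have "cval (p # ps) (\<lambda>v. F v * G v) =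
    (\<lambda>x. of_nat (i + j) * evec p x) + cval ps (\<lambda>v. C v * D v) - cval ps (\<lambda>v. A v * B v)"
   using p by (intro step[OF _ _ d] poly_mult nz_mult F G) simp
  also have "cval ps (\<lambda>v. C v * D v) = cval ps C + cval ps D"
   using dF(1) dG(1) by (intro mult) (auto simp: dec_def)
  also have "cval ps (\<lambda>v. A v * B v) = cval ps A + cval ps B"
   using dF(1) dG(1) by (intro mult) (auto simp: dec_def)
  finally show ?thesis unfolding dF(2) dG(2) by (simp add: fun_eq_iff algebra_simps)
 qed
 have cong': "cval (p # ps) F = cval (p # ps) G"
  if FG: "polyfun F" "polyfun G" "nz (Some p) F" "\<forall>v\<in>scone S p. F v = G v" for F G
 proof -
  obtain i A C where dF: "dec p (head ps) F i A C"
   "cval (p # ps) F = (\<lambda>x. of_nat i * evec p x) + cval ps C - cval ps A"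
   by (rule cval_step_choice[OF cov FG(1,3)])
  have "nz (Some p) G" using FG(3,4) by (auto simp: nz_def)
  moreover have "dec p (head ps) G i A C" using dF(1) FG(4) by (simp add: dec_def)
  ultimately show ?thesis using step[OF FG(2)] dF(2) by simp
 qed
 \<comment> \<open>Two decompositions of the same function give the same fraction C / G on p', so
   multiplicativity and independence of the representative on the chain below equate the differences
   of their values.\<close>
 have step': "cval (p' # p # ps) F = (\<lambda>x. of_nat i * evec p' x) + cval (p # ps) C - cval (p # ps) G"
  if cov': "covers p' (Some p)" and F: "polyfun F" "nz (Some p') F" and d: "dec p' (Some p) F i G C"
  for p' F i G C
 proof -
  have cov2: "covers p' (head (p # ps))" using cov' by simp
  obtain i' G' C' where d': "dec p' (head (p # ps)) F i' G' C'"
   "cval (p' # p # ps) F = (\<lambda>x. of_nat i' * evec p' x) + cval (p # ps) C' - cval (p # ps) G'"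
   by (rule cval_step_choice[OF cov2 F])
  have d2: "dec p' (Some p) F i' G' C'" using d'(1) by simp
  have u: "i = i'" "\<forall>v\<in>scone S p'. C v * G' v = C' v * G v" using dec_unique[OF cov' F d d2] by auto
  have P: "polyfun G" "polyfun C" "polyfun G'" "polyfun C'" "nz (Some p) G" "nz (Some p) C"
   "nz (Some p) G'" "nz (Some p) C'" using d d2 by (auto simp: dec_def)
  have "cval (p # ps) C + cval (p # ps) G' = cval (p # ps) (\<lambda>v. C v * G' v)" using P mult' by simp
  also have "\<dots> = cval (p # ps) (\<lambda>v. C' v * G v)"
   using P p u(2) scone_mono[OF cov'] by (intro cong' poly_mult nz_mult) auto
  also have "\<dots> = cval (p # ps) C' + cval (p # ps) G" using P mult' by simp
  finally have "cval (p # ps) C - cval (p # ps) G = cval (p # ps) C' - cval (p # ps) G'"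
   by (simp add: algebra_simps)
  thus ?thesis unfolding d'(2) u(1) add_diff_eq[symmetric] by (rule arg_cong[OF sym])
 qed
 show ?case unfolding well_behaved_def head.simps scone'.simps
 proof (intro conjI allI impI)
  fix F G assume "polyfun F" "polyfun G" "nz (Some p) F" "nz (Some p) G"
  thus "cval (p # ps) (\<lambda>v. F v * G v) = cval (p # ps) F + cval (p # ps) G" by (intro mult')
 next
  fix F G assume "polyfun F" "polyfun G" "nz (Some p) F" "\<forall>v\<in>scone S p. F v = G v"
  thus "cval (p # ps) F = cval (p # ps) G" by (rule cong')
 next
  fix p' F i G C assume "covers p' (Some p)" "polyfun F" "nz (Some p') F" "dec p' (Some p) F i G C"
  thus "cval (p' # p # ps) F = (\<lambda>x. of_nat i * evec p' x) + cval (p # ps) C - cval (p # ps) G"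
   by (rule step')
 qed
qed

lemma cval_mult:
 "saturated ps \<Longrightarrow> polyfun F \<Longrightarrow> polyfun G \<Longrightarrow> nz (head ps) F \<Longrightarrow> nz (head ps) G \<Longrightarrow>
  cval ps (\<lambda>v. F v * G v) = cval ps F + cval ps G"
 by (rule conjunct1[OF saturated_well_behaved[unfolded well_behaved_def], rule_format])

lemma cval_cong:
 "saturated ps \<Longrightarrow> polyfun F \<Longrightarrow> polyfun G \<Longrightarrow> nz (head ps) F \<Longrightarrow> (\<And>v. v \<in> scone' S (head ps) \<Longrightarrow> F v = G v) \<Longrightarrow>
  cval ps F = cval ps G"
 by (rule conjunct1[OF conjunct2[OF saturated_well_behaved[unfolded well_behaved_def]], rule_format])

lemma cval_step:
 assumes "saturated (p # ps)" "polyfun F" "nz (Some p) F" "dec p (head ps) F i G C"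
 shows "cval (p # ps) F = (\<lambda>x. of_nat i * evec p x) + cval ps C - cval ps G"
proof -
 have "saturated ps" "covers p (head ps)" using assms(1) by auto
 from conjunct2[OF conjunct2[OF saturated_well_behaved[OF this(1), unfolded well_behaved_def]]] this(2) assms(2-4)
 show ?thesis by blast
qed

lemma dec_regular:
 assumes "covers p q" "polyfun F" "nz q F"
 shows "dec p q F 0 (\<lambda>_. 1) F"
 using assms covers_strat[OF assms(1)] by (simp add: dec_def poly_const nz_const)

lemma dec_ext: "covers p q \<Longrightarrow> dec p q (ext p) 1 (\<lambda>_. 1) (\<lambda>_. 1)"
 using covers_strat[of p q] by (simp add: dec_def poly_const nz_const)

lemma cval_one: "saturated ps \<Longrightarrow> cval ps (\<lambda>_. 1) = 0"
 using cval_mult[of ps "\<lambda>_. 1" "\<lambda>_. 1"] saturated_strat[of ps] by (simp add: poly_const nz_const)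

lemma cval_regular:
 assumes "saturated (p # ps)" "polyfun F" "nz (head ps) F"
 shows "cval (p # ps) F = cval ps F"
proof -
 have cov: "covers p (head ps)" using assms by simp
 show ?thesis using cval_step[OF assms(1,2) nz_mono[OF cov assms(3)] dec_regular[OF cov assms(2,3)]] assms(1)
  by (simp add: cval_one fun_eq_iff)
qed

lemma cval_const:
 assumes "saturated ps" "c \<noteq> 0"
 shows "cval ps (\<lambda>_. c) = 0"
 using assms
proof (induction ps)
 case (Cons p ps)
 thus ?case using cval_regular[OF Cons.prems(1) poly_const[of c]] saturated_strat[of ps]
  by (simp add: nz_const)
qed simp

text \<open>Above p the function \<open>ext p\<close> does not vanish on the strata of the chain and
  is passed down unchanged; at p it has order 1 and leaves the unit 1.\<close>

lemma cval_ext: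
 assumes "saturated ps" "p \<in> set ps"
 shows "cval ps (ext p) = evec p"
 using assms
proof (induction ps)
 case (Cons x ps)
 have p: "p \<in> strata S" using Cons.prems saturated_strata by blast
 show ?case
 proof (cases "p = x")
  case True
  have cov: "covers p (head ps)" using Cons.prems True by simp
  thus ?thesis
   using cval_step[OF Cons.prems(1) polyfun_ext[OF p], of 1] nz_ext[OF p] dec_ext[OF cov] Cons.prems(1) True
   by (simp add: fun_eq_iff cval_one)
 next
  case False
  hence "p \<in> set ps" using Cons.prems by simp
  then obtain y ys where y: "ps = y # ys" by (cases ps) auto
  have "str_le S p y" using \<open>p \<in> set ps\<close> Cons.prems(1) covers_head_less[of y ys p] unfolding y
   by (auto simp: str_less_def)
  moreover have "y \<in> strata S" using Cons.prems(1) y by (auto simp: covers_def)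
  ultimately have "nz (head ps) (ext p)" using ext_nonzero_iff[of y p] p y by (simp add: nz_def)
  thus ?thesis using cval_regular[OF Cons.prems(1) polyfun_ext[OF p]] Cons \<open>p \<in> set ps\<close> by simp
 qed
qed simp

lemma dec_pos: "dec p q F i G C \<Longrightarrow> covers p q \<Longrightarrow> \<not> nz q F \<Longrightarrow> 0 < i"
proof (rule ccontr)
 assume d: "dec p q F i G C" and cov: "covers p q" and nF: "\<not> nz q F" and "\<not> 0 < i"
 hence "F v * G v = C v" if "v \<in> scone' S q" for v using that scone_mono[OF cov] by (auto simp: dec_def)
 hence "C v = 0" if "v \<in> scone' S q" for v using that nF by (fastforce simp: nz_def)
 thus False using d by (auto simp: dec_def nz_def)
qed

end

section \<open>Comparison of values in the lexicographic order\<close>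

locale seshadri_order = seshadri S ext wt tor top
 for S :: "('a, 'b, 'k::field_char_0) stratification" and ext wt tor top +
 fixes r :: "'a rel"
 assumes refinement: "total_refinement S r"
begin

lemma linear: "linear_order_on (strata S) r"
 using refinement by (simp add: total_refinement_def)

lemma r_total: "p \<in> strata S \<Longrightarrow> q \<in> strata S \<Longrightarrow> (p, q) \<in> r \<or> (q, p) \<in> r"
 using linear unfolding order_on_defs total_on_def refl_on_def by metis

lemma r_antisym: "(p, q) \<in> r \<Longrightarrow> (q, p) \<in> r \<Longrightarrow> p = q"
 using linear unfolding order_on_defs antisym_def by metis

lemma r_trans: "(p, q) \<in> r \<Longrightarrow> (q, x) \<in> r \<Longrightarrow> (p, x) \<in> r"
 using linear unfolding order_on_defs trans_def by metis

lemma r_refines: "p \<in> strata S \<Longrightarrow> q \<in> strata S \<Longrightarrow> str_less S p q \<Longrightarrow> (p, q) \<in> r \<and> p \<noteq> q"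
 using refinement by (auto simp: total_refinement_def str_less_def)

abbreviation lless (infix "\<prec>" 50) where "a \<prec> b \<equiv> lex_less S r a b"
abbreviation lleq (infix "\<preceq>" 50) where "a \<preceq> b \<equiv> a = b \<or> lex_less S r a b"

lemma lless_irrefl: "\<not> a \<prec> a"
 by (simp add: lex_less_def)

lemma lless_trans:
 assumes "a \<prec> b" "b \<prec> c"
 shows "a \<prec> c"
proof -
 obtain x where x: "x \<in> strata S" "a x < b x" "\<And>p. p \<in> strata S \<Longrightarrow> (x, p) \<in> r \<Longrightarrow> p \<noteq> x \<Longrightarrow> a p = b p"
  using assms(1) unfolding lex_less_def by blast
 obtain y where y: "y \<in> strata S" "b y < c y" "\<And>p. p \<in> strata S \<Longrightarrow> (y, p) \<in> r \<Longrightarrow> p \<noteq> y \<Longrightarrow> b p = c p"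
  using assms(2) unfolding lex_less_def by blast
 \<comment> \<open>The comparison of a with c is decided at the larger of the two deciding
   positions.\<close>
 define z where "z = (if (x, y) \<in> r then y else x)"
 have z: "z \<in> strata S" using x(1) y(1) by (simp add: z_def)
 have up: "a p = c p" if p: "p \<in> strata S" "(z, p) \<in> r" "p \<noteq> z" for p
 proof -
  have "(x, p) \<in> r" "(y, p) \<in> r" using p(2) r_trans r_total[OF x(1) y(1)] by (auto simp: z_def split: if_splits)
  moreover have "p \<noteq> x" "p \<noteq> y"
   using p(2,3) r_antisym r_total[OF x(1) y(1)] by (auto simp: z_def split: if_splits)
  ultimately show ?thesis using x(3) y(3) p(1) by simp
 qed
 have "a z < c z"
 proof (cases "x = y")
  case True
  thus ?thesis using x y by (simp add: z_def)
 next
  case False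
  show ?thesis
  proof (cases "(x, y) \<in> r")
   case True
   thus ?thesis using x(3)[OF y(1)] False y(2) by (auto simp: z_def)
  next
   case False
   hence "(y, x) \<in> r" using r_total[OF x(1) y(1)] by blast
   thus ?thesis using y(3)[OF x(1)] \<open>x \<noteq> y\<close> x(2) False by (auto simp: z_def)
  qed
 qed
 with z up show ?thesis unfolding lex_less_def by blast
qed

lemma lless_add: "a \<prec> b \<Longrightarrow> a + c \<prec> b + c"
 by (simp add: lex_less_def)

lemma lless_diff: "a - c \<prec> b - c \<longleftrightarrow> a \<prec> b"
 by (simp add: lex_less_def)

lemma r_max_exists:
 assumes "finite A" "A \<noteq> {}" "A \<subseteq> strata S"
 shows "\<exists>q\<in>A. \<forall>p\<in>A. (p, q) \<in> r"
 using assms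
proof (induction rule: finite_ne_induct)
 case (singleton x)
 thus ?case using r_total[of x x] by auto
next
 case (insert x A)
 then obtain q where q: "q \<in> A" "\<forall>p\<in>A. (p, q) \<in> r" by auto
 show ?case
 proof (cases "(x, q) \<in> r")
  case True
  thus ?thesis using q by auto
 next
  case False
  hence "(q, x) \<in> r" "(x, x) \<in> r" using r_total[of x q] r_total[of x x] q(1) insert.prems by auto
  thus ?thesis using q(2) r_trans by blast
 qed
qed

lemma lless_total:
 assumes "\<And>x. x \<notin> strata S \<Longrightarrow> a x = b x"
 shows "a \<preceq> b \<or> b \<prec> a"
proof (cases "a = b")
 case False
 let ?A = "{x. a x \<noteq> b x}"
 have A: "?A \<subseteq> strata S" using assms by blast
 have "?A \<noteq> {}" using False by (auto simp: fun_eq_iff)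
 then obtain q where q: "q \<in> ?A" "\<forall>p\<in>?A. (p, q) \<in> r"
  using r_max_exists[OF finite_subset[OF A finite_strata] _ A] by blast
 have "a p = b p" if "(q, p) \<in> r" "p \<noteq> q" for p using q(2) that r_antisym[of p q] by blast
 moreover have "q \<in> strata S" using q(1) A by blast
 ultimately show ?thesis using q(1) unfolding lex_less_def by (auto simp: neq_iff)
qed simp

lemma lleq_coeff_le:
 assumes "a \<preceq> b" "p \<in> strata S" "\<And>x. x \<in> strata S \<Longrightarrow> (p, x) \<in> r \<Longrightarrow> x \<noteq> p \<Longrightarrow> a x = b x"
 shows "a p \<le> b p"
proof (cases "a = b")
 case False
 then obtain q where q: "q \<in> strata S" "a q < b q" "\<And>x. x \<in> strata S \<Longrightarrow> (q, x) \<in> r \<Longrightarrow> x \<noteq> q \<Longrightarrow> a x = b x"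
  using assms(1) unfolding lex_less_def by blast
 have "\<not> ((p, q) \<in> r \<and> q \<noteq> p)" using assms(3)[of q] q by auto
 hence "q = p \<or> (q, p) \<in> r" using r_total[OF q(1) assms(2)] by blast
 thus ?thesis using q(2) q(3)[OF assms(2)] by fastforce
qed simp

lemma lless_coeff:
 assumes "p \<in> strata S" "a p < b p" "\<And>x. x \<in> strata S \<Longrightarrow> (p, x) \<in> r \<Longrightarrow> x \<noteq> p \<Longrightarrow> a x = b x"
 shows "a \<prec> b"
 unfolding lex_less_def using assms by blast

lemma not_in_chain_above:
 assumes "saturated (p # ps)" "x \<in> strata S" "(p, x) \<in> r" "x \<noteq> p"
 shows "x \<notin> set (p # ps)"
proof
 assume "x \<in> set (p # ps)"
 hence "str_less S x p" using assms covers_head_less by auto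
 hence "(x, p) \<in> r" using r_refines assms(1,2) by (auto dest: covers_strata(1))
 thus False using r_antisym assms by blast
qed

lemma cval_head_coeff:
 assumes "saturated (p # ps)" "polyfun F" "nz (Some p) F" "dec p (head ps) F i G C"
 shows "cval (p # ps) F p = of_nat i"
proof -
 have "p \<notin> set ps" using covers_head_less[of p ps p] assms(1) by (auto simp: str_less_def)
 thus ?thesis unfolding cval_step[OF assms] by (simp add: cval_supp evec_def)
qed

text \<open>Descend the chain while \<open>ext p\<close> survives. At the last such stratum x the
  next one is not above p, so the order at x is positive; as x is larger than p, this coefficient
  decides the comparison. A minimal x would have to be p itself, which the chain misses.\<close>

lemma cval_ext_less:
 assumes "saturated (x # ps)" "p \<in> strata S" "p \<notin> set (x # ps)" "str_le S p x"
 shows "evec p \<prec> cval (x # ps) (ext p)"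
 using assms
proof (induction ps arbitrary: x)
 case Nil
 have cov: "covers x (head [])" using Nil by simp
 have x: "x \<in> strata S" by (rule covers_strata(1)[OF cov])
 have "str_less S p x" using Nil by (auto simp: str_less_def)
 thus ?case using cov Nil(2) by (simp add: covers_def)
next
 case (Cons y ps)
 have cov: "covers x (head (y # ps))" using Cons.prems by simp
 have x: "x \<in> strata S" by (rule covers_strata(1)[OF cov])
 have y: "y \<in> strata S" using cov by (simp add: covers_def)
 have nzx: "nz (Some x) (ext p)" using ext_nonzero_iff[OF x Cons.prems(2)] Cons.prems(4) by (simp add: nz_def)
 show ?case
 proof (cases "str_le S p y")
  case True
  hence "nz (head (y # ps)) (ext p)" using ext_nonzero_iff[OF y Cons.prems(2)] by (simp add: nz_def)
  hence "cval (x # y # ps) (ext p) = cval (y # ps) (ext p)"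
   by (rule cval_regular[OF Cons.prems(1) polyfun_ext[OF Cons.prems(2)]])
  thus ?thesis using Cons.IH[of y] Cons.prems True by simp
 next
  case False
  hence nzy: "\<not> nz (head (y # ps)) (ext p)" using ext_nonzero_iff[OF y Cons.prems(2)] by (simp add: nz_def)
  obtain i G C where d: "dec x (head (y # ps)) (ext p) i G C"
   using dec_exists[OF cov polyfun_ext[OF Cons.prems(2)] nzx] by - (elim exE, rule that)
  have i: "0 < i" by (rule dec_pos[OF d cov nzy])
  have px: "(p, x) \<in> r" "p \<noteq> x" using r_refines[OF Cons.prems(2) x] Cons.prems(3,4) by (auto simp: str_less_def)
  show ?thesis
  proof (rule lless_coeff[OF x])
   show "evec p x < cval (x # y # ps) (ext p) x"
    using cval_head_coeff[OF Cons.prems(1) polyfun_ext[OF Cons.prems(2)] nzx d] i px(2) by (simp add: evec_def)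
   fix z assume z: "z \<in> strata S" "(x, z) \<in> r" "z \<noteq> x"
   have "z \<noteq> p" using z px r_antisym by blast
   thus "evec p z = cval (x # y # ps) (ext p) z"
    using cval_supp[OF not_in_chain_above[OF Cons.prems(1) z]] by (simp add: evec_def)
  qed
 qed
qed

end

context seshadri
begin

text \<open>This allows two decompositions to be written with a common denominator.\<close>

lemma dec_mult_denominator:
 assumes "covers p q" "dec p q F i G C" "polyfun A" "nz q A"
 shows "dec p q F i (\<lambda>v. G v * A v) (\<lambda>v. C v * A v)"
proof -
 have sq: "strat q" by (rule covers_strat[OF assms(1)])
 have "F v * (G v * A v) = ext p v ^ i * (C v * A v)" if "v \<in> scone S p" for v
 proof -
  have "F v * G v = ext p v ^ i * C v" using assms(2) that by (simp add: dec_def)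
  thus ?thesis by (simp add: mult.assoc[symmetric])
 qed
 thus ?thesis using assms nz_mult[OF sq] unfolding dec_def by (auto intro: poly_mult)
qed

end

context seshadri_order
begin

lemma cval_above:
 "saturated (p # ps) \<Longrightarrow> x \<in> strata S \<Longrightarrow> (p, x) \<in> r \<Longrightarrow> x \<noteq> p \<Longrightarrow> cval (p # ps) F x = 0"
 by (rule cval_supp) (rule not_in_chain_above)

lemma lleq_translate: "a + c - d \<preceq> a + c' - d \<longleftrightarrow> c \<preceq> c'"
 unfolding lless_diff by (auto simp: lex_less_def)

text \<open>Clearing denominators, the leading terms at the top of the chain decide, unless they have
 the same order; then induct on the chain, where cancellation only raises the order.\<close>

definition ultrametric :: "'a list \<Rightarrow> bool" where
 "ultrametric ps \<longleftrightarrow> (\<forall>F H. polyfun F \<longrightarrow> polyfun H \<longrightarrow> nz (head ps) F \<longrightarrow> nz (head ps) H \<longrightarrow>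
  nz (head ps) (\<lambda>v. F v + H v) \<longrightarrow> cval ps F \<preceq> cval ps H \<longrightarrow> cval ps F \<preceq> cval ps (\<lambda>v. F v + H v))"

lemma saturated_ultrametric: "saturated ps \<Longrightarrow> ultrametric ps"
proof (induction ps)
 case Nil
 show ?case by (simp add: ultrametric_def)
next
 case (Cons p ps)
 let ?q = "head ps"
 have sat: "saturated (p # ps)" and sat': "saturated ps" and cov: "covers p ?q" using Cons.prems by auto
 have ultra: "ultrametric ps" by (rule Cons.IH[OF sat'])
 have p: "p \<in> strata S" by (rule covers_strata(1)[OF cov])
 have sq: "strat ?q" by (rule covers_strat[OF cov])
 show ?case unfolding ultrametric_def head.simps
 proof (intro allI impI)
 fix F H assume F: "polyfun F" and H: "polyfun H" and F': "nz (Some p) F" and H': "nz (Some p) H"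
  and FH': "nz (Some p) (\<lambda>v. F v + H v)" and le: "cval (p # ps) F \<preceq> cval (p # ps) H"
 note F = F F' and H = H H'
 have FH: "polyfun (\<lambda>v. F v + H v)" "nz (Some p) (\<lambda>v. F v + H v)"
  using F H FH' by (auto intro: poly_add)
 obtain i G0 C0 where d0: "dec p ?q F i G0 C0" using dec_exists[OF cov F] by - (elim exE, rule that)
 obtain j G1 D1 where d1: "dec p ?q H j G1 D1" using dec_exists[OF cov H] by - (elim exE, rule that)
 define G C D where "G = (\<lambda>v. G0 v * G1 v)" and "C = (\<lambda>v. C0 v * G1 v)" and "D = (\<lambda>v. D1 v * G0 v)"
 have dF: "dec p ?q F i G C"
  unfolding G_def C_def using d1 by (intro dec_mult_denominator[OF cov d0]) (auto simp: dec_def)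
 have "dec p ?q H j (\<lambda>v. G1 v * G0 v) D"
  unfolding D_def using d0 by (intro dec_mult_denominator[OF cov d1]) (auto simp: dec_def)
 hence dH: "dec p ?q H j G D" unfolding G_def by (simp add: mult.commute)
 have P: "polyfun G" "polyfun C" "polyfun D" "nz ?q G" "nz ?q C" "nz ?q D" using dF dH by (auto simp: dec_def)
 note VF = cval_step[OF sat F dF] and VH = cval_step[OF sat H dH]
 have "cval (p # ps) F p \<le> cval (p # ps) H p"
  using cval_above[OF sat] by (intro lleq_coeff_le[OF le p]) simp
 hence ij: "i \<le> j" unfolding cval_head_coeff[OF sat F dF] cval_head_coeff[OF sat H dH] by simp
 \<comment> \<open>With the common denominator G, the sum is \<open>ext p ^ i\<close> times E / G.
   The comparison of values has shown that i is at most j, so E is a polynomial function.\<close>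
 define E where "E = (\<lambda>v. C v + ext p v ^ (j - i) * D v)"
 have E: "polyfun E" unfolding E_def by (intro poly_add poly_mult polyfun_power polyfun_ext P p)
 have eq: "(F v + H v) * G v = ext p v ^ i * E v" if "v \<in> scone S p" for v
 proof -
  have "(F v + H v) * G v = ext p v ^ i * C v + ext p v ^ (i + (j - i)) * D v"
   using dF dH that ij by (simp add: dec_def distrib_right)
  thus ?thesis unfolding E_def power_add by (simp add: distrib_left mult.assoc)
 qed
 show "cval (p # ps) F \<preceq> cval (p # ps) (\<lambda>v. F v + H v)"
 proof (cases "nz ?q E")
  case True
  hence d: "dec p ?q (\<lambda>v. F v + H v) i G E" using P E eq by (simp add: dec_def)
  note VFH = cval_step[OF sat FH d]
  show ?thesis
  proof (cases "i = j")
   case True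
   hence E': "E = (\<lambda>v. C v + D v)" by (simp add: E_def)
   have "cval ps C \<preceq> cval ps D" using le unfolding VF VH True lleq_translate .
   hence "cval ps C \<preceq> cval ps E"
    using ultra P \<open>nz ?q E\<close> unfolding E' ultrametric_def by blast
   thus ?thesis unfolding VF VFH lleq_translate .
  next
   case False
   hence "E v = C v" if "v \<in> scone' S ?q" for v
    using ext_below[OF cov that] ij by (simp add: E_def power_0_left)
   hence "cval ps E = cval ps C" by (rule cval_cong[OF sat' E P(2) \<open>nz ?q E\<close>])
   thus ?thesis unfolding VF VFH by simp
  qed
 next
  case False
  \<comment> \<open>The leading terms cancel on the next stratum. Then E contributes a positive
    order of its own, and the value of the sum is strictly larger already at p.\<close>
  have "nz (Some p) (\<lambda>v. (F v + H v) * G v)"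
   using p by (intro nz_mult FH P nz_mono[OF cov]) simp
  hence "nz (Some p) (\<lambda>v. ext p v ^ i * E v)" by (rule nz_cong) (use eq in simp)
  hence nzE: "nz (Some p) E" using nz_multD[of "Some p" "\<lambda>v. ext p v ^ i" E] by blast
  obtain l A B where d: "dec p ?q E l A B" using dec_exists[OF cov E nzE] by - (elim exE, rule that)
  have l: "0 < l" by (rule dec_pos[OF d cov False])
  have "(F v + H v) * (G v * A v) = ext p v ^ (i + l) * B v" if v: "v \<in> scone S p" for v
  proof -
   have "(F v + H v) * (G v * A v) = ext p v ^ i * (E v * A v)" using eq[OF v] by (simp only: mult.assoc[symmetric])
   also have "E v * A v = ext p v ^ l * B v" using d v by (simp add: dec_def)
   finally show ?thesis by (simp add: power_add mult.assoc)
  qed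
  hence d': "dec p ?q (\<lambda>v. F v + H v) (i + l) (\<lambda>v. G v * A v) B"
   using d P nz_mult[OF sq P(1) _ P(4), of A] unfolding dec_def by (auto intro: poly_mult)
  have "cval (p # ps) F \<prec> cval (p # ps) (\<lambda>v. F v + H v)"
  proof (rule lless_coeff[OF p])
   show "cval (p # ps) F p < cval (p # ps) (\<lambda>v. F v + H v) p"
    unfolding cval_head_coeff[OF sat F dF] cval_head_coeff[OF sat FH d'] using l by simp
   fix x assume x: "x \<in> strata S" "(p, x) \<in> r" "x \<noteq> p"
   show "cval (p # ps) F x = cval (p # ps) (\<lambda>v. F v + H v) x" unfolding cval_above[OF sat x] ..
  qed
  thus ?thesis ..
 qed
 qed
qed

lemma cval_add_aux:
 "saturated ps \<Longrightarrow> polyfun F \<Longrightarrow> polyfun H \<Longrightarrow> nz (head ps) F \<Longrightarrow> nz (head ps) H \<Longrightarrow>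
  nz (head ps) (\<lambda>v. F v + H v) \<Longrightarrow> cval ps F \<preceq> cval ps H \<Longrightarrow> cval ps F \<preceq> cval ps (\<lambda>v. F v + H v)"
 by (rule saturated_ultrametric[unfolded ultrametric_def, rule_format])

lemma cval_total:
 assumes "saturated ps"
 shows "cval ps F \<preceq> cval ps H \<or> cval ps H \<prec> cval ps F"
proof (rule lless_total)
 fix x assume "x \<notin> strata S"
 hence x: "x \<notin> set ps" using saturated_strata[OF assms] by blast
 show "cval ps F x = cval ps H x" unfolding cval_supp[OF x] ..
qed

lemma cval_add:
 assumes "saturated ps" "polyfun F" "polyfun H" "nz (head ps) F" "nz (head ps) H"
  "nz (head ps) (\<lambda>v. F v + H v)"
 shows "cval ps F \<preceq> cval ps (\<lambda>v. F v + H v) \<or> cval ps H \<preceq> cval ps (\<lambda>v. F v + H v)"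
proof (cases "cval ps F \<preceq> cval ps H")
 case True
 thus ?thesis using cval_add_aux[OF assms] by blast
next
 case False
 hence "cval ps H \<preceq> cval ps F" using cval_total[OF assms(1), of F H] by blast
 moreover have "nz (head ps) (\<lambda>v. H v + F v)" using assms(6) by (simp add: add.commute)
 ultimately have "cval ps H \<preceq> cval ps (\<lambda>v. H v + F v)"
  using cval_add_aux[OF assms(1,3,2,5,4)] by blast
 thus ?thesis by (simp add: add.commute)
qed

text \<open>Values of functions that vanish on the top of the chain carry no meaning, hence the
  conditional bounds; such a summand does not change the other one there.\<close>

lemma cval_add_less:
 assumes "saturated ps" "polyfun F" "polyfun H" "nz (head ps) (\<lambda>v. F v + H v)"
  and "nz (head ps) F \<Longrightarrow> a \<prec> cval ps F" "nz (head ps) H \<Longrightarrow> a \<prec> cval ps H"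
 shows "a \<prec> cval ps (\<lambda>v. F v + H v)"
proof -
 have sum: "polyfun (\<lambda>v. F v + H v)" by (intro poly_add assms)
 consider (F) "nz (head ps) F" "nz (head ps) H" | (H) "\<not> nz (head ps) F" | (G) "\<not> nz (head ps) H" by blast
 thus ?thesis
 proof cases
  case F
  thus ?thesis using cval_add[OF assms(1-3) F assms(4)] assms(5)[OF F(1)] assms(6)[OF F(2)]
    lless_trans[of a "cval ps F"] lless_trans[of a "cval ps H"] by auto
 next
  case H
  hence eq: "F v + H v = H v" if "v \<in> scone' S (head ps)" for v using that by (simp add: nz_def)
  have nz: "nz (head ps) H" by (rule nz_cong[OF assms(4) eq])
  have "cval ps (\<lambda>v. F v + H v) = cval ps H" by (rule cval_cong[OF assms(1) sum assms(3,4) eq])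
  thus ?thesis using assms(6)[OF nz] by simp
 next
  case G
  hence eq: "F v + H v = F v" if "v \<in> scone' S (head ps)" for v using that by (simp add: nz_def)
  have nz: "nz (head ps) F" by (rule nz_cong[OF assms(4) eq])
  have "cval ps (\<lambda>v. F v + H v) = cval ps F" by (rule cval_cong[OF assms(1) sum assms(2,4) eq])
  thus ?thesis using assms(5)[OF nz] by simp
 qed
qed

lemma cval_sum_less:
 assumes "saturated ps" "finite E" "\<And>T. T \<in> E \<Longrightarrow> polyfun (f T)"
  and "\<And>T. T \<in> E \<Longrightarrow> nz (head ps) (f T) \<Longrightarrow> a \<prec> cval ps (f T)" "nz (head ps) (\<lambda>v. \<Sum>T\<in>E. f T v)"
 shows "a \<prec> cval ps (\<lambda>v. \<Sum>T\<in>E. f T v)"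
 using assms(2-)
proof (induction E rule: finite_induct)
 case empty
 thus ?case by (simp add: nz_def)
next
 case (insert T E)
 have sum: "(\<lambda>v. \<Sum>T\<in>insert T E. f T v) = (\<lambda>v. f T v + (\<Sum>T\<in>E. f T v))" using insert.hyps by simp
 show ?case unfolding sum
 proof (rule cval_add_less[OF assms(1)])
  show "polyfun (f T)" using insert.prems by simp
  show "polyfun (\<lambda>v. \<Sum>T\<in>E. f T v)" using insert.prems insert.hyps by (intro polyfun_sum) auto
  show "nz (head ps) (\<lambda>v. f T v + (\<Sum>T\<in>E. f T v))" using insert.prems(3) unfolding sum .
  show "a \<prec> cval ps (f T)" if "nz (head ps) (f T)" using insert.prems(2)[of T] that by simp
  show "a \<prec> cval ps (\<lambda>v. \<Sum>T\<in>E. f T v)" if "nz (head ps) (\<lambda>v. \<Sum>T\<in>E. f T v)"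
   by (rule insert.IH) (use insert.prems that in auto)
 qed
qed

lemma cval_uminus:
 assumes "saturated ps" "polyfun F" "nz (head ps) F"
 shows "cval ps (\<lambda>v. - 1 * F v) = cval ps F"
 using cval_mult[OF assms(1) poly_const[of "- 1"] assms(2) _ assms(3)] cval_const[OF assms(1), of "- 1"]
  saturated_strat[OF assms(1)] by (simp add: nz_const)

text \<open>Apply the strict bound to F = (F + H) - H: if the sum vanished or had a larger value, F
  would have a larger value than itself.\<close>

lemma cval_add_leading:
 assumes "saturated ps" "polyfun F" "polyfun H" "nz (head ps) F" "nz (head ps) H \<Longrightarrow> cval ps F \<prec> cval ps H"
 shows "nz (head ps) (\<lambda>v. F v + H v) \<and> cval ps (\<lambda>v. F v + H v) = cval ps F"
proof -
 let ?s = "\<lambda>v. F v + H v"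
 have sum: "polyfun ?s" by (intro poly_add assms)
 have neg: "polyfun (\<lambda>v. - 1 * H v)" by (intro polyfun_scale assms)
 have F: "F = (\<lambda>v. ?s v + - 1 * H v)" by (simp add: fun_eq_iff)
 have less_neg: "cval ps F \<prec> cval ps (\<lambda>v. - 1 * H v)" if "nz (head ps) (\<lambda>v. - 1 * H v)"
 proof -
  have H: "nz (head ps) H" using that by (simp add: nz_def)
  thus ?thesis using assms(5) cval_uminus[OF assms(1,3) H] by simp
 qed
 have "nz (head ps) (\<lambda>v. ?s v + - 1 * H v)" using assms(4) by simp
 hence "cval ps F \<prec> cval ps (\<lambda>v. ?s v + - 1 * H v)" if "nz (head ps) ?s \<Longrightarrow> cval ps F \<prec> cval ps ?s"
  by (rule cval_add_less[OF assms(1) sum neg]) (use that less_neg in blast)+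
 hence no: "\<not> (nz (head ps) ?s \<longrightarrow> cval ps F \<prec> cval ps ?s)"
  using lless_irrefl[of "cval ps F"] unfolding F[symmetric] by blast
 hence s: "nz (head ps) ?s" and ge: "\<not> cval ps F \<prec> cval ps ?s" by blast+
 have "cval ps F \<preceq> cval ps ?s"
 proof (cases "nz (head ps) H")
  case True
  thus ?thesis using cval_add[OF assms(1-4) True s] assms(5)[OF True]
    lless_trans[of "cval ps F" "cval ps H" "cval ps ?s"] by auto
 next
  case False
  hence "cval ps F = cval ps ?s" by (intro cval_cong assms sum) (simp add: nz_def)
  thus ?thesis ..
 qed
 with ge s show ?thesis by auto
qed

end

section \<open>Fractions of functions on the strata\<close>

context seshadri
begin

lemma nz_cancel:
 assumes q: "strat q" and P: "polyfun A" "polyfun B" "polyfun D" and D: "nz q D"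
  and eq: "\<And>v. v \<in> scone' S q \<Longrightarrow> A v * D v = B v * D v" and v: "v \<in> scone' S q"
 shows "A v = B v"
proof (rule ccontr)
 assume "A v \<noteq> B v"
 let ?H = "\<lambda>v. A v + (- 1) * B v"
 have H: "polyfun ?H" by (intro poly_add polyfun_scale P)
 have "nz q ?H" using v \<open>A v \<noteq> B v\<close> by (auto simp: nz_def)
 hence "nz q (\<lambda>v. ?H v * D v)" by (intro nz_mult q H P D)
 then obtain w where w: "w \<in> scone' S q" "(A w + (- 1) * B w) * D w \<noteq> 0" unfolding nz_def by blast
 thus False using eq[OF w(1)] by (simp add: algebra_simps)
qed

abbreviation sring :: "'a option \<Rightarrow> (('b, 'k) mpoint \<Rightarrow> 'k) ring" where
 "sring q \<equiv> coord_ring (scone' S q)"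

text \<open>Names the class of a fraction by polynomial functions on the ambient space, so that
  equations between classes become equations of values on the stratum.\<close>

definition fr :: "'a option \<Rightarrow> (('b, 'k) mpoint \<Rightarrow> 'k) \<Rightarrow> (('b, 'k) mpoint \<Rightarrow> 'k)
  \<Rightarrow> ((('b, 'k) mpoint \<Rightarrow> 'k) \<times> (('b, 'k) mpoint \<Rightarrow> 'k)) set" where
 "fr q F D = frac (sring q) (restr (scone' S q) F) (restr (scone' S q) D)"

abbreviation ffield :: "'a option \<Rightarrow> ((('b, 'k) mpoint \<Rightarrow> 'k) \<times> (('b, 'k) mpoint \<Rightarrow> 'k)) set ring" where
 "ffield q \<equiv> frac_field (sring q)"

abbreviation ff :: "'a \<Rightarrow> ((('b, 'k) mpoint \<Rightarrow> 'k) \<times> (('b, 'k) mpoint \<Rightarrow> 'k)) set ring" where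
 "ff p \<equiv> ffield (Some p)"

lemma restr_eq_iff: "restr Y F = restr Y G \<longleftrightarrow> (\<forall>v\<in>Y. F v = G v)"
 by (auto simp: restr_def fun_eq_iff)

lemma sring_carrier: "carrier (sring q) = {restr (scone' S q) F | F. polyfun F}"
 by (simp add: coord_ring_def)

lemma sring_nonzero: "carrier (sring q) - {\<zero>\<^bsub>sring q\<^esub>} = {restr (scone' S q) F | F. polyfun F \<and> nz q F}"
 by (auto simp: coord_ring_def restr_def nz_def fun_eq_iff) metis+

lemma fr_iff: "(a, b) \<in> fr q F D \<longleftrightarrow> (\<exists>A B. a = restr (scone' S q) A \<and> b = restr (scone' S q) B \<and>
  polyfun A \<and> polyfun B \<and> nz q B \<and> (\<forall>v\<in>scone' S q. F v * B v = A v * D v))"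
proof -
 have eq: "restr (scone' S q) F \<otimes>\<^bsub>sring q\<^esub> restr (scone' S q) B = restr (scone' S q) A \<otimes>\<^bsub>sring q\<^esub> restr (scone' S q) D
   \<longleftrightarrow> (\<forall>v\<in>scone' S q. F v * B v = A v * D v)" for A B
  by (auto simp: coord_ring_def restr_def fun_eq_iff)
 have "(a, b) \<in> fr q F D \<longleftrightarrow> (\<exists>A. a = restr (scone' S q) A \<and> polyfun A) \<and>
   (\<exists>B. b = restr (scone' S q) B \<and> polyfun B \<and> nz q B) \<and>
   restr (scone' S q) F \<otimes>\<^bsub>sring q\<^esub> b = a \<otimes>\<^bsub>sring q\<^esub> restr (scone' S q) D" (is "_ \<longleftrightarrow> ?R")
  unfolding fr_def frac_def sring_nonzero by (simp add: sring_carrier)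
 also have "?R \<longleftrightarrow> (\<exists>A B. a = restr (scone' S q) A \<and> b = restr (scone' S q) B \<and>
   polyfun A \<and> polyfun B \<and> nz q B \<and> restr (scone' S q) F \<otimes>\<^bsub>sring q\<^esub> restr (scone' S q) B =
   restr (scone' S q) A \<otimes>\<^bsub>sring q\<^esub> restr (scone' S q) D)" by blast
 finally show ?thesis unfolding eq .
qed

lemma fr_self: "polyfun F \<Longrightarrow> polyfun D \<Longrightarrow> nz q D \<Longrightarrow> (restr (scone' S q) F, restr (scone' S q) D) \<in> fr q F D"
 unfolding fr_iff by blast

lemma fr_eqI:
 assumes q: "strat q" and P: "polyfun F" "polyfun D" "polyfun F'" "polyfun D'" "nz q D" "nz q D'"
  and eq: "\<And>v. v \<in> scone' S q \<Longrightarrow> F v * D' v = F' v * D v"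
 shows "fr q F D = fr q F' D'"
proof -
 have sub: "(a, b) \<in> fr q F' D'"
  if m: "(a, b) \<in> fr q F D" and P: "polyfun F" "polyfun D" "polyfun F'" "polyfun D'" "nz q D"
   and eq: "\<And>v. v \<in> scone' S q \<Longrightarrow> F v * D' v = F' v * D v" for a b F D F' D'
 proof -
  obtain A B where AB: "a = restr (scone' S q) A" "b = restr (scone' S q) B" "polyfun A" "polyfun B" "nz q B"
   and AB_eq: "\<forall>v\<in>scone' S q. F v * B v = A v * D v" using m unfolding fr_iff by blast
  have "F' v * B v = A v * D' v" if v: "v \<in> scone' S q" for v
  proof (rule nz_cancel[OF q _ _ P(2,5) _ v])
   show "polyfun (\<lambda>v. F' v * B v)" "polyfun (\<lambda>v. A v * D' v)" by (intro poly_mult P AB)+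
   fix v assume v: "v \<in> scone' S q"
   have "F' v * B v * D v = F' v * D v * B v" by (simp add: mult_ac)
   also have "\<dots> = F v * B v * D' v" using eq[OF v] by (simp add: mult_ac)
   also have "\<dots> = A v * D' v * D v" using AB_eq v by (simp add: mult_ac)
   finally show "F' v * B v * D v = A v * D' v * D v" .
  qed
  thus ?thesis unfolding fr_iff using AB by blast
 qed
 show ?thesis
 proof (rule equalityI; rule subrelI)
  fix a b assume "(a, b) \<in> fr q F D"
  thus "(a, b) \<in> fr q F' D'" by (rule sub[OF _ P(1-5) eq])
 next
  fix a b assume "(a, b) \<in> fr q F' D'"
  thus "(a, b) \<in> fr q F D" by (rule sub[OF _ P(3,4,1,2,6) eq[symmetric]])
 qed
qed

lemma fr_eqD:
 assumes "fr q F D = fr q F' D'" "polyfun F" "polyfun D" "nz q D" "v \<in> scone' S q"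
 shows "F v * D' v = F' v * D v"
proof -
 have "(restr (scone' S q) F, restr (scone' S q) D) \<in> fr q F' D'" using fr_self[OF assms(2-4)] assms(1) by simp
 then obtain A B where AB: "restr (scone' S q) F = restr (scone' S q) A" "restr (scone' S q) D = restr (scone' S q) B"
  "\<forall>v\<in>scone' S q. F' v * B v = A v * D' v" unfolding fr_iff by blast
 have "F v = A v" "D v = B v" using AB(1,2) assms(5) unfolding restr_eq_iff by auto
 thus ?thesis using AB(3) assms(5) by simp
qed

lemma frac_fr:
 assumes "(a, b) \<in> fr q F D" "polyfun F" "polyfun D" "nz q D" "strat q"
 shows "\<exists>A B. a = restr (scone' S q) A \<and> b = restr (scone' S q) B \<and> polyfun A \<and> polyfun B \<and> nz q B \<and>
  fr q A B = fr q F D"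
proof -
 obtain A B where AB: "a = restr (scone' S q) A" "b = restr (scone' S q) B" "polyfun A" "polyfun B" "nz q B"
  "\<forall>v\<in>scone' S q. F v * B v = A v * D v" using assms(1) unfolding fr_iff by blast
 have "fr q A B = fr q F D" by (rule fr_eqI[OF assms(5) AB(3,4) assms(2,3) AB(5) assms(4)]) (use AB(6) in simp)
 with AB show ?thesis by blast
qed

lemma restr_mult: "restr Y F \<otimes>\<^bsub>coord_ring Y\<^esub> restr Y G = restr Y (\<lambda>v. F v * G v)"
 by (simp add: coord_ring_def restr_def fun_eq_iff)

lemma fr_mult:
 assumes q: "strat q" and P: "polyfun F" "polyfun D" "polyfun F'" "polyfun D'" "nz q D" "nz q D'"
 shows "fr q F D \<otimes>\<^bsub>ffield q\<^esub> fr q F' D' = fr q (\<lambda>v. F v * F' v) (\<lambda>v. D v * D' v)"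
proof -
 have eq: "frac (sring q) (a \<otimes>\<^bsub>sring q\<^esub> c) (b \<otimes>\<^bsub>sring q\<^esub> d) = fr q (\<lambda>v. F v * F' v) (\<lambda>v. D v * D' v)"
  if ab: "(a, b) \<in> fr q F D" and cd: "(c, d) \<in> fr q F' D'" for a b c d
 proof -
  obtain A B where AB: "a = restr (scone' S q) A" "b = restr (scone' S q) B" "polyfun A" "polyfun B" "nz q B"
   "\<forall>v\<in>scone' S q. F v * B v = A v * D v" using ab unfolding fr_iff by blast
  obtain A' B' where AB': "c = restr (scone' S q) A'" "d = restr (scone' S q) B'" "polyfun A'" "polyfun B'" "nz q B'"
   "\<forall>v\<in>scone' S q. F' v * B' v = A' v * D' v" using cd unfolding fr_iff by blast
  have "fr q (\<lambda>v. A v * A' v) (\<lambda>v. B v * B' v) = fr q (\<lambda>v. F v * F' v) (\<lambda>v. D v * D' v)"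
  proof (rule fr_eqI[OF q])
   fix v assume v: "v \<in> scone' S q"
   have "A v * A' v * (D v * D' v) = (A v * D v) * (A' v * D' v)" by (simp add: mult_ac)
   also have "\<dots> = (F v * B v) * (F' v * B' v)" using AB(6) AB'(6) v by simp
   also have "\<dots> = F v * F' v * (B v * B' v)" by (simp add: mult_ac)
   finally show "A v * A' v * (D v * D' v) = F v * F' v * (B v * B' v)" .
  qed (intro poly_mult nz_mult q P AB AB')+
  thus ?thesis unfolding AB(1,2) AB'(1,2) restr_mult fr_def .
 qed
 have "fr q F D \<otimes>\<^bsub>ffield q\<^esub> fr q F' D' =
   (\<Union>(a, b)\<in>fr q F D. \<Union>(c, d)\<in>fr q F' D'. frac (sring q) (a \<otimes>\<^bsub>sring q\<^esub> c) (b \<otimes>\<^bsub>sring q\<^esub> d))"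
  by (simp add: frac_field_def)
 also have "\<dots> = (\<Union>(a, b)\<in>fr q F D. \<Union>(c, d)\<in>fr q F' D'. fr q (\<lambda>v. F v * F' v) (\<lambda>v. D v * D' v))"
  using eq by (intro SUP_cong refl) auto
 also have "\<dots> = fr q (\<lambda>v. F v * F' v) (\<lambda>v. D v * D' v)"
  using fr_self[OF P(1,2,5)] fr_self[OF P(3,4,6)] by auto
 finally show ?thesis .
qed

lemma fr_one: "\<one>\<^bsub>ffield q\<^esub> = fr q (\<lambda>_. 1) (\<lambda>_. 1)"
 by (simp add: frac_field_def fr_def coord_ring_def)

lemma ffield_carrier: "carrier (ffield q) = {fr q F D | F D. polyfun F \<and> polyfun D \<and> nz q D}"
 unfolding frac_field_def by (simp add: sring_nonzero) (auto simp: fr_def sring_carrier)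

lemma fr_nat_pow:
 assumes q: "strat q" and P: "polyfun F" "polyfun D" "nz q D"
 shows "fr q F D [^]\<^bsub>ffield q\<^esub> (e :: nat) = fr q (\<lambda>v. F v ^ e) (\<lambda>v. D v ^ e)"
proof (induction e)
 case 0
 thus ?case by (simp add: nat_pow_def fr_one)
next
 case (Suc e)
 have "fr q F D [^]\<^bsub>ffield q\<^esub> Suc e = fr q F D [^]\<^bsub>ffield q\<^esub> e \<otimes>\<^bsub>ffield q\<^esub> fr q F D"
  by (simp add: nat_pow_def)
 also have "\<dots> = fr q (\<lambda>v. F v ^ e * F v) (\<lambda>v. D v ^ e * D v)"
  unfolding Suc.IH by (intro fr_mult q P polyfun_power nz_power)
 finally show ?case by (simp add: mult.commute)
qed

lemma fr_inv:
 assumes q: "strat q" and P: "polyfun F" "polyfun D" "nz q F" "nz q D"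
 shows "inv\<^bsub>ffield q\<^esub> fr q F D = fr q D F"
 unfolding m_inv_def
proof (rule the_equality)
 have one: "fr q (\<lambda>v. A v * B v) (\<lambda>v. B v * A v) = \<one>\<^bsub>ffield q\<^esub>"
  if A: "polyfun A" "nz q A" and B: "polyfun B" "nz q B" for A B
  unfolding fr_one
  by (rule fr_eqI[OF q poly_mult[OF A(1) B(1)] poly_mult[OF B(1) A(1)] poly_const poly_const
     nz_mult[OF q B(1) A(1) B(2) A(2)] nz_const[OF one_neq_zero q]]) simp
 have "fr q (\<lambda>v. F v * D v) (\<lambda>v. D v * F v) = \<one>\<^bsub>ffield q\<^esub>" "fr q (\<lambda>v. D v * F v) (\<lambda>v. F v * D v) = \<one>\<^bsub>ffield q\<^esub>"
  by (rule one[OF P(1,3,2,4)], rule one[OF P(2,4,1,3)])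
 thus "fr q D F \<in> carrier (ffield q) \<and> fr q F D \<otimes>\<^bsub>ffield q\<^esub> fr q D F = \<one>\<^bsub>ffield q\<^esub> \<and>
   fr q D F \<otimes>\<^bsub>ffield q\<^esub> fr q F D = \<one>\<^bsub>ffield q\<^esub>"
  unfolding ffield_carrier fr_mult[OF q P(1,2,2,1,4,3)] fr_mult[OF q P(2,1,1,2,3,4)] using P by blast
next
 fix y assume y: "y \<in> carrier (ffield q) \<and> fr q F D \<otimes>\<^bsub>ffield q\<^esub> y = \<one>\<^bsub>ffield q\<^esub> \<and> y \<otimes>\<^bsub>ffield q\<^esub> fr q F D = \<one>\<^bsub>ffield q\<^esub>"
 then obtain A B where AB: "y = fr q A B" "polyfun A" "polyfun B" "nz q B" unfolding ffield_carrier by blast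
 have "fr q (\<lambda>v. F v * A v) (\<lambda>v. D v * B v) = fr q (\<lambda>_. 1) (\<lambda>_. 1)"
  using y unfolding AB(1) fr_one fr_mult[OF q P(1,2) AB(2,3) P(4) AB(4)] by blast
 from fr_eqD[OF this poly_mult[OF P(1) AB(2)] poly_mult[OF P(2) AB(3)] nz_mult[OF q P(2) AB(3) P(4) AB(4)]]
 have "F v * A v * 1 = 1 * (D v * B v)" if "v \<in> scone' S q" for v using that by blast
 thus "y = fr q D F" unfolding AB(1) by (intro fr_eqI q P AB) (simp add: mult_ac)
qed

lemma fr_int_pow:
 assumes q: "strat q" and P: "polyfun F" "polyfun D" "nz q F" "nz q D"
 shows "fr q F D [^]\<^bsub>ffield q\<^esub> (z :: int) =
  (if z < 0 then fr q (\<lambda>v. D v ^ nat (- z)) (\<lambda>v. F v ^ nat (- z)) else fr q (\<lambda>v. F v ^ nat z) (\<lambda>v. D v ^ nat z))"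
proof -
 have "fr q F D [^]\<^bsub>ffield q\<^esub> z = (if z < 0 then inv\<^bsub>ffield q\<^esub> (fr q F D [^]\<^bsub>ffield q\<^esub> nat (- z))
   else fr q F D [^]\<^bsub>ffield q\<^esub> nat z)"
  by (simp add: int_pow_def nat_pow_def)
 thus ?thesis unfolding fr_nat_pow[OF q P(1,2,4)]
  using fr_inv[OF q polyfun_power[OF P(1)] polyfun_power[OF P(2)] nz_power[OF q P(1,3)] nz_power[OF q P(2,4)]]
  by simp
qed

end

section \<open>Orders of vanishing and the discrete valuations\<close>

context seshadri
begin

definition ord :: "'a \<Rightarrow> 'a option \<Rightarrow> (('b, 'k) mpoint \<Rightarrow> 'k) \<Rightarrow> nat" where
 "ord p q F = (THE i. \<exists>G C. dec p q F i G C)"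

lemma ord_eq:
 assumes "covers p q" "polyfun F" "nz (Some p) F" "dec p q F i G C"
 shows "ord p q F = i"
 unfolding ord_def
proof (rule the_equality)
 show "\<exists>G C. dec p q F i G C" using assms(4) by blast
 fix j assume "\<exists>G C. dec p q F j G C"
 then obtain G' C' where d: "dec p q F j G' C'" by blast
 show "j = i" by (rule conjunct1[OF dec_unique[OF assms(1-3) d assms(4)]])
qed

lemma ord_dec:
 assumes "covers p q" "polyfun F" "nz (Some p) F"
 obtains G C where "dec p q F (ord p q F) G C"
proof -
 obtain i G C where d: "dec p q F i G C" using dec_exists[OF assms] by - (elim exE, rule that)
 show thesis by (rule that[of G C]) (use d ord_eq[OF assms d] in simp)
qed

lemma ord_mult:
 assumes cov: "covers p q" and P: "polyfun F" "nz (Some p) F" "polyfun G" "nz (Some p) G"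
 shows "ord p q (\<lambda>v. F v * G v) = ord p q F + ord p q G"
proof -
 obtain A C where dF: "dec p q F (ord p q F) A C" by (rule ord_dec[OF cov P(1,2)])
 obtain B D where dG: "dec p q G (ord p q G) B D" by (rule ord_dec[OF cov P(3,4)])
 have "strat (Some p)" using covers_strata(1)[OF cov] by simp
 from ord_eq[OF cov poly_mult[OF P(1,3)] nz_mult[OF this P(1,3,2,4)] dec_mult[OF covers_strat[OF cov] dF dG]]
 show ?thesis .
qed

lemma ord_regular:
 assumes cov: "covers p q" and P: "polyfun F" "nz q F"
 shows "ord p q F = 0"
 by (rule ord_eq[OF cov P(1) nz_mono[OF cov P(2)] dec_regular[OF cov P]])

lemma ord_pos:
 assumes cov: "covers p q" and P: "polyfun F" "nz (Some p) F" "\<not> nz q F"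
 shows "0 < ord p q F"
proof -
 obtain G C where d: "dec p q F (ord p q F) G C" by (rule ord_dec[OF cov P(1,2)])
 show ?thesis by (rule dec_pos[OF d cov P(3)])
qed

lemma ord_cong:
 assumes cov: "covers p q" and P: "polyfun F" "nz (Some p) F" "polyfun G"
  and eq: "\<And>v. v \<in> scone S p \<Longrightarrow> F v = G v"
 shows "ord p q F = ord p q G"
proof -
 obtain A C where d: "dec p q F (ord p q F) A C" by (rule ord_dec[OF cov P(1,2)])
 have "nz (Some p) G" by (rule nz_cong[OF P(2)]) (use eq in simp)
 moreover have "dec p q G (ord p q F) A C" using d eq by (simp add: dec_def)
 ultimately show ?thesis using ord_eq[OF cov P(3)] by simp
qed

lemma ord_ext: "covers p q \<Longrightarrow> ord p q (ext p) = 1"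
 by (rule ord_eq[OF _ _ _ dec_ext]) (auto intro: polyfun_ext nz_ext dest: covers_strata(1))

lemma fr_ord:
 assumes cov: "covers p q" and P: "polyfun F" "nz (Some p) F" "polyfun D" "nz (Some p) D"
  "polyfun F'" "nz (Some p) F'" "polyfun D'" "nz (Some p) D'" and eq: "fr (Some p) F D = fr (Some p) F' D'"
 shows "int (ord p q F) - int (ord p q D) = int (ord p q F') - int (ord p q D')"
proof -
 have s: "strat (Some p)" using covers_strata(1)[OF cov] by simp
 have "F v * D' v = F' v * D v" if "v \<in> scone S p" for v
  using fr_eqD[OF eq P(1,3,4)] that by simp
 hence "ord p q (\<lambda>v. F v * D' v) = ord p q (\<lambda>v. F' v * D v)"
  by (rule ord_cong[OF cov poly_mult[OF P(1,7)] nz_mult[OF s P(1,7,2,8)] poly_mult[OF P(5,3)]])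
 hence "ord p q F + ord p q D' = ord p q F' + ord p q D"
  unfolding ord_mult[OF cov P(1,2,7,8)] ord_mult[OF cov P(5,6,3,4)] .
 thus ?thesis by simp
qed

abbreviation videal :: "'a \<Rightarrow> 'a option \<Rightarrow> (('b, 'k) mpoint \<Rightarrow> 'k) set" where
 "videal p q \<equiv> vanishing_ideal (scone S p) (scone' S q)"

lemma videal_iff:
 assumes "covers p q"
 shows "f \<in> videal p q \<longleftrightarrow> (\<exists>A. f = restr (scone S p) A \<and> polyfun A \<and> \<not> nz q A)"
proof -
 have "(\<forall>v\<in>scone' S q. restr (scone S p) A v = 0) \<longleftrightarrow> \<not> nz q A" for A
  using scone_mono[OF assms] by (auto simp: restr_def nz_def)
 thus ?thesis unfolding vanishing_ideal_def by (auto simp: coord_ring_def)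
qed

lemma videal_restr: "covers p q \<Longrightarrow> polyfun B \<Longrightarrow> restr (scone S p) B \<notin> videal p q \<longleftrightarrow> nz q B"
proof -
 assume cov: "covers p q" and B: "polyfun B"
 have "(\<forall>v\<in>scone' S q. restr (scone S p) B v = 0) \<longleftrightarrow> \<not> nz q B"
  using scone_mono[OF cov] by (auto simp: restr_def nz_def)
 thus ?thesis using B unfolding vanishing_ideal_def by (auto simp: coord_ring_def)
qed

lemma carrier_minus_videal:
 assumes cov: "covers p q"
 shows "carrier (sring (Some p)) - videal p q = {restr (scone S p) B | B. polyfun B \<and> nz q B}"
 unfolding sring_carrier unfolding scone'.simps using videal_restr[OF cov] by blast

lemma local_ring_eq:
 assumes cov: "covers p q"
 shows "local_ring (sring (Some p)) (videal p q) =
  {fr (Some p) A B | A B. polyfun A \<and> polyfun B \<and> nz q B}"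
 unfolding local_ring_def carrier_minus_videal[OF cov]
 unfolding sring_carrier fr_def unfolding scone'.simps by auto

lemma local_max_eq:
 assumes cov: "covers p q"
 shows "local_max (sring (Some p)) (videal p q) =
  {fr (Some p) A B | A B. polyfun A \<and> polyfun B \<and> \<not> nz q A \<and> nz q B}"
proof -
 have "videal p q = {restr (scone S p) A | A. polyfun A \<and> \<not> nz q A}" using videal_iff[OF cov] by blast
 thus ?thesis unfolding local_max_def carrier_minus_videal[OF cov]
  unfolding fr_def scone'.simps by auto
qed

text \<open>If A vanishes on q, \<open>covers_ideal\<close> writes A * s' as \<open>ext p\<close>
  times C with s' a unit at q, so A / B is \<open>ext p\<close> times the fraction of C by B *
  s'.\<close>

lemma uniformizer_ext:
 assumes cov: "covers p q"
 shows "uniformizer (sring (Some p)) (videal p q) (fr (Some p) (ext p) (\<lambda>_. 1))"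
proof -
 let ?t = "fr (Some p) (ext p) (\<lambda>_. 1)"
 have p: "p \<in> strata S" and s: "strat (Some p)" using covers_strata(1)[OF cov] by auto
 have sq: "strat q" by (rule covers_strat[OF cov])
 have e: "polyfun (ext p)" by (rule polyfun_ext[OF p])
 have one: "polyfun (\<lambda>_. 1)" "nz q (\<lambda>_. 1)" "nz (Some p) (\<lambda>_. 1)"
  using sq s by (auto intro: poly_const nz_const)
 have ne: "\<not> nz q (\<lambda>v. A v * ext p v)" for A using ext_below[OF cov] by (simp add: nz_def)
 have mult: "fr (Some p) A B \<otimes>\<^bsub>ff p\<^esub> ?t = fr (Some p) (\<lambda>v. A v * ext p v) B"
  if "polyfun A" "polyfun B" "nz q B" for A B
  using fr_mult[OF s that(1,2) e one(1) nz_mono[OF cov that(3)] one(3)] by simp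
 have "?t \<in> local_max (sring (Some p)) (videal p q)"
  unfolding local_max_eq[OF cov] using e one ne[of "\<lambda>_. 1"] by auto
 moreover have "fr (Some p) A B \<in> (\<lambda>u. u \<otimes>\<^bsub>ff p\<^esub> ?t) ` local_ring (sring (Some p)) (videal p q)"
  if A: "polyfun A" "\<not> nz q A" and B: "polyfun B" "nz q B" for A B
 proof -
  obtain s' l where s': "polyfun s'" "nz q s'" "nz (Some p) s'"
   and ideal: "\<forall>F. polyfun F \<longrightarrow> \<not> nz q F \<longrightarrow> (\<exists>C. polyfun C \<and> (\<forall>v\<in>scone S p. F v * s' v = ext p v * C v))"
   using covers_ideal[OF cov] by - (elim exE conjE, rule that)
  obtain C where C: "polyfun C" "\<forall>v\<in>scone S p. A v * s' v = ext p v * C v" using ideal A by blast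
  have Bs: "polyfun (\<lambda>v. B v * s' v)" "nz q (\<lambda>v. B v * s' v)" by (intro poly_mult B s' nz_mult[OF sq])+
  have "fr (Some p) A B = fr (Some p) (\<lambda>v. C v * ext p v) (\<lambda>v. B v * s' v)"
  proof (rule fr_eqI[OF s A(1) B(1) poly_mult[OF C(1) e] Bs(1) nz_mono[OF cov B(2)] nz_mono[OF cov Bs(2)]])
   fix v assume "v \<in> scone' S (Some p)"
   hence eq: "A v * s' v = C v * ext p v" using C(2) by (simp add: mult.commute)
   have "A v * (B v * s' v) = (A v * s' v) * B v" by (simp add: mult_ac)
   thus "A v * (B v * s' v) = C v * ext p v * B v" unfolding eq .
  qed
  also have "\<dots> = fr (Some p) C (\<lambda>v. B v * s' v) \<otimes>\<^bsub>ff p\<^esub> ?t" by (rule mult[OF C(1) Bs, symmetric])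
  finally show ?thesis unfolding local_ring_eq[OF cov] using C(1) Bs by blast
 qed
 moreover have "u \<otimes>\<^bsub>ff p\<^esub> ?t \<in> local_max (sring (Some p)) (videal p q)"
  if "u \<in> local_ring (sring (Some p)) (videal p q)" for u
 proof -
  obtain A B where AB: "u = fr (Some p) A B" "polyfun A" "polyfun B" "nz q B"
   using \<open>u \<in> _\<close> unfolding local_ring_eq[OF cov] by blast
  show ?thesis unfolding AB(1) mult[OF AB(2-4)] local_max_eq[OF cov]
   using poly_mult[OF AB(2) e] AB(3,4) ne[of A] by blast
 qed
 ultimately show ?thesis unfolding uniformizer_def local_max_eq[OF cov] by blast
qed

text \<open>\<open>disc_val\<close> ranges over all uniformizers, so the order of an arbitrary one
  is needed. It is positive because t lies in the maximal ideal, and at most 1 because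
  \<open>ext p\<close>, of order 1, is a multiple of t.\<close>

lemma uniformizer_ord:
 assumes cov: "covers p q" and t: "uniformizer (sring (Some p)) (videal p q) t"
 obtains A B where "t = fr (Some p) A B" "polyfun A" "nz (Some p) A" "polyfun B" "nz q B" "ord p q A = 1"
proof -
 let ?t = "fr (Some p) (ext p) (\<lambda>_. 1)"
 have p: "p \<in> strata S" and s: "strat (Some p)" using covers_strata(1)[OF cov] by auto
 have one: "polyfun (\<lambda>_. 1)" "nz (Some p) (\<lambda>_. 1)" "nz q (\<lambda>_. 1)"
  using s covers_strat[OF cov] by (auto intro: poly_const nz_const)
 have e: "polyfun (ext p)" "nz (Some p) (ext p)" by (rule polyfun_ext[OF p], rule nz_ext[OF p])
 obtain A B where AB: "t = fr (Some p) A B" "polyfun A" "polyfun B" "\<not> nz q A" "nz q B"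
  using conjunct1[OF t[unfolded uniformizer_def]] unfolding local_max_eq[OF cov] by blast
 have "?t \<in> local_max (sring (Some p)) (videal p q)"
  using uniformizer_ext[OF cov] unfolding uniformizer_def by (rule conjunct1)
 also have "local_max (sring (Some p)) (videal p q) =
   (\<lambda>u. u \<otimes>\<^bsub>ff p\<^esub> t) ` local_ring (sring (Some p)) (videal p q)"
  using t unfolding uniformizer_def by (rule conjunct2)
 finally obtain u where u: "?t = u \<otimes>\<^bsub>ff p\<^esub> t" "u \<in> local_ring (sring (Some p)) (videal p q)"
  by (rule imageE)
 obtain X Y where XY': "u = fr (Some p) X Y" "polyfun X" "polyfun Y" "nz q Y"
  using u(2) unfolding local_ring_eq[OF cov] by blast
 have XY: "polyfun X" "polyfun Y" "nz q Y" "?t = fr (Some p) X Y \<otimes>\<^bsub>ff p\<^esub> fr (Some p) A B"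
  by (rule XY'(2), rule XY'(3), rule XY'(4)) (use u(1) in \<open>simp only: XY'(1) AB(1)\<close>)
 have Bp: "nz (Some p) B" and Yp: "nz (Some p) Y" using nz_mono[OF cov] AB XY by auto
 have eq: "?t = fr (Some p) (\<lambda>v. X v * A v) (\<lambda>v. Y v * B v)"
  unfolding XY(4) by (rule fr_mult[OF s XY(1,2) AB(2,3) Yp Bp])
 have YB: "polyfun (\<lambda>v. Y v * B v)" "nz (Some p) (\<lambda>v. Y v * B v)" by (intro poly_mult nz_mult[OF s] XY AB Yp Bp)+
 have "ext p v * (Y v * B v) = X v * A v" if "v \<in> scone' S (Some p)" for v
  using fr_eqD[OF eq e(1) one(1,2) that] by simp
 hence "nz (Some p) (\<lambda>v. X v * A v)"
  by (rule nz_cong[OF nz_mult[OF s e(1) YB(1) e(2) YB(2)]])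
 from nz_multD[OF this] have XA: "nz (Some p) X" "nz (Some p) A" by blast+
 have "int (ord p q (ext p)) - int (ord p q (\<lambda>_. 1)) = int (ord p q (\<lambda>v. X v * A v)) - int (ord p q (\<lambda>v. Y v * B v))"
  by (rule fr_ord[OF cov e one(1,2) poly_mult[OF XY(1) AB(2)] \<open>nz (Some p) (\<lambda>v. X v * A v)\<close> YB eq])
 hence "1 = ord p q X + ord p q A"
  using ord_ext[OF cov] ord_regular[OF cov one(1,3)] ord_regular[OF cov XY(2,3)] ord_regular[OF cov AB(3,5)]
   ord_mult[OF cov XY(1) XA(1) AB(2) XA(2)] ord_mult[OF cov XY(2) Yp AB(3) Bp] by simp
 moreover have "0 < ord p q A" by (rule ord_pos[OF cov AB(2) XA(2) AB(4)])
 ultimately have "ord p q A = 1" by simp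
 thus thesis by (rule that[OF AB(1,2) XA(2) AB(3,5)])
qed

lemma unit_nz:
 assumes cov: "covers p q" and u: "u \<in> local_ring (sring (Some p)) (videal p q) - local_max (sring (Some p)) (videal p q)"
 obtains X Y where "u = fr (Some p) X Y" "polyfun X" "polyfun Y" "nz q X" "nz q Y"
proof -
 obtain X Y where XY: "u = fr (Some p) X Y" "polyfun X" "polyfun Y" "nz q Y"
  using u unfolding local_ring_eq[OF cov] by blast
 moreover have "nz q X" using u XY unfolding local_max_eq[OF cov] by blast
 ultimately show thesis using that by blast
qed

lemma fr_unit:
 assumes cov: "covers p q" and XY: "polyfun X" "polyfun Y" "nz q X" "nz q Y"
 shows "fr (Some p) X Y \<in> local_ring (sring (Some p)) (videal p q) - local_max (sring (Some p)) (videal p q)"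
proof -
 have s: "strat (Some p)" using covers_strata(1)[OF cov] by auto
 have "fr (Some p) X Y \<noteq> fr (Some p) A B" if AB: "polyfun A" "polyfun B" "\<not> nz q A" "nz q B" for A B
 proof
  assume eq: "fr (Some p) X Y = fr (Some p) A B"
  have "X v * B v = A v * Y v" if "v \<in> scone' S q" for v
   using fr_eqD[OF eq XY(1,2) nz_mono[OF cov XY(4)]] that scone_mono[OF cov] by auto
  hence "nz q (\<lambda>v. A v * Y v)"
   by (rule nz_cong[OF nz_mult[OF covers_strat[OF cov] XY(1) AB(2) XY(3) AB(4)]])
  from nz_multD[OF this] show False using AB(3) by blast
 qed
 thus ?thesis unfolding local_ring_eq[OF cov] local_max_eq[OF cov] using XY by blast
qed

lemma fr_factor:
 assumes cov: "covers p q" and P: "polyfun F" "nz (Some p) F" "polyfun D" "nz (Some p) D"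
  and dF: "dec p q F i G C" and dD: "dec p q D j G' C'"
 defines "X \<equiv> \<lambda>v. C v * G' v" and "Y \<equiv> \<lambda>v. G v * C' v" and "t \<equiv> fr (Some p) (ext p) (\<lambda>_. 1)"
 shows "fr (Some p) F D = fr (Some p) X Y \<otimes>\<^bsub>ff p\<^esub> t [^]\<^bsub>ff p\<^esub> (int i - int j)" (is ?a)
  and "fr (Some p) F D \<otimes>\<^bsub>ff p\<^esub> t [^]\<^bsub>ff p\<^esub> (- (int i - int j)) = fr (Some p) X Y" (is ?b)
proof -
 have p: "p \<in> strata S" and s: "strat (Some p)" using covers_strata(1)[OF cov] by auto
 have sq: "strat q" by (rule covers_strat[OF cov])
 have one: "polyfun (\<lambda>_. 1)" "nz (Some p) (\<lambda>_. 1)" using s by (auto intro: poly_const nz_const)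
 have e: "polyfun (ext p)" "nz (Some p) (ext p)" by (rule polyfun_ext[OF p], rule nz_ext[OF p])
 have pw: "polyfun (\<lambda>v. ext p v ^ l)" "nz (Some p) (\<lambda>v. ext p v ^ l)" for l
  by (rule polyfun_power[OF e(1)], rule nz_power[OF s e])
 note pow = fr_int_pow[OF s e(1) one(1) e(2) one(2)]
 \<comment> \<open>The integer power of t as a fraction with non-negative exponents, whichever of i
   and j is larger.\<close>
 obtain U V where UV: "polyfun U" "polyfun V" "nz (Some p) U" "nz (Some p) V"
  "t [^]\<^bsub>ff p\<^esub> (int i - int j) = fr (Some p) U V"
  "t [^]\<^bsub>ff p\<^esub> (- (int i - int j)) = fr (Some p) V U"
  "\<And>v. ext p v ^ i * V v = ext p v ^ j * U v"
 proof (cases "j \<le> i")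
  case True
  show thesis
   by (rule that[OF pw(1) one(1) pw(2) one(2), of "i - j"], unfold t_def pow, insert True)
    (cases "i = j"; simp add: nat_diff_distrib flip: power_add)+
 next
  case False
  show thesis
   by (rule that[OF one(1) pw(1) one(2) pw(2), of "j - i"], unfold t_def pow, insert False)
    (simp_all add: nat_diff_distrib flip: power_add)
 qed
 have Q: "polyfun G" "polyfun C" "polyfun G'" "polyfun C'" "nz q G" "nz q C" "nz q G'" "nz q C'"
  and eqF: "\<And>v. v \<in> scone S p \<Longrightarrow> F v * G v = ext p v ^ i * C v"
  and eqD: "\<And>v. v \<in> scone S p \<Longrightarrow> D v * G' v = ext p v ^ j * C' v"
  using dF dD by (auto simp: dec_def)
 have XY: "polyfun X" "polyfun Y" "nz q X" "nz q Y" unfolding X_def Y_def by (intro poly_mult nz_mult sq Q)+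
 have Yp: "nz (Some p) Y" by (rule nz_mono[OF cov XY(4)])
 have XU: "polyfun (\<lambda>v. X v * U v)" "polyfun (\<lambda>v. Y v * V v)" "nz (Some p) (\<lambda>v. Y v * V v)"
  by (intro poly_mult nz_mult s XY Yp UV)+
 have eq: "fr (Some p) F D = fr (Some p) (\<lambda>v. X v * U v) (\<lambda>v. Y v * V v)"
 proof (rule fr_eqI[OF s P(1,3) XU(1,2) P(4) XU(3)])
  fix v assume "v \<in> scone' S (Some p)"
  hence v: "v \<in> scone S p" by simp
  have "F v * (Y v * V v) = (F v * G v) * C' v * V v" by (simp add: Y_def mult_ac)
  also have "\<dots> = C v * C' v * (ext p v ^ i * V v)" unfolding eqF[OF v] by (simp add: mult_ac)
  also have "\<dots> = C v * (ext p v ^ j * C' v) * U v" unfolding UV(7) by (simp add: mult_ac)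
  also have "\<dots> = X v * U v * D v" unfolding eqD[OF v, symmetric] by (simp add: X_def mult_ac)
  finally show "F v * (Y v * V v) = X v * U v * D v" .
 qed
 show ?a unfolding eq UV(5) fr_mult[OF s XY(1,2) UV(1,2) Yp UV(4)] ..
 show ?b
  unfolding eq UV(6) fr_mult[OF s XU(1,2) UV(2,1) XU(3) UV(3)]
  by (rule fr_eqI[OF s poly_mult[OF XU(1) UV(2)] poly_mult[OF XU(2) UV(1)] XY(1,2)
     nz_mult[OF s XU(2) UV(1) XU(3) UV(3)] Yp]) (simp add: mult_ac)
qed

text \<open>The exponent exists with the uniformizer \<open>ext p\<close>, and it is unique because
  every uniformizer has order 1 and every unit order 0.\<close>

lemma disc_val_fr:
 assumes cov: "covers p q" and P: "polyfun F" "nz (Some p) F" "polyfun D" "nz (Some p) D"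
 shows "str_val S p q (fr (Some p) F D) = int (ord p q F) - int (ord p q D)"
 unfolding str_val_def disc_val_def
proof (rule the_equality)
 obtain G C where dF: "dec p q F (ord p q F) G C" by (rule ord_dec[OF cov P(1,2)])
 obtain G' C' where dD: "dec p q D (ord p q D) G' C'" by (rule ord_dec[OF cov P(3,4)])
 have XY: "polyfun (\<lambda>v. C v * G' v)" "polyfun (\<lambda>v. G v * C' v)" "nz q (\<lambda>v. C v * G' v)" "nz q (\<lambda>v. G v * C' v)"
  using dF dD covers_strat[OF cov] by (auto simp: dec_def intro!: poly_mult nz_mult)
 from fr_factor(1)[OF cov P dF dD]
 show "\<exists>t u. uniformizer (coord_ring (scone S p)) (videal p q) t \<and>
   u \<in> local_ring (coord_ring (scone S p)) (videal p q) - local_max (coord_ring (scone S p)) (videal p q) \<and>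
   fr (Some p) F D = u \<otimes>\<^bsub>frac_field (coord_ring (scone S p))\<^esub>
    t [^]\<^bsub>frac_field (coord_ring (scone S p))\<^esub> (int (ord p q F) - int (ord p q D))"
  using uniformizer_ext[OF cov] fr_unit[OF cov XY] unfolding scone'.simps by blast
next
 fix z :: int
 assume "\<exists>t u. uniformizer (coord_ring (scone S p)) (videal p q) t \<and>
   u \<in> local_ring (coord_ring (scone S p)) (videal p q) - local_max (coord_ring (scone S p)) (videal p q) \<and>
   fr (Some p) F D = u \<otimes>\<^bsub>frac_field (coord_ring (scone S p))\<^esub> t [^]\<^bsub>frac_field (coord_ring (scone S p))\<^esub> z"
 then obtain t u where t: "uniformizer (sring (Some p)) (videal p q) t"
  and u: "u \<in> local_ring (sring (Some p)) (videal p q) - local_max (sring (Some p)) (videal p q)"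
  and eq: "fr (Some p) F D = u \<otimes>\<^bsub>ff p\<^esub> t [^]\<^bsub>ff p\<^esub> z"
  unfolding scone'.simps by blast
 have s: "strat (Some p)" using covers_strata(1)[OF cov] by auto
 obtain A B where AB: "t = fr (Some p) A B" "polyfun A" "nz (Some p) A" "polyfun B" "nz q B" "ord p q A = 1"
  by (rule uniformizer_ord[OF cov t])
 obtain X Y where XY: "u = fr (Some p) X Y" "polyfun X" "polyfun Y" "nz q X" "nz q Y"
  by (rule unit_nz[OF cov u])
 have Bp: "nz (Some p) B" and Xp: "nz (Some p) X" and Yp: "nz (Some p) Y" using nz_mono[OF cov] AB XY by auto
 have oB: "ord p q B = 0" "ord p q X = 0" "ord p q Y = 0"
  by (rule ord_regular[OF cov AB(4,5)], rule ord_regular[OF cov XY(2,4)], rule ord_regular[OF cov XY(3,5)])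
 have pw: "polyfun (\<lambda>v. A v ^ l)" "nz (Some p) (\<lambda>v. A v ^ l)" "polyfun (\<lambda>v. B v ^ l)" "nz (Some p) (\<lambda>v. B v ^ l)" for l
  by (intro polyfun_power nz_power[OF s] AB Bp)+
 have opw: "ord p q (\<lambda>v. A v ^ l) = l \<and> ord p q (\<lambda>v. B v ^ l) = 0" for l
 proof (induction l)
  case 0
  have "ord p q (\<lambda>_. 1) = 0" by (rule ord_regular[OF cov poly_const nz_const[OF one_neq_zero covers_strat[OF cov]]])
  thus ?case by simp
 next
  case (Suc l)
  thus ?case
   using ord_mult[OF cov AB(2,3) pw(1,2), of l] ord_mult[OF cov AB(4) Bp pw(3,4), of l] AB(6) oB(1) by simp
 qed
 have val: "int (ord p q F) - int (ord p q D) = int (ord p q U) - int (ord p q V)"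
  if U: "polyfun U" "nz (Some p) U" and V: "polyfun V" "nz (Some p) V"
   and pw': "t [^]\<^bsub>ff p\<^esub> z = fr (Some p) U V" for U V
 proof -
  have XU: "polyfun (\<lambda>v. X v * U v)" "nz (Some p) (\<lambda>v. X v * U v)" "polyfun (\<lambda>v. Y v * V v)" "nz (Some p) (\<lambda>v. Y v * V v)"
   by (intro poly_mult nz_mult[OF s] XY Xp Yp U V)+
  have "fr (Some p) F D = fr (Some p) (\<lambda>v. X v * U v) (\<lambda>v. Y v * V v)"
   unfolding eq XY(1) pw' by (rule fr_mult[OF s XY(2,3) U(1) V(1) Yp V(2)])
  from fr_ord[OF cov P XU this] show ?thesis
   unfolding ord_mult[OF cov XY(2) Xp U] ord_mult[OF cov XY(3) Yp V] oB by simp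
 qed
 show "z = int (ord p q F) - int (ord p q D)"
 proof (cases "z < 0")
  case True
  hence "t [^]\<^bsub>ff p\<^esub> z = fr (Some p) (\<lambda>v. B v ^ nat (- z)) (\<lambda>v. A v ^ nat (- z))"
   unfolding AB(1) fr_int_pow[OF s AB(2,4,3) Bp] by simp
  from val[OF pw(3,4,1,2) this] show ?thesis using True opw by simp
 next
  case False
  hence "t [^]\<^bsub>ff p\<^esub> z = fr (Some p) (\<lambda>v. A v ^ nat z) (\<lambda>v. B v ^ nat z)"
   unfolding AB(1) fr_int_pow[OF s AB(2,4,3) Bp] by simp
  from val[OF pw(1,2,3,4) this] show ?thesis using False opw by simp
 qed
qed

end

section \<open>The sequence of functions along a maximal chain\<close>

context seshadri
begin

lemma rat_extremal_eq:
 assumes p: "p \<in> strata S"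
 shows "rat_extremal S p = fr (Some p) (ext p) (\<lambda>_. 1)"
proof -
 have "scone S p \<subseteq> total S" using le_top[OF p] top(2) by (simp add: str_le_def)
 hence "restr (scone S p) (extremal S p) = restr (scone S p) (ext p)"
  by (auto simp: restr_def extremal_eq[OF p] fun_eq_iff)
 thus ?thesis by (simp add: rat_extremal_def to_frac_def fr_def coord_ring_def)
qed

lemma bond_eq_1:
 assumes cov: "covers p q"
 shows "bond S p q = 1"
proof -
 have p: "p \<in> strata S" and s: "strat (Some p)" using covers_strata(1)[OF cov] by auto
 have one: "polyfun (\<lambda>_. 1)" "nz (Some p) (\<lambda>_. 1)" "nz q (\<lambda>_. 1)"
  using s covers_strat[OF cov] by (auto intro: poly_const nz_const)
 show ?thesis unfolding bond_def rat_extremal_eq[OF p]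
   disc_val_fr[OF cov polyfun_ext[OF p] nz_ext[OF p] one(1,2)] ord_ext[OF cov] ord_regular[OF cov one(1,3)] by simp
qed

text \<open>\<open>rat_restrict\<close> unites the restrictions of all representatives whose
  denominator does not vanish on q; they all give the same class.\<close>

lemma rat_restrict_fr:
 assumes cov: "covers p q" and P: "polyfun F" "polyfun D" "nz q D"
 shows "rat_restrict (scone S p) (scone' S q) (fr (Some p) F D) = fr q F D"
proof -
 have s: "strat (Some p)" using covers_strata(1)[OF cov] by simp
 have sq: "strat q" by (rule covers_strat[OF cov])
 have sub: "restr (scone' S q) (restr (scone S p) A) = restr (scone' S q) A" for A :: "('b, 'k) mpoint \<Rightarrow> 'k"
  using scone_mono[OF cov] by (auto simp: restr_def fun_eq_iff)
 have each: "frac (coord_ring (scone' S q)) (restr (scone' S q) a) (restr (scone' S q) b) = fr q F D"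
  if ab: "(a, b) \<in> fr (Some p) F D" "b \<notin> videal p q" for a b
 proof -
  obtain A B where AB: "a = restr (scone S p) A" "b = restr (scone S p) B" "polyfun A" "polyfun B"
   "fr (Some p) A B = fr (Some p) F D" "nz (Some p) B"
   using frac_fr[OF ab(1) P(1,2) nz_mono[OF cov P(3)] s] unfolding scone'.simps by blast
  have B: "nz q B" using ab(2) videal_restr[OF cov AB(4)] unfolding AB(2) by blast
  have "A v * D v = F v * B v" if "v \<in> scone' S q" for v
   using fr_eqD[OF AB(5,3,4,6)] that scone_mono[OF cov] by auto
  hence "fr q A B = fr q F D" by (rule fr_eqI[OF sq AB(3,4) P(1,2) B P(3)])
  thus ?thesis unfolding AB(1,2) sub fr_def .
 qed
 have self: "(restr (scone S p) F, restr (scone S p) D) \<in> fr (Some p) F D" "restr (scone S p) D \<notin> videal p q"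
  using fr_self[OF P(1,2) nz_mono[OF cov P(3)]] videal_restr[OF cov P(2)] P(3) by simp_all
 have "rat_restrict (scone S p) (scone' S q) (fr (Some p) F D) =
   (\<Union>(a, b)\<in>{(a, b) \<in> fr (Some p) F D. b \<notin> videal p q}. fr q F D)"
  unfolding rat_restrict_def using each by (intro SUP_cong refl) auto
 also have "\<dots> = fr q F D" using self by auto
 finally show ?thesis .
qed

text \<open>With bond 1 the next function of the sequence is the unit part of F / D along the lower
  stratum. The sequence consists of fractions, so the values of numerator and denominator are
  followed together.\<close>

lemma chain_step:
 assumes sat: "saturated (p # ps)" and P: "polyfun F" "nz (Some p) F" "polyfun D" "nz (Some p) D"
 obtains X Y where "polyfun X" "polyfun Y" "nz (head ps) X" "nz (head ps) Y"
  "rat_restrict (scone S p) (scone' S (head ps)) (fr (Some p) F D [^]\<^bsub>ff p\<^esub> bond S p (head ps)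
   \<otimes>\<^bsub>ff p\<^esub> rat_extremal S p [^]\<^bsub>ff p\<^esub> (- str_val S p (head ps) (fr (Some p) F D))) =
   fr (head ps) X Y"
  "cval (p # ps) F - cval (p # ps) D =
   (\<lambda>x. of_int (str_val S p (head ps) (fr (Some p) F D)) * evec p x) + (cval ps X - cval ps Y)"
proof -
 let ?q = "head ps" and ?t = "fr (Some p) (ext p) (\<lambda>_. 1)"
 have cov: "covers p ?q" and sat': "saturated ps" using sat by auto
 have p: "p \<in> strata S" and s: "strat (Some p)" using covers_strata(1)[OF cov] by auto
 have sq: "strat ?q" by (rule covers_strat[OF cov])
 define i j where "i = ord p ?q F" and "j = ord p ?q D"
 obtain G C where dF: "dec p ?q F i G C" unfolding i_def by (rule ord_dec[OF cov P(1,2)])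
 obtain G' C' where dD: "dec p ?q D j G' C'" unfolding j_def by (rule ord_dec[OF cov P(3,4)])
 have Q: "polyfun G" "polyfun C" "polyfun G'" "polyfun C'" "nz ?q G" "nz ?q C" "nz ?q G'" "nz ?q C'"
  using dF dD by (auto simp: dec_def)
 define X Y where "X = (\<lambda>v. C v * G' v)" and "Y = (\<lambda>v. G v * C' v)"
 have XY: "polyfun X" "polyfun Y" "nz ?q X" "nz ?q Y" unfolding X_def Y_def by (intro poly_mult nz_mult sq Q)+
 have val: "str_val S p ?q (fr (Some p) F D) = int i - int j"
  unfolding i_def j_def by (rule disc_val_fr[OF cov P])
 have "fr (Some p) F D [^]\<^bsub>ff p\<^esub> bond S p ?q = fr (Some p) F D"
  unfolding bond_eq_1[OF cov] fr_int_pow[OF s P(1,3,2,4)] by simp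
 hence "rat_restrict (scone S p) (scone' S ?q) (fr (Some p) F D [^]\<^bsub>ff p\<^esub> bond S p ?q
   \<otimes>\<^bsub>ff p\<^esub> rat_extremal S p [^]\<^bsub>ff p\<^esub> (- str_val S p ?q (fr (Some p) F D))) =
   rat_restrict (scone S p) (scone' S ?q) (fr (Some p) X Y)"
  unfolding val rat_extremal_eq[OF p] X_def Y_def using fr_factor(2)[OF cov P dF dD] by simp
 also have "\<dots> = fr ?q X Y" by (rule rat_restrict_fr[OF cov XY(1,2,4)])
 finally have r: "rat_restrict (scone S p) (scone' S ?q) (fr (Some p) F D [^]\<^bsub>ff p\<^esub> bond S p ?q
   \<otimes>\<^bsub>ff p\<^esub> rat_extremal S p [^]\<^bsub>ff p\<^esub> (- str_val S p ?q (fr (Some p) F D))) = fr ?q X Y" .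
 have c: "cval (p # ps) F - cval (p # ps) D =
   (\<lambda>x. of_int (str_val S p ?q (fr (Some p) F D)) * evec p x) + (cval ps X - cval ps Y)"
  unfolding val cval_step[OF sat P(1,2) dF] cval_step[OF sat P(3,4) dD] X_def Y_def
   cval_mult[OF sat' Q(2,3,6,7)] cval_mult[OF sat' Q(1,4,5,8)]
  by (simp add: fun_eq_iff algebra_simps)
 show thesis by (rule that[OF XY r c])
qed

lemma saturated_append: "saturated (xs @ ys) \<Longrightarrow> saturated ys"
 by (induction xs) auto

lemma head_below: "j \<le> length ps \<Longrightarrow> head (rev (take j ps)) = below ps j"
 by (cases j) (auto simp: below_def take_Suc_conv_app_nth)

text \<open>Invariant of the descent: the current function is a fraction X / Y on the stratum
  reached, and the value of F is the part already collected plus the difference of the values of X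
  and Y on the rest of the chain. All products of bonds in the denominators are 1.\<close>

lemma chain_val_eq_cval:
 assumes ps: "saturated (rev ps)" "ps \<noteq> []" "last ps = top"
  and g: "polyfun F" "nz (Some top) F"
 shows "chain_val S ps (restr (total S) F) = cval (rev ps) F"
proof -
 let ?L = "length ps" and ?g = "restr (total S) F"
 let ?h = "chain_fun_rev S ps ?g"
 let ?term = "\<lambda>j x. of_int (str_val S (ps ! j) (below ps j) (?h (?L - 1 - j))) * evec (ps ! j) x :: rat"
 have top': "strat (Some top)" using top(1) by simp
 have "\<exists>X Y. polyfun X \<and> polyfun Y \<and> nz (below ps (?L - i)) X \<and> nz (below ps (?L - i)) Y \<and>
   ?h i = fr (below ps (?L - i)) X Y \<and>
   cval (rev ps) F = (\<lambda>x. \<Sum>j\<in>{?L - i..<?L}. ?term j x) +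
    (cval (rev (take (?L - i) ps)) X - cval (rev (take (?L - i) ps)) Y)" if "i \<le> ?L" for i
  using that
 proof (induction i)
  case 0
  have below: "below ps ?L = Some top" using ps(2,3) by (simp add: below_def last_conv_nth)
  have "restr (scone S top) ?g = restr (scone S top) F" by (simp add: restr_def top(2) fun_eq_iff)
  hence "?h 0 = fr (Some top) F (\<lambda>_. 1)" unfolding fr_def using ps(3) by (simp add: to_frac_def coord_ring_def)
  moreover have "cval (rev ps) (\<lambda>_. 1) = 0" by (rule cval_one[OF ps(1)])
  ultimately show ?case using g top' below
   by (intro exI[of _ F] exI[of _ "\<lambda>_. 1"]) (auto simp: poly_const nz_const fun_eq_iff)
 next
  case (Suc i)
  define j p where "j = ?L - 1 - i" and "p = ps ! j"
  have j: "j < ?L" "?L - i = Suc j" "?L - Suc i = j" "?L - 1 - j = i" using Suc.prems by (auto simp: j_def)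
  have "i \<le> ?L" using Suc.prems by simp
  from Suc.IH[OF this, unfolded j(2)]
  obtain X Y where XY: "polyfun X" "polyfun Y" "nz (below ps (Suc j)) X" "nz (below ps (Suc j)) Y"
   "?h i = fr (below ps (Suc j)) X Y"
   "cval (rev ps) F = (\<lambda>x. \<Sum>j\<in>{Suc j..<?L}. ?term j x) +
    (cval (rev (take (Suc j) ps)) X - cval (rev (take (Suc j) ps)) Y)"
   by - (elim exE conjE, rule that)
  have below: "below ps (Suc j) = Some p" by (simp add: below_def p_def)
  have rev: "rev (take (Suc j) ps) = p # rev (take j ps)" using j(1) by (simp add: take_Suc_conv_app_nth p_def)
  have "rev ps = rev (drop (Suc j) ps) @ rev (take (Suc j) ps)" by (simp flip: rev_append)
  hence sat: "saturated (p # rev (take j ps))" using ps(1) saturated_append unfolding rev by metis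
  have head: "head (rev (take j ps)) = below ps j" using j(1) by (intro head_below) simp
  obtain X' Y' where XY': "polyfun X'" "polyfun Y'" "nz (below ps j) X'" "nz (below ps j) Y'"
   "rat_restrict (scone S p) (scone' S (below ps j)) (fr (Some p) X Y [^]\<^bsub>ff p\<^esub> bond S p (below ps j)
    \<otimes>\<^bsub>ff p\<^esub> rat_extremal S p [^]\<^bsub>ff p\<^esub> (- str_val S p (below ps j) (fr (Some p) X Y))) =
    fr (below ps j) X' Y'"
   "cval (p # rev (take j ps)) X - cval (p # rev (take j ps)) Y =
    (\<lambda>x. of_int (str_val S p (below ps j) (fr (Some p) X Y)) * evec p x) +
    (cval (rev (take j ps)) X' - cval (rev (take j ps)) Y')"
   by (rule chain_step[OF sat XY(1) _ XY(2)]) (use XY(3,4) in \<open>simp_all only: below head\<close>)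
  have h: "?h i = fr (Some p) X Y" using XY(5) unfolding below .
  have "?h (Suc i) = fr (below ps j) X' Y'"
   using XY'(5) unfolding chain_fun_rev.simps Let_def h j_def[symmetric] p_def[symmetric] scone'.simps .
  moreover have "cval (rev ps) F = (\<lambda>x. \<Sum>j\<in>{j..<?L}. ?term j x) +
    (cval (rev (take j ps)) X' - cval (rev (take j ps)) Y')"
   unfolding XY(6) rev XY'(6) using j(1,4) h
   by (simp add: fun_eq_iff sum.atLeast_Suc_lessThan p_def[symmetric])
  ultimately show ?case unfolding j(3) using XY'(1-4) by blast
 qed
 from this[of ?L]
 have "cval (rev ps) F = (\<lambda>x. \<Sum>j\<in>{0..<?L}. ?term j x)" by auto
 moreover have "(\<Prod>i = j..<?L. bond S (ps ! i) (below ps i)) = 1" if "j < ?L" for j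
 proof (intro prod.neutral ballI)
  fix i assume "i \<in> {j..<?L}"
  hence i: "i < ?L" by simp
  have "rev ps = rev (drop (Suc i) ps) @ rev (take (Suc i) ps)" by (simp flip: rev_append)
  moreover have "rev (take (Suc i) ps) = ps ! i # rev (take i ps)" using i by (simp add: take_Suc_conv_app_nth)
  ultimately have "saturated (ps ! i # rev (take i ps))" using ps(1) saturated_append by metis
  hence "covers (ps ! i) (below ps i)" using head_below[of i ps] i by simp
  thus "bond S (ps ! i) (below ps i) = 1" by (rule bond_eq_1)
 qed
 ultimately show ?thesis unfolding chain_val_def chain_fun_def by (simp add: lessThan_atLeast0)
qed

end

section \<open>The quasi-valuation and its fan of monoids\<close>

context seshadri
begin

lemma less_irrefl: "\<not> str_less S p p"
 by (simp add: str_less_def)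

lemma max_chain_insert:
 assumes "max_chain S (xs @ ys)" "x \<in> strata S" "\<And>y. y \<in> set xs \<Longrightarrow> str_less S y x"
  "\<And>y. y \<in> set ys \<Longrightarrow> str_less S x y"
 shows False
proof -
 have qs: "set (xs @ x # ys) \<subseteq> strata S" "sorted_wrt (str_less S) (xs @ x # ys)"
  using assms by (auto simp: max_chain_def sorted_wrt_append)
 moreover have "set (xs @ ys) \<subseteq> set (xs @ x # ys)" by auto
 ultimately have "set (xs @ x # ys) = set (xs @ ys)" using assms(1) unfolding max_chain_def by blast
 hence "x \<in> set xs \<or> x \<in> set ys" by auto
 thus False using assms(3,4) less_irrefl by blast
qed

text \<open>A gap between neighbours, below the first element or above the last one could be
  filled.\<close>

lemma max_chain_saturated:
 assumes "max_chain S ps"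
 shows "saturated (rev ps)" "ps \<noteq> []" "last ps = top"
proof -
 have st: "set ps \<subseteq> strata S" and sorted: "sorted_wrt (str_less S) ps" using assms by (auto simp: max_chain_def)
 have "saturated (rev xs)" if "ps = xs @ ys" for xs ys
  using that
 proof (induction xs arbitrary: ys rule: rev_induct)
  case (snoc p xs)
  have eq: "ps = xs @ (p # ys)" using snoc.prems by simp
  have p: "p \<in> strata S" using st eq by simp
  have ys: "str_less S p y" if "y \<in> set ys" for y using sorted that unfolding eq by (simp add: sorted_wrt_append)
  have above: "str_less S x y" if "x \<in> strata S" "str_less S x p" "y \<in> set (p # ys)" for x y
   using that ys less_trans[OF that(1) p that(2)] by auto
  have "covers p (head (rev xs))"
  proof (cases xs rule: rev_cases)
   case Nil
   have "\<not> str_less S x p" if x: "x \<in> strata S" for x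
   proof
    assume "str_less S x p"
    thus False using max_chain_insert[of "[]" "p # ys" x] assms x above eq Nil by auto
   qed
   thus ?thesis using p Nil by (simp add: covers_def)
  next
   case (snoc zs q)
   have q: "q \<in> strata S" "str_less S q p" "\<And>z. z \<in> set zs \<Longrightarrow> str_less S z q" "set zs \<subseteq> strata S"
    using st sorted unfolding eq snoc by (auto simp: sorted_wrt_append)
   have "\<not> str_less S x p" if x: "x \<in> strata S" "str_less S q x" for x
   proof
    assume "str_less S x p"
    moreover have "str_less S y x" if "y \<in> set xs" for y
     using that x(2) q(3,4) less_trans[OF _ q(1) _ x(2)] unfolding snoc by auto
    ultimately show False using max_chain_insert[of xs "p # ys" x] assms x(1) above eq by blast
   qed
   thus ?thesis using p q(1,2) snoc by (simp add: covers_def)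
  qed
  thus ?case using snoc.IH[OF eq] by simp
 qed simp
 thus "saturated (rev ps)" by simp
 show ne: "ps \<noteq> []"
 proof
  assume "ps = []"
  thus False using max_chain_insert[of "[]" "[]" top] assms top(1) by simp
 qed
 show "last ps = top"
 proof (rule ccontr)
  assume neq: "last ps \<noteq> top"
  have eq: "ps = butlast ps @ [last ps]" using ne by simp
  have l: "last ps \<in> strata S" using st ne by auto
  have lt: "str_less S (last ps) top" using le_top[OF l] neq by (simp add: str_less_def)
  have "str_less S y top" if "y \<in> set ps" for y
  proof (cases "y = last ps")
   case False
   hence "y \<in> set (butlast ps)" using that by (subst (asm) eq) auto
   moreover have "sorted_wrt (str_less S) (butlast ps @ [last ps])" using sorted eq by simp
   ultimately have "str_less S y (last ps)" by (simp add: sorted_wrt_append)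
   thus ?thesis using that st l lt less_trans by blast
  qed (use lt in simp)
  thus False using max_chain_insert[of ps "[]" top] assms top(1) by simp
 qed
qed

lemma max_chain_rev: "max_chain S ps \<Longrightarrow> saturated (rev ps) \<and> head (rev ps) = Some top"
 using max_chain_saturated[of ps] by (cases ps rule: rev_cases) auto

text \<open>Read through column sets these are the semistandard tableaux, columns from left to
  right.\<close>

definition chains :: "'a list set" where
 "chains = {T. set T \<subseteq> strata S \<and> sorted_wrt (str_le S) T}"

lemma chainsD: "T \<in> chains \<Longrightarrow> set T \<subseteq> strata S" "T \<in> chains \<Longrightarrow> sorted_wrt (str_le S) T"
 by (auto simp: chains_def)

lemma chain_remdups: "T \<in> chains \<Longrightarrow> sorted_wrt (str_less S) (remdups T)"
 unfolding chains_def by (induction T) (auto simp: str_less_def)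

text \<open>Among the strictly increasing lists containing T, whose lengths are bounded by the
  number of strata, a longest one is a maximal chain.\<close>

lemma chain_extend:
 assumes T: "T \<in> chains"
 obtains ps where "max_chain S ps" "set T \<subseteq> set ps"
proof -
 let ?P = "\<lambda>qs. set qs \<subseteq> strata S \<and> sorted_wrt (str_less S) qs \<and> set T \<subseteq> set qs"
 have len: "length qs = card (set qs)" if "sorted_wrt (str_less S) qs" for qs
 proof -
  have "distinct qs" using that by (induction qs) (auto simp: less_irrefl)
  thus ?thesis by (simp add: distinct_card)
 qed
 have "?P (remdups T)" using chain_remdups[OF T] chainsD(1)[OF T] by simp
 moreover have "\<forall>qs. ?P qs \<longrightarrow> length qs \<le> card (strata S)"
  using len card_mono[OF finite_strata] by (simp add: len)
 ultimately obtain ps where ps: "?P ps" "\<And>qs. ?P qs \<Longrightarrow> length qs \<le> length ps"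
  using ex_has_greatest_nat[of ?P "remdups T" length "Suc (card (strata S))"] unfolding less_Suc_eq_le by blast
 have "set qs = set ps" if "set qs \<subseteq> strata S" "sorted_wrt (str_less S) qs" "set ps \<subseteq> set qs" for qs
 proof -
  have "length qs \<le> length ps" using ps that by blast
  thus ?thesis using card_seteq[OF _ that(3)] len[OF that(2)] len[of ps] ps(1) by auto
 qed
 hence "max_chain S ps" using ps(1) by (simp add: max_chain_def)
 thus thesis by (rule that) (use ps in blast)
qed

definition ev :: "'a list \<Rightarrow> 'a \<Rightarrow> rat" where
 "ev T = (\<Sum>p\<leftarrow>T. evec p)"

lemma ev_simps [simp]: "ev [] = 0" "ev (p # T) = evec p + ev T"
 by (simp_all add: ev_def)

lemma ev_append: "ev (T @ U) = ev T + ev U"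
 by (simp add: ev_def)

lemma ev_count: "ev T p = of_nat (count_list T p)"
 by (induction T) (auto simp: evec_def)

text \<open>The first element is the least element of the support, so it can be read off and
  removed.\<close>

lemma ev_inj:
 assumes "T \<in> chains" "U \<in> chains" "ev T = ev U"
 shows "T = U"
 using assms
proof (induction T arbitrary: U)
 case Nil
 have "count_list U p = 0" for p using fun_cong[OF Nil(3), of p] unfolding ev_count by simp
 thus ?case using count_list_0_iff by (metis list.set_intros(1) neq_Nil_conv)
next
 case (Cons x xs)
 have count: "count_list (x # xs) p = count_list U p" for p using fun_cong[OF Cons.prems(3), of p] unfolding ev_count by simp
 have set: "set (x # xs) = set U" using count count_list_0_iff by (metis Set.set_eqI)
 then obtain y ys where U: "U = y # ys" by (cases U) auto
 have "x \<in> set U" "y \<in> set (x # xs)" using set U by auto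
 hence "str_le S y x" "str_le S x y"
  using chainsD(2)[OF Cons.prems(1)] chainsD(2)[OF Cons.prems(2)] unfolding U by auto
 hence xy: "x = y" using chainsD(1)[OF Cons.prems(1)] chainsD(1)[OF Cons.prems(2)] U le_antisym by auto
 have "xs = ys"
 proof (rule Cons.IH)
  show "xs \<in> chains" "ys \<in> chains" using Cons.prems(1,2) unfolding U chains_def by auto
  show "ev xs = ev ys" using Cons.prems(3) unfolding U xy ev_simps by (simp only: add_left_cancel)
 qed
 thus ?case using xy U by simp
qed

definition emon :: "'a list \<Rightarrow> ('b, 'k) mpoint \<Rightarrow> 'k" where
 "emon T v = (\<Prod>p\<leftarrow>T. ext p v)"

lemma emon_simps [simp]: "emon [] = (\<lambda>_. 1)" "emon (p # T) = (\<lambda>v. ext p v * emon T v)"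
 by (simp_all add: emon_def fun_eq_iff)

lemma polyfun_emon: "set T \<subseteq> strata S \<Longrightarrow> polyfun (emon T)"
 by (induction T) (auto intro: poly_const poly_mult polyfun_ext)

lemma nz_top_ext: "p \<in> strata S \<Longrightarrow> nz (Some top) (ext p)"
 using ext_nonzero_iff[OF top(1)] le_top by (simp add: nz_def)

lemma nz_top_emon: "set T \<subseteq> strata S \<Longrightarrow> nz (Some top) (emon T)"
proof (induction T)
 case Nil
 show ?case using top(1) by (auto intro: nz_const)
next
 case (Cons p T)
 thus ?case
  using nz_mult[of "Some top" "ext p" "emon T"] polyfun_ext[of p] polyfun_emon[of T] nz_top_ext top(1) by simp
qed

lemma cval_emon:
 assumes "saturated ps" "head ps = Some top" "set T \<subseteq> strata S"
 shows "cval ps (emon T) = (\<Sum>p\<leftarrow>T. cval ps (ext p))"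
 using assms(3)
proof (induction T)
 case Nil
 show ?case using cval_one[OF assms(1)] by simp
next
 case (Cons p T)
 thus ?case
  using cval_mult[OF assms(1) polyfun_ext[of p] polyfun_emon[of T]] nz_top_ext nz_top_emon assms(2) by simp
qed

end

context seshadri_order
begin

lemma lless_add_lleq:
 assumes "a \<prec> b" "c \<preceq> d"
 shows "a + c \<prec> b + d" "c + a \<prec> d + b"
proof -
 have "a + c \<prec> b + c" by (rule lless_add[OF assms(1)])
 moreover have "b + c \<preceq> b + d" using assms(2) lless_add[of c d b] by (auto simp: add.commute)
 ultimately show *: "a + c \<prec> b + d" using lless_trans[of "a + c" "b + c" "b + d"] by auto
 thus "c + a \<prec> d + b" by (simp only: add.commute)
qed

lemma cval_ext_cases:
 assumes "max_chain S ps" "p \<in> strata S"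
 shows "if p \<in> set ps then cval (rev ps) (ext p) = evec p else evec p \<prec> cval (rev ps) (ext p)"
proof -
 note sat = max_chain_saturated[OF assms(1)]
 have rev: "rev ps = top # rev (butlast ps)" using sat(2,3) by (cases ps rule: rev_cases) auto
 show ?thesis
 proof (cases "p \<in> set ps")
  case True
  thus ?thesis using cval_ext[OF sat(1)] by simp
 next
  case False
  have "saturated (top # rev (butlast ps))" using sat(1) unfolding rev .
  moreover have "p \<notin> set (top # rev (butlast ps))" using False unfolding rev[symmetric] by simp
  ultimately have "evec p \<prec> cval (rev ps) (ext p)"
   unfolding rev using cval_ext_less assms(2) le_top[OF assms(2)] by blast
  thus ?thesis using False by simp
 qed
qed

lemma cval_emon_cases:
 assumes ps: "max_chain S ps" and T: "set T \<subseteq> strata S"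
 shows "if set T \<subseteq> set ps then cval (rev ps) (emon T) = ev T else ev T \<prec> cval (rev ps) (emon T)"
proof -
 note em = cval_emon[OF conjunct1[OF max_chain_rev[OF ps]] conjunct2[OF max_chain_rev[OF ps]]]
 show ?thesis
  using T
 proof (induction T)
  case Nil
  show ?case using em[of "[]"] by simp
 next
  case (Cons p T)
  have p: "if p \<in> set ps then cval (rev ps) (ext p) = evec p else evec p \<prec> cval (rev ps) (ext p)"
   using Cons.prems by (intro cval_ext_cases[OF ps]) simp
  have T: "if set T \<subseteq> set ps then cval (rev ps) (emon T) = ev T else ev T \<prec> cval (rev ps) (emon T)"
   using Cons by simp
  have eq: "cval (rev ps) (emon (p # T)) = cval (rev ps) (ext p) + cval (rev ps) (emon T)"
   using em[of "p # T"] em[of T] Cons.prems by simp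
  show ?case
  proof (cases "p \<in> set ps")
   case True
   hence pe: "cval (rev ps) (ext p) = evec p" using p by simp
   have sub: "set (p # T) \<subseteq> set ps \<longleftrightarrow> set T \<subseteq> set ps" using True by simp
   show ?thesis
   proof (cases "set T \<subseteq> set ps")
    case True
    hence "cval (rev ps) (emon T) = ev T" using T by simp
    thus ?thesis unfolding sub eq pe ev_simps using True by (simp only: if_True)
   next
    case False
    hence "ev T \<prec> cval (rev ps) (emon T)" using T by simp
    from lless_add_lleq(2)[OF this disjI1[OF refl]] show ?thesis
     unfolding sub eq pe ev_simps using False by (simp only: if_False)
   qed
  next
   case False
   hence "evec p \<prec> cval (rev ps) (ext p)" using p by simp
   moreover have "ev T \<preceq> cval (rev ps) (emon T)" using T by (auto split: if_splits)
   ultimately have "evec p + ev T \<prec> cval (rev ps) (ext p) + cval (rev ps) (emon T)" by (rule lless_add_lleq(1))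
   moreover have "\<not> set (p # T) \<subseteq> set ps" using False by simp
   ultimately show ?thesis unfolding eq ev_simps by (simp only: if_False)
  qed
 qed
qed

lemma ev_min_exists:
 assumes "finite E" "E \<noteq> {}" "E \<subseteq> chains"
 shows "\<exists>T0\<in>E. \<forall>T\<in>E - {T0}. ev T0 \<prec> ev T"
 using assms
proof (induction rule: finite_ne_induct)
 case (insert T E)
 then obtain T0 where T0: "T0 \<in> E" "\<forall>T\<in>E - {T0}. ev T0 \<prec> ev T" by blast
 have T: "T \<in> chains" "T0 \<in> chains" "T \<noteq> T0" using insert T0(1) by auto
 have "ev T x = ev T0 x" if "x \<notin> strata S" for x
  using that chainsD(1)[OF T(1)] chainsD(1)[OF T(2)] unfolding ev_count by (metis count_notin subsetD)
 hence "ev T \<prec> ev T0 \<or> ev T0 \<prec> ev T" using lless_total ev_inj[OF T(1,2)] T(3) by blast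
 thus ?case
 proof
  assume lt: "ev T \<prec> ev T0"
  have "ev T \<prec> ev U" if "U \<in> E" for U using lt T0(2) that lless_trans[OF lt] by (cases "U = T0") auto
  thus ?thesis by blast
 next
  assume "ev T0 \<prec> ev T"
  thus ?thesis using T0 by blast
 qed
qed simp

end

section \<open>Standard expansions and the quasi-valuation\<close>

locale seshadri_smt = seshadri_order S ext wt tor top r
 for S :: "('a, 'b, 'k::field_char_0) stratification" and ext wt tor top r +
 assumes spanning: "\<And>F. polyfun F \<Longrightarrow>
   \<exists>E q. finite E \<and> E \<subseteq> chains \<and> (\<forall>v\<in>total S. F v = (\<Sum>T\<in>E. q T * emon T v))"
  and degree: "\<And>p. p \<in> strata S \<Longrightarrow> (\<Sum>j = 1..nfac S. mdegree S (extremal S p) j) = 1"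
begin

text \<open>Along any maximal chain a standard monomial has at least the value of its tableau, with
 equality if and only if the chain contains the tableau. So the smallest tableau of the expansion
 is attained on a chain through it and is a lower bound on all others.\<close>

lemma quasi_val_expansion:
 assumes F: "polyfun F" and E: "finite E" "E \<subseteq> chains" "\<And>T. T \<in> E \<Longrightarrow> q T \<noteq> 0"
  and eq: "\<And>v. v \<in> total S \<Longrightarrow> F v = (\<Sum>T\<in>E. q T * emon T v)"
  and T0: "T0 \<in> E" "\<And>T. T \<in> E - {T0} \<Longrightarrow> ev T0 \<prec> ev T"
 shows "nz (Some top) F" "quasi_val S r (restr (total S) F) = ev T0"
proof -
 let ?f = "\<lambda>T v. q T * emon T v"
 have P: "polyfun (?f T)" "nz (Some top) (?f T)" if "T \<in> E" for T
 proof -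
  have T: "set T \<subseteq> strata S" using that E(2) chainsD(1) by blast
  show "polyfun (?f T)" by (rule polyfun_scale[OF polyfun_emon[OF T]])
  show "nz (Some top) (?f T)" using nz_top_emon[OF T] E(3)[OF that] by (simp add: nz_def)
 qed
 have sumP: "polyfun (\<lambda>v. \<Sum>T\<in>E'. ?f T v)" if "E' \<subseteq> E" for E' using that P(1) by (intro polyfun_sum) blast
 have F': "F v = (\<Sum>T\<in>E. ?f T v)" if "v \<in> scone S top" for v using eq that top(2) by simp
 have cf: "cval (rev ps) (?f T) = cval (rev ps) (emon T)" if ps: "max_chain S ps" and T: "T \<in> E" for ps T
 proof -
  have sat: "saturated (rev ps)" and hd: "head (rev ps) = Some top" using max_chain_rev[OF ps] by auto
  have Ts: "set T \<subseteq> strata S" using T E(2) chainsD(1) by blast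
  have "cval (rev ps) (?f T) = cval (rev ps) (\<lambda>_. q T) + cval (rev ps) (emon T)"
   using top(1) E(3)[OF T] nz_top_emon[OF Ts] hd
   by (intro cval_mult[OF sat poly_const polyfun_emon[OF Ts]]) (auto intro: nz_const)
  thus ?thesis using cval_const[OF sat E(3)[OF T]] by simp
 qed
 have split: "(\<lambda>v. \<Sum>T\<in>E. ?f T v) = (\<lambda>v. ?f T0 v + (\<Sum>T\<in>E - {T0}. ?f T v))"
  using sum.remove[OF E(1) T0(1)] by (intro ext) (simp add: fun_eq_iff)
 have lead: "nz (Some top) F \<and> cval (rev ps) F = ev T0" if ps: "max_chain S ps" "set T0 \<subseteq> set ps" for ps
 proof -
  have sat: "saturated (rev ps)" and hd: "head (rev ps) = Some top" using max_chain_rev[OF ps(1)] by auto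
  have c0: "cval (rev ps) (?f T0) = ev T0"
   using cf[OF ps(1) T0(1)] cval_emon_cases[OF ps(1), of T0] ps(2) chainsD(1) E(2) T0(1) by auto
  have ge: "ev T0 \<prec> cval (rev ps) (?f T)" if T: "T \<in> E - {T0}" for T
  proof -
   have "ev T \<preceq> cval (rev ps) (emon T)"
    using cval_emon_cases[OF ps(1), of T] chainsD(1) E(2) T by (auto split: if_splits)
   thus ?thesis using T0(2)[OF T] cf[OF ps(1), of T] T lless_trans[OF T0(2)[OF T]] by auto
  qed
  have "nz (head (rev ps)) (\<lambda>v. ?f T0 v + (\<Sum>T\<in>E - {T0}. ?f T v)) \<and>
    cval (rev ps) (\<lambda>v. ?f T0 v + (\<Sum>T\<in>E - {T0}. ?f T v)) = cval (rev ps) (?f T0)"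
  proof (rule cval_add_leading[OF sat P(1)[OF T0(1)] sumP])
   show "nz (head (rev ps)) (?f T0)" using P(2)[OF T0(1)] hd by simp
   assume "nz (head (rev ps)) (\<lambda>v. \<Sum>T\<in>E - {T0}. ?f T v)"
   thus "cval (rev ps) (?f T0) \<prec> cval (rev ps) (\<lambda>v. \<Sum>T\<in>E - {T0}. ?f T v)"
    unfolding c0 using E(1) P(1) ge by (intro cval_sum_less[OF sat]) auto
  qed simp
  hence nzs: "nz (Some top) (\<lambda>v. \<Sum>T\<in>E. ?f T v)" and cs: "cval (rev ps) (\<lambda>v. \<Sum>T\<in>E. ?f T v) = ev T0"
   unfolding split[symmetric] c0 hd by blast+
  have "nz (Some top) F" by (rule nz_cong[OF nzs]) (use F' in simp)
  moreover have "cval (rev ps) F = cval (rev ps) (\<lambda>v. \<Sum>T\<in>E. ?f T v)"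
   by (rule cval_cong[OF sat F sumP[OF subset_refl]]) (use calculation F' hd in simp_all)
  ultimately show ?thesis using cs by simp
 qed
 have "T0 \<in> chains" using E(2) T0(1) by blast
 then obtain ps0 where ps0: "max_chain S ps0" "set T0 \<subseteq> set ps0" by (rule chain_extend)
 show nzF: "nz (Some top) F" by (rule conjunct1[OF lead[OF ps0]])
 have val: "chain_val S ps (restr (total S) F) = cval (rev ps) F" if "max_chain S ps" for ps
  using max_chain_saturated[OF that] by (intro chain_val_eq_cval F nzF)
 have min: "ev T0 \<preceq> chain_val S ps (restr (total S) F)" if ps: "max_chain S ps" for ps
 proof (cases "set T0 \<subseteq> set ps")
  case True
  thus ?thesis using lead[OF ps] val[OF ps] by simp
 next
  case False
  have sat: "saturated (rev ps)" and hd: "head (rev ps) = Some top" using max_chain_rev[OF ps] by auto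
  \<comment> \<open>Here even the monomial of \<open>T0\<close> is strictly above its tableau, since
    the chain does not contain \<open>T0\<close>; the others are above \<open>ev T0\<close>
    anyway.\<close>
  have ge: "ev T0 \<prec> cval (rev ps) (?f T)" if T: "T \<in> E" for T
  proof (cases "T = T0")
   case True
   thus ?thesis using cf[OF ps T] cval_emon_cases[OF ps, of T0] False chainsD(1) E(2) T by auto
  next
   case neq: False
   hence lt: "ev T0 \<prec> ev T" using T0(2) T by blast
   have "ev T \<preceq> cval (rev ps) (emon T)"
    using cval_emon_cases[OF ps, of T] chainsD(1) E(2) T by (auto split: if_splits)
   thus ?thesis using lt cf[OF ps T] lless_trans[OF lt] by auto
  qed
  have nzs: "nz (Some top) (\<lambda>v. \<Sum>T\<in>E. ?f T v)" by (rule nz_cong[OF nzF]) (use F' in simp)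
  hence "ev T0 \<prec> cval (rev ps) (\<lambda>v. \<Sum>T\<in>E. ?f T v)"
   using E(1) P(1) ge hd by (intro cval_sum_less[OF sat]) auto
  moreover have "cval (rev ps) F = cval (rev ps) (\<lambda>v. \<Sum>T\<in>E. ?f T v)"
   by (rule cval_cong[OF sat F sumP[OF subset_refl]]) (use nzF F' hd in simp_all)
  ultimately show ?thesis using val[OF ps] by simp
 qed
 show "quasi_val S r (restr (total S) F) = ev T0"
  unfolding quasi_val_def
 proof (rule the_equality)
  have "chain_val S ps0 (restr (total S) F) = ev T0" using lead[OF ps0] val[OF ps0(1)] by simp
  thus att: "(\<exists>ps. max_chain S ps \<and> ev T0 = chain_val S ps (restr (total S) F)) \<and>
    (\<forall>ps. max_chain S ps \<longrightarrow> ev T0 \<preceq> chain_val S ps (restr (total S) F))"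
   using ps0(1) min by auto
  fix a assume a: "(\<exists>ps. max_chain S ps \<and> a = chain_val S ps (restr (total S) F)) \<and>
    (\<forall>ps. max_chain S ps \<longrightarrow> a \<preceq> chain_val S ps (restr (total S) F))"
  hence "ev T0 \<preceq> a" using min by blast
  moreover have "a \<preceq> ev T0" using a ps0(1) lead[OF ps0] val[OF ps0(1)] by auto
  ultimately show "a = ev T0" using lless_trans[of a "ev T0" a] lless_irrefl[of a] by blast
 qed
qed

lemma quasi_val_emon:
 assumes "T \<in> chains"
 shows "quasi_val S r (restr (total S) (emon T)) = ev T"
 by (rule quasi_val_expansion(2)[of "emon T" "{T}" "\<lambda>_. 1"]) (use assms in \<open>auto intro: polyfun_emon dest: chainsD\<close>)

lemma quasi_val_extremal:
 assumes "p \<in> strata S"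
 shows "quasi_val S r (extremal S p) = evec p"
 using quasi_val_emon[of "[p]"] assms extremal_eq[OF assms] by (simp add: chains_def)

lemma ring_nonzero: "carrier (coord_ring (total S)) - {\<zero>\<^bsub>coord_ring (total S)\<^esub>} =
  {restr (total S) F | F. polyfun F \<and> nz (Some top) F}"
 using sring_nonzero[of "Some top"] unfolding scone'.simps top(2) .

lemma expansion:
 assumes "polyfun F" "nz (Some top) F"
 obtains E q T0 where "finite E" "E \<subseteq> chains" "\<forall>T\<in>E. q T \<noteq> 0"
  "\<forall>v\<in>total S. F v = (\<Sum>T\<in>E. q T * emon T v)" "T0 \<in> E" "\<forall>T\<in>E - {T0}. ev T0 \<prec> ev T"
proof -
 obtain E q where E: "finite E" "E \<subseteq> chains" "\<forall>v\<in>total S. F v = (\<Sum>T\<in>E. q T * emon T v)"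
  using spanning[OF assms(1)] by blast
 let ?E = "{T \<in> E. q T \<noteq> 0}"
 have eq: "F v = (\<Sum>T\<in>?E. q T * emon T v)" if "v \<in> total S" for v
  using E(1,3) that by (auto intro!: sum.mono_neutral_right)
 have "?E \<noteq> {}"
 proof
  assume emp: "?E = {}"
  have "F v = 0" if "v \<in> total S" for v using eq[OF that] unfolding emp by simp
  thus False using assms(2) top(2) by (simp add: nz_def)
 qed
 then obtain T0 where T0: "T0 \<in> ?E" "\<forall>T\<in>?E - {T0}. ev T0 \<prec> ev T" using ev_min_exists[of ?E] E by auto
 show thesis by (rule that[of ?E q T0]) (use E T0 eq in auto)
qed

lemma fan_eq: "fan S r = ev ` chains"
proof (intro equalityI subsetI)
 fix a assume "a \<in> fan S r"
 then obtain F where F: "a = quasi_val S r (restr (total S) F)" "polyfun F" "nz (Some top) F"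
  unfolding fan_def ring_nonzero by blast
 obtain E q T0 where E: "finite E" "E \<subseteq> chains" "\<forall>T\<in>E. q T \<noteq> 0"
  "\<forall>v\<in>total S. F v = (\<Sum>T\<in>E. q T * emon T v)" "T0 \<in> E" "\<forall>T\<in>E - {T0}. ev T0 \<prec> ev T"
  by (rule expansion[OF F(2,3)])
 have "quasi_val S r (restr (total S) F) = ev T0"
  by (rule quasi_val_expansion(2)[OF F(2) E(1,2) _ _ E(5)]) (use E(3,4,6) in blast)+
 thus "a \<in> ev ` chains" using F(1) E(2,5) by blast
next
 fix a assume "a \<in> ev ` chains"
 then obtain T where T: "T \<in> chains" "a = ev T" by (rule imageE)
 have "restr (total S) (emon T) \<in> carrier (coord_ring (total S)) - {\<zero>\<^bsub>coord_ring (total S)\<^esub>}"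
  unfolding ring_nonzero using polyfun_emon[OF chainsD(1)[OF T(1)]] nz_top_emon[OF chainsD(1)[OF T(1)]] by blast
 thus "a \<in> fan S r" unfolding fan_def T(2) quasi_val_emon[OF T(1), symmetric] by (rule imageI)
qed

end

section \<open>Normality, indecomposable elements and standard monomials\<close>

context seshadri
begin

lemma supp_ev: "supp (ev T) = set T"
 by (auto simp: supp_def ev_count count_list_0_iff)

lemma evec_supp: "supp (evec p) = {p}"
 by (auto simp: supp_def evec_def)

lemma supp_ge_evec: "supp_ge S (evec p) (evec q) \<longleftrightarrow> str_le S q p"
 by (simp add: supp_ge_def evec_supp)

lemma max_chain_multiset:
 assumes "max_chain S ps" "supp a \<subseteq> set ps" "\<forall>p. a p \<in> \<nat>"
 shows "a \<in> ev ` chains"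
proof -
 define n where "n p = (SOME l. a p = of_nat l)" for p
 have n: "a p = of_nat (n p)" for p
 proof -
  have "\<exists>l. a p = of_nat l" using assms(3) Nats_cases by metis
  thus ?thesis unfolding n_def by (rule someI_ex)
 qed
 have st: "set ps \<subseteq> strata S" and sorted: "sorted_wrt (str_less S) ps" using assms(1) by (auto simp: max_chain_def)
 have dist: "distinct ps" using sorted by (induction ps) (auto simp: less_irrefl)
 \<comment> \<open>Each stratum of the chain is repeated as often as its coefficient says.\<close>
 let ?T = "\<lambda>ps. concat (map (\<lambda>p. replicate (n p) p) ps)"
 have "sorted_wrt (str_le S) (?T ps)"
  using sorted
 proof (induction ps)
  case (Cons p ps)
  have "sorted_wrt (str_le S) (replicate l p)" for l by (induction l) auto
  thus ?case using Cons by (auto simp: sorted_wrt_append str_less_def)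
 qed simp
 hence T: "?T ps \<in> chains" using st by (auto simp: chains_def)
 have count: "count_list (?T ps) x = (if x \<in> set ps then n x else 0)" for x
  using dist
 proof (induction ps)
  case (Cons p ps)
  have "count_list (replicate l p) x = (if x = p then l else 0)" for l by (induction l) auto
  thus ?case using Cons by (auto simp: count_list_append)
 qed simp
 have "a = ev (?T ps)"
 proof (intro ext)
  fix x show "a x = ev (?T ps) x"
  proof (cases "x \<in> set ps")
   case True
   thus ?thesis using n[of x] unfolding ev_count count by simp
  next
   case False
   hence "a x = 0" using assms(2) by (auto simp: supp_def)
   thus ?thesis using False unfolding ev_count count by simp
  qed
 qed
 with T show ?thesis by blast
qed

lemma sum_ev: "set T \<subseteq> strata S \<Longrightarrow> (\<Sum>p\<in>strata S. ev T p) = of_nat (length T)"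
proof (induction T)
 case (Cons p T)
 have "(\<Sum>x\<in>strata S. evec p x :: rat) = 1"
  using Cons.prems finite_strata by (simp add: evec_def sum.delta')
 thus ?case using Cons by (simp add: sum.distrib)
qed simp

end

context seshadri_smt
begin

text \<open>Elements of the lattice have integer coefficients. Those that are non-negative and
  supported on the chain are therefore sums of its unit vectors, hence tableaux.\<close>

lemma normal: "str_normal S r"
 unfolding str_normal_def
proof (intro allI impI)
 fix ps assume ps: "max_chain S ps"
 let ?M = "fan_chain S r (set ps)"
 let ?H = "{a. \<forall>p. a p \<in> \<int>} :: ('a \<Rightarrow> rat) set"
 have M: "?M \<subseteq> lattice_gen ?M" by (auto simp: lattice_gen_def)
 have sub: "lattice_gen ?M \<subseteq> ?H"
 proof -
  have "?M \<subseteq> ?H" by (auto simp: fan_chain_def fan_eq ev_count)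
  thus ?thesis unfolding lattice_gen_def by (intro Inter_lower) auto
 qed
 show "?M = lattice_gen ?M \<inter> {a. supp a \<subseteq> set ps \<and> (\<forall>p. 0 \<le> a p)}"
 proof (intro equalityI subsetI)
  fix a assume a: "a \<in> ?M"
  hence "\<forall>p. 0 \<le> a p" by (auto simp: fan_chain_def fan_eq ev_count)
  thus "a \<in> lattice_gen ?M \<inter> {a. supp a \<subseteq> set ps \<and> (\<forall>p. 0 \<le> a p)}"
   using a M by (auto simp: fan_chain_def)
 next
  fix a assume a: "a \<in> lattice_gen ?M \<inter> {a. supp a \<subseteq> set ps \<and> (\<forall>p. 0 \<le> a p)}"
  have "a p \<in> \<nat>" for p using a sub by (auto simp: Nats_altdef2)
  hence "a \<in> ev ` chains" using max_chain_multiset[OF ps] a by blast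
  thus "a \<in> ?M" using a by (simp add: fan_chain_def fan_eq)
 qed
qed

text \<open>The description of the fan in \<open>fan_eq\<close> does not mention the total
  order.\<close>

lemma balanced: "str_balanced S"
 unfolding str_balanced_def
proof (intro allI impI)
 fix r1 r2 assume r: "total_refinement S r1 \<and> total_refinement S r2"
 interpret r1: seshadri_smt S ext wt tor top r1 by unfold_locales (use r spanning degree in auto)
 interpret r2: seshadri_smt S ext wt tor top r2 by unfold_locales (use r spanning degree in auto)
 show "fan S r1 = fan S r2" using r1.fan_eq r2.fan_eq by simp
qed

lemma ev_zero_iff: "ev T = 0 \<longleftrightarrow> T = []"
proof
 assume "ev T = 0"
 hence "supp (ev T) = {}" by (simp add: supp_def)
 thus "T = []" by (simp add: supp_ev)
qed simp

text \<open>The length of a tableau is the sum of its coefficients, hence additive, so a single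
  column does not split. A longer one splits off its last column, which is its maximum and has to
  come first in the decomposition.\<close>

lemma decomposable_iff:
 assumes T: "T \<in> chains"
 shows "decomposable S r (ev T) \<longleftrightarrow> length T \<noteq> 1"
proof
 assume "decomposable S r (ev T)"
 then consider "ev T = 0" | b c where "b \<in> fan S r - {0}" "c \<in> fan S r - {0}" "ev T = b + c"
  unfolding decomposable_def by blast
 thus "length T \<noteq> 1"
 proof cases
  case 1
  thus ?thesis by (simp add: ev_zero_iff)
 next
  case (2 b c)
  obtain U V where U: "U \<in> chains" "b = ev U" and V: "V \<in> chains" "c = ev V" using 2(1,2) unfolding fan_eq by blast
  have "U \<noteq> []" "V \<noteq> []" using 2 U V by auto
  have "(\<Sum>p\<in>strata S. ev T p) = (\<Sum>p\<in>strata S. ev U p) + (\<Sum>p\<in>strata S. ev V p)"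
   unfolding 2(3) U(2) V(2) by (simp add: sum.distrib)
  hence "rat_of_nat (length T) = of_nat (length U) + of_nat (length V)"
   using sum_ev chainsD(1) T U(1) V(1) by simp
  hence "length T = length U + length V" unfolding of_nat_add[symmetric] of_nat_eq_iff .
  moreover have "0 < length U" "0 < length V" using \<open>U \<noteq> []\<close> \<open>V \<noteq> []\<close> by auto
  ultimately show ?thesis by linarith
 qed
next
 assume len: "length T \<noteq> 1"
 show "decomposable S r (ev T)"
 proof (cases T rule: rev_cases)
  case Nil
  thus ?thesis by (simp add: decomposable_def)
 next
  case (snoc U y)
  have U: "U \<in> chains" "U \<noteq> []" "y \<in> strata S" "\<And>x. x \<in> set U \<Longrightarrow> str_le S x y"
   using T len unfolding snoc chains_def by (auto simp: sorted_wrt_append)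
  obtain V z where V: "U = V @ [z]" using U(2) by (cases U rule: rev_cases) auto
  have "\<And>x. x \<in> set U \<Longrightarrow> str_le S x z" using U(1) unfolding V chains_def by (auto simp: sorted_wrt_append)
  hence "supp_ge S (ev [y]) (ev U)"
   unfolding supp_ge_def supp_ev using U(4) V by auto
  moreover have "[y] \<in> chains" using U(3) by (simp add: chains_def)
  hence "ev [y] \<in> fan S r" "ev U \<in> fan S r" unfolding fan_eq using U(1) by (blast intro: imageI)+
  moreover have "ev T = ev [y] + ev U" unfolding snoc ev_append by (rule add.commute)
  moreover have "ev [y] \<noteq> 0" "ev U \<noteq> 0" unfolding ev_zero_iff using U(2) by simp_all
  ultimately show ?thesis unfolding decomposable_def by blast
 qed
qed

lemma singleton_chain: "p \<in> strata S \<Longrightarrow> [p] \<in> chains" "ev [p] = evec p"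
 by (simp_all add: chains_def)

lemma indecomposables_eq: "indecomposables S r = evec ` strata S"
proof (intro equalityI subsetI)
 fix a assume "a \<in> indecomposables S r"
 then obtain T where T: "T \<in> chains" "a = ev T" "length T = 1"
  unfolding indecomposables_def fan_eq using decomposable_iff by auto
 obtain p where p: "T = [p]" using T(3) by (cases T) auto
 show "a \<in> evec ` strata S" using chainsD(1)[OF T(1)] singleton_chain(2)[of p] unfolding T(2) p by simp
next
 fix a :: "'a \<Rightarrow> rat" assume "a \<in> evec ` strata S"
 then obtain p where p: "p \<in> strata S" "a = ev [p]" using singleton_chain(2) by auto
 show "a \<in> indecomposables S r"
  unfolding indecomposables_def fan_eq p(2)
  using imageI[OF singleton_chain(1)[OF p(1)], of ev] decomposable_iff[OF singleton_chain(1)[OF p(1)]] by simp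
qed

lemma total_degree_ev: "set T \<subseteq> strata S \<Longrightarrow> total_degree S (ev T) = of_nat (length T)"
proof -
 assume T: "set T \<subseteq> strata S"
 have "total_degree S (ev T) = (\<Sum>p\<in>strata S. ev T p * (\<Sum>j = 1..nfac S. of_nat (mdegree S (extremal S p) j)))"
  unfolding total_degree_def deg_map_def sum_distrib_left by (rule sum.swap)
 also have "\<dots> = (\<Sum>p\<in>strata S. ev T p)"
  using degree by (intro sum.cong refl) (simp flip: of_nat_sum)
 finally show ?thesis unfolding sum_ev[OF T] .
qed

lemma indecomposables_degree: "indecomposables S r = {a \<in> fan S r. total_degree S a = 1}"
proof -
 have "total_degree S (ev T) = 1 \<longleftrightarrow> length T = 1" if "T \<in> chains" for T
  unfolding total_degree_ev[OF chainsD(1)[OF that]] by simp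
 thus ?thesis unfolding indecomposables_def fan_eq using decomposable_iff by auto
qed

text \<open>Decompositions list the supports in decreasing order and tableaux in increasing order,
  hence the reversal; uniqueness is \<open>ev_inj\<close>.\<close>

lemma decomposition_ev:
 assumes T: "T \<in> chains"
 shows "decomposition S r (ev T) = map evec (rev T)"
 unfolding decomposition_def indecomposables_eq
proof (rule the_equality)
 have "sum_list (map evec (rev T)) = ev T" by (induction T) (simp_all add: ev_append add.commute)
 moreover have "supp_ge S (map evec (rev T) ! i) (map evec (rev T) ! Suc i)" if "Suc i < length T" for i
 proof -
  have "str_le S (T ! (length T - Suc (Suc i))) (T ! (length T - Suc i))"
   using that chainsD(2)[OF T] by (auto simp: sorted_wrt_iff_nth_less)
  thus ?thesis using that by (simp add: supp_ge_evec rev_nth)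
 qed
 ultimately show "set (map evec (rev T)) \<subseteq> evec ` strata S \<and> sum_list (map evec (rev T)) = ev T \<and>
   (\<forall>i. Suc i < length (map evec (rev T)) \<longrightarrow> supp_ge S (map evec (rev T) ! i) (map evec (rev T) ! Suc i))"
  using chainsD(1)[OF T] by auto
next
 fix as assume as: "set as \<subseteq> evec ` strata S \<and> sum_list as = ev T \<and>
   (\<forall>i. Suc i < length as \<longrightarrow> supp_ge S (as ! i) (as ! Suc i))"
 hence "as \<in> lists (evec ` strata S)" by auto
 then obtain U where U: "set U \<subseteq> strata S" "as = map evec U" unfolding lists_image by auto
 have "sorted_wrt (\<lambda>p q. str_le S q p) U"
 proof (subst sorted_wrt_iff_nth_Suc_transp)
  show "transp (\<lambda>p q. str_le S q p)" by (auto simp: transp_def intro: le_trans)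
  show "\<forall>i. Suc i < length U \<longrightarrow> str_le S (U ! Suc i) (U ! i)"
   using as unfolding U(2) by (auto simp: supp_ge_evec)
 qed
 hence R: "rev U \<in> chains" using U(1) by (simp add: chains_def sorted_wrt_rev)
 have "sum_list (map evec U) = ev (rev U)" by (induction U) (simp_all add: ev_append add.commute)
 hence "rev U = T" using as ev_inj[OF R T] unfolding U(2) by simp
 thus "as = map evec (rev T)" using U(2) by auto
qed

lemma ring_prod_extremal:
 "set T \<subseteq> strata S \<Longrightarrow> ring_prod (coord_ring (total S)) (map (extremal S) T) = restr (total S) (emon T)"
proof (induction T)
 case Nil
 show ?case by (simp add: ring_prod_def coord_ring_def)
next
 case (Cons p T)
 thus ?case
  using restr_mult[of "total S" "ext p" "emon T"] extremal_eq[of p] by (simp add: ring_prod_def)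
qed

lemma emon_rev: "emon (rev T) = emon T"
 by (simp add: emon_def fun_eq_iff flip: prod_mset_prod_list)

lemma std_monomial_ev:
 assumes x: "\<forall>p\<in>strata S. x (evec p) = extremal S p" and T: "T \<in> chains"
 shows "std_monomial S r x (ev T) = restr (total S) (emon T)"
proof -
 have eq: "map x (map evec (rev T)) = map (extremal S) (rev T)" using x chainsD(1)[OF T] by auto
 have "ring_prod (coord_ring (total S)) (map (extremal S) (rev T)) = restr (total S) (emon (rev T))"
  by (rule ring_prod_extremal) (use chainsD(1)[OF T] in simp)
 thus ?thesis unfolding std_monomial_def decomposition_ev[OF T] eq emon_rev .
qed

lemma std_monomial_image:
 assumes "\<forall>p\<in>strata S. x (evec p) = extremal S p"
 shows "std_monomial S r x ` fan S r = (\<lambda>T. restr (total S) (emon T)) ` chains"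
 unfolding fan_eq image_image using std_monomial_ev[OF assms] by (rule image_cong[OF refl])

lemma emon_inj: "inj_on (\<lambda>T. restr (total S) (emon T)) chains"
proof (rule inj_onI)
 fix T U assume T: "T \<in> chains" "U \<in> chains" and eq: "restr (total S) (emon T) = restr (total S) (emon U)"
 have "ev T = ev U" using quasi_val_emon[OF T(1)] quasi_val_emon[OF T(2)] eq by simp
 thus "T = U" by (rule ev_inj[OF T])
qed

lemma std_monomial_inj:
 assumes "\<forall>p\<in>strata S. x (evec p) = extremal S p"
 shows "inj_on (std_monomial S r x) (fan S r)"
proof (rule inj_onI)
 fix a b assume "a \<in> fan S r" "b \<in> fan S r" and eq: "std_monomial S r x a = std_monomial S r x b"
 then obtain T U where T: "T \<in> chains" "a = ev T" and U: "U \<in> chains" "b = ev U" unfolding fan_eq by blast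
 have "T = U"
  by (rule inj_onD[OF emon_inj _ T(1) U(1)])
   (use eq in \<open>simp only: T(2) U(2) std_monomial_ev[OF assms T(1)] std_monomial_ev[OF assms U(1)]\<close>)
 thus "a = b" using T(2) U(2) by simp
qed

text \<open>A non-trivial combination has a smallest tableau, and by
  \<open>quasi_val_expansion\<close> it cannot vanish on the total space. Generation is the
  assumption on expansions.\<close>

lemma emon_basis: "is_basis ((\<lambda>T. restr (total S) (emon T)) ` chains) (carrier (coord_ring (total S)))"
proof -
 let ?m = "\<lambda>T. restr (total S) (emon T)"
 interpret fs: Modules.module "fun_scale :: 'k \<Rightarrow> (('b, 'k) mpoint \<Rightarrow> 'k) \<Rightarrow> _"
  by unfold_locales (auto simp: fun_scale_def fun_eq_iff algebra_simps)
 have indep: "\<not> fs.dependent (?m ` chains)"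
 proof
  assume "fs.dependent (?m ` chains)"
  then obtain t u where t: "finite t" "t \<subseteq> ?m ` chains" "(\<Sum>f\<in>t. fun_scale (u f) f) = 0" "\<exists>f\<in>t. u f \<noteq> 0"
   unfolding fs.dependent_explicit by - (elim exE conjE, rule that)
  obtain E where E: "E \<subseteq> chains" "finite E" "t = ?m ` E"
   using finite_subset_image[OF t(1,2)] by - (elim exE conjE, rule that)
  have inj: "inj_on ?m E" by (rule inj_on_subset[OF emon_inj E(1)])
  let ?E = "{T \<in> E. u (?m T) \<noteq> 0}"
  obtain f where f: "f \<in> t" "u f \<noteq> 0" using t(4) by (rule bexE)
  have "f \<in> ?m ` E" using f(1) unfolding E(3) .
  then obtain T where T: "f = ?m T" "T \<in> E" by (rule imageE)
  hence ne: "?E \<noteq> {}" using f(2) by auto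
  have fin: "finite ?E" and sub: "?E \<subseteq> chains" using E(1,2) by auto
  obtain T0 where T0: "T0 \<in> ?E" "\<forall>T\<in>?E - {T0}. ev T0 \<prec> ev T"
   using ev_min_exists[OF fin ne sub] by (rule bexE)
  let ?F = "\<lambda>v. \<Sum>T\<in>?E. u (?m T) * emon T v"
  have "nz (Some top) ?F"
  proof (rule quasi_val_expansion(1)[of _ ?E "\<lambda>T. u (?m T)" T0])
   show "polyfun ?F" using E(1) polyfun_emon chainsD(1) by (intro polyfun_sum polyfun_scale) blast
   show "finite ?E" by (rule fin)
   show "?E \<subseteq> chains" by (rule sub)
   show "u (?m T) \<noteq> 0" if "T \<in> ?E" for T using that by simp
   show "T0 \<in> ?E" by (rule T0(1))
   show "ev T0 \<prec> ev T" if "T \<in> ?E - {T0}" for T by (rule bspec[OF T0(2) that])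
  qed simp
  moreover have "?F v = 0" if v: "v \<in> total S" for v
  proof -
   have "?F v = (\<Sum>T\<in>E. u (?m T) * emon T v)" using E(2) by (intro sum.mono_neutral_left) auto
   also have "\<dots> = (\<Sum>T\<in>E. fun_scale (u (?m T)) (?m T) v)" using v by (simp add: fun_scale_def restr_def)
   also have "\<dots> = (\<Sum>f\<in>t. fun_scale (u f) f v)" unfolding E(3) sum.reindex[OF inj] by simp
   also have "\<dots> = (\<Sum>f\<in>t. fun_scale (u f) f) v" by (induction t rule: infinite_finite_induct) auto
   finally show ?thesis unfolding t(3) by simp
  qed
  ultimately show False using top(2) by (simp add: nz_def)
 qed
 have span: "fs.span (?m ` chains) = carrier (coord_ring (total S))"
 proof (intro equalityI subsetI)
  have "fs.subspace (carrier (coord_ring (total S)))"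
  proof (rule fs.subspaceI)
   have "(0 :: ('b, 'k) mpoint \<Rightarrow> 'k) = restr (total S) (\<lambda>_. 0)" by (simp add: restr_def fun_eq_iff)
   thus "0 \<in> carrier (coord_ring (total S))" using poly_const[of 0] by (auto simp: coord_ring_def)
  next
   fix f g assume "f \<in> carrier (coord_ring (total S))" "g \<in> carrier (coord_ring (total S))"
   then obtain F G where F: "f = restr (total S) F" "polyfun F" and G: "g = restr (total S) G" "polyfun G"
    by (auto simp: coord_ring_def)
   have "f + g = restr (total S) (\<lambda>v. F v + G v)" unfolding F G by (simp add: restr_def fun_eq_iff)
   thus "f + g \<in> carrier (coord_ring (total S))" using poly_add[OF F(2) G(2)] by (auto simp: coord_ring_def)
  next
   fix c f assume "f \<in> carrier (coord_ring (total S))"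
   then obtain F where F: "f = restr (total S) F" "polyfun F" by (auto simp: coord_ring_def)
   have "fun_scale c f = restr (total S) (\<lambda>v. c * F v)" unfolding F by (simp add: restr_def fun_scale_def fun_eq_iff)
   thus "fun_scale c f \<in> carrier (coord_ring (total S))" using polyfun_scale[OF F(2)] by (auto simp: coord_ring_def)
  qed
  moreover have "?m ` chains \<subseteq> carrier (coord_ring (total S))"
   using polyfun_emon chainsD(1) by (auto simp: coord_ring_def)
  ultimately show "f \<in> carrier (coord_ring (total S))" if "f \<in> fs.span (?m ` chains)" for f
   using fs.span_minimal that by blast
 next
  fix f assume "f \<in> carrier (coord_ring (total S))"
  then obtain F where F: "f = restr (total S) F" "polyfun F" by (auto simp: coord_ring_def)
  obtain E q where E: "finite E" "E \<subseteq> chains" "\<forall>v\<in>total S. F v = (\<Sum>T\<in>E. q T * emon T v)"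
   using spanning[OF F(2)] by blast
  have "(\<Sum>T\<in>E. fun_scale (q T) (?m T)) v = (\<Sum>T\<in>E. fun_scale (q T) (?m T) v)" for v
   by (induction E rule: infinite_finite_induct) auto
  hence "f = (\<Sum>T\<in>E. fun_scale (q T) (?m T))"
   unfolding F(1) using E(3) by (auto simp: fun_eq_iff restr_def fun_scale_def)
  also have "\<dots> \<in> fs.span (?m ` chains)" using E(2) by (intro fs.span_sum fs.span_scale fs.span_base) blast
  finally show "f \<in> fs.span (?m ` chains)" .
 qed
 show ?thesis unfolding is_basis_def using indep span by blast
qed

end

section \<open>The stratification by column sets\<close>

context flag_setup
begin

abbreviation cs :: "(nat \<Rightarrow> nat) set \<times> nat \<Rightarrow> nat set" where "cs \<equiv> column_set k"

definition of_set :: "nat set \<Rightarrow> (nat \<Rightarrow> nat) set \<times> nat" where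
 "of_set = inv_into (flag_strata n m k) cs"

lemma of_set: "J \<in> csets \<Longrightarrow> of_set J \<in> flag_strata n m k" "J \<in> csets \<Longrightarrow> cs (of_set J) = J"
 using bij_column_set unfolding of_set_def bij_betw_def by (metis inv_into_into, metis f_inv_into_f)

lemma cs_inj: "p \<in> flag_strata n m k \<Longrightarrow> q \<in> flag_strata n m k \<Longrightarrow> cs p = cs q \<Longrightarrow> p = q"
 using bij_column_set unfolding bij_betw_def inj_on_def by blast

lemma str_le_iff:
 assumes "p \<in> flag_strata n m k" "q \<in> flag_strata n m k"
 shows "str_le (str :: (_, _, 'k::{alg_closed_field, field_char_0}) stratification) p q \<longleftrightarrow> tle (cs p) (cs q)"
 unfolding str_le_def scone_eq_cone[OF assms(1)] scone_eq_cone[OF assms(2)]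
 by (rule cone_subset_iff) (use column_set_csets assms in auto)

text \<open>The shortest admissible column with the largest entries. It may stand to the right of
  every other column, so its stratum is the whole variety.\<close>

definition top_set :: "nat set" where
 "top_set = {n - k 1 + 1..n}"

lemma k_first: "1 \<le> k 1" "k 1 < n" "1 \<in> {1..m}"
 using k_bounds[of 1] k_less_n[of 1] m by auto

lemma top_set: "top_set \<in> csets"
proof (rule csetsI[OF _ k_first(3)])
 show "top_set \<subseteq> {1..n}" by (auto simp: top_set_def)
 show "card top_set = k 1" using k_first by (simp add: top_set_def)
qed

lemma tle_top_set:
 assumes J: "J \<in> csets"
 shows "tle J top_set"
 unfolding tle_def
proof
 fix x
 show "card (top_set \<inter> {..x}) \<le> card (J \<inter> {..x})"
 proof (cases "x \<le> n")
  case True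
  have "top_set \<inter> {..x} = {n - k 1 + 1..x}" using True by (auto simp: top_set_def)
  hence "card (top_set \<inter> {..x}) = k 1 + x - n" using k_first by simp
  moreover have "card J \<le> card (J \<inter> {..x}) + card {x<..n}"
  proof -
   have "J \<subseteq> (J \<inter> {..x}) \<union> {x<..n}" using csets_sub[OF J] by auto
   hence "card J \<le> card ((J \<inter> {..x}) \<union> {x<..n})" using csets_finite[OF J] by (intro card_mono) auto
   also have "\<dots> \<le> card (J \<inter> {..x}) + card {x<..n}" by (rule card_Un_le)
   finally show ?thesis .
  qed
  moreover have "k 1 \<le> card J" using idx[OF J] k_le_iff[of 1 "idx J"] k_first(3) by auto
  ultimately show ?thesis using True by simp
 next
  case False
  have "top_set \<inter> {..x} = top_set" "J \<inter> {..x} = J"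
   using False csets_sub[OF J] by (auto simp: top_set_def)
  moreover have "k 1 \<le> card J" using idx[OF J] k_le_iff[of 1 "idx J"] k_first(3) by auto
  ultimately show ?thesis using k_first by (simp add: top_set_def)
 qed
qed

lemma rank_set_pos:
 assumes "J \<in> csets"
 shows "0 < rank_set n J"
proof -
 have "card J < n" using idx[OF assms] k_less_n[of "idx J"] by simp
 \<comment> \<open>Admissible columns are shorter than n, so already the last summand is
   positive.\<close>
 hence "0 < n - card (J \<inter> {..n})" using card_mono[of J "J \<inter> {..n}"] csets_finite[OF assms] by simp
 moreover have "n - card (J \<inter> {..n}) \<le> rank_set n J"
  unfolding rank_set_def using n_pos by (intro member_le_sum) auto
 ultimately show ?thesis by simp
qed

lemma seshadri_flags:
 "seshadri (str :: (_, _, 'k::{alg_closed_field, field_char_0}) stratification) (\<lambda>p. crd (cs p))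
  (\<lambda>p. rank_set n (cs p)) torus (of_set top_set)"
proof -
 let ?S = "str :: (_, _, 'k) stratification"
 have J: "cs p \<in> csets" if "p \<in> strata ?S" for p using column_set_csets(1) that by (simp add: strata_str)
 have cone: "scone ?S p = cone (cs p)" if "p \<in> strata ?S" for p using scone_eq_cone that by (simp add: strata_str)
 have le: "str_le ?S p q \<longleftrightarrow> tle (cs p) (cs q)" if "p \<in> strata ?S" "q \<in> strata ?S" for p q
  using str_le_iff that by (simp add: strata_str)
 have inj: "p = q" if "p \<in> strata ?S" "q \<in> strata ?S" "cs p = cs q" for p q
  using cs_inj that by (simp add: strata_str)
 have top: "of_set top_set \<in> strata ?S" "cs (of_set top_set) = top_set"
  using of_set[OF top_set] by (simp_all add: strata_str)
 show ?thesis
 proof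
  show "finite (strata ?S)"
   using bij_betw_finite[OF bij_column_set] finite_csets by (simp add: strata_str)
 next
  fix p F G and u w :: "'k fpoint"
  assume "p \<in> strata ?S" "polyfun F" "polyfun G" "u \<in> scone ?S p" "F u \<noteq> 0" "w \<in> scone ?S p" "G w \<noteq> 0"
  thus "\<exists>v\<in>scone ?S p. F v * G v \<noteq> 0" unfolding cone[OF \<open>p \<in> _\<close>] using cone_irreducible[OF J] by blast
 next
  fix p assume p: "p \<in> strata ?S"
  show "polyfun (crd (cs p) :: 'k fpoint \<Rightarrow> 'k)" by (rule polyfun_crd)
  show "extremal ?S p = restr (total ?S) (crd (cs p))"
   using extremal_str p by (simp add: strata_str total_str)
  show "0 \<in> scone ?S p" unfolding cone[OF p] by (rule zero_in_cone[OF J[OF p]])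
  show "crd (cs p) (0 :: 'k fpoint) = 0" by (simp add: crd_def)
  show "0 < rank_set n (cs p)" by (rule rank_set_pos[OF J[OF p]])
  show "str_le ?S p (of_set top_set)" unfolding le[OF p top(1)] top(2) by (rule tle_top_set[OF J[OF p]])
  fix t :: 'k and v :: "'k fpoint"
  show "crd (cs p) (torus t v) = t ^ rank_set n (cs p) * crd (cs p) v" by (rule crd_torus)
  assume "t \<noteq> 0" "v \<in> scone ?S p"
  thus "torus t v \<in> scone ?S p" unfolding cone[OF p] by (rule torus_cone)
 next
  fix p q assume p: "p \<in> strata ?S" and q: "q \<in> strata ?S"
  show "(\<exists>v\<in>scone ?S p. crd (cs q) v \<noteq> 0) \<longleftrightarrow> str_le ?S q p"
   unfolding cone[OF p] le[OF q p] by (rule crd_cone_nonzero_iff[OF J[OF p] J[OF q]])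
  show "p = q" if "str_le ?S p q" "str_le ?S q p"
   using that tle_antisym inj[OF p q] unfolding le[OF p q] le[OF q p] by blast
  show "rank_set n (cs q) < rank_set n (cs p)" if "str_less ?S q p"
  proof (rule rank_set_csets_less[OF _ _ J[OF q] J[OF p]])
   show "tle (cs q) (cs p)" using that le[OF q p] by (simp add: str_less_def)
   show "cs q \<noteq> cs p" using that inj[OF q p] by (auto simp: str_less_def)
  qed
 next
  fix p and F :: "'k fpoint \<Rightarrow> 'k"
  assume p: "p \<in> strata ?S" and F: "polyfun F" "F 0 = 0"
   and zero: "\<And>q v. q \<in> strata ?S \<Longrightarrow> str_less ?S q p \<Longrightarrow> v \<in> scone ?S q \<Longrightarrow> F v = 0"
  show "\<exists>G. polyfun G \<and> (\<forall>v\<in>scone ?S p. F v = crd (cs p) v * G v)"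
   unfolding cone[OF p]
  proof (rule boundary_ideal[OF F J[OF p]])
   fix K and v :: "'k fpoint" assume K: "K \<in> csets" "tle K (cs p)" "K \<noteq> cs p" "v \<in> cone K"
   have q: "of_set K \<in> strata ?S" "cs (of_set K) = K" using of_set[OF K(1)] by (simp_all add: strata_str)
   have "str_less ?S (of_set K) p" unfolding str_less_def le[OF q(1) p] q(2) using K(2,3) q(2) by auto
   moreover have "v \<in> scone ?S (of_set K)" unfolding cone[OF q(1)] q(2) by (rule K(4))
   ultimately show "F v = 0" using zero q(1) by blast
  qed
 next
  show "torus 1 v = v" for v :: "'k fpoint" by (simp add: torus_def)
  show "is_poly (\<lambda>t. torus t v j b)" for v :: "'k fpoint" and j b by (rule is_poly_torus)
  show "of_set top_set \<in> strata ?S" by (rule top)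
  show "scone ?S (of_set top_set) = total ?S"
   unfolding cone[OF top(1)] top(2) total_str using tle_top_set by (auto simp: cone_def)
 qed
qed

lemma chains_iff:
 fixes S :: "(_, _, 'k::{alg_closed_field, field_char_0}) stratification"
 assumes "S = str"
 shows "T \<in> seshadri.chains S \<longleftrightarrow> set T \<subseteq> flag_strata n m k \<and> map cs T \<in> std"
proof -
 interpret seshadri S "\<lambda>p. crd (cs p)" "\<lambda>p. rank_set n (cs p)" torus "of_set top_set"
  unfolding assms by (rule seshadri_flags)
 have "sorted_wrt (str_le S) T \<longleftrightarrow> sorted_wrt tle (map cs T)" if T: "set T \<subseteq> flag_strata n m k"
  using T by (induction T) (auto simp: str_le_iff assms subset_iff)
 thus ?thesis
  unfolding chains_def using column_set_csets(1) by (auto simp: std_def assms strata_str)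
qed

lemma flags_spanning:
 fixes S :: "(_, _, 'k::{alg_closed_field, field_char_0}) stratification"
 assumes "S = str" "polyfun F"
 shows "\<exists>E q. finite E \<and> E \<subseteq> seshadri.chains S \<and>
  (\<forall>v\<in>total S. F v = (\<Sum>T\<in>E. q T * seshadri.emon (\<lambda>p. crd (cs p)) T v))"
proof -
 interpret seshadri S "\<lambda>p. crd (cs p)" "\<lambda>p. rank_set n (cs p)" torus "of_set top_set"
  unfolding assms(1) by (rule seshadri_flags)
 obtain E q where E: "finite E" "E \<subseteq> std" "\<forall>v\<in>tot. F v = (\<Sum>T\<in>E. q T * mon T v)"
  using cone_expansion[OF assms(2)] by blast
 have inv: "map cs (map of_set T) = T" if "T \<in> E" for T
  using that E(2) of_set(2) by (auto simp: std_def subset_iff intro!: map_idI)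
 have chain: "map of_set T \<in> chains" if "T \<in> E" for T
 proof -
  have T: "T \<in> std" using that E(2) by blast
  hence "set (map of_set T) \<subseteq> flag_strata n m k" using of_set(1) by (force simp: std_def)
  thus ?thesis unfolding chains_iff[OF assms(1)] inv[OF that] using T by blast
 qed
 have inj: "inj_on (map of_set) E" by (rule inj_on_inverseI[of _ "map cs"]) (rule inv)
 have mon: "emon (map of_set T) v = mon T v" if "T \<in> E" for T v
 proof -
  have "emon U v = mon (map cs U) v" for U by (induction U) simp_all
  thus ?thesis using inv[OF that] by simp
 qed
 have "F v = (\<Sum>T\<in>map of_set ` E. q (map cs T) * emon T v)" if "v \<in> total S" for v
 proof -
  have "F v = (\<Sum>T\<in>E. q T * mon T v)" using E(3) that unfolding assms(1) total_str by blast
  also have "\<dots> = (\<Sum>T\<in>E. q (map cs (map of_set T)) * emon (map of_set T) v)"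
   by (rule sum.cong[OF refl]) (simp only: inv mon)
  also have "\<dots> = (\<Sum>T\<in>map of_set ` E. q (map cs T) * emon T v)" unfolding sum.reindex[OF inj] comp_def ..
  finally show ?thesis .
 qed
 thus ?thesis using E(1) chain by (intro exI[of _ "map of_set ` E"] exI[of _ "\<lambda>T. q (map cs T)"]) auto
qed

text \<open>Doubling the i-th component multiplies a function of degree d by \<open>2 ^ d i\<close>.
  At a point where the coordinate does not vanish this determines \<open>d i\<close>, since the
  powers of 2 are distinct in characteristic zero.\<close>

lemma mdegree_extremal:
 fixes S :: "(_, _, 'k::{alg_closed_field, field_char_0}) stratification"
 assumes S: "S = str" and p: "p \<in> flag_strata n m k"
 shows "mdegree S (extremal S p) = evec (snd p)"
 unfolding mdegree_def
proof (rule the_equality)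
 let ?J = "cs p"
 have J: "?J \<in> csets" "idx ?J = snd p" using column_set_csets[OF p] by auto
 have crd: "crd ?J = (\<lambda>v. v (snd p) ?J)" by (simp add: crd_def fun_eq_iff J(2))
 have ex: "extremal S p = restr (total S) (crd ?J)" unfolding S extremal_str[OF p] total_str ..
 show "\<exists>F. mhom (evec (snd p)) F \<and> extremal S p = restr (total S) F"
  using mhom_coord[of "snd p" ?J] ex unfolding crd by blast
 fix d assume "\<exists>F. mhom d F \<and> extremal S p = restr (total S) F"
 then obtain F where F: "mhom d F" "restr (total S) F = restr (total S) (crd ?J)" using ex by auto
 have eq: "F v = crd ?J v" if "v \<in> tot" for v
  using fun_cong[OF F(2), of v] that by (simp add: restr_def S total_str)
 obtain v :: "'k fpoint" where v: "v \<in> cone ?J" "crd ?J v \<noteq> 0"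
  using crd_cone_nonzero_iff[OF J(1) J(1)] tle_refl by blast
 hence vt: "v \<in> tot" by (simp add: cone_def)
 then obtain c g where g: "g \<in> carrier_mat n n" "det g \<noteq> 0" "v = flag_vec {1..m} c g" by (auto simp: tot_def)
 have two: "(2 :: 'k) ^ a = 2 ^ b \<longleftrightarrow> a = b" for a b :: nat
 proof -
  have "(2 :: 'k) ^ a = 2 ^ b \<longleftrightarrow> of_nat (2 ^ a) = (of_nat (2 ^ b) :: 'k)" by simp
  also have "\<dots> \<longleftrightarrow> (2 :: nat) ^ a = 2 ^ b" by (rule of_nat_eq_iff)
  finally show ?thesis by simp
 qed
 show "d = evec (snd p)"
 proof
  fix i
  let ?c = "\<lambda>j :: nat. if j = i then 2 else (1 :: 'k)"
  let ?v = "\<lambda>j b. ?c j * v j b"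
  have "?v = flag_vec {1..m} (\<lambda>j. ?c j * c j) g" unfolding g(3) by (intro ext) (simp add: flag_vec_def)
  hence "?v \<in> tot" unfolding tot_def using g(1,2) by blast
  hence "F ?v = crd ?J ?v" by (rule eq)
  also have "\<dots> = ?c (snd p) * crd ?J v" unfolding crd ..
  finally have Fv: "F ?v = ?c (snd p) * crd ?J v" .
  have fin: "finite {j. d j \<noteq> 0}" and F': "F ?v = (\<Prod>j\<in>{j. d j \<noteq> 0}. ?c j ^ d j) * F v"
   using mhom_scale_point[OF F(1), of ?c v] by blast+
  have "(\<Prod>j\<in>{j. d j \<noteq> 0}. ?c j ^ d j) = (\<Prod>j\<in>{j. d j \<noteq> 0}. if i = j then 2 ^ d j else 1)"
   by (rule prod.cong) auto
  also have "\<dots> = 2 ^ d i" using fin by simp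
  finally have pr: "(\<Prod>j\<in>{j. d j \<noteq> 0}. ?c j ^ d j) = 2 ^ d i" .
  have "2 ^ d i * crd ?J v = ?c (snd p) * crd ?J v" using F' unfolding Fv pr eq[OF vt] by (rule sym)
  with v(2) have "(2 :: 'k) ^ d i = ?c (snd p)" unfolding mult_cancel_right by blast
  also have "\<dots> = 2 ^ evec (snd p) i" by (simp add: evec_def)
  finally show "d i = evec (snd p) i" unfolding two .
 qed
qed

lemma seshadri_smt_flags:
 fixes S :: "(_, _, 'k::{alg_closed_field, field_char_0}) stratification"
 assumes S: "S = str" and r: "total_refinement S r"
 shows "seshadri_smt S (\<lambda>p. crd (cs p)) (\<lambda>p. rank_set n (cs p)) torus (of_set top_set) r"
proof -
 interpret seshadri S "\<lambda>p. crd (cs p)" "\<lambda>p. rank_set n (cs p)" torus "of_set top_set"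
  unfolding S by (rule seshadri_flags)
 show ?thesis
 proof
  show "total_refinement S r" by (rule r)
  show "\<exists>E q. finite E \<and> E \<subseteq> chains \<and> (\<forall>v\<in>total S. F v = (\<Sum>T\<in>E. q T * emon T v))" if "polyfun F" for F
   using that by (rule flags_spanning[OF S])
  show "(\<Sum>j = 1..nfac S. mdegree S (extremal S p) j) = 1" if "p \<in> strata S" for p
  proof -
   have p: "p \<in> flag_strata n m k" using that by (simp add: S strata_str)
   have "snd p \<in> {1..m}" using column_set_csets[OF p] idx(1) by metis
   thus ?thesis unfolding mdegree_extremal[OF S p] by (simp add: S strata_str evec_def)
  qed
 qed
qed

section \<open>Tableaux as lists of strata\<close>

lemma column_set_sorted:
 assumes "p \<in> flag_strata n m k"
 shows "set (column k p) = cs p" "sorted_wrt (<) (column k p)"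
 using csets_finite[OF column_set_csets(1)[OF assms]] by (simp_all add: column_def)

lemma column_stratum:
 assumes "sorted_wrt (<) c" "set c \<in> csets"
 shows "column_stratum n m k c = of_set (set c)"
 unfolding column_stratum_def
proof (rule the_equality)
 have "sorted_list_of_set (set c) = c" using assms(1) by (simp add: sorted_list_of_set.idem_if_sorted_distinct strict_sorted_iff)
 thus "of_set (set c) \<in> flag_strata n m k \<and> column k (of_set (set c)) = c"
  using of_set[OF assms(2)] by (simp add: column_def)
 fix p assume p: "p \<in> flag_strata n m k \<and> column k p = c"
 hence pS: "p \<in> flag_strata n m k" and c: "column k p = c" by blast+
 have "cs p = cs (of_set (set c))" unfolding of_set(2)[OF assms(2)] using column_set_sorted(1)[OF pS] unfolding c by (rule sym)
 thus "p = of_set (set c)" by (rule cs_inj[OF pS of_set(1)[OF assms(2)]])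
qed

lemma SSYT_iff:
 "T \<in> SSYT n (k ` {1..m}) \<longleftrightarrow> (\<forall>c\<in>set T. sorted_wrt (<) c) \<and> map set T \<in> std"
proof -
 have col: "set c \<subseteq> {1..n} \<and> length c \<in> k ` {1..m} \<longleftrightarrow> set c \<in> csets" if "sorted_wrt (<) c" for c :: "nat list"
  using that by (simp add: csets_def distinct_card strict_sorted_iff)
 have sorted: "sorted_wrt (\<lambda>c c'. length c' \<le> length c \<and> (\<forall>i<length c'. c ! i \<le> c' ! i)) T \<longleftrightarrow>
   sorted_wrt tle (map set T)" if "\<forall>c\<in>set T. sorted_wrt (<) c"
  using that by (induction T) (simp_all add: tle_lists_iff)
 have "T \<in> SSYT n (k ` {1..m}) \<longleftrightarrow> (\<forall>c\<in>set T. sorted_wrt (<) c) \<and>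
   (\<forall>c\<in>set T. set c \<subseteq> {1..n} \<and> length c \<in> k ` {1..m}) \<and>
   sorted_wrt (\<lambda>c c'. length c' \<le> length c \<and> (\<forall>i<length c'. c ! i \<le> c' ! i)) T"
  unfolding SSYT_def by blast
 also have "\<dots> \<longleftrightarrow> (\<forall>c\<in>set T. sorted_wrt (<) c) \<and> (\<forall>c\<in>set T. set c \<in> csets) \<and> sorted_wrt tle (map set T)"
  by (intro conj_cong refl ball_cong) (use col sorted in blast)+
 finally show ?thesis unfolding std_def by (simp add: image_subset_iff)
qed

lemma SSYT_column:
 assumes "set T \<subseteq> flag_strata n m k"
 shows "map (column k) T \<in> SSYT n (k ` {1..m}) \<longleftrightarrow> map cs T \<in> std"
proof -
 have col: "set (column k p) = cs p" "sorted_wrt (<) (column k p)" if "p \<in> set T" for p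
  using that assms column_set_sorted[of p] by auto
 have "map set (map (column k) T) = map cs T" unfolding map_map comp_def using col(1) by (rule map_cong[OF refl])
 moreover have "\<forall>c\<in>set (map (column k) T). sorted_wrt (<) c" unfolding set_map ball_simps using col(2) by blast
 ultimately show ?thesis unfolding SSYT_iff by presburger
qed

lemma bij_SSYT_chains:
 fixes S :: "(_, _, 'k::{alg_closed_field, field_char_0}) stratification"
 assumes S: "S = str"
 shows "bij_betw (map (column_stratum n m k)) (SSYT n (k ` {1..m})) (seshadri.chains S)"
proof (rule bij_betw_byWitness[where f' = "map (column k)"])
 have col: "sorted_wrt (<) c" "set c \<in> csets" if "T \<in> SSYT n (k ` {1..m})" "c \<in> set T" for c T
  using that unfolding SSYT_iff std_def by auto
 have 1: "column k (column_stratum n m k c) = c" "column_stratum n m k c \<in> flag_strata n m k"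
  if "T \<in> SSYT n (k ` {1..m})" "c \<in> set T" for c T
 proof -
  note c = col[OF that]
  have "sorted_list_of_set (set c) = c" using c(1) by (simp add: sorted_list_of_set.idem_if_sorted_distinct strict_sorted_iff)
  thus "column k (column_stratum n m k c) = c" "column_stratum n m k c \<in> flag_strata n m k"
   unfolding column_stratum[OF c] using of_set[OF c(2)] by (simp_all add: column_def)
 qed
 have 2: "column_stratum n m k (column k p) = p" if p: "p \<in> flag_strata n m k" for p
 proof -
  have J: "cs p \<in> csets" by (rule column_set_csets(1)[OF p])
  note c = column_set_sorted(2,1)[OF p]
  have "column_stratum n m k (column k p) = of_set (cs p)" using column_stratum[OF c(1)] c(2) J by simp
  also have "\<dots> = p" by (rule cs_inj[OF of_set(1)[OF J] p of_set(2)[OF J]])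
  finally show ?thesis .
 qed
 show inv: "\<forall>T\<in>SSYT n (k ` {1..m}). map (column k) (map (column_stratum n m k) T) = T"
 proof
  fix T assume "T \<in> SSYT n (k ` {1..m})"
  thus "map (column k) (map (column_stratum n m k) T) = T" using 1(1) by (auto intro!: map_idI)
 qed
 show "\<forall>T\<in>seshadri.chains S. map (column_stratum n m k) (map (column k) T) = T"
 proof
  fix T assume "T \<in> seshadri.chains S"
  hence "set T \<subseteq> flag_strata n m k" unfolding chains_iff[OF S] by blast
  hence "column_stratum n m k (column k p) = p" if "p \<in> set T" for p using that by (intro 2) blast
  thus "map (column_stratum n m k) (map (column k) T) = T" unfolding map_map comp_def by (rule map_idI)
 qed
 show "map (column_stratum n m k) ` SSYT n (k ` {1..m}) \<subseteq> seshadri.chains S"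
 proof
  fix U assume "U \<in> map (column_stratum n m k) ` SSYT n (k ` {1..m})"
  then obtain T where T: "U = map (column_stratum n m k) T" "T \<in> SSYT n (k ` {1..m})" by (rule imageE)
  have U: "set U \<subseteq> flag_strata n m k" unfolding T(1) set_map using 1(2)[OF T(2)] by (rule image_subsetI)
  have "map (column k) U \<in> SSYT n (k ` {1..m})" using bspec[OF inv T(2)] T(2) unfolding T(1) by (simp only:)
  thus "U \<in> seshadri.chains S" unfolding chains_iff[OF S] SSYT_column[OF U] using U by simp
 qed
 show "map (column k) ` seshadri.chains S \<subseteq> SSYT n (k ` {1..m})"
 proof (rule image_subsetI)
  fix T assume "T \<in> seshadri.chains S"
  hence "set T \<subseteq> flag_strata n m k" "map cs T \<in> std" unfolding chains_iff[OF S] by blast+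
  thus "map (column k) T \<in> SSYT n (k ` {1..m})" using SSYT_column by blast
 qed
qed

text \<open>Columns do not get longer from left to right, and the index of a stratum grows with the
  length of its column.\<close>

lemma std_sorted_snd:
 assumes "set T \<subseteq> flag_strata n m k" "map cs T \<in> std"
 shows "sorted_wrt (\<lambda>p q. snd q \<le> snd p) T"
proof -
 have "sorted_wrt (\<lambda>p q. tle (cs p) (cs q)) T" using assms(2) by (simp add: std_def sorted_wrt_map)
 thus ?thesis
 proof (rule sorted_wrt_mono_rel[rotated])
  fix p q assume pq: "p \<in> set T" "q \<in> set T" "tle (cs p) (cs q)"
  hence p: "p \<in> flag_strata n m k" and q: "q \<in> flag_strata n m k" using assms(1) by auto
  show "snd q \<le> snd p"
   using tle_idx[OF column_set_csets(1)[OF p] column_set_csets(1)[OF q] pq(3)]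
   unfolding column_set_csets(3)[OF p] column_set_csets(3)[OF q] .
 qed
qed

end

theorem corollary11p11:
  fixes n m :: nat and k :: "nat \<Rightarrow> nat"
    and S :: "((nat \<Rightarrow> nat) set \<times> nat, nat set, 'k::{alg_closed_field, field_char_0}) stratification"
    and r :: "((nat \<Rightarrow> nat) set \<times> nat) rel"
  assumes m: "1 \<le> m"
    and k: "1 \<le> k 1" "strict_mono_on {1..m} k" "k m \<le> n - 1"
    and S: "S = flag_stratification n m k"
    and r: "total_refinement S r"
  shows
    "bij_betw (\<lambda>T. \<Sum>c\<leftarrow>T. evec (column_stratum n m k c)) (SSYT n (k ` {1..m})) (fan S r) \<and>
     (str_normal S r \<and> str_balanced S) \<and>
     (indecomposables S r = {a \<in> fan S r. total_degree S a = 1} \<and>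
      indecomposables S r = evec ` flag_strata n m k) \<and>
     (\<forall>p\<in>flag_strata n m k. quasi_val S r (extremal S p) = evec p) \<and>
     (\<forall>x. (\<forall>p\<in>flag_strata n m k. x (evec p) = extremal S p) \<longrightarrow>
        inj_on (std_monomial S r x) (fan S r) \<and>
        is_basis (std_monomial S r x ` fan S r) (carrier (coord_ring (total S))) \<and>
        std_monomial S r x ` fan S r =
          {ring_prod (coord_ring (total S)) (map (extremal S) ps) | ps.
             set ps \<subseteq> flag_strata n m k \<and> sorted_wrt (\<lambda>p q. snd q \<le> snd p) ps \<and>
             map (column k) ps \<in> SSYT n (k ` {1..m})})"
proof -
 interpret flag_setup n m k by unfold_locales (use m k in auto)
 interpret seshadri_smt S "\<lambda>p. crd (cs p)" "\<lambda>p. rank_set n (cs p)" torus "of_set top_set" r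
  by (rule seshadri_smt_flags[OF S r])
 have strata: "strata S = flag_strata n m k" by (simp add: S strata_str)
 have "bij_betw ev chains (fan S r)" unfolding fan_eq bij_betw_def using ev_inj by (auto intro: inj_onI)
 hence "bij_betw (ev \<circ> map (column_stratum n m k)) (SSYT n (k ` {1..m})) (fan S r)"
  by (rule bij_betw_trans[OF bij_SSYT_chains[OF S]])
 moreover have "ev \<circ> map (column_stratum n m k) = (\<lambda>T. \<Sum>c\<leftarrow>T. evec (column_stratum n m k c))"
  by (simp add: fun_eq_iff ev_def comp_def)
 ultimately have a: "bij_betw (\<lambda>T. \<Sum>c\<leftarrow>T. evec (column_stratum n m k c)) (SSYT n (k ` {1..m})) (fan S r)"
  by simp
 have d: "inj_on (std_monomial S r x) (fan S r) \<and>
    is_basis (std_monomial S r x ` fan S r) (carrier (coord_ring (total S))) \<and>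
    std_monomial S r x ` fan S r =
     {ring_prod (coord_ring (total S)) (map (extremal S) ps) | ps.
       set ps \<subseteq> flag_strata n m k \<and> sorted_wrt (\<lambda>p q. snd q \<le> snd p) ps \<and>
       map (column k) ps \<in> SSYT n (k ` {1..m})}"
  if x: "\<forall>p\<in>flag_strata n m k. x (evec p) = extremal S p" for x
 proof -
  have x': "\<forall>p\<in>strata S. x (evec p) = extremal S p" using x unfolding strata .
  have iff: "set ps \<subseteq> flag_strata n m k \<and> sorted_wrt (\<lambda>p q. snd q \<le> snd p) ps \<and>
    map (column k) ps \<in> SSYT n (k ` {1..m}) \<longleftrightarrow> ps \<in> chains" for ps
   unfolding chains_iff[OF S] using SSYT_column std_sorted_snd by blast
  have "{ring_prod (coord_ring (total S)) (map (extremal S) ps) | ps. ps \<in> chains} =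
    (\<lambda>ps. restr (total S) (emon ps)) ` chains"
   unfolding setcompr_eq_image Collect_mem_eq by (rule image_cong[OF refl ring_prod_extremal[OF chainsD(1)]])
  thus ?thesis
   unfolding std_monomial_image[OF x'] iff using std_monomial_inj[OF x'] emon_basis by (intro conjI) simp_all
 qed
 have e: "quasi_val S r (extremal S p) = evec p" if "p \<in> flag_strata n m k" for p
  using quasi_val_extremal that unfolding strata .
 show ?thesis
  by (intro conjI ballI allI impI; (rule a normal balanced indecomposables_degree
     indecomposables_eq[unfolded strata] e | (drule d, elim conjE, assumption)); assumption?)
qed

end
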